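(* Let $g\in H(\mathbb{D})$, let $1\le p\le\infty$, and let $v\in\widehat{\mathcal{D}}$ satisfy the two conditions $$M_1(v)=\sup_{0<r<1}\left(\int_r^1\frac{\widehat{v}(s)}{(1-s)^2}\,ds\right)^{1/2}\left(\int_0^r\frac{1}{\widehat{v}(s)}\,ds\right)^{1/2}<\infty$$ and $$M_2(v)=\sup_{0<r<1}\left(\int_0^r\frac{\widehat{v}(s)}{(1-s)^4}\,ds\right)^{1/2}\left(\int_r^1\frac{(1-s)^2}{\widehat{v}(s)}\,ds\right)^{1/2}<\infty.$$ Then the following conditions are equivalent: (i) $\mathcal{H}_g\in S_p(\mathcal{D}_v)$; (ii) $g\in\mathcal{B}(2,p)$. Moreover, $\|\mathcal{H}_g\|_{S_p(\mathcal{D}_v)}\asymp\|g-g(0)\|_{\mathcal{B}(2,p)}$, i.e. each side is bounded by a constant multiple of the other, with constants depending only on $p$ and $v$ (not on $g$).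
   Context: $\mathbb{D}$ is the open unit disc and $H(\mathbb{D})$ the space of analytic functions on $\mathbb{D}$; $dA=\frac{dx\,dy}{\pi}$. A weight is a function $v:\mathbb{D}\to(0,\infty)$ integrable over $\mathbb{D}$ with respect to $dA$; it is radial if $v(z)=v(|z|)$ for all $z$. For a radial weight $v$ put $\widehat{v}(r)=\int_r^1 v(s)\,ds$. The class $\widehat{\mathcal{D}}$ consists of the radial weights $v$ with $\sup_{0<r<1}\frac{\widehat v(r)}{\widehat v\left(\frac{1+r}{2}\right)}<\infty$. The weighted Dirichlet space $\mathcal{D}_v$ consists of $f\in H(\mathbb{D})$ with $\|f\|_{\mathcal{D}_v}^2=|f(0)|^2+\int_{\mathbb{D}}|f'(z)|^2v(z)\,dA(z)<\infty$; it is a Hilbert space. For $g\in H(\mathbb{D})$, the generalized Hilbert operator is $\mathcal{H}_g(f)(z)=\int_0^1 f(t)g'(tz)\,dt$. (The condition $\int_0^1\frac{(1-s)^2}{\widehat v(s)}\,ds<\infty$, which follows from $M_2(v)<\infty$, ensures that the integral defines an analytic function on $\mathbb{D}$ for each $f\in\mathcal{D}_v$.) $S_p(\mathcal{D}_v)$, $1\le p<\infty$, is the Schatten $p$-class of operators on $\mathcal{D}_v$ with its usual norm ($\ell^p$ norm of the singular values); $S_\infty(\mathcal{D}_v)$ is the space of bounded linear operators on $\mathcal{D}_v$ with the operator norm. With $M_2(r,f)=\left(\frac{1}{2\pi}\int_{-\pi}^{\pi}|f(re^{i\theta})|^2\,d\theta\right)^{1/2}$ (integral mean of a function $f$; not to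 be confused with the constant $M_2(v)$), the space $\mathcal{B}(2,p)$, $0<p<\infty$, consists of $g\in H(\mathbb{D})$ with $\|g\|_{\mathcal{B}(2,p)}^p=|g(0)|^p+\int_0^1 M_2^p(r,g')(1-r)^{\frac p2-1}\,dr<\infty$, and $\mathcal{B}(2,\infty)$ consists of $g\in H(\mathbb{D})$ with $\|g\|_{\mathcal{B}(2,\infty)}=|g(0)|+\sup_{0<r<1}M_2(r,g')(1-r)^{1/2}<\infty$. *)

theory Defs
  imports "HOL-Analysis.Analysis"
begin

text \<open>
  Norms take values in \<^typ>\<open>ennreal\<close>, so that membership in a space means finiteness of the
  corresponding norm; exponents \<open>p\<close> also live in \<^typ>\<open>ennreal\<close>, with \<open>p = \<infinity>\<close> allowed.
  Functions on the unit disc are total functions on \<^typ>\<open>complex\<close>; their values outside the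
  disc are irrelevant, and two of them represent the same element if they agree on the disc.
\<close>

abbreviation unit_disc :: "complex set" where
  "unit_disc \<equiv> ball 0 1"

definition area_measure :: "complex measure" where
  "area_measure = density (lebesgue_on unit_disc) (\<lambda>_. ennreal (1 / pi))"

text \<open>Real powers on the extended half-line; only used with a positive exponent.\<close>

definition epowr :: "ennreal \<Rightarrow> real \<Rightarrow> ennreal" where
  "epowr x a = (if x = \<infinity> then \<infinity> else ennreal (enn2real x powr a))"


subsection \<open>Weights\<close>

definition radial_weight :: "(complex \<Rightarrow> real) \<Rightarrow> bool" where
  "radial_weight v \<longleftrightarrow>
     (\<forall>z\<in>unit_disc. v z > 0) \<and> integrable area_measure v \<and>
     (\<forall>z\<in>unit_disc. v z = v (of_real (cmod z)))"

definition weight_hat :: "(complex \<Rightarrow> real) \<Rightarrow> real \<Rightarrow> ennreal" where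
  "weight_hat v r = (\<integral>\<^sup>+ s\<in>{r<..<1}. ennreal (v (of_real s)) \<partial>lebesgue)"

definition D_hat :: "(complex \<Rightarrow> real) set" where
  "D_hat = {v. radial_weight v \<and>
     (SUP r\<in>{0<..<1}. weight_hat v r / weight_hat v ((1 + r) / 2)) < \<infinity>}"

definition M1_const :: "(complex \<Rightarrow> real) \<Rightarrow> ennreal" where
  "M1_const v = (SUP r\<in>{0<..<1}.
     epowr (\<integral>\<^sup>+ s\<in>{r<..<1}. weight_hat v s / ennreal ((1 - s)^2) \<partial>lborel) (1/2) *
     epowr (\<integral>\<^sup>+ s\<in>{0<..<r}. 1 / weight_hat v s \<partial>lborel) (1/2))"

definition M2_const :: "(complex \<Rightarrow> real) \<Rightarrow> ennreal" where
  "M2_const v = (SUP r\<in>{0<..<1}.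
     epowr (\<integral>\<^sup>+ s\<in>{0<..<r}. weight_hat v s / ennreal ((1 - s)^4) \<partial>lborel) (1/2) *
     epowr (\<integral>\<^sup>+ s\<in>{r<..<1}. ennreal ((1 - s)^2) / weight_hat v s \<partial>lborel) (1/2))"


subsection \<open>The weighted Dirichlet space\<close>

definition dirichlet_norm :: "(complex \<Rightarrow> real) \<Rightarrow> (complex \<Rightarrow> complex) \<Rightarrow> ennreal" where
  "dirichlet_norm v f =
     epowr (ennreal ((cmod (f 0))^2) +
            (\<integral>\<^sup>+ z. ennreal ((cmod (deriv f z))^2 * v z) \<partial>area_measure)) (1/2)"

definition dirichlet_space :: "(complex \<Rightarrow> real) \<Rightarrow> (complex \<Rightarrow> complex) set" where
  "dirichlet_space v = {f. f holomorphic_on unit_disc \<and> dirichlet_norm v f < \<infinity>}"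

definition dirichlet_inner ::
    "(complex \<Rightarrow> real) \<Rightarrow> (complex \<Rightarrow> complex) \<Rightarrow> (complex \<Rightarrow> complex) \<Rightarrow> complex" where
  "dirichlet_inner v f h =
     f 0 * cnj (h 0) +
     (\<integral>z. deriv f z * cnj (deriv h z) * of_real (v z) \<partial>area_measure)"


subsection \<open>Operators on the weighted Dirichlet space and Schatten classes\<close>

type_synonym operator = "(complex \<Rightarrow> complex) \<Rightarrow> (complex \<Rightarrow> complex)"

definition linear_operator :: "(complex \<Rightarrow> real) \<Rightarrow> operator \<Rightarrow> bool" where
  "linear_operator v T \<longleftrightarrow>
     (\<forall>f\<in>dirichlet_space v. T f \<in> dirichlet_space v) \<and>
     (\<forall>f\<in>dirichlet_space v. \<forall>h\<in>dirichlet_space v. \<forall>z\<in>unit_disc.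
        T (\<lambda>w. f w + h w) z = T f z + T h z) \<and>
     (\<forall>c. \<forall>f\<in>dirichlet_space v. \<forall>z\<in>unit_disc. T (\<lambda>w. c * f w) z = c * T f z)"

definition operator_norm :: "(complex \<Rightarrow> real) \<Rightarrow> operator \<Rightarrow> ennreal" where
  "operator_norm v T =
     (SUP f\<in>{f \<in> dirichlet_space v. dirichlet_norm v f \<le> 1}. dirichlet_norm v (T f))"

definition bounded_operator :: "(complex \<Rightarrow> real) \<Rightarrow> operator \<Rightarrow> bool" where
  "bounded_operator v T \<longleftrightarrow> linear_operator v T \<and> operator_norm v T < \<infinity>"

definition compact_operator :: "(complex \<Rightarrow> real) \<Rightarrow> operator \<Rightarrow> bool" where
  "compact_operator v T \<longleftrightarrow> bounded_operator v T \<and>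
     (\<forall>F :: nat \<Rightarrow> complex \<Rightarrow> complex.
        (\<forall>n. F n \<in> dirichlet_space v \<and> dirichlet_norm v (F n) \<le> 1) \<longrightarrow>
        (\<exists>k h. strict_mono k \<and> h \<in> dirichlet_space v \<and>
           (\<lambda>n. dirichlet_norm v (\<lambda>z. T (F (k n)) z - h z)) \<longlonglongrightarrow> 0))"

text \<open>
  The singular values of a compact operator \<open>T\<close> are the square roots of the eigenvalues of
  \<open>T\<^sup>* T\<close>, repeated according to multiplicity. The equation \<open>T\<^sup>* T f = s\<^sup>2 f\<close> is written out through
  the definition of the adjoint, \<open>\<langle>T\<^sup>* T f, h\<rangle> = \<langle>T f, T h\<rangle>\<close>.
\<close>

definition singular_space :: "(complex \<Rightarrow> real) \<Rightarrow> operator \<Rightarrow> real \<Rightarrow> (complex \<Rightarrow> complex) set" where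
  "singular_space v T s =
     {f \<in> dirichlet_space v. \<forall>h\<in>dirichlet_space v.
        dirichlet_inner v (T f) (T h) = of_real (s^2) * dirichlet_inner v f h}"

definition disc_independent :: "nat \<Rightarrow> (nat \<Rightarrow> complex \<Rightarrow> complex) \<Rightarrow> bool" where
  "disc_independent n e \<longleftrightarrow>
     (\<forall>c :: nat \<Rightarrow> complex. (\<forall>z\<in>unit_disc. (\<Sum>i<n. c i * e i z) = 0) \<longrightarrow> (\<forall>i<n. c i = 0))"

text \<open>The dimension of the eigenspace; it is \<open>0\<close> if \<open>s\<close> is not a singular value.\<close>

definition singular_mult :: "(complex \<Rightarrow> real) \<Rightarrow> operator \<Rightarrow> real \<Rightarrow> ennreal" where
  "singular_mult v T s =
     (SUP n\<in>{n. \<exists>e. (\<forall>i<n. e i \<in> singular_space v T s) \<and> disc_independent n e}. of_nat n)"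

text \<open>
  For \<open>p < \<infinity>\<close> the integral is the sum of \<open>s\<^sup>p\<close> over all singular values \<open>s > 0\<close>, counted with
  multiplicity.
\<close>

definition schatten_norm :: "(complex \<Rightarrow> real) \<Rightarrow> ennreal \<Rightarrow> operator \<Rightarrow> ennreal" where
  "schatten_norm v p T =
     (if p = \<infinity> then operator_norm v T
      else if compact_operator v T then
        epowr (\<integral>\<^sup>+ s. singular_mult v T s * ennreal (s powr enn2real p) \<partial>count_space {0<..})
              (1 / enn2real p)
      else \<infinity>)"

definition schatten_class :: "(complex \<Rightarrow> real) \<Rightarrow> ennreal \<Rightarrow> operator set" where
  "schatten_class v p = {T. bounded_operator v T \<and> schatten_norm v p T < \<infinity>}"


subsection \<open>The generalized Hilbert operator and the spaces B(2,p)\<close>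

definition hilbert_op :: "(complex \<Rightarrow> complex) \<Rightarrow> operator" where
  "hilbert_op g f z =
     (LINT t:{0<..<1}|lborel. f (of_real t) * deriv g (of_real t * z))"

definition integral_mean2 :: "real \<Rightarrow> (complex \<Rightarrow> complex) \<Rightarrow> real" where
  "integral_mean2 r f =
     sqrt (1 / (2 * pi) * (LINT \<theta>:{-pi..pi}|lborel. (cmod (f (of_real r * cis \<theta>)))^2))"

definition B2_norm :: "ennreal \<Rightarrow> (complex \<Rightarrow> complex) \<Rightarrow> ennreal" where
  "B2_norm p g =
     (if p = \<infinity> then
        ennreal (cmod (g 0)) +
        (SUP r\<in>{0<..<1}. ennreal (integral_mean2 r (deriv g) * (1 - r) powr (1/2)))
      else
        epowr (ennreal (cmod (g 0) powr enn2real p) +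
               (\<integral>\<^sup>+ r\<in>{0<..<1}. ennreal (integral_mean2 r (deriv g) powr enn2real p *
                   (1 - r) powr (enn2real p / 2 - 1)) \<partial>lborel))
              (1 / enn2real p))"

definition B2_space :: "ennreal \<Rightarrow> (complex \<Rightarrow> complex) set" where
  "B2_space p = {g. g holomorphic_on unit_disc \<and> B2_norm p g < \<infinity>}"

end

theory Submission
  imports Defs "HOL-Complex_Analysis.Complex_Analysis"
begin

text \<open>
  In the orthonormal basis \<open>z\<^sup>n / sqrt (w n)\<close> of the weighted Dirichlet space, the operator
  \<open>f \<mapsto> \<integral> f(t) g'(tz) dt\<close> has the matrix \<open>\<gamma> n * sqrt (w n) / (sqrt (w m) * (n + m + 1))\<close>, where \<open>\<gamma>\<close>
  are the Taylor coefficients of \<open>g'\<close>. Cut the indices into the dyadic blocks \<open>2\<^sup>j \<le> n + 1 < 2\<^sup>j\<^sup>+\<^sup>1\<close> and let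
  \<open>A j\<close> be the root mean square of \<open>\<gamma>\<close> over the \<open>j\<close>-th block. The two Muckenhoupt type conditions on the
  weight say that the block \<open>(j, k)\<close> of the matrix has size \<open>O(A j * q\<^bsup>|j - k|\<^esup>)\<close> for some \<open>q < 1\<close>. Since
  \<open>1 / (n + m + 1) = \<integral> t\<^bsup>n+m\<^esup> dt\<close>, this controls sums over orthonormal systems as well as operator
  norms, and Schur's test bounds the Schatten norm by the \<open>\<ell>\<^sup>p\<close> norm of \<open>A\<close>. Conversely, testing the
  operator on normalized block indicators bounds the \<open>\<ell>\<^sup>p\<close> norm of \<open>A\<close> by the Schatten norm. Finally
  Parseval's identity on circles shows that the \<open>\<ell>\<^sup>p\<close> norm of \<open>A\<close> is equivalent to the norm of
  \<open>g - g(0)\<close> in \<open>B(2,p)\<close>.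
\<close>

section \<open>Square-summable sequences and singular vectors\<close>

text \<open>The Schatten norm is given by the eigenvectors of T*T, so both estimates work with
  singular vectors and orthonormal families instead of a Schmidt expansion. For the upper bound,
  singular vectors \<open>u i\<close> and their normalized images \<open>y i\<close> are orthonormal
  with \<open>s i = <S (u i), y i>\<close>; the block contributions to these numbers form an array
  whose row sums are bounded by Cauchy-Schwarz and whose column sums are bounded by Bessel. For the
  lower bound only the finitely many singular vectors with \<open>s \<ge> e\<close> are split off;
  the rest of the operator has norm at most \<open>e\<close>, and \<open>e\<close> tends to 0. Let
  \<open>V j\<close> be \<open>weight_hat v\<close> at 1 - 2^-(j+1). The squared norm of z^n is of
  order 4^j V j on the \<open>j\<close>-th block. Up to constants, \<open>M1_const\<close> makes 2^j
  V j decay geometrically and \<open>M2_const\<close> makes 8^j V j grow geometrically; quotients of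
  these numbers are what appears below and above the diagonal of the block matrix. An obstacle is
  that the image of a function is a priori only holomorphic, so the estimates start from truncated
  forms, which are finite sums for every g.\<close>

lemma norm_attained_on_subspace:
  fixes T :: "'a::{real_inner,complete_space} \<Rightarrow> 'b::real_inner"
  assumes T: "bounded_linear T" and X: "subspace X" "closed X"
    and compact: "\<And>x :: nat \<Rightarrow> 'a. (\<And>n. norm (x n) \<le> 1) \<Longrightarrow>
                   \<exists>k h. strict_mono (k :: nat \<Rightarrow> nat) \<and> (\<lambda>n. T (x (k n))) \<longlonglongrightarrow> h"
    and \<sigma>: "\<sigma> > 0" "\<And>x. x \<in> X \<Longrightarrow> norm (T x) \<le> \<sigma> * norm x"
    and sup: "\<And>e. e > 0 \<Longrightarrow> \<exists>x\<in>X. norm x \<le> 1 \<and> norm (T x) > \<sigma> - e"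
  obtains x where "x \<in> X" "norm x = 1" "\<And>h. h \<in> X \<Longrightarrow> T x \<bullet> T h = \<sigma>\<^sup>2 * (x \<bullet> h)"
proof -
  interpret T: bounded_linear T by fact
  have "\<exists>x\<in>X. norm x \<le> 1 \<and> norm (T x) > \<sigma> - 1 / real (Suc n)" for n
    by (rule sup) auto
  then obtain x where x: "\<And>n. x n \<in> X" "\<And>n. norm (x n) \<le> 1"
      "\<And>n. norm (T (x n)) > \<sigma> - 1 / real (Suc n)"
    by metis
  obtain k h where k: "strict_mono (k :: nat \<Rightarrow> nat)" and h: "(\<lambda>n. T (x (k n))) \<longlonglongrightarrow> h"
    using compact[of x, OF x(2)] by blast
  define y where "y n = x (k n)" for n
  have y: "\<And>n. y n \<in> X" "\<And>n. norm (y n) \<le> 1" and Ty: "(\<lambda>n. T (y n)) \<longlonglongrightarrow> h"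
    using x h by (auto simp: y_def)
  have "(\<lambda>n. 1 / real (Suc n)) \<longlonglongrightarrow> 0"
    using LIMSEQ_inverse_real_of_nat by (simp add: inverse_eq_divide)
  then have "(\<lambda>n. 1 / real (Suc (k n))) \<longlonglongrightarrow> 0"
    using LIMSEQ_subseq_LIMSEQ[OF _ k] by (fastforce simp: o_def)
  then have lim1: "(\<lambda>n. \<sigma> - 1 / real (Suc (k n))) \<longlonglongrightarrow> \<sigma> - 0"
    by (intro tendsto_intros)
  have "norm h \<ge> \<sigma> - 0"
    by (rule LIMSEQ_le[OF lim1 tendsto_norm[OF Ty]]) (use x(3) in \<open>auto simp: y_def intro: less_imp_le\<close>)
  then have normh: "norm h \<ge> \<sigma>" by simp
  \<comment> \<open>The maximizing vectors themselves converge, not only their images: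
    \<open>T (y m + y n)\<close> has norm close to \<open>2 * \<sigma>\<close>, hence
    \<open>y m + y n\<close> has norm close to 2, and the parallelogram law forces
    \<open>y m - y n\<close> to be small.\<close>
  have "Cauchy y"
  proof (rule metric_CauchyI)
    fix e :: real assume e: "e > 0"
    \<comment> \<open>\<open>d \<le> \<sigma>\<close> keeps \<open>2 - 2 * (d / \<sigma>)\<close>
      nonnegative, so that it may be squared; the factor 1/16 makes
      \<open>8 * (d / \<sigma>)\<close> at most half of \<open>e\<^sup>2\<close>.\<close>
    define d where "d = min \<sigma> (\<sigma> * e\<^sup>2 / 16)"
    have d: "d > 0" using e \<sigma> by (simp add: d_def)
    obtain N where N: "\<And>n. n \<ge> N \<Longrightarrow> norm (T (y n) - h) < d"
      using LIMSEQ_D[OF Ty d] by blast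
    have "dist (y m) (y n) < e" if mn: "m \<ge> N" "n \<ge> N" for m n
    proof -
      have "2 * norm h - norm (T (y m + y n)) \<le> norm ((h + h) - T (y m + y n))"
        using norm_triangle_ineq2[of "h + h" "T (y m + y n)"] by (simp flip: scaleR_2)
      also have "(h + h) - T (y m + y n) = - ((T (y m) - h) + (T (y n) - h))"
        by (simp add: T.add)
      also have "norm \<dots> < d + d"
        unfolding norm_minus_cancel
        by (rule norm_triangle_lt) (use N[OF mn(1)] N[OF mn(2)] in linarith)
      finally have "2 * \<sigma> - 2 * d < norm (T (y m + y n))" using normh by linarith
      also have "\<dots> \<le> \<sigma> * norm (y m + y n)"
        by (rule \<sigma>) (use X y in \<open>auto intro: subspace_add\<close>)
      finally have "\<sigma> * (2 - 2 * (d / \<sigma>)) < \<sigma> * norm (y m + y n)"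
        using \<sigma> by (simp add: algebra_simps)
      then have "2 - 2 * (d / \<sigma>) < norm (y m + y n)" using \<sigma> by simp
      moreover have "d / \<sigma> \<le> 1" using \<sigma>(1) by (simp add: d_def)
      then have "2 - 2 * (d / \<sigma>) \<ge> 0" by simp
      ultimately have *: "(2 - 2 * (d / \<sigma>))\<^sup>2 < (norm (y m + y n))\<^sup>2"
        by (simp add: power_strict_mono)
      have "(norm (y m + y n))\<^sup>2 + (norm (y m - y n))\<^sup>2 = 2 * (norm (y m))\<^sup>2 + 2 * (norm (y n))\<^sup>2"
        by (simp add: power2_norm_eq_inner inner_simps inner_commute)
      moreover have "(norm (y m))\<^sup>2 \<le> 1" "(norm (y n))\<^sup>2 \<le> 1"
        using y(2) by (simp_all add: power_le_one)
      moreover have "(2 - 2 * (d / \<sigma>))\<^sup>2 \<ge> 4 - 8 * (d / \<sigma>)"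
        by (simp add: power2_eq_square algebra_simps)
      ultimately have "(norm (y m - y n))\<^sup>2 < 8 * (d / \<sigma>)"
        using * by linarith
      also have "d \<le> \<sigma> * e\<^sup>2 / 16" by (simp add: d_def)
      then have "8 * (d / \<sigma>) \<le> e\<^sup>2 / 2" using \<sigma> by (simp add: field_simps)
      also have "\<dots> < e\<^sup>2" using e by simp
      finally show ?thesis
        using e by (simp add: dist_norm power_less_imp_less_base)
    qed
    then show "\<exists>M. \<forall>m\<ge>M. \<forall>n\<ge>M. dist (y m) (y n) < e" by blast
  qed
  then obtain z where z: "y \<longlonglongrightarrow> z" using Cauchy_convergent convergent_def by blast
  have zX: "z \<in> X" using X(2) y(1) z closed_sequentially by blast
  have "(\<lambda>n. T (y n)) \<longlonglongrightarrow> T z" using z by (rule T.tendsto)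
  then have Tz: "norm (T z) \<ge> \<sigma>" using Ty normh LIMSEQ_unique by blast
  have "norm z \<le> 1" using z y(2) by (intro LIMSEQ_le_const2[OF tendsto_norm[OF z]]) auto
  moreover have "\<sigma> \<le> \<sigma> * norm z" using Tz \<sigma>(2)[OF zX] by linarith
  ultimately have nz: "norm z = 1" using \<sigma>(1) by simp
  have nTz: "norm (T z) = \<sigma>" using Tz \<sigma>(2)[OF zX] nz by simp
  \<comment> \<open>First variation: on \<open>X\<close> the quadratic form \<sigma>^2 |x|^2 - |T
    x|^2 is nonnegative and vanishes at \<open>z\<close>, so its linear term in the direction
    \<open>h\<close> vanishes.\<close>
  have "T z \<bullet> T h = \<sigma>\<^sup>2 * (z \<bullet> h)" if h: "h \<in> X" for h
  proof -
    define b where "b = \<sigma>\<^sup>2 * (z \<bullet> h) - T z \<bullet> T h"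
    define a where "a = \<sigma>\<^sup>2 * (h \<bullet> h) - T h \<bullet> T h"
    have key: "2 * t * b + t\<^sup>2 * a \<ge> 0" for t
    proof -
      have "z + t *\<^sub>R h \<in> X" using zX h X by (simp add: subspace_add subspace_scale)
      then have "norm (T (z + t *\<^sub>R h)) \<le> \<sigma> * norm (z + t *\<^sub>R h)" by (rule \<sigma>)
      then have "(norm (T (z + t *\<^sub>R h)))\<^sup>2 \<le> (\<sigma> * norm (z + t *\<^sub>R h))\<^sup>2"
        by (rule power_mono) simp
      moreover have "(norm (T (z + t *\<^sub>R h)))\<^sup>2 = \<sigma>\<^sup>2 + 2 * t * (T z \<bullet> T h) + t\<^sup>2 * (T h \<bullet> T h)"
        unfolding nTz[symmetric] T.add T.scaleR power2_norm_eq_inner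
        by (simp add: inner_simps inner_commute power2_eq_square algebra_simps)
      moreover have "(norm (z + t *\<^sub>R h))\<^sup>2 = 1 + 2 * t * (z \<bullet> h) + t\<^sup>2 * (h \<bullet> h)"
        unfolding power2_norm_eq_inner using nz
        by (simp add: inner_simps inner_commute power2_eq_square algebra_simps norm_eq_1)
      ultimately show ?thesis by (simp add: power_mult_distrib a_def b_def algebra_simps)
    qed
    have "b = 0"
    proof (rule ccontr)
      assume "b \<noteq> 0"
      define t where "t = - b / (\<bar>a\<bar> + 1)"
      have b: "b = - (t * (\<bar>a\<bar> + 1))" by (simp add: t_def add_nonneg_eq_0_iff)
      have "t \<noteq> 0" using \<open>b \<noteq> 0\<close> by (simp add: t_def add_nonneg_eq_0_iff)
      have "2 * t * b + t\<^sup>2 * a = t\<^sup>2 * (a - 2 * (\<bar>a\<bar> + 1))"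
        unfolding b by (simp add: power2_eq_square algebra_simps)
      also have "\<dots> < 0" using \<open>t \<noteq> 0\<close> by (intro mult_pos_neg) auto
      finally show False using key[of t] by simp
    qed
    then show ?thesis by (simp add: b_def)
  qed
  with zX nz that show ?thesis by blast
qed

section \<open>The complex Hilbert space of square-summable sequences\<close>

typedef ell2 = "{u :: nat \<Rightarrow> complex. summable (\<lambda>n. (cmod (u n))\<^sup>2)}"
  morphisms cf Ell2
  by (rule exI[of _ "\<lambda>_. 0"]) simp

lemma summable_cf: "summable (\<lambda>n. (cmod (cf u n))\<^sup>2)"
  using cf by auto

lemma cf_Ell2: "summable (\<lambda>n. (cmod (u n))\<^sup>2) \<Longrightarrow> cf (Ell2 u) = u"
  by (simp add: Ell2_inverse)

lemma ell2_eqI: "(\<And>n. cf u n = cf v n) \<Longrightarrow> u = v"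
  by (metis cf_inverse ext)

lemma sq_summable_add:
  assumes "summable (\<lambda>n. (cmod (u n))\<^sup>2)" "summable (\<lambda>n. (cmod (v n))\<^sup>2)"
  shows "summable (\<lambda>n. (cmod (u n + v n))\<^sup>2)"
proof (rule summable_comparison_test)
  show "summable (\<lambda>n. 2 * (cmod (u n))\<^sup>2 + 2 * (cmod (v n))\<^sup>2)"
    using assms by (intro summable_add summable_mult)
  have "(cmod (a + b))\<^sup>2 \<le> 2 * (cmod a)\<^sup>2 + 2 * (cmod b)\<^sup>2" for a b
  proof -
    have "(cmod (a + b))\<^sup>2 \<le> (cmod a + cmod b)\<^sup>2"
      by (simp add: norm_triangle_ineq power_mono)
    also have "\<dots> \<le> 2 * (cmod a)\<^sup>2 + 2 * (cmod b)\<^sup>2"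
      using sum_squares_bound[of "cmod a" "cmod b"] by (simp add: power2_sum)
    finally show ?thesis .
  qed
  then show "\<exists>N. \<forall>n\<ge>N. norm ((cmod (u n + v n))\<^sup>2) \<le> 2 * (cmod (u n))\<^sup>2 + 2 * (cmod (v n))\<^sup>2"
    by simp
qed

lemma sq_summable_scale:
  "summable (\<lambda>n. (cmod (u n))\<^sup>2) \<Longrightarrow> summable (\<lambda>n. (cmod (c * u n))\<^sup>2)"
  by (simp add: norm_mult power_mult_distrib summable_mult)

lemma sq_summable_prod:
  assumes "summable (\<lambda>n. (cmod (u n))\<^sup>2)" "summable (\<lambda>n. (cmod (v n))\<^sup>2)"
  shows "summable (\<lambda>n. cmod (u n) * cmod (v n))"
proof (rule summable_comparison_test)
  show "summable (\<lambda>n. (cmod (u n))\<^sup>2 + (cmod (v n))\<^sup>2)"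
    using assms by (intro summable_add)
  show "\<exists>N. \<forall>n\<ge>N. norm (cmod (u n) * cmod (v n)) \<le> (cmod (u n))\<^sup>2 + (cmod (v n))\<^sup>2"
  proof (intro exI allI impI)
    fix n :: nat
    show "norm (cmod (u n) * cmod (v n)) \<le> (cmod (u n))\<^sup>2 + (cmod (v n))\<^sup>2"
      using sum_squares_bound[of "cmod (u n)" "cmod (v n)"]
        mult_nonneg_nonneg[OF norm_ge_zero[of "u n"] norm_ge_zero[of "v n"]]
      unfolding real_norm_def abs_mult abs_norm_cancel by linarith
  qed
qed

text \<open>Complex multiples and the complex inner product are carried as separate operations
  beside the real vector space structure; \<open>cinner\<close> is linear in its first
  argument.\<close>

definition cscale :: "complex \<Rightarrow> ell2 \<Rightarrow> ell2" where
  "cscale c u = Ell2 (\<lambda>n. c * cf u n)"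

definition cinner :: "ell2 \<Rightarrow> ell2 \<Rightarrow> complex" where
  "cinner u v = (\<Sum>n. cf u n * cnj (cf v n))"

lemma summable_cinner: "summable (\<lambda>n. cf u n * cnj (cf v n))"
  by (rule summable_norm_cancel)
    (use sq_summable_prod[OF summable_cf summable_cf, of u v] in \<open>simp add: norm_mult\<close>)

instantiation ell2 :: real_vector
begin
definition "0 = Ell2 (\<lambda>_. 0)"
definition "u + v = Ell2 (\<lambda>n. cf u n + cf v n)"
definition "- u = Ell2 (\<lambda>n. - cf u n)"
definition "u - v = Ell2 (\<lambda>n. cf u n - cf v n)"
definition "scaleR r u = cscale (of_real r) u"

lemma cf_zero [simp]: "cf 0 n = 0"
  by (simp add: zero_ell2_def cf_Ell2)

lemma cf_add [simp]: "cf (u + v) n = cf u n + cf v n"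
  by (simp add: plus_ell2_def cf_Ell2 sq_summable_add summable_cf)

lemma cf_uminus [simp]: "cf (- u) n = - cf u n"
  by (simp add: uminus_ell2_def cf_Ell2 summable_cf)

lemma cf_diff [simp]: "cf (u - v) n = cf u n - cf v n"
  using sq_summable_add[OF summable_cf[of u] summable_cf[of "- v"]]
  by (simp add: minus_ell2_def cf_Ell2)

lemma cf_cscale [simp]: "cf (cscale c u) n = c * cf u n"
  by (simp add: cscale_def cf_Ell2 sq_summable_scale summable_cf)

lemma cf_scaleR [simp]: "cf (r *\<^sub>R u) n = of_real r * cf u n"
  by (simp add: scaleR_ell2_def)

instance
  by standard (auto intro!: ell2_eqI simp: algebra_simps)
end

lemma cf_sum [simp]: "cf (sum u I) n = (\<Sum>i\<in>I. cf (u i) n)"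
  by (induction I rule: infinite_finite_induct) auto

lemma cinner_add_left: "cinner (u + v) w = cinner u w + cinner v w"
  by (simp add: cinner_def suminf_add summable_cinner distrib_right)

lemma cinner_cscale_left: "cinner (cscale c u) w = c * cinner u w"
  by (simp add: cinner_def suminf_mult summable_cinner mult.assoc)

lemma cinner_commute: "cinner u v = cnj (cinner v u)"
proof -
  have "(\<lambda>n. cnj (cf v n * cnj (cf u n))) sums cnj (cinner v u)"
    unfolding sums_cnj cinner_def using summable_cinner by (rule summable_sums)
  then show ?thesis by (simp add: cinner_def sums_iff mult.commute)
qed

lemma cinner_zero_left [simp]: "cinner 0 w = 0"
  by (simp add: cinner_def)

lemma cinner_zero_right [simp]: "cinner w 0 = 0"
  by (simp add: cinner_def)

lemma cinner_minus_left: "cinner (- u) w = - cinner u w"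
  using cinner_add_left[of "-u" u w] by (simp add: eq_neg_iff_add_eq_0)

lemma cinner_diff_left: "cinner (u - v) w = cinner u w - cinner v w"
  using cinner_add_left[of u "-v" w] by (simp add: cinner_minus_left)

lemma cinner_sum_left: "cinner (sum u I) w = (\<Sum>i\<in>I. cinner (u i) w)"
  by (induction I rule: infinite_finite_induct) (auto simp: cinner_add_left)

lemma cinner_add_right: "cinner w (u + v) = cinner w u + cinner w v"
  unfolding cinner_commute[of w] by (simp add: cinner_add_left)

lemma cinner_cscale_right: "cinner w (cscale c u) = cnj c * cinner w u"
  unfolding cinner_commute[of w] by (simp add: cinner_cscale_left)

lemma cinner_diff_right: "cinner w (u - v) = cinner w u - cinner w v"
  unfolding cinner_commute[of w] by (simp add: cinner_diff_left)

lemma cinner_sum_right: "cinner w (sum u I) = (\<Sum>i\<in>I. cinner w (u i))"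
  by (induction I rule: infinite_finite_induct) (auto simp: cinner_add_right)

lemma cinner_scaleR_left: "cinner (r *\<^sub>R u) w = of_real r * cinner u w"
  by (simp add: scaleR_ell2_def cinner_cscale_left)

lemma sums_cinner_self: "(\<lambda>n. (cmod (cf u n))\<^sup>2) sums Re (cinner u u)"
proof -
  have "(\<lambda>n. cf u n * cnj (cf u n)) sums cinner u u"
    unfolding cinner_def using summable_cinner by (rule summable_sums)
  then have "(\<lambda>n. Re (cf u n * cnj (cf u n))) sums Re (cinner u u)"
    by (rule sums_Re)
  then show ?thesis unfolding cmod_power2 by (simp add: power2_eq_square)
qed

text \<open>The real inner product is the real part of the complex one and has the same norm. The
  imaginary part is recovered by testing with a multiple by \<open>\<i>\<close>, so real Hilbert
  space arguments carry over to the complex structure.\<close>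

instantiation ell2 :: real_inner
begin
definition "inner u v = Re (cinner u v)"
definition "norm u = sqrt (inner u u)" for u :: ell2
definition "sgn u = u /\<^sub>R norm u" for u :: ell2
definition "dist u v = norm (u - v)" for u v :: ell2
definition "(uniformity :: (ell2 \<times> ell2) filter) = (INF e\<in>{0<..}. principal {(x, y). dist x y < e})"
definition "open S = (\<forall>x\<in>S. \<forall>\<^sub>F (x', y) in uniformity. x' = x \<longrightarrow> y \<in> S)" for S :: "ell2 set"

instance
proof
  fix u v w :: ell2 and r :: real and S :: "ell2 set"
  show "inner u v = inner v u" using cinner_commute[of u v] by (simp add: inner_ell2_def)
  show "inner (u + v) w = inner u w + inner v w" by (simp add: inner_ell2_def cinner_add_left)
  show "inner (r *\<^sub>R u) w = r * inner u w" by (simp add: inner_ell2_def cinner_scaleR_left)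
  show "inner u u \<ge> 0" unfolding inner_ell2_def
    by (rule sums_le[OF _ sums_zero sums_cinner_self]) simp
  show "inner u u = 0 \<longleftrightarrow> u = 0"
  proof
    assume "inner u u = 0"
    then have "(\<lambda>n. (cmod (cf u n))\<^sup>2) sums 0"
      using sums_cinner_self[of u] by (simp add: inner_ell2_def)
    then have "(cmod (cf u n))\<^sup>2 = 0" for n
      using suminf_eq_zero_iff[of "\<lambda>n. (cmod (cf u n))\<^sup>2"] by (auto simp: sums_iff)
    then show "u = 0" by (intro ell2_eqI) simp
  qed (simp add: inner_ell2_def)
qed (simp_all add: norm_ell2_def sgn_ell2_def dist_ell2_def uniformity_ell2_def open_ell2_def)
end

lemma cinner_self: "cinner u u = of_real ((norm u)\<^sup>2)"
proof (rule complex_eqI)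
  show "Re (cinner u u) = Re (of_real ((norm u)\<^sup>2))"
    by (simp add: power2_norm_eq_inner inner_ell2_def)
  show "Im (cinner u u) = Im (of_real ((norm u)\<^sup>2))"
    using arg_cong[OF cinner_commute[of u u], of Im] by simp
qed

lemma sums_norm_ell2: "(\<lambda>n. (cmod (cf u n))\<^sup>2) sums (norm u)\<^sup>2"
  using sums_cinner_self[of u] by (simp add: cinner_self)

lemma norm_cscale: "norm (cscale c u) = cmod c * norm u"
proof -
  have "cinner (cscale c u) (cscale c u) = (c * cnj c) * cinner u u"
    by (simp only: cinner_cscale_left cinner_cscale_right mult.assoc mult.left_commute)
  then have "complex_of_real ((norm (cscale c u))\<^sup>2) = of_real ((cmod c)\<^sup>2 * (norm u)\<^sup>2)"
    unfolding cinner_self complex_norm_square[symmetric] of_real_mult .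
  then have "(norm (cscale c u))\<^sup>2 = (cmod c * norm u)\<^sup>2"
    unfolding of_real_eq_iff power_mult_distrib .
  then show ?thesis by (rule power2_eq_imp_eq) simp_all
qed

lemma cinner_Im: "Im (cinner u v) = u \<bullet> cscale \<i> v"
  by (simp add: inner_ell2_def cinner_cscale_right)

lemma cinner_Re: "Re (cinner u v) = u \<bullet> v"
  by (simp add: inner_ell2_def)

text \<open>The real Cauchy-Schwarz inequality, applied after multiplying \<open>u\<close> by the
  unimodular constant that makes the complex inner product real and nonnegative.\<close>

lemma cinner_norm_le: "cmod (cinner u v) \<le> norm u * norm v"
proof (cases "cinner u v = 0")
  case False
  define c where "c = cnj (cinner u v) / cmod (cinner u v)"
  have "cmod c = 1" using False by (simp add: c_def norm_divide)
  have "complex_of_real (cmod (cinner u v)) = cinner (cscale c u) v"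
    unfolding c_def cinner_cscale_left times_divide_eq_left mult.commute[of "cnj _"] complex_norm_square[symmetric]
    using False by (simp add: power2_eq_square)
  then have "cmod (cinner u v) = cscale c u \<bullet> v"
    by (metis Re_complex_of_real cinner_Re)
  also have "\<dots> \<le> norm (cscale c u) * norm v" by (rule norm_cauchy_schwarz)
  finally show ?thesis by (simp add: norm_cscale \<open>cmod c = 1\<close>)
qed simp

lemma norm_ell2_boundI:
  assumes "\<And>N. (\<Sum>n<N. (cmod (u n))\<^sup>2) \<le> B\<^sup>2" "B \<ge> 0"
  shows "summable (\<lambda>n. (cmod (u n))\<^sup>2)" and "norm (Ell2 u) \<le> B"
proof -
  show *: "summable (\<lambda>n. (cmod (u n))\<^sup>2)"
    by (rule summableI_nonneg_bounded) (use assms in auto)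
  have "(norm (Ell2 u))\<^sup>2 = (\<Sum>n. (cmod (u n))\<^sup>2)"
    using sums_norm_ell2[of "Ell2 u"] by (simp add: cf_Ell2 * sums_iff)
  also have "\<dots> \<le> B\<^sup>2" by (rule suminf_le_const[OF * assms(1)])
  finally show "norm (Ell2 u) \<le> B" using assms(2) by (rule power2_le_imp_le)
qed

lemma sum_cf_le_norm: "finite I \<Longrightarrow> (\<Sum>n\<in>I. (cmod (cf u n))\<^sup>2) \<le> (norm u)\<^sup>2"
  using sum_le_suminf[OF summable_cf, of I u] sums_unique[OF sums_norm_ell2, of u] by simp

lemma cf_le_norm: "cmod (cf u n) \<le> norm u"
  by (rule power2_le_imp_le) (use sum_cf_le_norm[of "{n}" u] in simp_all)

text \<open>The coordinates of a Cauchy sequence converge. The Cauchy bound, restricted to finitely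
  many coordinates, survives this limit, and it is uniform in the number of coordinates.\<close>

instance ell2 :: complete_space
proof
  fix X :: "nat \<Rightarrow> ell2" assume C: "Cauchy X"
  have "Cauchy (\<lambda>k. cf (X k) n)" for n
  proof (rule metric_CauchyI)
    fix e :: real assume "e > 0"
    then obtain M where M: "\<forall>m\<ge>M. \<forall>n\<ge>M. dist (X m) (X n) < e"
      using C metric_CauchyD by blast
    have "dist (cf (X m) n) (cf (X k) n) < e" if "m \<ge> M" "k \<ge> M" for m k
      using M that cf_le_norm[of "X m - X k" n]
      by (auto simp: dist_norm intro: le_less_trans)
    then show "\<exists>M. \<forall>m\<ge>M. \<forall>k\<ge>M. dist (cf (X m) n) (cf (X k) n) < e" by blast
  qed
  then have "\<exists>l. (\<lambda>k. cf (X k) n) \<longlonglongrightarrow> l" for n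
    by (simp add: Cauchy_convergent flip: convergent_def)
  then obtain l where l: "\<And>n. (\<lambda>k. cf (X k) n) \<longlonglongrightarrow> l n"
    by metis
  have tail: "\<exists>M. \<forall>k\<ge>M. \<forall>N. (\<Sum>n<N. (cmod (l n - cf (X k) n))\<^sup>2) \<le> e\<^sup>2" if e: "e > 0" for e :: real
  proof -
    obtain M where M: "\<forall>m\<ge>M. \<forall>n\<ge>M. dist (X m) (X n) < e"
      using C metric_CauchyD e by blast
    have "(\<Sum>n<N. (cmod (l n - cf (X k) n))\<^sup>2) \<le> e\<^sup>2" if k: "k \<ge> M" for k N
    proof (rule LIMSEQ_le_const2)
      show "(\<lambda>m. \<Sum>n<N. (cmod (cf (X m) n - cf (X k) n))\<^sup>2) \<longlonglongrightarrow> (\<Sum>n<N. (cmod (l n - cf (X k) n))\<^sup>2)"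
        by (intro tendsto_intros l)
      have "(\<Sum>n<N. (cmod (cf (X m) n - cf (X k) n))\<^sup>2) \<le> e\<^sup>2" if "m \<ge> M" for m
      proof -
        have "(\<Sum>n<N. (cmod (cf (X m) n - cf (X k) n))\<^sup>2) \<le> (norm (X m - X k))\<^sup>2"
          using sum_cf_le_norm[of "{..<N}" "X m - X k"] by simp
        also have "\<dots> \<le> e\<^sup>2"
          using M k that by (intro power_mono) (auto simp: dist_norm less_imp_le)
        finally show ?thesis .
      qed
      then show "\<exists>N'. \<forall>m\<ge>N'. (\<Sum>n<N. (cmod (cf (X m) n - cf (X k) n))\<^sup>2) \<le> e\<^sup>2" by blast
    qed
    then show ?thesis by blast
  qed
  obtain M where M: "\<forall>k\<ge>M. \<forall>N. (\<Sum>n<N. (cmod (l n - cf (X k) n))\<^sup>2) \<le> 1\<^sup>2"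
    using tail[of 1] zero_less_one by blast
  then have "summable (\<lambda>n. (cmod (l n - cf (X M) n))\<^sup>2)"
    by (intro norm_ell2_boundI(1)[of _ 1]) auto
  then have sl: "summable (\<lambda>n. (cmod (l n))\<^sup>2)"
    using sq_summable_add[of "\<lambda>n. l n - cf (X M) n" "cf (X M)", OF _ summable_cf] by simp
  have "X \<longlonglongrightarrow> Ell2 l"
  proof (rule metric_LIMSEQ_I)
    fix e :: real assume e: "e > 0"
    then obtain M where M: "\<forall>k\<ge>M. \<forall>N. (\<Sum>n<N. (cmod (l n - cf (X k) n))\<^sup>2) \<le> (e/2)\<^sup>2"
      using tail[of "e/2"] half_gt_zero[OF e] by blast
    have "dist (X k) (Ell2 l) < e" if "k \<ge> M" for k
    proof -
      have "norm (Ell2 (\<lambda>n. l n - cf (X k) n)) \<le> e / 2"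
        using M that e by (intro norm_ell2_boundI(2)) auto
      moreover have "Ell2 (\<lambda>n. l n - cf (X k) n) = Ell2 l - X k"
        by (simp add: minus_ell2_def cf_Ell2 sl)
      ultimately show ?thesis using e by (simp add: dist_norm norm_minus_commute)
    qed
    then show "\<exists>no. \<forall>n\<ge>no. dist (X n) (Ell2 l) < e" by blast
  qed
  then show "convergent X" unfolding convergent_def by blast
qed

section \<open>Orthonormal systems and singular vectors\<close>

definition orthonormal_on :: "'i set \<Rightarrow> ('i \<Rightarrow> ell2) \<Rightarrow> bool" where
  "orthonormal_on I f \<longleftrightarrow> (\<forall>i\<in>I. \<forall>j\<in>I. cinner (f i) (f j) = (if i = j then 1 else 0))"

lemma orthonormal_on_norm: "orthonormal_on I f \<Longrightarrow> i \<in> I \<Longrightarrow> norm (f i) = 1"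
  using cinner_self[of "f i"] norm_ge_zero[of "f i"]
  by (auto simp: orthonormal_on_def power2_eq_1_iff simp del: norm_ge_zero simp flip: of_real_power)

lemma cinner_projection:
  assumes "finite I" "orthonormal_on I f" "i \<in> I"
  shows "cinner (\<Sum>j\<in>I. cscale (c j) (f j)) (f i) = c i"
proof -
  have "cinner (\<Sum>j\<in>I. cscale (c j) (f j)) (f i) = (\<Sum>j\<in>I. if i = j then c j else 0)"
    unfolding cinner_sum_left cinner_cscale_left
    using assms by (intro sum.cong) (auto simp: orthonormal_on_def)
  then show ?thesis using assms by simp
qed

lemma bessel_identity:
  assumes I: "finite I" "orthonormal_on I f"
  defines "p \<equiv> (\<lambda>x. \<Sum>i\<in>I. cscale (cinner x (f i)) (f i))"
  shows "(norm (x - p x))\<^sup>2 = (norm x)\<^sup>2 - (\<Sum>i\<in>I. (cmod (cinner x (f i)))\<^sup>2)"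
proof -
  let ?q = "\<Sum>i\<in>I. (cmod (cinner x (f i)))\<^sup>2"
  have xp: "cinner x (p x) = of_real ?q"
    unfolding p_def cinner_sum_right cinner_cscale_right of_real_sum
    by (intro sum.cong) (simp_all only: complex_norm_square mult.commute)
  have pp: "cinner (p x) (p x) = of_real ?q"
    unfolding p_def cinner_sum_right[of _ "\<lambda>i. cscale (cinner x (f i)) (f i)"] cinner_cscale_right of_real_sum
    by (intro sum.cong) (simp_all only: complex_norm_square mult.commute cinner_projection[OF I])
  have px: "cinner (p x) x = of_real ?q"
    using xp cinner_commute[of "p x" x] by simp
  have "complex_of_real ((norm (x - p x))\<^sup>2) = of_real ((norm x)\<^sup>2 - ?q)"
    unfolding cinner_self[symmetric] cinner_diff_left cinner_diff_right xp pp px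
    by (simp add: cinner_self)
  then show ?thesis unfolding of_real_eq_iff .
qed

lemma bessel:
  assumes "finite I" "orthonormal_on I f"
  shows "(\<Sum>i\<in>I. (cmod (cinner x (f i)))\<^sup>2) \<le> (norm x)\<^sup>2"
  using bessel_identity[OF assms, of x] zero_le_power2[of "norm (x - (\<Sum>i\<in>I. cscale (cinner x (f i)) (f i)))"]
  by linarith

lemma norm_projection_le:
  assumes "finite I" "orthonormal_on I f"
  shows "norm (x - (\<Sum>i\<in>I. cscale (cinner x (f i)) (f i))) \<le> norm x"
proof (rule power2_le_imp_le)
  show "(norm (x - (\<Sum>i\<in>I. cscale (cinner x (f i)) (f i))))\<^sup>2 \<le> (norm x)\<^sup>2"
    using bessel_identity[OF assms, of x] sum_nonneg[of I "\<lambda>i. (cmod (cinner x (f i)))\<^sup>2"] by simp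
qed simp

lemma cinner_complement:
  assumes "finite I" "orthonormal_on I f" "i \<in> I"
  shows "cinner (x - (\<Sum>i\<in>I. cscale (cinner x (f i)) (f i))) (f i) = 0"
  using cinner_projection[OF assms] by (simp add: cinner_diff_left)

lemma continuous_cinner_left: "continuous_on UNIV (\<lambda>x. cinner x u)"
proof -
  have "(\<lambda>x. cinner x u) = (\<lambda>x. Complex (x \<bullet> u) (x \<bullet> cscale \<i> u))"
    by (intro ext complex_eqI) (simp_all add: cinner_Re cinner_Im)
  moreover have "continuous_on UNIV (\<lambda>x. Complex (x \<bullet> u) (x \<bullet> cscale \<i> u))"
    unfolding Complex_eq by (intro continuous_intros)
  ultimately show ?thesis by (simp only:)
qed

text \<open>The eigenspace of S*S for the eigenvalue \<open>s\<^sup>2\<close>, with the adjoint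
  eliminated; the counterpart of \<open>singular_space\<close> in coordinates.\<close>

definition singular_vectors :: "(ell2 \<Rightarrow> ell2) \<Rightarrow> real \<Rightarrow> ell2 set" where
  "singular_vectors S s = {x. \<forall>h. cinner (S x) (S h) = of_real (s\<^sup>2) * cinner x h}"

text \<open>This takes the place of the spectral theorem. Among the orthonormal sets of singular
  vectors at levels \<open>s \<ge> e\<close> take one with the largest number of elements;
  \<open>N\<close> bounds this number. If \<open>S\<close> had norm above \<open>e\<close> on the
  orthogonal complement, the norm there would be attained by compactness, and the extremal vector
  would be one more singular vector.\<close>

lemma singular_vectors_exhaustion:
  fixes S :: "ell2 \<Rightarrow> ell2" and N :: nat
  assumes S: "bounded_linear S" and Sc: "\<And>c x. S (cscale c x) = cscale c (S x)"
    and compact: "\<And>x :: nat \<Rightarrow> ell2. (\<And>n. norm (x n) \<le> 1) \<Longrightarrow>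
                   \<exists>k h. strict_mono (k :: nat \<Rightarrow> nat) \<and> (\<lambda>n. S (x (k n))) \<longlonglongrightarrow> h"
    and e: "e > 0"
    and N: "\<And>U. finite U \<Longrightarrow> orthonormal_on U (\<lambda>u. u) \<Longrightarrow>
              (\<And>u. u \<in> U \<Longrightarrow> \<exists>s\<ge>e. u \<in> singular_vectors S s) \<Longrightarrow> card U \<le> N"
  obtains U s where "finite U" "orthonormal_on U (\<lambda>u. u)"
    "\<And>u. u \<in> U \<Longrightarrow> s u \<ge> e \<and> u \<in> singular_vectors S (s u)"
    "\<And>x. (\<And>u. u \<in> U \<Longrightarrow> cinner x u = 0) \<Longrightarrow> norm (S x) \<le> e * norm x"
proof -
  interpret S: bounded_linear S by fact
  define good where "good U \<longleftrightarrow> finite U \<and> orthonormal_on U (\<lambda>u. u) \<and>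
     (\<forall>u\<in>U. \<exists>s\<ge>e. u \<in> singular_vectors S s)" for U
  have good0: "good {}" by (simp add: good_def orthonormal_on_def)
  have goodN: "\<forall>U. good U \<longrightarrow> card U < Suc N" using N unfolding good_def by (simp add: less_Suc_eq_le)
  have "\<exists>U. good U \<and> (\<forall>V. good V \<longrightarrow> card V \<le> card U)"
    by (rule ex_has_greatest_nat[OF good0 goodN])
  then obtain U where U: "good U" and Umax: "\<And>V. good V \<Longrightarrow> card V \<le> card U" by blast
  have fin: "finite U" and orth: "orthonormal_on U (\<lambda>u. u)" using U by (auto simp: good_def)
  have "\<forall>u\<in>U. \<exists>s. s \<ge> e \<and> u \<in> singular_vectors S s" using U by (auto simp: good_def)
  then obtain s where s: "\<And>u. u \<in> U \<Longrightarrow> s u \<ge> e \<and> u \<in> singular_vectors S (s u)"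
    using bchoice by metis
  define X where "X = {x. \<forall>u\<in>U. cinner x u = 0}"
  have X_add: "x + y \<in> X" if "x \<in> X" "y \<in> X" for x y
    using that by (simp add: X_def cinner_add_left)
  have X_scale: "cscale c x \<in> X" if "x \<in> X" for x c
    using that by (simp add: X_def cinner_cscale_left)
  have subX: "subspace X"
    unfolding subspace_def using X_add X_scale by (auto simp: scaleR_ell2_def) (simp add: X_def)
  have "closed {x. cinner x u = 0}" for u
    by (intro closed_Collect_eq continuous_cinner_left continuous_intros)
  moreover have "X = (\<Inter>u\<in>U. {x. cinner x u = 0})" by (auto simp: X_def)
  ultimately have clX: "closed X" by auto
  have "norm (S x) \<le> e * norm x" if x0: "x \<in> X" for x
  proof (rule ccontr)
    assume neg: "\<not> norm (S x) \<le> e * norm x"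
    then have "x \<noteq> 0" by (auto simp: S.zero)
    obtain K where K: "\<And>x. norm (S x) \<le> norm x * K" "K > 0" using S.pos_bounded by blast
    define B where "B = {norm (S y) | y. y \<in> X \<and> norm y \<le> 1}"
    define \<sigma> where "\<sigma> = Sup B"
    have "b \<le> K" if b: "b \<in> B" for b
    proof -
      obtain y where y: "b = norm (S y)" "norm y \<le> 1" using b unfolding B_def by blast
      have "b \<le> norm y * K" using K(1) y by simp
      also have "\<dots> \<le> 1 * K" using y K(2) by (intro mult_right_mono) auto
      finally show ?thesis by simp
    qed
    then have bdd: "bdd_above B" by (meson bdd_above.I)
    have "norm (S (x /\<^sub>R norm x)) \<in> B"
      unfolding B_def using x0 \<open>x \<noteq> 0\<close> subspace_scale[OF subX] by fastforce
    then have "norm (S (x /\<^sub>R norm x)) \<le> \<sigma>" unfolding \<sigma>_def using bdd by (intro cSup_upper)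
    moreover have "norm (S (x /\<^sub>R norm x)) = norm (S x) / norm x" by (simp add: S.scaleR divide_inverse_commute)
    moreover have "norm (S x) / norm x > e" using neg \<open>x \<noteq> 0\<close> by (simp add: field_simps)
    ultimately have \<sigma>e: "\<sigma> > e" by simp
    then have \<sigma>0: "\<sigma> > 0" using e by simp
    have \<sigma>le: "norm (S y) \<le> \<sigma> * norm y" if y: "y \<in> X" for y
    proof (cases "y = 0")
      case False
      have "norm (S (y /\<^sub>R norm y)) \<in> B"
        unfolding B_def using y False subspace_scale[OF subX] by fastforce
      then have "norm (S (y /\<^sub>R norm y)) \<le> \<sigma>" unfolding \<sigma>_def using bdd by (intro cSup_upper)
      then show ?thesis using False by (simp add: S.scaleR field_simps)
    qed (simp add: S.zero)
    have "\<exists>y\<in>X. norm y \<le> 1 \<and> norm (S y) > \<sigma> - d" if "d > 0" for d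
    proof -
      have "B \<noteq> {}" using \<open>norm (S (x /\<^sub>R norm x)) \<in> B\<close> by blast
      moreover have "\<sigma> - d < Sup B" using that by (simp add: \<sigma>_def)
      ultimately obtain b where "b \<in> B" "b > \<sigma> - d" using less_cSupD by blast
      then show ?thesis by (auto simp: B_def)
    qed
    then obtain z where z: "z \<in> X" "norm z = 1" "\<And>h. h \<in> X \<Longrightarrow> S z \<bullet> S h = \<sigma>\<^sup>2 * (z \<bullet> h)"
      using norm_attained_on_subspace[OF S subX clX compact \<sigma>0 \<sigma>le] by blast
    \<comment> \<open>The extremal vector satisfies a real identity on \<open>X\<close>; since
      \<open>X\<close> is a complex subspace, testing with \<open>h\<close> and with
      \<open>cscale \<i> h\<close> gives the complex one.\<close>
    have zX: "cinner (S z) (S h) = of_real (\<sigma>\<^sup>2) * cinner z h" if h: "h \<in> X" for h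
    proof (rule complex_eqI)
      show "Re (cinner (S z) (S h)) = Re (of_real (\<sigma>\<^sup>2) * cinner z h)"
        using z(3)[OF h] by (simp add: cinner_Re del: of_real_power)
      show "Im (cinner (S z) (S h)) = Im (of_real (\<sigma>\<^sup>2) * cinner z h)"
        using z(3)[OF X_scale[OF h, of \<i>]] by (simp add: cinner_Im Sc del: of_real_power)
    qed
    have zU: "cinner z u = 0" "cinner u z = 0" if "u \<in> U" for u
      using z(1) that cinner_commute[of u z] by (auto simp: X_def)
    have SzU: "cinner (S z) (S u) = 0" if u: "u \<in> U" for u
    proof -
      have "cinner (S u) (S z) = of_real ((s u)\<^sup>2) * cinner u z"
        using s[OF u] by (auto simp: singular_vectors_def)
      then show ?thesis using zU(2)[OF u] cinner_commute[of "S z" "S u"] by simp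
    qed
    \<comment> \<open>The identity is known on \<open>X\<close> only. The projection of
      \<open>h\<close> to the span of \<open>U\<close> contributes 0 to both sides, because
      \<open>z\<close> is orthogonal to every \<open>u\<close> and, \<open>u\<close> being a
      singular vector, \<open>S z\<close> is orthogonal to \<open>S u\<close>.\<close>
    have "z \<in> singular_vectors S \<sigma>"
      unfolding singular_vectors_def
    proof (intro CollectI allI)
      fix h
      define p where "p = (\<Sum>u\<in>U. cscale (cinner h u) u)"
      have "h - p \<in> X" using cinner_complement[OF fin orth, of _ h] by (simp add: X_def p_def)
      then have "cinner (S z) (S (h - p)) = of_real (\<sigma>\<^sup>2) * cinner z (h - p)" by (rule zX)
      moreover have "cinner z p = 0"
        using zU by (simp add: p_def cinner_sum_right cinner_cscale_right)
      moreover have "cinner (S z) (S p) = 0"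
        using SzU by (simp add: p_def S.sum Sc cinner_sum_right cinner_cscale_right)
      ultimately show "cinner (S z) (S h) = of_real (\<sigma>\<^sup>2) * cinner z h"
        by (simp add: S.diff cinner_diff_right)
    qed
    moreover have "cinner z z = 1" by (simp add: cinner_self z)
    then have "z \<notin> U" "orthonormal_on (insert z U) (\<lambda>u. u)"
      using zU orth by (auto simp: orthonormal_on_def)
    ultimately have "good (insert z U)" "card (insert z U) = Suc (card U)"
      using U \<sigma>e unfolding good_def by (auto intro: less_imp_le)
    then show False using Umax by fastforce
  qed
  then show ?thesis using that[OF fin orth s] by (simp add: X_def)
qed

text \<open>The closure properties of \<open>X\<close> are those of a complex subspace, so the
  orthonormalized vectors stay in it. Applied to eigenspaces, this turns a multiplicity defined by
  linear independence into an orthonormal family, to which Bessel's inequality applies.\<close>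

lemma gram_schmidt:
  fixes e :: "nat \<Rightarrow> ell2"
  assumes ind: "\<And>c. (\<Sum>i<n. cscale (c i) (e i)) = 0 \<Longrightarrow> \<forall>i<n. c i = 0"
    and X: "0 \<in> X" "\<And>x y. x \<in> X \<Longrightarrow> y \<in> X \<Longrightarrow> x + y \<in> X" "\<And>c x. x \<in> X \<Longrightarrow> cscale c x \<in> X"
    and e: "\<And>i. i < n \<Longrightarrow> e i \<in> X"
  obtains f where "orthonormal_on {..<n} f" "\<And>i. i < n \<Longrightarrow> f i \<in> X"
proof -
  define Sp where "Sp m = range (\<lambda>c. \<Sum>i<m. cscale (c i) (e i))" for m
  have SpI: "(\<Sum>i<m. cscale (c i) (e i)) \<in> Sp m" for c m
    unfolding Sp_def by (rule rangeI)
  have Sp_add: "x + y \<in> Sp m" if xy: "x \<in> Sp m" "y \<in> Sp m" for x y m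
  proof -
    obtain a b where ab: "x = (\<Sum>i<m. cscale (a i) (e i))" "y = (\<Sum>i<m. cscale (b i) (e i))"
      using xy unfolding Sp_def by blast
    have "x + y = (\<Sum>i<m. cscale (a i + b i) (e i))"
      unfolding ab by (rule ell2_eqI) (simp add: sum.distrib distrib_right)
    then show ?thesis using SpI[of "\<lambda>i. a i + b i"] by (simp only:)
  qed
  have Sp_scale: "cscale c x \<in> Sp m" if x: "x \<in> Sp m" for x c m
  proof -
    obtain a where a: "x = (\<Sum>i<m. cscale (a i) (e i))" using x unfolding Sp_def by blast
    have "cscale c x = (\<Sum>i<m. cscale (c * a i) (e i))"
      unfolding a by (rule ell2_eqI) (simp add: sum_distrib_left mult.assoc)
    then show ?thesis using SpI[of "\<lambda>i. c * a i"] by (simp only:)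
  qed
  have Sp_0: "0 \<in> Sp m" for m
  proof -
    have "0 = (\<Sum>i<m. cscale 0 (e i))" by (rule ell2_eqI) simp
    then show ?thesis using SpI[of "\<lambda>_. 0" m] by (simp only:)
  qed
  have Sp_sum: "sum g I \<in> Sp m" if "\<And>i. i \<in> I \<Longrightarrow> g i \<in> Sp m" for g :: "nat \<Rightarrow> ell2" and I m
    using that by (induction I rule: infinite_finite_induct) (auto simp: Sp_0 Sp_add)
  have Sp_Suc: "Sp m \<subseteq> Sp (Suc m)" for m
  proof
    fix x assume "x \<in> Sp m"
    then obtain a where a: "x = (\<Sum>i<m. cscale (a i) (e i))" unfolding Sp_def by blast
    have "x = (\<Sum>i<Suc m. cscale (if i < m then a i else 0) (e i))"
      unfolding a by (rule ell2_eqI) simp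
    then show "x \<in> Sp (Suc m)" using SpI[of "\<lambda>i. if i < m then a i else 0"] by (simp only:)
  qed
  have Sp_e: "e m \<in> Sp (Suc m)" for m
  proof -
    have "e m = (\<Sum>i<Suc m. cscale (if i < m then 0 else 1) (e i))"
      by (rule ell2_eqI) simp
    then show ?thesis using SpI[of "\<lambda>i. if i < m then 0 else 1"] by (simp only:)
  qed
  have Sp_X: "x \<in> X" if x: "x \<in> Sp m" "m \<le> n" for x m
  proof -
    have "(\<Sum>i<k. cscale (a i) (e i)) \<in> X" if "k \<le> n" for a k
      using that by (induction k) (auto intro!: X e)
    then show ?thesis using x by (auto simp: Sp_def)
  qed
  have "\<exists>f. orthonormal_on {..<m} f \<and> (\<forall>i<m. f i \<in> Sp m)" if "m \<le> n" for m
    using that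
  proof (induction m)
    case 0 then show ?case by (simp add: orthonormal_on_def)
  next
    case (Suc m)
    then obtain f where f: "orthonormal_on {..<m} f" "\<And>i. i < m \<Longrightarrow> f i \<in> Sp m" by auto
    define p where "p = (\<Sum>i<m. cscale (cinner (e m) (f i)) (f i))"
    have p: "p \<in> Sp m" unfolding p_def by (rule Sp_sum) (auto intro: Sp_scale f)
    define r where "r = e m - p"
    have "r \<noteq> 0"
    proof
      assume "r = 0"
      then have "e m \<in> Sp m" using p by (simp add: r_def)
      then obtain a where a: "e m = (\<Sum>i<m. cscale (a i) (e i))" unfolding Sp_def by blast
      \<comment> \<open>A vanishing remainder would express \<open>e m\<close> through its
        predecessors; these are the coefficients of the forbidden linear relation.\<close>
      define c where "c i = (if i < m then a i else if i = m then - 1 else 0)" for i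
      have "(\<Sum>i<n. cscale (c i) (e i)) = (\<Sum>i<Suc m. cscale (c i) (e i))"
        using Suc.prems by (intro sum.mono_neutral_right) (auto simp: c_def intro!: ell2_eqI)
      also have "\<dots> = (\<Sum>i<m. cscale (a i) (e i)) + cscale (- 1) (e m)"
        by (simp add: c_def)
      also have "\<dots> = 0" unfolding a[symmetric] by (rule ell2_eqI) simp
      finally have "c m = 0" using ind Suc.prems by auto
      then show False by (simp add: c_def)
    qed
    have rf: "cinner r (f i) = 0" "cinner (f i) r = 0" if "i < m" for i
    proof -
      show *: "cinner r (f i) = 0"
        using cinner_complement[OF _ f(1), of i "e m"] that by (simp add: r_def p_def)
      show "cinner (f i) r = 0" using * cinner_commute[of "f i" r] by simp
    qed
    have rS: "r \<in> Sp (Suc m)"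
    proof -
      have "r = e m + cscale (- 1) p" unfolding r_def by (rule ell2_eqI) simp
      then show ?thesis using Sp_add[OF Sp_e Sp_scale[OF subsetD[OF Sp_Suc p]]] by (simp only:)
    qed
    define f' where "f' = f(m := cscale (of_real (1 / norm r)) r)"
    have "cinner (f' m) (f' m) = 1"
      using \<open>r \<noteq> 0\<close> by (simp add: f'_def cinner_self norm_cscale norm_divide)
    then have "orthonormal_on {..<Suc m} f'"
      using f(1) rf unfolding orthonormal_on_def
      by (auto simp: less_Suc_eq f'_def cinner_cscale_left cinner_cscale_right)
    moreover have "\<forall>i<Suc m. f' i \<in> Sp (Suc m)"
      using f(2) Sp_Suc rS Sp_scale by (auto simp: less_Suc_eq f'_def)
    ultimately show ?case by blast
  qed
  from this[of n] obtain f where "orthonormal_on {..<n} f" "\<And>i. i < n \<Longrightarrow> f i \<in> Sp n" by auto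
  then show ?thesis using that Sp_X by blast
qed

section \<open>The weighted Hilbert matrix in dyadic blocks\<close>

text \<open>Jensen's inequality for weights of total mass \<open>M \<le> 1\<close>. Normalizing by
  \<open>M\<close> costs the factor \<open>M powr p / M\<close>, which is at most 1 because
  \<open>p \<ge> 1\<close>.\<close>

lemma jensen_powr_submass:
  fixes a y :: "'j \<Rightarrow> real"
  assumes J: "finite J" and p: "p \<ge> 1" and a: "\<And>j. j \<in> J \<Longrightarrow> a j \<ge> 0" "sum a J \<le> 1"
    and y: "\<And>j. j \<in> J \<Longrightarrow> y j \<ge> 0"
  shows "(\<Sum>j\<in>J. a j * y j) powr p \<le> (\<Sum>j\<in>J. a j * y j powr p)"
proof -
  \<comment> \<open>Terms with weight 0 or value 0 vanish on both sides, as
    \<open>0 powr p = 0\<close>; without them all weights and values are positive.\<close>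
  define J' where "J' = {j\<in>J. a j > 0 \<and> y j > 0}"
  define M where "M = sum a J'"
  have J': "finite J'" "J' \<subseteq> J" using J by (auto simp: J'_def)
  have 1: "(\<Sum>j\<in>J. a j * y j) = (\<Sum>j\<in>J'. a j * y j)"
    by (rule sum.mono_neutral_right) (use J a y in \<open>auto simp: J'_def order.order_iff_strict\<close>)
  have 2: "(\<Sum>j\<in>J. a j * y j powr p) = (\<Sum>j\<in>J'. a j * y j powr p)"
    by (rule sum.mono_neutral_right) (use J a y in \<open>auto simp: J'_def order.order_iff_strict\<close>)
  show ?thesis
  proof (cases "J' = {}")
    case True
    then show ?thesis unfolding 1 2 by simp
  next
    case False
    have M0: "M > 0" unfolding M_def by (rule sum_pos) (use False J' in \<open>auto simp: J'_def\<close>)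
    have "M \<le> sum a J" unfolding M_def by (rule sum_mono2) (use J J' a in auto)
    then have M1: "M \<le> 1" using a by simp
    have "(\<Sum>j\<in>J'. (a j / M) *\<^sub>R y j) powr p \<le> (\<Sum>j\<in>J'. (a j / M) * y j powr p)"
    proof (rule convex_on_sum[OF J'(1) False powr_convex[OF p]])
      show "(\<Sum>j\<in>J'. a j / M) = 1" using M0 by (simp add: M_def flip: sum_divide_distrib)
    qed (use M0 in \<open>auto simp: J'_def\<close>)
    then have le: "((\<Sum>j\<in>J'. a j * y j) / M) powr p \<le> (\<Sum>j\<in>J'. a j * y j powr p) / M"
      by (simp add: sum_divide_distrib)
    have "(M * ((\<Sum>j\<in>J'. a j * y j) / M)) powr p = M powr p * ((\<Sum>j\<in>J'. a j * y j) / M) powr p"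
      by (rule powr_mult)
    then have "(\<Sum>j\<in>J'. a j * y j) powr p = M powr p * ((\<Sum>j\<in>J'. a j * y j) / M) powr p"
      using M0 by simp
    also have "\<dots> \<le> M powr p * ((\<Sum>j\<in>J'. a j * y j powr p) / M)"
      by (intro mult_left_mono le) simp
    also have "\<dots> \<le> M * ((\<Sum>j\<in>J'. a j * y j powr p) / M)"
    proof (rule mult_right_mono)
      show "M powr p \<le> M" using powr_mono'[of 1 p M] p M0 M1 by simp
      show "0 \<le> (\<Sum>j\<in>J'. a j * y j powr p) / M"
        using M0 by (intro divide_nonneg_pos sum_nonneg) (auto simp: J'_def)
    qed
    also have "\<dots> = (\<Sum>j\<in>J'. a j * y j powr p)" using M0 by simp
    finally show ?thesis unfolding 1 2 .
  qed
qed

text \<open>Schur's test for exponent \<open>p\<close>: Jensen along each row with the weights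
  \<open>m i j / K\<close>, then interchange of the sums, where the column bound enters.\<close>

lemma schur_powr:
  fixes m :: "'i \<Rightarrow> 'j \<Rightarrow> real"
  assumes fin: "finite I" "finite J" and p: "p \<ge> 1" and K: "K > 0"
    and A: "\<And>j. j \<in> J \<Longrightarrow> A j \<ge> 0" and m: "\<And>i j. i \<in> I \<Longrightarrow> j \<in> J \<Longrightarrow> m i j \<ge> 0"
    and row: "\<And>i. i \<in> I \<Longrightarrow> (\<Sum>j\<in>J. m i j) \<le> K"
    and col: "\<And>j. j \<in> J \<Longrightarrow> (\<Sum>i\<in>I. m i j) \<le> K"
  shows "(\<Sum>i\<in>I. (\<Sum>j\<in>J. A j * m i j) powr p) \<le> K powr p * (\<Sum>j\<in>J. A j powr p)"
proof -
  have 1: "(\<Sum>j\<in>J. A j * m i j) powr p \<le> K powr p * (\<Sum>j\<in>J. (m i j / K) * A j powr p)" if i: "i \<in> I" for i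
  proof -
    have "(\<Sum>j\<in>J. A j * m i j) = K * (\<Sum>j\<in>J. (m i j / K) * A j)"
      using K by (simp add: sum_distrib_left mult.commute)
    moreover have "(\<Sum>j\<in>J. (m i j / K) * A j) \<ge> 0"
      using K m[OF i] A by (intro sum_nonneg) auto
    ultimately have "(\<Sum>j\<in>J. A j * m i j) powr p = K powr p * (\<Sum>j\<in>J. (m i j / K) * A j) powr p"
      using K by (simp add: powr_mult)
    also have "\<dots> \<le> K powr p * (\<Sum>j\<in>J. (m i j / K) * A j powr p)"
    proof (intro mult_left_mono jensen_powr_submass)
      show "(\<Sum>j\<in>J. m i j / K) \<le> 1" using row[OF i] K by (simp flip: sum_divide_distrib)
    qed (use fin p K m[OF i] A in auto)
    finally show ?thesis .
  qed
  have "(\<Sum>i\<in>I. (\<Sum>j\<in>J. A j * m i j) powr p) \<le> (\<Sum>i\<in>I. K powr p * (\<Sum>j\<in>J. (m i j / K) * A j powr p))"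
    by (intro sum_mono 1)
  also have "\<dots> = K powr p * (\<Sum>j\<in>J. (\<Sum>i\<in>I. m i j) / K * A j powr p)"
    unfolding sum_distrib_left[symmetric] by (subst sum.swap) (simp add: sum_distrib_right sum_divide_distrib)
  also have "\<dots> \<le> K powr p * (\<Sum>j\<in>J. 1 * A j powr p)"
  proof (intro mult_left_mono sum_mono mult_right_mono)
    show "(\<Sum>i\<in>I. m i j) / K \<le> 1" if "j \<in> J" for j using col[OF that] K by simp
  qed auto
  finally show ?thesis by simp
qed

section \<open>Dyadic blocks and geometric off-diagonal sums\<close>

definition blk :: "nat \<Rightarrow> nat set" where
  "blk j = {2 ^ j - 1..<2 ^ Suc j - 1}"

lemma finite_blk [simp]: "finite (blk j)"
  by (simp add: blk_def)

lemma card_blk [simp]: "card (blk j) = 2 ^ j"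
  by (simp add: blk_def)

lemma blk_iff: "n \<in> blk j \<longleftrightarrow> 2 ^ j \<le> Suc n \<and> Suc n < 2 ^ Suc j"
  by (auto simp: blk_def)

lemma blk_0: "blk 0 = {0}"
  by (auto simp: blk_def)

lemma blk_disjoint: "n \<in> blk j \<Longrightarrow> n \<in> blk k \<Longrightarrow> j = k"
proof -
  have "j \<le> k" if "n \<in> blk j" "n \<in> blk k" for j k
  proof -
    have "(2::nat) ^ j < 2 ^ Suc k" using that by (auto simp: blk_iff)
    then show ?thesis using power_less_imp_less_exp[of "2::nat" j "Suc k"] by simp
  qed
  then show "n \<in> blk j \<Longrightarrow> n \<in> blk k \<Longrightarrow> j = k" by (simp add: antisym)
qed

text \<open>The shift by one in the blocks makes the first \<open>N\<close> of them tile the indices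
  below \<open>2 ^ N - 1\<close>; hence all truncations are made at these numbers.\<close>

lemma sum_blk:
  fixes f :: "nat \<Rightarrow> 'a::comm_monoid_add"
  shows "(\<Sum>n<2 ^ N - 1. f n) = (\<Sum>j<N. \<Sum>n\<in>blk j. f n)"
proof (induction N)
  case (Suc N)
  have "{..<2 ^ Suc N - 1} = {..<2 ^ N - 1} \<union> blk N"
    unfolding blk_def by (rule ivl_disj_un_one(2)[symmetric]) (use power_increasing[of N "Suc N" "2::nat"] in simp)
  moreover have "{..<2 ^ N - 1} \<inter> blk N = {}" by (auto simp: blk_def)
  ultimately show ?case using Suc by (simp add: sum.union_disjoint)
qed simp

lemma le_two_power_minus_1: "n \<le> (2::nat) ^ n - 1"
  using less_exp[of n] by arith

lemma in_blk_exists: "\<exists>j\<le>n. n \<in> blk j"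
proof -
  have "n < 2 ^ Suc n - 1" using le_two_power_minus_1[of "Suc n"] by simp
  have "(\<Sum>i<2 ^ Suc n - 1. if i = n then 1 else 0::nat) = 1"
    using \<open>n < 2 ^ Suc n - 1\<close> by simp
  then have "(\<Sum>j<Suc n. \<Sum>i\<in>blk j. if i = n then 1 else 0::nat) = 1"
    unfolding sum_blk .
  then have "\<not> (\<forall>j\<in>{..<Suc n}. (\<Sum>i\<in>blk j. if i = n then 1 else 0::nat) = 0)"
    using sum.neutral[of "{..<Suc n}" "\<lambda>j. \<Sum>i\<in>blk j. if i = n then 1 else 0::nat"] by linarith
  then obtain j where "j < Suc n" "n \<in> blk j" by (auto split: if_splits)
  then show ?thesis by (auto simp: less_Suc_eq_le)
qed

text \<open>The distance |j - k| without leaving the natural numbers; the subtraction is exact,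
  since the maximum dominates the minimum.\<close>

definition absdiff :: "nat \<Rightarrow> nat \<Rightarrow> nat" where
  "absdiff j k = max j k - min j k"

lemma absdiff_commute: "absdiff j k = absdiff k j"
  by (simp add: absdiff_def max.commute min.commute)

text \<open>One geometric series for \<open>k \<le> j\<close> and one for \<open>k \<ge> j\<close>;
  the diagonal term is counted twice.\<close>

lemma sum_geometric_absdiff:
  fixes q :: real
  assumes q: "0 \<le> q" "q < 1"
  shows "(\<Sum>k<N. q ^ absdiff j k) \<le> 2 / (1 - q)"
proof -
  have geo: "(\<Sum>i\<in>D. q ^ i) \<le> 1 / (1 - q)" if "finite D" for D
    using sum_le_suminf[of "\<lambda>i. q ^ i" D] that q by (simp add: suminf_geometric summable_geometric)
  have "(\<Sum>k<N. q ^ absdiff j k) \<le> (\<Sum>k\<in>{..<N} \<inter> {..j}. q ^ (j - k)) + (\<Sum>k\<in>{..<N} \<inter> {j..}. q ^ (k - j))"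
  proof -
    have "(\<Sum>k<N. q ^ absdiff j k) \<le> (\<Sum>k<N. (if k \<le> j then q ^ (j - k) else 0) + (if j \<le> k then q ^ (k - j) else 0))"
      using q by (intro sum_mono) (auto simp: absdiff_def)
    also have "\<dots> = (\<Sum>k\<in>{..<N} \<inter> {..j}. q ^ (j - k)) + (\<Sum>k\<in>{..<N} \<inter> {j..}. q ^ (k - j))"
      by (simp add: sum.distrib sum.inter_restrict atMost_def atLeast_def)
    finally show ?thesis .
  qed
  also have "(\<Sum>k\<in>{..<N} \<inter> {..j}. q ^ (j - k)) = (\<Sum>i\<in>(\<lambda>k. j - k) ` ({..<N} \<inter> {..j}). q ^ i)"
    by (subst sum.reindex) (auto simp: inj_on_def)
  also have "\<dots> \<le> 1 / (1 - q)" by (rule geo) auto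
  also have "(\<Sum>k\<in>{..<N} \<inter> {j..}. q ^ (k - j)) = (\<Sum>i\<in>(\<lambda>k. k - j) ` ({..<N} \<inter> {j..}). q ^ i)"
    by (subst sum.reindex) (auto simp: inj_on_def)
  also have "\<dots> \<le> 1 / (1 - q)" by (rule geo) auto
  finally show ?thesis by (simp add: field_simps)
qed

text \<open>Schur's test for exponent 2: by \<open>x * y \<le> (x\<^sup>2 + y\<^sup>2) / 2\<close>
  the form splits into a sum weighted by rows and one weighted by columns, and both are controlled
  by the same geometric series.\<close>

lemma sum_geometric_absdiff_bilinear:
  fixes a b :: "nat \<Rightarrow> real"
  assumes q: "0 \<le> q" "q < 1"
    and a: "(\<Sum>k<N. (a k)\<^sup>2) \<le> 1" and b: "(\<Sum>j<N. (b j)\<^sup>2) \<le> 1"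
  shows "(\<Sum>j<N. \<Sum>k<N. q ^ absdiff j k * (a k * b j)) \<le> 2 / (1 - q)"
proof -
  let ?K = "2 / (1 - q)"
  have K: "?K \<ge> 0" using q by simp
  have ab: "x * y \<le> (x\<^sup>2 + y\<^sup>2) / 2" for x y :: real
    using sum_squares_bound[of x y] by simp
  have "(\<Sum>j<N. \<Sum>k<N. q ^ absdiff j k * (a k * b j)) \<le> (\<Sum>j<N. \<Sum>k<N. q ^ absdiff j k * (((a k)\<^sup>2 + (b j)\<^sup>2) / 2))"
    by (intro sum_mono mult_left_mono ab) (use q in auto)
  also have "\<dots> = ((\<Sum>j<N. \<Sum>k<N. q ^ absdiff j k * (a k)\<^sup>2) + (\<Sum>j<N. \<Sum>k<N. q ^ absdiff j k * (b j)\<^sup>2)) / 2"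
    by (simp add: sum.distrib sum_divide_distrib distrib_left add_divide_distrib)
  also have "(\<Sum>j<N. \<Sum>k<N. q ^ absdiff j k * (a k)\<^sup>2) = (\<Sum>k<N. (\<Sum>j<N. q ^ absdiff k j) * (a k)\<^sup>2)"
    by (subst sum.swap) (simp add: sum_distrib_right absdiff_commute)
  also have "\<dots> \<le> (\<Sum>k<N. ?K * (a k)\<^sup>2)"
    by (intro sum_mono mult_right_mono sum_geometric_absdiff q) auto
  also have "\<dots> \<le> ?K * 1" unfolding sum_distrib_left[symmetric] by (intro mult_left_mono a K)
  also have "(\<Sum>j<N. \<Sum>k<N. q ^ absdiff j k * (b j)\<^sup>2) = (\<Sum>j<N. (\<Sum>k<N. q ^ absdiff j k) * (b j)\<^sup>2)"
    by (simp add: sum_distrib_right)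
  also have "\<dots> \<le> (\<Sum>k<N. ?K * (b k)\<^sup>2)"
    by (intro sum_mono mult_right_mono sum_geometric_absdiff q) auto
  also have "\<dots> \<le> ?K * 1" unfolding sum_distrib_left[symmetric] by (intro mult_left_mono b K)
  finally show ?thesis by (simp only: mult_1_right add_divide_distrib field_sum_of_halves)
qed

section \<open>Finitely supported vectors and block norms\<close>

definition finvec :: "nat set \<Rightarrow> (nat \<Rightarrow> complex) \<Rightarrow> ell2" where
  "finvec D a = Ell2 (\<lambda>n. if n \<in> D then a n else 0)"

lemma cf_finvec:
  assumes "finite D" shows "cf (finvec D a) n = (if n \<in> D then a n else 0)"
proof -
  have "summable (\<lambda>n. (cmod (if n \<in> D then a n else 0))\<^sup>2)"
    by (rule summable_finite[OF assms]) simp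
  then show ?thesis unfolding finvec_def by (subst cf_Ell2) simp_all
qed

lemma cinner_finvec_right:
  assumes "finite D" shows "cinner u (finvec D a) = (\<Sum>n\<in>D. cf u n * cnj (a n))"
proof -
  have "cinner u (finvec D a) = (\<Sum>n\<in>D. cf u n * cnj (cf (finvec D a) n))"
    unfolding cinner_def by (rule suminf_finite[OF assms]) (simp add: cf_finvec assms)
  then show ?thesis by (simp add: cf_finvec assms)
qed

lemma cinner_finvec_left:
  assumes "finite D" shows "cinner (finvec D a) u = (\<Sum>n\<in>D. a n * cnj (cf u n))"
proof -
  have "cinner (finvec D a) u = (\<Sum>n\<in>D. cf (finvec D a) n * cnj (cf u n))"
    unfolding cinner_def by (rule suminf_finite[OF assms]) (simp add: cf_finvec assms)
  then show ?thesis by (simp add: cf_finvec assms)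
qed

lemma norm_finvec:
  assumes "finite D" shows "(norm (finvec D a))\<^sup>2 = (\<Sum>n\<in>D. (cmod (a n))\<^sup>2)"
proof -
  have "(\<lambda>n. (cmod (cf (finvec D a) n))\<^sup>2) sums (\<Sum>n\<in>D. (cmod (cf (finvec D a) n))\<^sup>2)"
    by (rule sums_finite[OF assms]) (auto simp: cf_finvec assms)
  then have "(norm (finvec D a))\<^sup>2 = (\<Sum>n\<in>D. (cmod (cf (finvec D a) n))\<^sup>2)"
    by (rule sums_unique2[OF sums_norm_ell2])
  then show ?thesis by (simp add: cf_finvec assms)
qed

definition blk_norm :: "nat \<Rightarrow> ell2 \<Rightarrow> real" where
  "blk_norm j u = sqrt (\<Sum>n\<in>blk j. (cmod (cf u n))\<^sup>2)"

lemma blk_norm_nonneg [simp]: "blk_norm j u \<ge> 0"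
  by (simp add: blk_norm_def sum_nonneg)

lemma sum_blk_norm_le: "(\<Sum>j<N. (blk_norm j u)\<^sup>2) \<le> (norm u)\<^sup>2"
  using sum_cf_le_norm[of "{..<2 ^ N - 1}" u]
  by (simp add: blk_norm_def sum_nonneg sum_blk del: One_nat_def)

text \<open>A vector supported in block \<open>j\<close> sees only that block of \<open>u\<close>.
  Keeping the block norm in place of the full norm is what later makes the sum over blocks
  finite.\<close>

lemma cinner_blk_le: "cmod (cinner u (finvec (blk j) a)) \<le> blk_norm j u * norm (finvec (blk j) a)"
proof -
  have "cinner u (finvec (blk j) a) = cinner (finvec (blk j) (cf u)) (finvec (blk j) a)"
    by (simp add: cinner_finvec_right cf_finvec)
  moreover have "norm (finvec (blk j) (cf u)) = blk_norm j u"
    unfolding blk_norm_def norm_finvec[OF finite_blk, symmetric] by simp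
  ultimately show ?thesis using cinner_norm_le[of "finvec (blk j) (cf u)"] by simp
qed

definition dyadic_mean :: "(nat \<Rightarrow> complex) \<Rightarrow> nat \<Rightarrow> real" where
  "dyadic_mean \<gamma> j = sqrt ((\<Sum>n\<in>blk j. (cmod (\<gamma> n))\<^sup>2) / 2 ^ j)"

lemma dyadic_mean_nonneg [simp]: "dyadic_mean \<gamma> j \<ge> 0"
  by (simp add: dyadic_mean_def sum_nonneg)

lemma dyadic_mean_sq: "2 ^ j * (dyadic_mean \<gamma> j)\<^sup>2 = (\<Sum>n\<in>blk j. (cmod (\<gamma> n))\<^sup>2)"
  by (simp add: dyadic_mean_def sum_nonneg)

text \<open>
  \<open>w n\<close> is the squared norm of the monomial \<open>z\<^sup>n\<close> and \<open>W j\<close> its order of magnitude on the \<open>j\<close>-th block;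
  \<open>decay\<close> is what the two integral conditions on the weight amount to.
\<close>

locale hilbert_matrix =
  fixes w W :: "nat \<Rightarrow> real" and c C q :: real and \<gamma> :: "nat \<Rightarrow> complex"
  assumes w_pos: "w n > 0" and W_pos: "W j > 0"
    and c_ge: "c \<ge> 1" and C_pos: "C > 0" and q: "0 < q" "q < 1"
    and w_lower: "n \<in> blk j \<Longrightarrow> W j \<le> c * w n"
    and w_upper: "n \<in> blk j \<Longrightarrow> w n \<le> c * W j"
    and decay: "sqrt (W j * 2 ^ j * 2 ^ k / W k) / 2 ^ max j k \<le> C * q ^ absdiff j k"
begin

abbreviation A :: "nat \<Rightarrow> real" where
  "A \<equiv> dyadic_mean \<gamma>"

lemmas A_nonneg = dyadic_mean_nonneg[of \<gamma>]
lemmas A_sq = dyadic_mean_sq[of _ \<gamma>]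

text \<open>
  The block \<open>(j, k)\<close> of the matrix is the integral over \<open>t\<close> of the rank one operators
  \<open>u \<mapsto> \<langle>u, xi k t\<rangle> eta j t\<close>.
\<close>

definition xi :: "nat \<Rightarrow> real \<Rightarrow> ell2" where
  "xi k t = finvec (blk k) (\<lambda>m. of_real (t ^ m / sqrt (w m)))"

definition eta :: "nat \<Rightarrow> real \<Rightarrow> ell2" where
  "eta j t = finvec (blk j) (\<lambda>n. \<gamma> n * of_real (sqrt (w n) * t ^ n))"

text \<open>The \<open>2 ^ k\<close> weights of the block are comparable to \<open>W k\<close>, and
  for \<open>t\<close> in the unit interval the first power in the block is the largest.\<close>

lemma norm_xi_le:
  assumes t: "0 \<le> t" "t \<le> 1"
  shows "norm (xi k t) \<le> sqrt (c * 2 ^ k / W k) * t ^ (2 ^ k - 1)"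
proof (rule power2_le_imp_le)
  have "(norm (xi k t))\<^sup>2 = (\<Sum>m\<in>blk k. (t ^ m)\<^sup>2 / w m)"
    using t w_pos by (simp add: xi_def norm_finvec norm_divide norm_power power_divide less_imp_le)
  also have "\<dots> \<le> (\<Sum>m\<in>blk k. (t ^ (2 ^ k - 1))\<^sup>2 * (c / W k))"
  proof (rule sum_mono)
    fix m assume m: "m \<in> blk k"
    have "t ^ m \<le> t ^ (2 ^ k - 1)" using t m by (intro power_decreasing) (auto simp: blk_def)
    moreover have "1 / w m \<le> c / W k" using w_lower[OF m] w_pos W_pos by (simp add: field_simps)
    ultimately have "(t ^ m)\<^sup>2 * (1 / w m) \<le> (t ^ (2 ^ k - 1))\<^sup>2 * (c / W k)"
      using t w_pos by (intro mult_mono power_mono) (auto simp: less_imp_le)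
    then show "(t ^ m)\<^sup>2 / w m \<le> (t ^ (2 ^ k - 1))\<^sup>2 * (c / W k)" by simp
  qed
  also have "\<dots> = (sqrt (c * 2 ^ k / W k) * t ^ (2 ^ k - 1))\<^sup>2"
    using W_pos[of k] c_ge by (simp add: power_mult_distrib)
  finally show "(norm (xi k t))\<^sup>2 \<le> (sqrt (c * 2 ^ k / W k) * t ^ (2 ^ k - 1))\<^sup>2" .
qed (use t W_pos[of k] c_ge in simp)

lemma norm_eta_le:
  assumes t: "0 \<le> t" "t \<le> 1"
  shows "norm (eta j t) \<le> sqrt (c * W j * 2 ^ j) * A j * t ^ (2 ^ j - 1)"
proof (rule power2_le_imp_le)
  have "(norm (eta j t))\<^sup>2 = (\<Sum>n\<in>blk j. (cmod (\<gamma> n))\<^sup>2 * (w n * (t ^ n)\<^sup>2))"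
    using t w_pos by (simp add: eta_def norm_finvec norm_mult norm_power power_mult_distrib less_imp_le)
  also have "\<dots> \<le> (\<Sum>n\<in>blk j. (cmod (\<gamma> n))\<^sup>2 * (c * W j * (t ^ (2 ^ j - 1))\<^sup>2))"
  proof (intro sum_mono mult_left_mono mult_mono power_mono)
    fix m assume m: "m \<in> blk j"
    show "t ^ m \<le> t ^ (2 ^ j - 1)" using t m by (intro power_decreasing) (auto simp: blk_def)
    show "w m \<le> c * W j" by (rule w_upper[OF m])
  qed (use t W_pos[of j] c_ge in auto)
  also have "\<dots> = (sqrt (c * W j * 2 ^ j) * A j * t ^ (2 ^ j - 1))\<^sup>2"
    using W_pos[of j] c_ge by (simp add: power_mult_distrib A_sq[symmetric] flip: sum_distrib_right)
  finally show "(norm (eta j t))\<^sup>2 \<le> (sqrt (c * W j * 2 ^ j) * A j * t ^ (2 ^ j - 1))\<^sup>2" .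
qed (use t W_pos[of j] c_ge in simp)

section \<open>Integrated block pairings and the array for Schur's test\<close>

definition pair :: "nat \<Rightarrow> nat \<Rightarrow> ell2 \<Rightarrow> ell2 \<Rightarrow> real \<Rightarrow> complex" where
  "pair j k u y t = cinner u (xi k t) * cnj (cinner y (eta j t))"

lemma pair_eq:
  "pair j k u y t = (\<Sum>n\<in>blk j. \<Sum>m\<in>blk k.
     (\<gamma> n * of_real (sqrt (w n)) * cf u m * cnj (cf y n) / of_real (sqrt (w m))) * of_real (t ^ (n + m)))"
  unfolding pair_def xi_def eta_def cinner_finvec_right[OF finite_blk] cnj_sum sum_product
  by (subst sum.swap) (simp add: power_add field_simps)

lemma continuous_pair: "continuous_on S (pair j k u y)"
  unfolding pair_eq by (intro continuous_intros)

lemma has_integral_power_01: "((\<lambda>t::real. t ^ n) has_integral 1 / real (Suc n)) {0..1}"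
proof -
  have "((\<lambda>t::real. t ^ n) has_integral (1 ^ Suc n / real (Suc n) - 0 ^ Suc n / real (Suc n))) {0..1}"
  proof (rule fundamental_theorem_of_calculus)
    show "((\<lambda>t. t ^ Suc n / real (Suc n)) has_vector_derivative x ^ n) (at x within {0..1})" for x :: real
      unfolding has_real_derivative_iff_has_vector_derivative[symmetric]
      by (rule derivative_eq_intros refl | simp)+
  qed simp
  then show ?thesis by simp
qed

lemma integral_pair:
  "integral {0..1} (pair j k u y) = (\<Sum>n\<in>blk j. \<Sum>m\<in>blk k.
     (\<gamma> n * of_real (sqrt (w n)) * cf u m * cnj (cf y n) / of_real (sqrt (w m))) / of_nat (Suc (n + m)))"
proof (rule integral_unique)
  have "((\<lambda>t. complex_of_real (t ^ n)) has_integral of_real (1 / real (Suc n))) {0..1}" for n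
    by (rule has_integral_of_real[OF has_integral_power_01])
  then have "((\<lambda>t. a * complex_of_real (t ^ n)) has_integral a * of_real (1 / real (Suc n))) {0..1}" for n a
    by (rule has_integral_mult_right)
  then have "((\<lambda>t. a * complex_of_real (t ^ n)) has_integral a / of_nat (Suc n)) {0..1}" for n a
    by simp
  then show "(pair j k u y has_integral (\<Sum>n\<in>blk j. \<Sum>m\<in>blk k.
     (\<gamma> n * of_real (sqrt (w n)) * cf u m * cnj (cf y n) / of_real (sqrt (w m))) / of_nat (Suc (n + m)))) {0..1}"
    unfolding pair_eq by (intro has_integral_sum finite_blk)
qed

text \<open>The modulus stands inside the integral: at each fixed \<open>t\<close> the pairing is a
  product of two inner products, which can be summed over a family by Cauchy-Schwarz and
  Bessel.\<close>

definition pairint :: "nat \<Rightarrow> nat \<Rightarrow> ell2 \<Rightarrow> ell2 \<Rightarrow> real" where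
  "pairint j k u y = integral {0..1} (\<lambda>t. cmod (pair j k u y t))"

lemma pairint_integrable: "(\<lambda>t. cmod (pair j k u y t)) integrable_on {0..1}"
  by (intro integrable_continuous_real continuous_on_norm continuous_pair)

lemma pairint_nonneg: "pairint j k u y \<ge> 0"
  unfolding pairint_def by (rule integral_nonneg[OF pairint_integrable]) simp

lemma integral_pair_le: "cmod (integral {0..1} (pair j k u y)) \<le> pairint j k u y"
  unfolding pairint_def
  by (rule integral_norm_bound_integral[OF _ pairint_integrable])
    (auto intro: integrable_continuous_real continuous_pair)

text \<open>The left side is the integral over the unit interval of the product of the leading
  powers of the two blocks.\<close>

lemma power_integral_bound: "1 / real (Suc (2 ^ j - 1 + (2 ^ k - 1))) \<le> 1 / 2 ^ max j k"
proof -
  have "(2::nat) ^ max j k \<le> Suc (2 ^ j - 1 + (2 ^ k - 1))"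
  proof -
    have "x \<le> Suc (x - 1 + (y - 1))" "y \<le> Suc (x - 1 + (y - 1))" if "1 \<le> x" "1 \<le> y" for x y :: nat
      using that by arith+
    then show ?thesis by (auto simp: max_def)
  qed
  then have "real (2 ^ max j k) \<le> real (Suc (2 ^ j - 1 + (2 ^ k - 1)))"
    unfolding of_nat_le_iff .
  then show ?thesis by (intro divide_left_mono) auto
qed

text \<open>The common source of the row and column bounds. For a single pair of vectors,
  \<open>P\<close> and \<open>Q\<close> are block norms; for orthonormal families both are 1 by
  Bessel's inequality. Cauchy-Schwarz over \<open>I\<close> is applied at each fixed
  \<open>t\<close>, then the leading powers are integrated and \<open>decay\<close> is
  inserted.\<close>

lemma sum_pairint_le:
  assumes I: "finite I" and P: "P \<ge> 0" and Q: "Q \<ge> 0"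
    and u: "\<And>t. (\<Sum>i\<in>I. (cmod (cinner (u i) (xi k t)))\<^sup>2) \<le> (P * norm (xi k t))\<^sup>2"
    and y: "\<And>t. (\<Sum>i\<in>I. (cmod (cinner (y i) (eta j t)))\<^sup>2) \<le> (Q * norm (eta j t))\<^sup>2"
  shows "(\<Sum>i\<in>I. pairint j k (u i) (y i)) \<le> c * C * (q ^ absdiff j k * (P * Q)) * A j"
proof -
  let ?e = "2 ^ j - 1 + (2 ^ k - 1) :: nat"
  let ?B = "P * Q * (c * sqrt (W j * 2 ^ j * 2 ^ k / W k) * A j)"
  have B0: "?B \<ge> 0" using P Q c_ge W_pos[of j] W_pos[of k] by simp
  have pt: "(\<Sum>i\<in>I. cmod (pair j k (u i) (y i) t)) \<le> ?B * t ^ ?e" if t: "t \<in> {0..1}" for t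
  proof -
    have "(\<Sum>i\<in>I. cmod (pair j k (u i) (y i) t)) =
        (\<Sum>i\<in>I. \<bar>cmod (cinner (u i) (xi k t))\<bar> * \<bar>cmod (cinner (y i) (eta j t))\<bar>)"
      by (simp add: pair_def norm_mult)
    also have "\<dots> \<le> L2_set (\<lambda>i. cmod (cinner (u i) (xi k t))) I * L2_set (\<lambda>i. cmod (cinner (y i) (eta j t))) I"
      by (rule L2_set_mult_ineq)
    also have "\<dots> \<le> (P * norm (xi k t)) * (Q * norm (eta j t))"
    proof (rule mult_mono)
      show "L2_set (\<lambda>i. cmod (cinner (u i) (xi k t))) I \<le> P * norm (xi k t)"
        unfolding L2_set_def using P u[of t] by (intro real_le_lsqrt) (auto simp: sum_nonneg)
      show "L2_set (\<lambda>i. cmod (cinner (y i) (eta j t))) I \<le> Q * norm (eta j t)"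
        unfolding L2_set_def using Q y[of t] by (intro real_le_lsqrt) (auto simp: sum_nonneg)
    qed (use P in \<open>auto simp: L2_set_nonneg\<close>)
    also have "\<dots> = P * Q * (norm (xi k t) * norm (eta j t))" by (simp only: mult_ac)
    also have "\<dots> \<le> P * Q * ((sqrt (c * 2 ^ k / W k) * t ^ (2 ^ k - 1)) * (sqrt (c * W j * 2 ^ j) * A j * t ^ (2 ^ j - 1)))"
      using t P Q c_ge W_pos[of k]
      by (intro mult_left_mono mult_mono norm_xi_le norm_eta_le) auto
    also have "\<dots> = P * Q * ((sqrt (c * 2 ^ k / W k) * sqrt (c * W j * 2 ^ j)) * A j) * t ^ ?e"
      by (simp only: mult_ac power_add)
    also have "sqrt (c * 2 ^ k / W k) * sqrt (c * W j * 2 ^ j) = sqrt (c\<^sup>2 * (W j * 2 ^ j * 2 ^ k / W k))"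
      unfolding real_sqrt_mult[symmetric] by (simp add: power2_eq_square field_simps)
    also have "\<dots> = c * sqrt (W j * 2 ^ j * 2 ^ k / W k)"
      using c_ge by (simp only: real_sqrt_mult real_sqrt_abs abs_of_nonneg)
    finally show ?thesis .
  qed
  have "(\<Sum>i\<in>I. pairint j k (u i) (y i)) = integral {0..1} (\<lambda>t. \<Sum>i\<in>I. cmod (pair j k (u i) (y i) t))"
    unfolding pairint_def by (rule integral_sum[symmetric, OF I pairint_integrable])
  also have "\<dots> \<le> integral {0..1} (\<lambda>t. ?B * t ^ ?e)"
    by (rule integral_le[OF integrable_sum[OF I pairint_integrable] _ pt])
      (auto intro!: integrable_continuous_real continuous_intros)
  also have "\<dots> = ?B * (1 / real (Suc ?e))"
    by (rule integral_unique[OF has_integral_mult_right[OF has_integral_power_01]])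
  also have "\<dots> \<le> ?B * (1 / 2 ^ max j k)"
    by (rule mult_left_mono[OF power_integral_bound B0])
  also have "\<dots> = (P * Q * c * A j) * (sqrt (W j * 2 ^ j * 2 ^ k / W k) / 2 ^ max j k)"
    by simp
  also have "\<dots> \<le> (P * Q * c * A j) * (C * q ^ absdiff j k)"
    by (rule mult_left_mono[OF decay]) (use P Q c_ge in simp)
  finally show ?thesis by (simp add: mult_ac)
qed

text \<open>The constant \<open>c * C\<close> of a single block times the bound
  \<open>2 / (1 - q)\<close> for the geometric sum over the distance of the blocks.\<close>

definition K :: real where "K = c * C * (2 / (1 - q))"

lemma K_pos: "K > 0"
  using c_ge C_pos q by (simp add: K_def)

lemma pairint_eq_0: "A j = 0 \<Longrightarrow> pairint j k u y = 0"
  using sum_pairint_le[of "{()}" "norm u" "norm y" "\<lambda>_. u" k "\<lambda>_. y" j] pairint_nonneg[of j k u y]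
    power_mono[OF cinner_norm_le[of u], of _ 2] power_mono[OF cinner_norm_le[of y], of _ 2]
  by (auto intro: antisym)

lemma pairint_blk_le: "pairint j k u y \<le> c * C * (q ^ absdiff j k * (blk_norm k u * blk_norm j y)) * A j"
  using sum_pairint_le[of "{()}" "blk_norm k u" "blk_norm j y" "\<lambda>_. u" k "\<lambda>_. y" j]
    power_mono[OF cinner_blk_le[of u], of _ _ 2] power_mono[OF cinner_blk_le[of y], of _ _ 2]
  by (simp add: xi_def eta_def)

text \<open>If \<open>A j = 0\<close>, then \<open>pairint j k u y = 0\<close> as well and the division by zero is harmless.\<close>

definition mass :: "nat \<Rightarrow> nat \<Rightarrow> ell2 \<Rightarrow> ell2 \<Rightarrow> real" where
  "mass N j u y = (\<Sum>k<N. pairint j k u y) / A j"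

lemma mass_nonneg: "mass N j u y \<ge> 0"
  by (simp add: mass_def sum_nonneg pairint_nonneg)

lemma A_mass: "A j * mass N j u y = (\<Sum>k<N. pairint j k u y)"
  by (cases "A j = 0") (simp_all add: mass_def pairint_eq_0)

text \<open>For one pair of unit vectors the block norms of \<open>u\<close> and \<open>y\<close>
  are square summable with sum at most 1, so the bilinear geometric estimate applies.\<close>

lemma sum_mass_row:
  assumes "norm u \<le> 1" "norm y \<le> 1"
  shows "(\<Sum>j<N. mass N j u y) \<le> K"
proof -
  have "mass N j u y \<le> (\<Sum>k<N. c * C * (q ^ absdiff j k * (blk_norm k u * blk_norm j y)))" for j
  proof (cases "A j = 0")
    case True
    then show ?thesis using c_ge C_pos q by (simp add: mass_def sum_nonneg)
  next
    case False
    then have "A j > 0" using A_nonneg[of j] by linarith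
    have "(\<Sum>k<N. pairint j k u y) \<le> (\<Sum>k<N. c * C * (q ^ absdiff j k * (blk_norm k u * blk_norm j y)) * A j)"
      by (intro sum_mono pairint_blk_le)
    then show ?thesis using \<open>A j > 0\<close> by (simp add: mass_def divide_le_eq flip: sum_distrib_right)
  qed
  then have "(\<Sum>j<N. mass N j u y) \<le> (\<Sum>j<N. \<Sum>k<N. c * C * (q ^ absdiff j k * (blk_norm k u * blk_norm j y)))"
    by (intro sum_mono)
  also have "\<dots> = c * C * (\<Sum>j<N. \<Sum>k<N. q ^ absdiff j k * (blk_norm k u * blk_norm j y))"
    by (simp add: sum_distrib_left)
  also have "\<dots> \<le> c * C * (2 / (1 - q))"
  proof (rule mult_left_mono[OF sum_geometric_absdiff_bilinear])
    show "(\<Sum>k<N. (blk_norm k u)\<^sup>2) \<le> 1" "(\<Sum>k<N. (blk_norm k y)\<^sup>2) \<le> 1"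
      using sum_blk_norm_le[of u N] sum_blk_norm_le[of y N] assms
        power_le_one[of "norm u" 2] power_le_one[of "norm y" 2] by auto
  qed (use q c_ge C_pos in auto)
  finally show ?thesis by (simp add: K_def)
qed

text \<open>For a fixed block \<open>j\<close> the whole orthonormal families are summed at once:
  Bessel bounds each pair of blocks by \<open>q ^ absdiff j k\<close> up to constants, and only the
  sum over \<open>k\<close> remains.\<close>

lemma sum_mass_col:
  assumes I: "finite I" "orthonormal_on I u" "orthonormal_on I y"
  shows "(\<Sum>i\<in>I. mass N j (u i) (y i)) \<le> K"
proof (cases "A j = 0")
  case True
  then show ?thesis using K_pos by (simp add: mass_def)
next
  case False
  then have A: "A j > 0" using A_nonneg[of j] by linarith
  have bes: "(\<Sum>i\<in>I. (cmod (cinner (f i) x))\<^sup>2) \<le> (norm x)\<^sup>2" if "orthonormal_on I f" for f x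
  proof -
    have "cmod (cinner (f i) x) = cmod (cinner x (f i))" for i
      by (subst cinner_commute) simp
    then show ?thesis using bessel[OF I(1) that, of x] by simp
  qed
  have "(\<Sum>i\<in>I. \<Sum>k<N. pairint j k (u i) (y i)) = (\<Sum>k<N. \<Sum>i\<in>I. pairint j k (u i) (y i))"
    by (rule sum.swap)
  also have "\<dots> \<le> (\<Sum>k<N. c * C * (q ^ absdiff j k * (1 * 1)) * A j)"
    by (intro sum_mono sum_pairint_le) (use I bes in auto)
  also have "\<dots> = c * C * A j * (\<Sum>k<N. q ^ absdiff j k)"
    by (simp add: sum_distrib_left mult_ac)
  also have "\<dots> \<le> c * C * A j * (2 / (1 - q))"
    by (intro mult_left_mono sum_geometric_absdiff) (use q c_ge C_pos in auto)
  finally show ?thesis using A by (simp add: mass_def K_def divide_le_eq mult_ac flip: sum_divide_distrib)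
qed

text \<open>The sesquilinear form of the matrix, cut off to the first \<open>N\<close> blocks. It is
  a finite sum, hence available before the matrix is known to define an operator.\<close>

definition form :: "nat \<Rightarrow> ell2 \<Rightarrow> ell2 \<Rightarrow> complex" where
  "form N u y = (\<Sum>n<2 ^ N - 1. \<Sum>m<2 ^ N - 1.
     (\<gamma> n * of_real (sqrt (w n)) * cf u m * cnj (cf y n) / of_real (sqrt (w m))) / of_nat (Suc (n + m)))"

lemma form_le: "cmod (form N u y) \<le> (\<Sum>j<N. A j * mass N j u y)"
proof -
  have "form N u y = (\<Sum>j<N. \<Sum>k<N. integral {0..1} (pair j k u y))"
    unfolding form_def sum_blk integral_pair by (rule sum.cong[OF refl], rule sum.swap)
  then have "cmod (form N u y) \<le> (\<Sum>j<N. \<Sum>k<N. cmod (integral {0..1} (pair j k u y)))"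
    using norm_sum[of "\<lambda>j. \<Sum>k<N. integral {0..1} (pair j k u y)" "{..<N}"]
    by (auto intro!: order_trans[OF _ sum_mono[OF norm_sum]])
  also have "\<dots> \<le> (\<Sum>j<N. \<Sum>k<N. pairint j k u y)"
    by (intro sum_mono integral_pair_le)
  finally show ?thesis by (simp add: A_mass)
qed

text \<open>The array \<open>mass N j (u i) (y i)\<close> has rows \<open>i\<close>, columns
  \<open>j\<close> and both kinds of sums bounded by \<open>K\<close>; Schur's test applied to the
  vector \<open>A\<close> gives the estimate.\<close>

lemma sum_form_powr_le:
  assumes p: "p \<ge> 1" and I: "finite I" "orthonormal_on I u" "orthonormal_on I y"
  shows "(\<Sum>i\<in>I. cmod (form N (u i) (y i)) powr p) \<le> K powr p * (\<Sum>j<N. A j powr p)"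
proof -
  have "(\<Sum>i\<in>I. cmod (form N (u i) (y i)) powr p) \<le> (\<Sum>i\<in>I. (\<Sum>j<N. A j * mass N j (u i) (y i)) powr p)"
    using p by (intro sum_mono powr_mono2 form_le) auto
  also have "\<dots> \<le> K powr p * (\<Sum>j<N. A j powr p)"
  proof (rule schur_powr)
    show "(\<Sum>j<N. mass N j (u i) (y i)) \<le> K" if "i \<in> I" for i
      using orthonormal_on_norm[OF I(2) that] orthonormal_on_norm[OF I(3) that]
      by (intro sum_mass_row) auto
  qed (use p I K_pos in \<open>auto intro: mass_nonneg sum_mass_col\<close>)
  finally show ?thesis .
qed

lemma pairint_blk_0: "blk_norm j y = 0 \<Longrightarrow> pairint j k u y = 0"
  using pairint_blk_le[of j k u y] pairint_nonneg[of j k u y] by simp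

text \<open>Only the blocks in which \<open>y\<close> lives contribute. With \<open>J = 0\<close>
  this is the boundedness estimate; with large \<open>J\<close> it controls the tails that
  compactness requires.\<close>

lemma form_le_sup_unit:
  assumes B: "\<And>j. j \<ge> J \<Longrightarrow> A j \<le> B" "B \<ge> 0" and y: "\<And>j. j < J \<Longrightarrow> blk_norm j y = 0"
    and 1: "norm u \<le> 1" "norm y \<le> 1"
  shows "cmod (form N u y) \<le> K * B"
proof -
  have "A j * mass N j u y \<le> B * mass N j u y" for j
  proof (cases "j < J")
    case True
    then have "mass N j u y = 0" by (simp add: mass_def pairint_blk_0 y)
    then show ?thesis by simp
  next
    case False
    then show ?thesis using B by (intro mult_right_mono mass_nonneg) auto
  qed
  then have "cmod (form N u y) \<le> (\<Sum>j<N. B * mass N j u y)"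
    by (intro order_trans[OF form_le] sum_mono)
  also have "\<dots> \<le> B * K"
    unfolding sum_distrib_left[symmetric] by (intro mult_left_mono sum_mass_row 1 B)
  finally show ?thesis by (simp add: mult.commute)
qed

end

section \<open>Convergence of truncated vectors\<close>

lemma tendsto_cinner:
  assumes "(f \<longlongrightarrow> a) F" "(g \<longlongrightarrow> b) F"
  shows "((\<lambda>x. cinner (f x) (g x)) \<longlongrightarrow> cinner a b) F"
proof -
  have i: "cscale (- \<i>) u \<bullet> v = u \<bullet> cscale \<i> v" for u v
    by (simp add: inner_ell2_def cinner_cscale_left cinner_cscale_right)
  have "bounded_linear (cscale (- \<i>))"
  proof (rule bounded_linear_intro)
    show "norm (cscale (- \<i>) x) \<le> norm x * 1" for x by (simp add: norm_cscale)
  qed (auto intro!: ell2_eqI simp: algebra_simps)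
  then have "((\<lambda>x. cscale (- \<i>) (f x)) \<longlongrightarrow> cscale (- \<i>) a) F"
    using assms(1) by (rule bounded_linear.tendsto)
  then have "((\<lambda>x. Complex (f x \<bullet> g x) (cscale (- \<i>) (f x) \<bullet> g x)) \<longlongrightarrow> Complex (a \<bullet> b) (cscale (- \<i>) a \<bullet> b)) F"
    by (intro tendsto_Complex tendsto_inner assms)
  moreover have "cinner u v = Complex (u \<bullet> v) (cscale (- \<i>) u \<bullet> v)" for u v
    unfolding i by (intro complex_eqI) (simp_all add: cinner_Re cinner_Im)
  ultimately show ?thesis by (simp only:)
qed

definition trunc :: "nat \<Rightarrow> ell2 \<Rightarrow> ell2" where
  "trunc N u = finvec {..<2 ^ N - 1} (cf u)"

lemma cf_trunc: "cf (trunc N u) n = (if n < 2 ^ N - 1 then cf u n else 0)"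
  by (simp add: trunc_def cf_finvec)

lemma trunc_diff: "trunc N (u - v) = trunc N u - trunc N v"
  by (rule ell2_eqI) (simp add: cf_trunc)

lemma filterlim_two_power_minus_1: "filterlim (\<lambda>N. 2 ^ N - 1 :: nat) at_top sequentially"
  unfolding filterlim_at_top eventually_sequentially
  using le_two_power_minus_1 order_trans by blast

lemma trunc_tendsto: "(\<lambda>N. trunc N u) \<longlonglongrightarrow> u"
proof -
  have "(norm (u - trunc N u))\<^sup>2 = (norm u)\<^sup>2 - (\<Sum>n<2 ^ N - 1. (cmod (cf u n))\<^sup>2)" for N
  proof -
    have "cinner u (trunc N u) = of_real (\<Sum>n<2 ^ N - 1. (cmod (cf u n))\<^sup>2)"
      unfolding trunc_def cinner_finvec_right[OF finite_lessThan] of_real_sum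
      by (intro sum.cong refl) (rule complex_norm_square[symmetric])
    then have "u \<bullet> trunc N u = (\<Sum>n<2 ^ N - 1. (cmod (cf u n))\<^sup>2)"
      by (metis Re_complex_of_real cinner_Re)
    moreover have "trunc N u \<bullet> trunc N u = (\<Sum>n<2 ^ N - 1. (cmod (cf u n))\<^sup>2)"
      unfolding power2_norm_eq_inner[symmetric] by (simp add: trunc_def norm_finvec)
    ultimately show ?thesis
      by (simp add: power2_norm_eq_inner inner_diff_left inner_diff_right inner_commute)
  qed
  moreover have "(\<lambda>N. \<Sum>n<2 ^ N - 1. (cmod (cf u n))\<^sup>2) \<longlonglongrightarrow> (norm u)\<^sup>2"
    using filterlim_compose[OF sums_norm_ell2[of u, unfolded sums_def] filterlim_two_power_minus_1] .
  ultimately have "(\<lambda>N. (norm (u - trunc N u))\<^sup>2) \<longlonglongrightarrow> (norm u)\<^sup>2 - (norm u)\<^sup>2"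
    by (simp only: tendsto_diff tendsto_const)
  then have "(\<lambda>N. sqrt ((norm (u - trunc N u))\<^sup>2)) \<longlonglongrightarrow> sqrt 0"
    by (intro tendsto_real_sqrt) simp
  then have "(\<lambda>N. norm (trunc N u - u)) \<longlonglongrightarrow> 0"
    by (simp add: norm_minus_commute)
  then show ?thesis
    by (simp add: LIM_zero_iff tendsto_norm_zero_iff)
qed

lemma norm_minus_trunc_le:
  assumes "\<And>D. finite D \<Longrightarrow> D \<subseteq> {2 ^ J - 1..} \<Longrightarrow> (\<Sum>n\<in>D. (cmod (cf u n))\<^sup>2) \<le> B\<^sup>2" "B \<ge> 0"
  shows "norm (u - trunc J u) \<le> B"
proof -
  have "(\<Sum>n<N. (cmod (cf (u - trunc J u) n))\<^sup>2) \<le> B\<^sup>2" for N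
  proof -
    have "(\<Sum>n<N. (cmod (cf (u - trunc J u) n))\<^sup>2) = (\<Sum>n\<in>{..<N} \<inter> {2 ^ J - 1..}. (cmod (cf u n))\<^sup>2)"
      by (rule sum.mono_neutral_cong_right) (auto simp: cf_trunc)
    also have "\<dots> \<le> B\<^sup>2" by (rule assms) auto
    finally show ?thesis .
  qed
  then have "norm (Ell2 (cf (u - trunc J u))) \<le> B" by (intro norm_ell2_boundI(2) assms(2))
  then show ?thesis by (simp only: cf_inverse)
qed

section \<open>The operator defined by the full matrix, its singular values and its
  compactness\<close>

context hilbert_matrix
begin

text \<open>This is \<open>decay\<close> with \<open>j = 0\<close>: the indices in block
  \<open>k\<close> contribute at most a constant times \<open>q ^ (2 * k)\<close>.\<close>

lemma summable_kernel: "summable (\<lambda>m. (cmod (of_real (1 / (sqrt (w m) * real (Suc (n + m))))))\<^sup>2)"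
proof -
  let ?B = "c * C\<^sup>2 / W 0 * (1 / (1 - q\<^sup>2))"
  have q2: "0 \<le> q\<^sup>2" "q\<^sup>2 < 1" using q by (auto simp: power_less_one_iff abs_square_less_1)
  have blk_le: "(\<Sum>m\<in>blk k. 1 / (w m * (real (Suc m))\<^sup>2)) \<le> c * C\<^sup>2 / W 0 * (q\<^sup>2) ^ k" for k
  proof -
    have "(\<Sum>m\<in>blk k. 1 / (w m * (real (Suc m))\<^sup>2)) \<le> (\<Sum>m\<in>blk k. c / W k * (1 / (2 ^ k)\<^sup>2))"
    proof (rule sum_mono)
      fix m assume m: "m \<in> blk k"
      have "(2::real) ^ k \<le> real (Suc m)"
        using m unfolding blk_iff by (metis of_nat_le_iff of_nat_numeral of_nat_power)
      then have "1 / (real (Suc m))\<^sup>2 \<le> 1 / (2 ^ k)\<^sup>2"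
        by (intro divide_left_mono power_mono) auto
      moreover have "1 / w m \<le> c / W k" using w_lower[OF m] w_pos W_pos by (simp add: field_simps)
      ultimately have "1 / w m * (1 / (real (Suc m))\<^sup>2) \<le> c / W k * (1 / (2 ^ k)\<^sup>2)"
        using c_ge W_pos[of k] by (intro mult_mono) auto
      then show "1 / (w m * (real (Suc m))\<^sup>2) \<le> c / W k * (1 / (2 ^ k)\<^sup>2)" by simp
    qed
    also have "\<dots> = c / W 0 * (sqrt (W 0 * 2 ^ 0 * 2 ^ k / W k) / 2 ^ max 0 k)\<^sup>2"
      using W_pos[of k] W_pos[of 0] by (simp add: power_divide power2_eq_square)
    also have "\<dots> \<le> c / W 0 * (C * q ^ absdiff 0 k)\<^sup>2"
      using c_ge W_pos[of 0] W_pos[of k] by (intro mult_left_mono power_mono decay) auto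
    also have "\<dots> = c * C\<^sup>2 / W 0 * (q\<^sup>2) ^ k"
      by (simp add: absdiff_def power_mult_distrib power_mult[symmetric] mult.commute)
    finally show ?thesis .
  qed
  have "(\<Sum>m<N. (cmod (of_real (1 / (sqrt (w m) * real (Suc (n + m))))))\<^sup>2) \<le> ?B" for N
  proof -
    have "(\<Sum>m<N. (cmod (of_real (1 / (sqrt (w m) * real (Suc (n + m))))))\<^sup>2) \<le> (\<Sum>m<2 ^ N - 1. 1 / (w m * (real (Suc m))\<^sup>2))"
    proof (rule sum_mono2[THEN order_trans[rotated]])
      show "{..<N} \<subseteq> {..<2 ^ N - 1}" using le_two_power_minus_1[of N] by auto
      show "(\<Sum>m<N. (cmod (of_real (1 / (sqrt (w m) * real (Suc (n + m))))))\<^sup>2) \<le> (\<Sum>m<N. 1 / (w m * (real (Suc m))\<^sup>2))"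
      proof (rule sum_mono)
        fix m
        have "(cmod (of_real (1 / (sqrt (w m) * real (Suc (n + m))))))\<^sup>2 = 1 / (w m * (real (Suc (n + m)))\<^sup>2)"
          using w_pos[of m] by (simp add: norm_divide norm_mult power_divide power_mult_distrib less_imp_le del: of_nat_Suc)
        also have "\<dots> \<le> 1 / (w m * (real (Suc m))\<^sup>2)"
          using w_pos[of m] by (intro divide_left_mono mult_left_mono power_mono mult_pos_pos) auto
        finally show "(cmod (of_real (1 / (sqrt (w m) * real (Suc (n + m))))))\<^sup>2 \<le> 1 / (w m * (real (Suc m))\<^sup>2)" .
      qed
    qed (use w_pos in \<open>auto simp: less_imp_le\<close>)
    also have "\<dots> \<le> (\<Sum>k<N. c * C\<^sup>2 / W 0 * (q\<^sup>2) ^ k)"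
      unfolding sum_blk by (intro sum_mono blk_le)
    also have "\<dots> = c * C\<^sup>2 / W 0 * (\<Sum>k<N. (q\<^sup>2) ^ k)"
      by (simp add: sum_distrib_left)
    also have "\<dots> \<le> ?B"
    proof (rule mult_left_mono)
      show "(\<Sum>k<N. (q\<^sup>2) ^ k) \<le> 1 / (1 - q\<^sup>2)"
        using sum_le_suminf[of "\<lambda>k. (q\<^sup>2) ^ k" "{..<N}"] q2 suminf_geometric[of "q\<^sup>2"] summable_geometric[of "q\<^sup>2"]
        by simp
    qed (use c_ge C_pos W_pos[of 0] in simp)
    finally show ?thesis .
  qed
  then show ?thesis by (intro summableI_nonneg_bounded[where x = ?B]) auto
qed

text \<open>In the orthonormal basis of normalized monomials this vector represents the functional
  that integrates a function against \<open>t ^ n\<close> over the unit interval.\<close>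

definition kernel :: "nat \<Rightarrow> ell2" where
  "kernel n = Ell2 (\<lambda>m. of_real (1 / (sqrt (w m) * real (Suc (n + m)))))"

lemma cf_kernel: "cf (kernel n) m = of_real (1 / (sqrt (w m) * real (Suc (n + m))))"
  using cf_Ell2[OF summable_kernel] by (simp add: kernel_def)

text \<open>Each coordinate of the image exists for every \<open>u\<close>, since the rows of the
  matrix are square summable; whether the coordinates form a vector is a separate question.\<close>

definition M :: "ell2 \<Rightarrow> nat \<Rightarrow> complex" where
  "M u n = \<gamma> n * of_real (sqrt (w n)) * cinner u (kernel n)"

definition S :: "ell2 \<Rightarrow> ell2" where
  "S u = Ell2 (M u)"

lemma M_add: "M (u + v) n = M u n + M v n"
  by (simp add: M_def cinner_add_left distrib_left)

lemma M_cscale: "M (cscale a u) n = a * M u n"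
  by (simp add: M_def cinner_cscale_left)

lemma M_tendsto: "(f \<longlongrightarrow> u) F \<Longrightarrow> ((\<lambda>x. M (f x) n) \<longlongrightarrow> M u n) F"
  unfolding M_def by (intro tendsto_intros tendsto_cinner)

lemma form_eq: "form N u y = (\<Sum>n<2 ^ N - 1. M (trunc N u) n * cnj (cf y n))"
proof -
  have "M (trunc N u) n * cnj (cf y n) = (\<Sum>m<2 ^ N - 1.
     (\<gamma> n * of_real (sqrt (w n)) * cf u m * cnj (cf y n) / of_real (sqrt (w m))) / of_nat (Suc (n + m)))" for n
    unfolding M_def trunc_def cinner_finvec_left[OF finite_lessThan] sum_distrib_left sum_distrib_right cf_kernel
    by (intro sum.cong refl) (simp add: mult_ac)
  then show ?thesis unfolding form_def by (simp only:)
qed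

lemma form_0_left: "form N 0 y = 0"
  by (simp add: form_def)

lemma form_0_right: "form N u 0 = 0"
  by (simp add: form_def)

lemma form_scaleR: "form N (a *\<^sub>R u) (b *\<^sub>R y) = of_real (a * b) * form N u y"
  unfolding form_def sum_distrib_left by (intro sum.cong refl) (simp add: mult_ac)

lemma form_le_sup:
  assumes B: "\<And>j. j \<ge> J \<Longrightarrow> A j \<le> B" "B \<ge> 0" and y: "\<And>j. j < J \<Longrightarrow> blk_norm j y = 0"
  shows "cmod (form N u y) \<le> K * B * norm u * norm y"
proof (cases "u = 0 \<or> y = 0")
  case True
  then show ?thesis by (auto simp: form_0_left form_0_right)
next
  case False
  have sc: "blk_norm j (r *\<^sub>R y) = 0" if "j < J" for j r
  proof -
    have "(\<Sum>n\<in>blk j. (cmod (cf y n))\<^sup>2) = 0" using y[OF that] by (simp add: blk_norm_def)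
    then show ?thesis
      by (simp add: blk_norm_def norm_mult power_mult_distrib flip: sum_distrib_left)
  qed
  have "cmod (form N ((1 / norm u) *\<^sub>R u) ((1 / norm y) *\<^sub>R y)) \<le> K * B"
    by (rule form_le_sup_unit[OF B sc]) (use False in auto)
  then have "cmod (form N u y) / (norm u * norm y) \<le> K * B"
    unfolding form_scaleR by (simp add: norm_mult norm_divide)
  then show ?thesis using False by (simp add: divide_le_eq mult.assoc)
qed

text \<open>Duality: a finite piece of the image is paired with itself as the vector
  \<open>y\<close>, so the form estimate reads \<open>Y\<^sup>2 \<le> K * B * norm u * Y\<close>.
  The estimate is available for truncations of \<open>u\<close> only, hence the passage to the limit
  in \<open>N\<close>.\<close>

lemma sum_M_le:
  assumes B: "\<And>j. j \<ge> J \<Longrightarrow> A j \<le> B" "B \<ge> 0" and D: "finite D" "D \<subseteq> {2 ^ J - 1..}"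
  shows "(\<Sum>n\<in>D. (cmod (M u n))\<^sup>2) \<le> (K * B * norm u)\<^sup>2"
proof -
  define y where "y = finvec D (M u)"
  define Y where "Y = norm y"
  have Y2: "Y\<^sup>2 = (\<Sum>n\<in>D. (cmod (M u n))\<^sup>2)" unfolding Y_def y_def by (rule norm_finvec[OF D(1)])
  have y0: "blk_norm j y = 0" if "j < J" for j
  proof -
    have "n \<notin> D" if n: "n \<in> blk j" for n
    proof
      assume "n \<in> D"
      then have "2 ^ J - 1 \<le> n" using D by auto
      moreover have "(2::nat) ^ Suc j \<le> 2 ^ J" using \<open>j < J\<close> by (intro power_increasing) auto
      ultimately show False using n unfolding blk_def by auto
    qed
    then show ?thesis by (simp add: blk_norm_def y_def cf_finvec D)
  qed
  obtain N0 where N0: "D \<subseteq> {..<N0}" using D(1) finite_nat_iff_bounded by auto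
  have form: "form N u y = (\<Sum>n\<in>D. M (trunc N u) n * cnj (M u n))" if "N \<ge> N0" for N
  proof -
    have "D \<subseteq> {..<2 ^ N - 1}" using N0 that le_two_power_minus_1[of N] by fastforce
    then show ?thesis unfolding form_eq
      by (intro sum.mono_neutral_cong_right) (auto simp: y_def cf_finvec D)
  qed
  have lim: "(\<lambda>N. cmod (\<Sum>n\<in>D. M (trunc N u) n * cnj (M u n))) \<longlonglongrightarrow> cmod (\<Sum>n\<in>D. M u n * cnj (M u n))"
    by (intro tendsto_intros M_tendsto trunc_tendsto)
  have "cmod (\<Sum>n\<in>D. M u n * cnj (M u n)) \<le> K * B * norm u * Y"
    by (rule LIMSEQ_le_const2[OF lim], rule exI[of _ N0])
      (use form_le_sup[OF B y0] in \<open>auto simp: form[symmetric] Y_def\<close>)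
  moreover have "(\<Sum>n\<in>D. M u n * cnj (M u n)) = of_real (Y\<^sup>2)"
    unfolding Y2 of_real_sum by (intro sum.cong refl) (rule complex_norm_square[symmetric])
  ultimately have "Y\<^sup>2 \<le> K * B * norm u * Y" by (simp only: norm_of_real abs_power2)
  moreover have "Y \<ge> 0" by (simp add: Y_def)
  ultimately have "Y \<le> K * B * norm u"
    using K_pos B(2) by (cases "Y = 0") (auto simp: power2_eq_square)
  then show ?thesis unfolding Y2[symmetric] by (intro power_mono \<open>Y \<ge> 0\<close>)
qed

text \<open>\<open>Ell2\<close> of a sequence that is not square summable is unspecified, so \<open>S u\<close> is meaningful only under this condition.\<close>

definition total :: bool where
  "total \<longleftrightarrow> (\<forall>u. summable (\<lambda>n. (cmod (M u n))\<^sup>2))"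

lemma cf_S: "total \<Longrightarrow> cf (S u) n = M u n"
  by (simp add: S_def total_def cf_Ell2)

lemma S_cscale: "total \<Longrightarrow> S (cscale a u) = cscale a (S u)"
  by (rule ell2_eqI) (simp add: cf_S M_cscale)

lemma S_add: "total \<Longrightarrow> S (u + v) = S u + S v"
  by (rule ell2_eqI) (simp add: cf_S M_add)

lemma S_scaleR: "total \<Longrightarrow> S (r *\<^sub>R u) = r *\<^sub>R S u"
  by (simp add: scaleR_ell2_def S_cscale)

lemma bounded_imp_total:
  assumes B: "\<And>j. A j \<le> B"
  shows total and "norm (S u) \<le> K * B * norm u" and "bounded_linear S"
proof -
  have B0: "B \<ge> 0" using B[of 0] A_nonneg[of 0] by linarith
  have *: "(\<Sum>n<N. (cmod (M u n))\<^sup>2) \<le> (K * B * norm u)\<^sup>2" for u N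
    by (rule sum_M_le[of 0]) (use B B0 in auto)
  have nn: "K * B * norm u \<ge> 0" for u using K_pos B0 by simp
  show t: total unfolding total_def using norm_ell2_boundI(1)[OF * nn] by blast
  show le: "norm (S u) \<le> K * B * norm u" for u unfolding S_def by (rule norm_ell2_boundI(2)[OF * nn])
  show "bounded_linear S"
    by (rule bounded_linear_intro[of _ "K * B"]) (use le t in \<open>auto simp: S_add S_scaleR mult.commute\<close>)
qed

lemma form_tendsto:
  assumes B: "\<And>j. A j \<le> B"
  shows "(\<lambda>N. form N u y) \<longlonglongrightarrow> cinner (S u) y"
proof -
  note t = bounded_imp_total(1)[OF B]
  interpret S: bounded_linear S by (rule bounded_imp_total(3)[OF B])
  have "form N u y = cinner (S (trunc N u)) (trunc N y)" for N
    unfolding form_eq trunc_def[of N y] cinner_finvec_right[OF finite_lessThan] cf_S[OF t] ..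
  moreover have "(\<lambda>N. cinner (S (trunc N u)) (trunc N y)) \<longlonglongrightarrow> cinner (S u) y"
    by (intro tendsto_cinner S.tendsto trunc_tendsto)
  ultimately show ?thesis by (simp only:)
qed

text \<open>The normalized images \<open>y i\<close> of orthonormal singular vectors are orthonormal
  as well, and the form at \<open>(u i, y i)\<close> tends to \<open>s i\<close>. The bound for
  truncated forms is uniform in \<open>N\<close>, so it passes to the singular values.\<close>

lemma sum_singular_powr_le:
  assumes B: "\<And>j. A j \<le> B" and p: "p \<ge> 1" and R: "\<And>N. (\<Sum>j<N. A j powr p) \<le> R"
    and I: "finite I" "orthonormal_on I u"
    and s: "\<And>i. i \<in> I \<Longrightarrow> s i > 0" "\<And>i. i \<in> I \<Longrightarrow> u i \<in> singular_vectors S (s i)"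
  shows "(\<Sum>i\<in>I. s i powr p) \<le> K powr p * R"
proof -
  define y where "y i = cscale (of_real (1 / s i)) (S (u i))" for i
  have SS: "cinner (S (u i)) (S (u j)) = (if i = j then of_real ((s i)\<^sup>2) else 0)" if "i \<in> I" "j \<in> I" for i j
    using s(2)[OF that(1)] I(2) that by (auto simp: singular_vectors_def orthonormal_on_def)
  have ne: "s i \<noteq> 0" if "i \<in> I" for i
    using s(1)[OF that] by simp
  have ony: "orthonormal_on I y"
    unfolding orthonormal_on_def y_def cinner_cscale_left cinner_cscale_right
    by (auto simp: SS power2_eq_square ne)
  have sy: "cinner (S (u i)) (y i) = of_real (s i)" if "i \<in> I" for i
    using s(1)[OF that] by (simp add: y_def cinner_cscale_right SS that power2_eq_square)
  have "(\<lambda>N. \<Sum>i\<in>I. cmod (form N (u i) (y i)) powr p) \<longlonglongrightarrow> (\<Sum>i\<in>I. cmod (cinner (S (u i)) (y i)) powr p)"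
    by (intro tendsto_sum tendsto_powr' tendsto_norm form_tendsto[OF B] tendsto_const) (use p in auto)
  then have "(\<Sum>i\<in>I. cmod (cinner (S (u i)) (y i)) powr p) \<le> K powr p * R"
  proof (rule LIMSEQ_le_const2)
    have "(\<Sum>i\<in>I. cmod (form N (u i) (y i)) powr p) \<le> K powr p * R" for N
      using sum_form_powr_le[OF p I ony, of N] mult_left_mono[OF R[of N], of "K powr p"] by simp
    then show "\<exists>N. \<forall>n\<ge>N. (\<Sum>i\<in>I. cmod (form n (u i) (y i)) powr p) \<le> K powr p * R" by blast
  qed
  moreover have "(\<Sum>i\<in>I. cmod (cinner (S (u i)) (y i)) powr p) = (\<Sum>i\<in>I. s i powr p)"
    by (intro sum.cong refl) (use s(1) in \<open>simp add: sy less_imp_le\<close>)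
  ultimately show ?thesis by simp
qed

text \<open>A diagonal subsequence makes every coordinate of the images converge. The coordinates
  beyond block \<open>J\<close> are uniformly small because \<open>A j\<close> is small there, so
  convergence in finitely many coordinates suffices.\<close>

lemma compact_S:
  assumes A: "A \<longlonglongrightarrow> 0" and x: "\<And>n :: nat. norm (x n) \<le> 1"
  shows "\<exists>k h. strict_mono (k :: nat \<Rightarrow> nat) \<and> (\<lambda>n. S (x (k n))) \<longlonglongrightarrow> h"
proof -
  have "Bseq A" using A by (intro convergent_imp_Bseq) (auto simp: convergent_def)
  then obtain B where "\<forall>j. norm (A j) \<le> B" by (auto simp: Bseq_def)
  then have B: "\<And>j. A j \<le> B" by simp
  have B0: "B \<ge> 0" using B[of 0] A_nonneg[of 0] by linarith
  note t = bounded_imp_total(1)[OF B]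
  interpret S: bounded_linear S by (rule bounded_imp_total(3)[OF B])
  have "norm (S (x n)) \<le> K * B * 1" for n
    using bounded_imp_total(2)[OF B, of "x n"] x[of n] K_pos B0
    by (meson mult_left_mono mult_nonneg_nonneg less_imp_le order_trans)
  then have bd: "norm (cf (S (x n)) m) \<le> K * B * 1" for n m using cf_le_norm order_trans by blast
  have cu: "countable (UNIV :: nat set)" by simp
  obtain k where k: "strict_mono (k :: nat \<Rightarrow> nat)" "\<And>m. m \<in> UNIV \<Longrightarrow> \<exists>l. (\<lambda>n. cf (S (x (k n))) m) \<longlonglongrightarrow> l"
    by (rule function_convergent_subsequence[OF cu, of "\<lambda>n m. cf (S (x n)) m", OF bd]) blast
  define X where "X n = S (x (k n))" for n
  have "\<forall>m. \<exists>l. (\<lambda>n. cf (X n) m) \<longlonglongrightarrow> l" using k(2) by (simp add: X_def)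
  from choice[OF this] obtain l where l: "\<And>m. (\<lambda>n. cf (X n) m) \<longlonglongrightarrow> l m" by blast
  have "Cauchy X"
  proof (rule metric_CauchyI)
    fix e :: real assume e: "e > 0"
    \<comment> \<open>The difference of two vectors of the unit ball has norm at most 2, so the tail
      of its image is at most \<open>K * d * 2 = e / 4\<close>.\<close>
    define d where "d = e / (8 * K)"
    have d: "d > 0" using e K_pos by (simp add: d_def)
    obtain J where "\<forall>j\<ge>J. norm (A j - 0) < d" using LIMSEQ_D[OF A d] by blast
    then have J: "\<And>j. j \<ge> J \<Longrightarrow> A j \<le> d" by (simp add: less_imp_le)
    have tail: "norm (S u - trunc J (S u)) \<le> K * d * norm u" for u
    proof (rule norm_minus_trunc_le)
      show "(\<Sum>n\<in>D. (cmod (cf (S u) n))\<^sup>2) \<le> (K * d * norm u)\<^sup>2" if "finite D" "D \<subseteq> {2 ^ J - 1..}" for D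
        unfolding cf_S[OF t] by (rule sum_M_le[OF J _ that]) (use d in auto)
    qed (use d K_pos in simp)
    have "(\<lambda>n. trunc J (X n)) \<longlonglongrightarrow> finvec {..<2 ^ J - 1} l"
    proof -
      have "trunc J (X n) - finvec {..<2 ^ J - 1} l = finvec {..<2 ^ J - 1} (\<lambda>m. cf (X n) m - l m)" for n
        by (rule ell2_eqI) (simp add: cf_trunc cf_finvec)
      then have n: "(norm (trunc J (X n) - finvec {..<2 ^ J - 1} l))\<^sup>2 = (\<Sum>m<2 ^ J - 1. (cmod (cf (X n) m - l m))\<^sup>2)" for n
        by (simp add: norm_finvec)
      have "(\<lambda>n. \<Sum>m<2 ^ J - 1. (cmod (cf (X n) m - l m))\<^sup>2) \<longlonglongrightarrow> (\<Sum>m<2 ^ J - 1. (cmod (l m - l m))\<^sup>2)"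
        by (intro tendsto_intros l)
      then have "(\<lambda>n. sqrt ((norm (trunc J (X n) - finvec {..<2 ^ J - 1} l))\<^sup>2)) \<longlonglongrightarrow> sqrt 0"
        unfolding n by (intro tendsto_real_sqrt) simp
      then show ?thesis by (simp add: LIM_zero_iff tendsto_norm_zero_iff)
    qed
    then have C: "Cauchy (\<lambda>n. trunc J (X n))" by (rule LIMSEQ_imp_Cauchy)
    from metric_CauchyD[OF C half_gt_zero[OF e]]
    obtain N where "\<forall>m\<ge>N. \<forall>n\<ge>N. dist (trunc J (X m)) (trunc J (X n)) < e / 2" by blast
    then have N: "\<And>m n. m \<ge> N \<Longrightarrow> n \<ge> N \<Longrightarrow> dist (trunc J (X m)) (trunc J (X n)) < e / 2"
      by blast
    have "dist (X m) (X n) < e" if mn: "m \<ge> N" "n \<ge> N" for m n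
    proof -
      let ?u = "x (k m) - x (k n)"
      have X: "X m - X n = S ?u" by (simp add: X_def S.diff)
      have "norm ?u \<le> 2" using norm_triangle_ineq4[of "x (k m)" "x (k n)"] x[of "k m"] x[of "k n"] by linarith
      then have "K * d * norm ?u \<le> K * d * 2" using K_pos d by (intro mult_left_mono) auto
      also have "\<dots> = e / 4" using K_pos by (simp add: d_def)
      finally have "norm (S ?u - trunc J (S ?u)) \<le> e / 4" using tail[of ?u] by linarith
      moreover have "norm (trunc J (S ?u)) < e / 2"
        using N[OF mn] by (simp add: dist_norm flip: X trunc_diff)
      moreover have "norm (S ?u) \<le> norm (trunc J (S ?u)) + norm (S ?u - trunc J (S ?u))"
        by (rule norm_triangle_sub)
      ultimately show ?thesis using e by (simp add: dist_norm X)
    qed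
    then show "\<exists>M. \<forall>m\<ge>M. \<forall>n\<ge>M. dist (X m) (X n) < e" by blast
  qed
  then obtain h where "X \<longlonglongrightarrow> h" using Cauchy_convergent convergent_def by blast
  then have "(\<lambda>n. S (x (k n))) \<longlonglongrightarrow> h" unfolding X_def[abs_def] .
  then show ?thesis using k(1) by (intro exI[of _ k] exI[of _ h] conjI)
qed



section \<open>Lower bounds from block test vectors\<close>

definition testvec :: "nat \<Rightarrow> ell2" where
  "testvec j = finvec (blk j) (\<lambda>_. of_real (1 / sqrt (2 ^ j)))"

text \<open>The normalized block of \<open>\<gamma>\<close>. If that block vanishes, the test vector
  takes its place, so that the family is orthonormal in all cases.\<close>

definition dualvec :: "nat \<Rightarrow> ell2" where
  "dualvec j = (if A j = 0 then testvec j else finvec (blk j) (\<lambda>n. \<gamma> n * of_real (1 / (A j * sqrt (2 ^ j)))))"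

lemma norm_testvec [simp]: "norm (testvec j) = 1"
proof -
  have "(norm (testvec j))\<^sup>2 = 1\<^sup>2"
    by (simp add: testvec_def norm_finvec norm_divide power_divide)
  then show ?thesis by (rule power2_eq_imp_eq) simp_all
qed

lemma norm_dualvec [simp]: "norm (dualvec j) = 1"
proof (cases "A j = 0")
  case False
  have "(norm (dualvec j))\<^sup>2 = (\<Sum>n\<in>blk j. (cmod (\<gamma> n))\<^sup>2 * (1 / ((A j)\<^sup>2 * 2 ^ j)))"
    using False by (simp add: dualvec_def norm_finvec norm_mult norm_divide power_divide power_mult_distrib)
  also have "\<dots> = 1\<^sup>2"
    unfolding sum_distrib_right[symmetric] A_sq[symmetric] using False by simp
  finally show ?thesis by (rule power2_eq_imp_eq) simp_all
qed (simp add: dualvec_def)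

lemma finvec_blk_orthogonal: "j \<noteq> k \<Longrightarrow> cinner (finvec (blk j) a) (finvec (blk k) b) = 0"
  unfolding cinner_finvec_left[OF finite_blk] by (rule sum.neutral) (auto simp: cf_finvec dest: blk_disjoint)

lemma dualvec_finvec: "\<exists>a. dualvec j = finvec (blk j) a"
  by (auto simp: dualvec_def testvec_def)

lemma orthonormal_testvec: "orthonormal_on I testvec"
  unfolding orthonormal_on_def using finvec_blk_orthogonal by (auto simp: cinner_self) (simp add: testvec_def finvec_blk_orthogonal)

lemma orthonormal_dualvec: "orthonormal_on I dualvec"
  unfolding orthonormal_on_def
proof (intro ballI)
  fix i j
  show "cinner (dualvec i) (dualvec j) = (if i = j then 1 else 0)"
    using dualvec_finvec[of i] dualvec_finvec[of j] finvec_blk_orthogonal[of i j]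
    by (cases "i = j") (auto simp: cinner_self)
qed

text \<open>The factor by which the \<open>n\<close>-th coordinate of the image of
  \<open>testvec j\<close> differs from \<open>\<gamma> n\<close>. It is a sum of positive terms, so
  no cancellation can occur.\<close>

definition tau :: "nat \<Rightarrow> nat \<Rightarrow> real" where
  "tau j n = sqrt (w n) * (\<Sum>m\<in>blk j. 1 / (sqrt (2 ^ j) * (sqrt (w m) * real (Suc (n + m)))))"

lemma M_testvec: "M (testvec j) n = \<gamma> n * of_real (tau j n)"
  unfolding M_def tau_def testvec_def cinner_finvec_left[OF finite_blk] cf_kernel complex_cnj_complex_of_real
    of_real_mult[symmetric] of_real_sum[symmetric] mult.assoc
  by simp

text \<open>Inside one block the weights agree up to the factor \<open>c\<^sup>2\<close> and
  \<open>n + m + 1\<close> is at most \<open>2 ^ (j + 2)\<close>. Hence each of the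
  \<open>2 ^ j\<close> terms, together with the weight in front, is at least
  \<open>1 / (c * sqrt (2 ^ j) * 2 ^ (j + 2))\<close>.\<close>

lemma tau_ge:
  assumes n: "n \<in> blk j"
  shows "tau j n \<ge> 1 / (4 * c * sqrt (2 ^ j))"
proof -
  have c0: "c > 0" using c_ge by simp
  have "1 / (sqrt (2 ^ j) * (c * sqrt (w n) * 2 ^ (j + 2))) \<le> 1 / (sqrt (2 ^ j) * (sqrt (w m) * real (Suc (n + m))))"
    if m: "m \<in> blk j" for m
  proof -
    have "w m \<le> c\<^sup>2 * w n"
      using w_upper[OF m] mult_left_mono[OF w_lower[OF n], of c] c0
      unfolding power2_eq_square mult.assoc by linarith
    then have "sqrt (w m) \<le> sqrt (c\<^sup>2 * w n)" by (rule real_sqrt_le_mono)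
    then have 1: "sqrt (w m) \<le> c * sqrt (w n)" using c0 by (simp add: real_sqrt_mult)
    have "Suc (n + m) \<le> 2 ^ (j + 2)" using n m by (auto simp: blk_iff)
    then have "real (Suc (n + m)) \<le> real (2 ^ (j + 2))" unfolding of_nat_le_iff .
    then have 2: "real (Suc (n + m)) \<le> 2 ^ (j + 2)" by simp
    show ?thesis
    proof (intro divide_left_mono mult_left_mono mult_mono 1 2 mult_pos_pos)
    qed (use w_pos[of m] w_pos[of n] c0 in auto)
  qed
  then have "(\<Sum>m\<in>blk j. 1 / (sqrt (2 ^ j) * (c * sqrt (w n) * 2 ^ (j + 2)))) \<le>
      (\<Sum>m\<in>blk j. 1 / (sqrt (2 ^ j) * (sqrt (w m) * real (Suc (n + m)))))"
    by (rule sum_mono)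
  then have "sqrt (w n) * (\<Sum>m\<in>blk j. 1 / (sqrt (2 ^ j) * (c * sqrt (w n) * 2 ^ (j + 2)))) \<le> tau j n"
    unfolding tau_def using w_pos[of n] by (intro mult_left_mono) auto
  also have "sqrt (w n) * (\<Sum>m\<in>blk j. 1 / (sqrt (2 ^ j) * (c * sqrt (w n) * 2 ^ (j + 2)))) = 1 / (4 * c * sqrt (2 ^ j))"
    using w_pos[of n] c0 by (simp add: power_add field_simps)
  finally show ?thesis .
qed

text \<open>Formulated with coordinates instead of \<open>S\<close>, so that it can be used before
  the operator is known to map the space into itself.\<close>

lemma sum_M_testvec_ge: "(A j / (4 * c))\<^sup>2 \<le> (\<Sum>n\<in>blk j. (cmod (M (testvec j) n))\<^sup>2)"
proof -
  have c0: "c > 0" using c_ge by simp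
  have "(A j / (4 * c))\<^sup>2 = (2 ^ j * (A j)\<^sup>2) * (1 / (4 * c * sqrt (2 ^ j)))\<^sup>2"
    by (simp add: power_divide power_mult_distrib)
  also have "\<dots> = (\<Sum>n\<in>blk j. (cmod (\<gamma> n))\<^sup>2 * (1 / (4 * c * sqrt (2 ^ j)))\<^sup>2)"
    unfolding A_sq sum_distrib_right ..
  also have "\<dots> \<le> (\<Sum>n\<in>blk j. (cmod (\<gamma> n))\<^sup>2 * (tau j n)\<^sup>2)"
    by (intro sum_mono mult_left_mono power_mono tau_ge) (use c0 in auto)
  also have "\<dots> = (\<Sum>n\<in>blk j. (cmod (M (testvec j) n))\<^sup>2)"
    by (simp add: M_testvec norm_mult power_mult_distrib)
  finally show ?thesis .
qed

text \<open>The conjugate of \<open>\<gamma>\<close> in the dual vector turns the pairing into a sum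
  of nonnegative terms, to which the lower bound for \<open>tau\<close> applies one by one.\<close>

lemma A_le_cinner:
  assumes total
  shows "A j / (4 * c) \<le> cmod (cinner (S (testvec j)) (dualvec j))"
proof (cases "A j = 0")
  case False
  then have A0: "A j > 0" using A_nonneg[of j] by linarith
  have c0: "c > 0" using c_ge by simp
  have "cinner (S (testvec j)) (dualvec j) = (\<Sum>n\<in>blk j. of_real ((cmod (\<gamma> n))\<^sup>2 * (tau j n / (A j * sqrt (2 ^ j)))))"
    unfolding dualvec_def if_not_P[OF False] cinner_finvec_right[OF finite_blk] cf_S[OF assms] M_testvec
  proof (intro sum.cong refl)
    fix n
    let ?x = "1 / (A j * sqrt (2 ^ j))"
    have "\<gamma> n * of_real (tau j n) * cnj (\<gamma> n * of_real ?x) = (\<gamma> n * cnj (\<gamma> n)) * of_real (tau j n * ?x)"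
      by (simp only: complex_cnj_mult complex_cnj_complex_of_real of_real_mult mult_ac)
    also have "\<dots> = of_real ((cmod (\<gamma> n))\<^sup>2 * (tau j n * ?x))"
      unfolding complex_norm_square[symmetric] of_real_mult ..
    finally show "\<gamma> n * of_real (tau j n) * cnj (\<gamma> n * of_real ?x) =
        of_real ((cmod (\<gamma> n))\<^sup>2 * (tau j n / (A j * sqrt (2 ^ j))))" by simp
  qed
  then have eq: "cinner (S (testvec j)) (dualvec j) = of_real (\<Sum>n\<in>blk j. (cmod (\<gamma> n))\<^sup>2 * (tau j n / (A j * sqrt (2 ^ j))))"
    by (simp only: of_real_sum)
  have "A j / (4 * c) = (2 ^ j * (A j)\<^sup>2) * (1 / (4 * c * sqrt (2 ^ j)) / (A j * sqrt (2 ^ j)))"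
    using A0 c0 by (simp add: power2_eq_square)
  also have "\<dots> = (\<Sum>n\<in>blk j. (cmod (\<gamma> n))\<^sup>2 * (1 / (4 * c * sqrt (2 ^ j)) / (A j * sqrt (2 ^ j))))"
    unfolding A_sq sum_distrib_right ..
  also have "\<dots> \<le> (\<Sum>n\<in>blk j. (cmod (\<gamma> n))\<^sup>2 * (tau j n / (A j * sqrt (2 ^ j))))"
    by (intro sum_mono mult_left_mono divide_right_mono tau_ge) (use A0 in auto)
  also have "\<dots> \<le> cmod (cinner (S (testvec j)) (dualvec j))"
    unfolding eq norm_of_real by simp
  finally show ?thesis .
qed simp

text \<open>The diagonal entries of an operator with respect to two orthonormal systems have an l^p
  norm of at most the Schatten norm. Here this is proved for the part spanned by singular vectors at
  levels \<open>\<ge> e\<close>, with an error of at most \<open>e\<close> in each entry, and then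
  \<open>e\<close> tends to 0.\<close>

lemma sum_A_powr_le:
  assumes total and S: "bounded_linear S" and p: "p \<ge> 1"
    and compact: "\<And>x :: nat \<Rightarrow> ell2. (\<And>n. norm (x n) \<le> 1) \<Longrightarrow>
                   \<exists>k h. strict_mono (k :: nat \<Rightarrow> nat) \<and> (\<lambda>n. S (x (k n))) \<longlonglongrightarrow> h"
    and R: "\<And>U s. finite U \<Longrightarrow> orthonormal_on U (\<lambda>u. u) \<Longrightarrow>
              (\<And>u. u \<in> U \<Longrightarrow> s u > 0 \<and> u \<in> singular_vectors S (s u)) \<Longrightarrow> (\<Sum>u\<in>U. s u powr p) \<le> R"
  shows "(\<Sum>j<N. A j powr p) \<le> (4 * c) powr p * R"
proof -
  interpret S: bounded_linear S by fact
  have c0: "c > 0" using c_ge by simp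
  have eps: "(\<Sum>j<N. (max 0 (A j / (4 * c) - e)) powr p) \<le> R" if e: "e > 0" for e
  proof -
    have R0: "R \<ge> 0" using R[of "{}"] by (auto simp: orthonormal_on_def)
    \<comment> \<open>Each such singular vector contributes at least \<open>e powr p\<close> to a
      sum that is bounded by \<open>R\<close>; this is the cardinality bound required for the
      exhaustion.\<close>
    have card: "card U \<le> nat \<lceil>R / e powr p\<rceil>"
      if U: "finite U" "orthonormal_on U (\<lambda>u. u)" "\<And>u. u \<in> U \<Longrightarrow> \<exists>s\<ge>e. u \<in> singular_vectors S s" for U
    proof -
      have "\<forall>u\<in>U. \<exists>s. s \<ge> e \<and> u \<in> singular_vectors S s" using U(3) by blast
      from bchoice[OF this]
      obtain s where s: "\<And>u. u \<in> U \<Longrightarrow> s u \<ge> e \<and> u \<in> singular_vectors S (s u)" by blast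
      have "(\<Sum>u\<in>U. e powr p) \<le> (\<Sum>u\<in>U. s u powr p)"
        using s e p by (intro sum_mono powr_mono2) auto
      also have "\<dots> \<le> R" by (rule R[OF U(1,2)]) (use s e in \<open>auto intro: less_le_trans\<close>)
      finally have "real (card U) \<le> R / e powr p" using e by (simp add: field_simps)
      then show ?thesis by linarith
    qed
    obtain U s where U: "finite U" "orthonormal_on U (\<lambda>u. u)"
      and s: "\<And>u. u \<in> U \<Longrightarrow> s u \<ge> e \<and> u \<in> singular_vectors S (s u)"
      and perp: "\<And>x. (\<And>u. u \<in> U \<Longrightarrow> cinner x u = 0) \<Longrightarrow> norm (S x) \<le> e * norm x"
      by (rule singular_vectors_exhaustion[OF S S_cscale[OF assms(1)] compact e card]) blast+
    have s0: "s u > 0" if "u \<in> U" for u using s[OF that] e by simp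
    define y where "y u = cscale (of_real (1 / s u)) (S u)" for u
    have SS: "cinner (S u) (S v) = (if u = v then of_real ((s u)\<^sup>2) else 0)" if "u \<in> U" "v \<in> U" for u v
      using s[OF that(1)] U(2) that by (auto simp: singular_vectors_def orthonormal_on_def)
    have ne: "s u \<noteq> 0" if "u \<in> U" for u
      using s0[OF that] by simp
    have ony: "orthonormal_on U y"
      unfolding orthonormal_on_def y_def cinner_cscale_left cinner_cscale_right
      by (auto simp: SS power2_eq_square ne)
    have Su: "S u = cscale (of_real (s u)) (y u)" if "u \<in> U" for u
      by (rule ell2_eqI) (simp add: y_def ne[OF that])
    define m where "m j u = cmod (cinner (testvec j) u) * cmod (cinner (y u) (dualvec j))" for j u
    \<comment> \<open>\<open>testvec j\<close> is split into its projection \<open>P\<close> to the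
      span of \<open>U\<close> and a remainder of norm at most 1, on whose image the operator costs
      at most \<open>e\<close>. The maximum with 0 keeps the base of the power nonnegative.\<close>
    have Aj: "max 0 (A j / (4 * c) - e) \<le> (\<Sum>u\<in>U. s u * m j u)" for j
    proof -
      define P where "P = (\<Sum>u\<in>U. cscale (cinner (testvec j) u) u)"
      have "norm (S (testvec j - P)) \<le> e * norm (testvec j - P)"
        using cinner_complement[OF U] by (intro perp) (simp add: P_def)
      also have "\<dots> \<le> e * 1"
        using norm_projection_le[OF U, of "testvec j"] e unfolding P_def by (intro mult_left_mono) auto
      finally have "norm (S (testvec j - P)) \<le> e" by simp
      then have 1: "cmod (cinner (S (testvec j - P)) (dualvec j)) \<le> e"
        using cinner_norm_le[of "S (testvec j - P)" "dualvec j"] by simp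
      have "S P = (\<Sum>u\<in>U. cscale (cinner (testvec j) u * of_real (s u)) (y u))"
        unfolding P_def S.sum S_cscale[OF assms(1)]
        by (intro sum.cong refl) (simp add: Su, rule ell2_eqI, simp)
      then have "cinner (S P) (dualvec j) = (\<Sum>u\<in>U. cinner (testvec j) u * of_real (s u) * cinner (y u) (dualvec j))"
        by (simp add: cinner_sum_left cinner_cscale_left)
      then have "cmod (cinner (S P) (dualvec j)) \<le> (\<Sum>u\<in>U. cmod (cinner (testvec j) u * of_real (s u) * cinner (y u) (dualvec j)))"
        by (simp only: norm_sum)
      also have "\<dots> = (\<Sum>u\<in>U. s u * m j u)"
        using s0 by (intro sum.cong refl) (auto simp: norm_mult m_def abs_of_pos)
      finally have 2: "cmod (cinner (S P) (dualvec j)) \<le> (\<Sum>u\<in>U. s u * m j u)" .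
      have split: "cinner (S (testvec j)) (dualvec j) = cinner (S P) (dualvec j) + cinner (S (testvec j - P)) (dualvec j)"
        by (simp add: S.diff cinner_diff_left)
      have "cmod (cinner (S (testvec j)) (dualvec j)) \<le> (\<Sum>u\<in>U. s u * m j u) + e"
        using norm_triangle_ineq[of "cinner (S P) (dualvec j)" "cinner (S (testvec j - P)) (dualvec j)"] 1 2
        unfolding split by linarith
      then have "A j / (4 * c) - e \<le> (\<Sum>u\<in>U. s u * m j u)" using A_le_cinner[OF assms(1), of j] by linarith
      moreover have "0 \<le> (\<Sum>u\<in>U. s u * m j u)" using s0 by (intro sum_nonneg) (auto simp: m_def less_imp_le)
      ultimately show ?thesis by simp
    qed
    have CS: "(\<Sum>i\<in>I. cmod (a i) * cmod (b i)) \<le> 1"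
      if "(\<Sum>i\<in>I. (cmod (a i))\<^sup>2) \<le> 1" "(\<Sum>i\<in>I. (cmod (b i))\<^sup>2) \<le> 1" for I :: "'z set" and a b
    proof -
      have "L2_set (\<lambda>i. cmod (a i)) I \<le> 1" "L2_set (\<lambda>i. cmod (b i)) I \<le> 1"
        using that by (auto simp: L2_set_def)
      then have "L2_set (\<lambda>i. cmod (a i)) I * L2_set (\<lambda>i. cmod (b i)) I \<le> 1 * 1"
        by (intro mult_mono) (auto simp: L2_set_nonneg)
      then show ?thesis using L2_set_mult_ineq[of "\<lambda>i. cmod (a i)" "\<lambda>i. cmod (b i)" I] by simp
    qed
    have cm: "cmod (cinner a b) = cmod (cinner b a)" for a b
      by (subst cinner_commute) simp
    have "(\<Sum>j<N. (max 0 (A j / (4 * c) - e)) powr p) \<le> (\<Sum>j<N. (\<Sum>u\<in>U. s u * m j u) powr p)"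
      using p by (intro sum_mono powr_mono2 Aj) auto
    \<comment> \<open>Schur's test with constant 1: row and column sums of \<open>m\<close> are sums
      of products of Fourier coefficients, bounded by Cauchy-Schwarz and Bessel, since
      \<open>U\<close>, \<open>y\<close>, the test vectors and the dual vectors are all
      orthonormal.\<close>
    also have "\<dots> \<le> 1 powr p * (\<Sum>u\<in>U. s u powr p)"
    proof (rule schur_powr)
      show "(\<Sum>u\<in>U. m j u) \<le> 1" for j
        unfolding m_def
      proof (rule CS)
        show "(\<Sum>u\<in>U. (cmod (cinner (testvec j) u))\<^sup>2) \<le> 1"
          using bessel[OF U, of "testvec j"] by simp
        show "(\<Sum>u\<in>U. (cmod (cinner (y u) (dualvec j)))\<^sup>2) \<le> 1"
          using bessel[OF U(1) ony, of "dualvec j"] by (simp add: cm[of "y _"])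
      qed
      show "(\<Sum>j<N. m j u) \<le> 1" if u: "u \<in> U" for u
        unfolding m_def
      proof (rule CS)
        show "(\<Sum>j<N. (cmod (cinner (testvec j) u))\<^sup>2) \<le> 1"
          using bessel[OF _ orthonormal_testvec, of "{..<N}" u] orthonormal_on_norm[OF U(2) u]
          by (simp add: cm[of "testvec _"])
        show "(\<Sum>j<N. (cmod (cinner (y u) (dualvec j)))\<^sup>2) \<le> 1"
          using bessel[OF _ orthonormal_dualvec, of "{..<N}" "y u"] orthonormal_on_norm[OF ony u] by simp
      qed
    qed (use U p s0 in \<open>auto simp: m_def less_imp_le\<close>)
    also have "\<dots> \<le> R" using R[OF U, of s] s s0 by simp
    finally show ?thesis .
  qed
  have e0: "(\<lambda>n. 1 / real (Suc n)) \<longlonglongrightarrow> 0"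
    using LIMSEQ_inverse_real_of_nat by (simp add: inverse_eq_divide)
  have "(\<lambda>n. \<Sum>j<N. (max 0 (A j / (4 * c) - 1 / real (Suc n))) powr p) \<longlonglongrightarrow> (\<Sum>j<N. (max 0 (A j / (4 * c) - 0)) powr p)"
    by (intro tendsto_sum tendsto_powr' tendsto_max tendsto_diff tendsto_const e0) (use p in auto)
  then have "(\<Sum>j<N. (max 0 (A j / (4 * c) - 0)) powr p) \<le> R"
    by (rule LIMSEQ_le_const2) (use eps in auto)
  moreover have "A j powr p = (4 * c) powr p * (max 0 (A j / (4 * c) - 0)) powr p" for j
    using c0 by (simp add: powr_mult[symmetric])
  ultimately show ?thesis
    by (simp add: mult_left_mono flip: sum_distrib_left)
qed

end

section \<open>Taylor coefficients and radial weights\<close>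

lemma vimage_mult_ball:
  fixes a :: complex assumes a: "cmod a = 1"
  shows "(\<lambda>z. a * z) -` ball x r = ball (cnj a * x) r"
proof -
  have aa: "a * cnj a = 1" using a complex_norm_square[of a] by simp
  have "dist x (a * z) = dist (cnj a * x) z" for z
  proof -
    have "x - a * z = a * (cnj a * x - z)" using aa by (simp add: algebra_simps)
    then show ?thesis by (simp add: dist_norm norm_mult a)
  qed
  then show ?thesis by (auto simp: ball_def)
qed

text \<open>By Vitali's covering theorem an open set is, up to a null set, a countable disjoint
  union of balls. Rotations carry balls to balls of the same radius, whereas they do not preserve
  boxes.\<close>

lemma emeasure_le_vimage_mult:
  fixes a :: complex assumes a: "cmod a = 1" and S: "open S"
  shows "emeasure lborel S \<le> emeasure lborel ((\<lambda>z. a * z) -` S)"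
proof -
  define K where "K = {p. snd p > (0::real) \<and> ball (fst p) (snd p) \<subseteq> S}"
  have "\<exists>i. i \<in> K \<and> x \<in> ball (fst i) (snd i) \<and> snd i < d" if x: "x \<in> S" "0 < d" for x d
  proof -
    obtain e where "e > 0" "ball x e \<subseteq> S" using S x open_contains_ball by blast
    then show ?thesis using x
      by (intro exI[of _ "(x, min e (d / 2))"]) (auto simp: K_def)
  qed
  then obtain C where C: "countable C" "C \<subseteq> K"
     "pairwise (\<lambda>i j. disjnt (ball (fst i) (snd i)) (ball (fst j) (snd j))) C"
     "negligible (S - (\<Union>i\<in>C. ball (fst i) (snd i)))"
    by (rule Vitali_covering_theorem_balls)
  define U where "U = (\<Union>i\<in>C. ball (fst i) (snd i))"
  have U: "U \<subseteq> S" "open U" using C(2) by (auto simp: U_def K_def)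
  have disj: "disjoint_family_on (\<lambda>i. ball (fst i) (snd i)) C"
    using C(3) by (auto simp: disjoint_family_on_def pairwise_def disjnt_def)
  have "S - U \<in> null_sets lborel"
    using C(4) U S by (simp add: negligible_iff_null_sets null_sets_completion_iff U_def borel_open)
  then have "emeasure lborel S = emeasure lborel U"
    using U S emeasure_Un_null_set[of U lborel "S - U"] by (simp add: Un_absorb1)
  also have "\<dots> = (\<integral>\<^sup>+i. emeasure lborel (ball (fst i) (snd i)) \<partial>count_space C)"
    unfolding U_def by (rule emeasure_UN_countable[OF _ C(1) disj]) simp
  also have "\<dots> = (\<integral>\<^sup>+i. emeasure lborel ((\<lambda>z. a * z) -` ball (fst i) (snd i)) \<partial>count_space C)"
    using C(2) unfolding vimage_mult_ball[OF a]
    by (intro nn_integral_cong) (auto simp: emeasure_ball K_def)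
  also have "\<dots> = emeasure lborel (\<Union>i\<in>C. (\<lambda>z. a * z) -` ball (fst i) (snd i))"
  proof (rule emeasure_UN_countable[symmetric, OF _ C(1)])
    show "disjoint_family_on (\<lambda>i. (\<lambda>z. a * z) -` ball (fst i) (snd i)) C"
      using disj unfolding disjoint_family_on_def by (simp flip: vimage_Int)
  qed (simp add: vimage_mult_ball[OF a])
  also have "\<dots> \<le> emeasure lborel ((\<lambda>z. a * z) -` S)"
  proof (rule emeasure_mono)
    have "open ((\<lambda>z. a * z) -` S)" using S by (intro open_vimage continuous_intros)
    then show "(\<lambda>z. a * z) -` S \<in> sets lborel" by simp
  qed (use U in \<open>auto simp: U_def\<close>)
  finally show ?thesis .
qed

text \<open>The one-sided estimate is applied to \<open>a\<close> and to its inverse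
  \<open>cnj a\<close>; equality on boxes then determines the measure.\<close>

lemma lborel_distr_rotation:
  fixes a :: complex assumes a: "cmod a = 1"
  shows "distr lborel borel (\<lambda>z. a * z) = lborel"
proof (rule lborel_eqI[symmetric])
  fix l u :: complex assume lu: "\<And>b. b \<in> Basis \<Longrightarrow> l \<bullet> b \<le> u \<bullet> b"
  have aa: "a * cnj a = 1" using a complex_norm_square[of a] by simp
  have op: "open ((\<lambda>z. a * z) -` box l u)" by (intro open_vimage continuous_intros open_box)
  have inv: "(\<lambda>z. cnj a * z) -` ((\<lambda>z. a * z) -` box l u) = box l u"
    using aa by (auto simp flip: mult.assoc)
  have "emeasure lborel ((\<lambda>z. a * z) -` box l u) \<le> emeasure lborel (box l u)"
    using emeasure_le_vimage_mult[of "cnj a", OF _ op] a unfolding inv by simp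
  then have "emeasure lborel ((\<lambda>z. a * z) -` box l u) = emeasure lborel (box l u)"
    using emeasure_le_vimage_mult[OF a open_box, of l u] by (rule antisym)
  then show "emeasure (distr lborel borel (\<lambda>z. a * z)) (box l u) = ennreal (\<Prod>b\<in>Basis. (u - l) \<bullet> b)"
    using lu by (simp add: emeasure_distr emeasure_lborel_box)
qed simp

lemma measurable_indicator_disc [measurable]:
  "(indicator unit_disc :: complex \<Rightarrow> ennreal) \<in> borel_measurable borel"
  by (rule borel_measurable_indicator) simp

text \<open>The two measures on the line are compared on half-lines, whose preimages in the disc are
  annuli of area \<open>pi - pi * m\<^sup>2\<close>. This is polar integration of radial functions,
  obtained without a change of variables in the plane.\<close>

lemma distr_cmod_disc:
  "distr (density lborel (indicator unit_disc)) borel cmod =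
   density lborel (\<lambda>s. ennreal (2 * pi * s) * indicator {0<..<1} s)"
  (is "?M = ?N")
proof (rule measure_eqI_lessThan)
  have meas: "cmod \<in> borel_measurable (density lborel (indicator unit_disc))" by simp
  have L: "emeasure ?M {x<..} = emeasure lborel (unit_disc \<inter> {z. x < cmod z})" for x
  proof -
    have "emeasure ?M {x<..} = emeasure (density lborel (indicator unit_disc)) (cmod -` {x<..})"
      by (subst emeasure_distr) auto
    also have "\<dots> = (\<integral>\<^sup>+z. indicator unit_disc z * indicator (cmod -` {x<..}) z \<partial>lborel)"
      by (rule emeasure_density) (auto intro: borel_open open_vimage continuous_intros)
    also have "\<dots> = (\<integral>\<^sup>+z. indicator (unit_disc \<inter> {z. x < cmod z}) z \<partial>lborel)"
      by (intro nn_integral_cong) (auto simp: indicator_def)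
    also have "\<dots> = emeasure lborel (unit_disc \<inter> {z. x < cmod z})"
      by (rule nn_integral_indicator) simp
    finally show ?thesis .
  qed
  have "emeasure ?M {x<..} \<le> emeasure lborel (ball (0::complex) 1)" for x
    unfolding L by (rule emeasure_mono) auto
  then show "emeasure ?M {x<..} < \<infinity>" for x
    by (rule le_less_trans) (simp add: emeasure_ball)
  fix x :: real
  \<comment> \<open>The inner radius of the annulus, that is \<open>x\<close> clamped to the unit
    interval. For negative \<open>x\<close> the origin is lost, which is a null set.\<close>
  define m where "m = min 1 (max 0 x)"
  have m: "0 \<le> m" "m \<le> 1" by (auto simp: m_def)
  have null: "{0::complex} \<in> null_sets lborel" by (intro finite_imp_null_set_lborel) simp
  have "emeasure lborel (unit_disc \<inter> {z. x < cmod z}) = emeasure lborel (unit_disc - cball 0 m)"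
  proof (cases "x < 0")
    case True
    then have eq: "unit_disc \<inter> {z. x < cmod z} = (unit_disc - cball 0 m) \<union> {0}" by (auto simp: m_def intro: less_le_trans)
    show ?thesis unfolding eq by (rule emeasure_Un_null_set[OF _ null]) simp
  next
    case False
    then have "unit_disc \<inter> {z. x < cmod z} = unit_disc - cball 0 m" by (auto simp: m_def)
    then show ?thesis by simp
  qed
  also have "\<dots> = ennreal (pi - pi * m\<^sup>2)"
  proof (cases "m = 1")
    case True
    then have eq: "unit_disc - cball (0::complex) m = {}" by auto
    show ?thesis unfolding eq using True by simp
  next
    case False
    then have "m < 1" using m by simp
    then have "cball (0::complex) m \<subseteq> ball 0 1" by auto
    then have "emeasure lborel (unit_disc - cball (0::complex) m) = emeasure lborel (ball (0::complex) 1) - emeasure lborel (cball (0::complex) m)"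
      by (intro emeasure_Diff) (auto simp: emeasure_cball m)
    also have "\<dots> = ennreal pi - ennreal (pi * m\<^sup>2)"
      using m by (simp add: emeasure_ball emeasure_cball unit_ball_vol_2 power2_eq_square)
    also have "\<dots> = ennreal (pi - pi * m\<^sup>2)" by (simp add: ennreal_minus m)
    finally show ?thesis .
  qed
  also have "ennreal (pi - pi * m\<^sup>2) = (\<integral>\<^sup>+s. ennreal (2 * pi * s) * indicator {m..1} s \<partial>lborel)"
  proof -
    have "(\<integral>\<^sup>+s. ennreal (2 * pi * s) * indicator {m..1} s \<partial>lborel) = ennreal (pi * 1\<^sup>2 - pi * m\<^sup>2)"
    proof (rule nn_integral_FTC_Icc)
      show "((\<lambda>s. pi * s\<^sup>2) has_real_derivative 2 * pi * s) (at s)" for s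
        by (rule derivative_eq_intros refl | simp)+
    qed (use m in auto)
    then show ?thesis by simp
  qed
  also have "\<dots> = (\<integral>\<^sup>+s. ennreal (2 * pi * s) * indicator {0<..<1} s * indicator {x<..} s \<partial>lborel)"
  proof (rule nn_integral_cong_AE)
    have "AE s in lborel. s \<noteq> m \<and> s \<noteq> 1 \<and> s \<noteq> 0"
      using AE_lborel_singleton[of m] AE_lborel_singleton[of 1] AE_lborel_singleton[of 0] by eventually_elim auto
    then show "AE s in lborel. ennreal (2 * pi * s) * indicator {m..1} s =
        ennreal (2 * pi * s) * indicator {0<..<1} s * indicator {x<..} s"
      by eventually_elim (auto simp: m_def indicator_def split: if_splits)
  qed
  also have "\<dots> = emeasure ?N {x<..}" by (simp add: emeasure_density)
  finally show "emeasure ?M {x<..} = emeasure ?N {x<..}" unfolding L .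
qed simp_all

lemma nn_integral_radial:
  assumes [measurable]: "f \<in> borel_measurable borel"
  shows "(\<integral>\<^sup>+z. f (cmod z) * indicator unit_disc z \<partial>lborel) =
         (\<integral>\<^sup>+s. f s * ennreal (2 * pi * s) * indicator {0<..<1} s \<partial>lborel)"
proof -
  have "(\<integral>\<^sup>+z. f (cmod z) * indicator unit_disc z \<partial>lborel) = (\<integral>\<^sup>+z. f (cmod z) \<partial>density lborel (indicator unit_disc))"
    by (subst nn_integral_density) (auto simp: mult.commute)
  also have "\<dots> = (\<integral>\<^sup>+s. f s \<partial>distr (density lborel (indicator unit_disc)) borel cmod)"
    by (subst nn_integral_distr) auto
  also have "\<dots> = (\<integral>\<^sup>+s. ennreal (2 * pi * s) * indicator {0<..<1} s * f s \<partial>lborel)"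
    unfolding distr_cmod_disc by (subst nn_integral_density) auto
  finally show ?thesis by (simp add: mult_ac)
qed

text \<open>The radial density \<open>2 * pi * s\<close> is positive on the open interval, so null
  sets of radii and null unions of circles correspond to each other.\<close>

lemma null_sets_radial_iff:
  assumes "N \<in> sets borel" "N \<subseteq> {0<..<1}"
  shows "{z\<in>unit_disc. cmod z \<in> N} \<in> null_sets lborel \<longleftrightarrow> N \<in> null_sets lborel"
proof -
  have [measurable]: "N \<in> sets borel" by fact
  have m: "{z\<in>unit_disc. cmod z \<in> N} \<in> sets borel" by measurable
  have "emeasure lborel {z\<in>unit_disc. cmod z \<in> N} = (\<integral>\<^sup>+z. indicator N (cmod z) * indicator unit_disc z \<partial>lborel)"
  proof -
    have "emeasure lborel {z\<in>unit_disc. cmod z \<in> N} = (\<integral>\<^sup>+z. indicator {z\<in>unit_disc. cmod z \<in> N} z \<partial>lborel)"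
      by (rule nn_integral_indicator[symmetric]) (use m in simp)
    also have "\<dots> = (\<integral>\<^sup>+z. indicator N (cmod z) * indicator unit_disc z \<partial>lborel)"
      by (intro nn_integral_cong) (auto simp: indicator_def)
    finally show ?thesis .
  qed
  also have "\<dots> = (\<integral>\<^sup>+s. indicator N s * ennreal (2 * pi * s) * indicator {0<..<1} s \<partial>lborel)"
    by (rule nn_integral_radial) simp
  finally have e: "emeasure lborel {z\<in>unit_disc. cmod z \<in> N} = (\<integral>\<^sup>+s. indicator N s * ennreal (2 * pi * s) * indicator {0<..<1} s \<partial>lborel)" .
  have "emeasure lborel {z\<in>unit_disc. cmod z \<in> N} = 0 \<longleftrightarrow>
      (AE s in lborel. indicator N s * ennreal (2 * pi * s) * indicator {0<..<1} s = 0)"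
    unfolding e by (rule nn_integral_0_iff_AE) simp
  also have "\<dots> \<longleftrightarrow> (AE s in lborel. s \<notin> N)"
    using assms(2) pi_gt_zero[folded not_le]
    by (intro AE_cong) (auto simp: indicator_def mult_eq_0_iff ennreal_eq_0_iff mult_le_0_iff)
  also have "\<dots> \<longleftrightarrow> N \<in> null_sets lborel" using assms(1) by (simp add: AE_iff_null)
  finally show ?thesis using m by (simp add: null_sets_def)
qed

text \<open>Continuous images of Borel sets need not be Borel. The set is therefore replaced, up to
  a null set, by a countable union of compact sets, whose image under \<open>cmod\<close> is again a
  countable union of compact sets.\<close>

lemma radial_inner_borel:
  assumes Z: "{z\<in>unit_disc. cmod z \<in> E} \<in> sets lebesgue"
  obtains K where "K \<in> sets borel" "K \<subseteq> E" "negligible {z\<in>unit_disc. cmod z \<in> E - K}"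
proof -
  obtain C T where CT: "fsigma C" "T \<in> null_sets lebesgue" "C \<union> T = {z\<in>unit_disc. cmod z \<in> E}"
    using lebesgue_set_almost_fsigma[OF Z] by metis
  obtain F :: "nat \<Rightarrow> complex set" where F: "range F \<subseteq> Collect compact" "C = \<Union>(range F)"
    using fsigma_Union_compact CT(1) by metis
  define K where "K = (\<Union>n. cmod ` F n)"
  have "compact (cmod ` F n)" for n
    using F(1) by (intro compact_continuous_image continuous_intros) auto
  then have "K \<in> sets borel" unfolding K_def by (intro sets.countable_UN) (auto intro: borel_compact)
  moreover have "K \<subseteq> E"
  proof
    fix s assume "s \<in> K"
    then obtain z where "z \<in> C" "s = cmod z" using F(2) by (auto simp: K_def)
    then show "s \<in> E" using CT(3) by auto
  qed
  moreover have "negligible {z\<in>unit_disc. cmod z \<in> E - K}"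
  proof (rule negligible_subset)
    show "negligible T" using CT(2) by (simp add: negligible_iff_null_sets)
    show "{z\<in>unit_disc. cmod z \<in> E - K} \<subseteq> T"
    proof
      fix z assume z: "z \<in> {z\<in>unit_disc. cmod z \<in> E - K}"
      then have "z \<in> C \<union> T" using CT(3) by auto
      moreover have "z \<notin> C" using z F(2) by (auto simp: K_def)
      ultimately show "z \<in> T" by simp
    qed
  qed
  ultimately show ?thesis using that by blast
qed

text \<open>Sandwich the set between Borel sets.\<close>

lemma radial_sets_lebesgue:
  assumes E: "E \<subseteq> {0<..<1}" and Z: "{z\<in>unit_disc. cmod z \<in> E} \<in> sets lebesgue"
  shows "E \<in> sets lebesgue"
proof -
  define E' where "E' = {0<..<1} - E"
  have "{z\<in>unit_disc. cmod z \<in> E'} = (unit_disc - {0}) - {z\<in>unit_disc. cmod z \<in> E}"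
    by (auto simp: E'_def)
  then have Z': "{z\<in>unit_disc. cmod z \<in> E'} \<in> sets lebesgue" using Z by (simp add: sets.Diff)
  obtain K where K: "K \<in> sets borel" "K \<subseteq> E" "negligible {z\<in>unit_disc. cmod z \<in> E - K}"
    using radial_inner_borel[OF Z] .
  obtain K' where K': "K' \<in> sets borel" "K' \<subseteq> E'" "negligible {z\<in>unit_disc. cmod z \<in> E' - K'}"
    using radial_inner_borel[OF Z'] .
  define G where "G = {0<..<1} - K' - K"
  have G: "G \<in> sets borel" "G \<subseteq> {0<..<1}" using K(1) K'(1) by (auto simp: G_def)
  have "negligible {z\<in>unit_disc. cmod z \<in> G}"
    by (rule negligible_subset[OF negligible_Un[OF K(3) K'(3)]]) (auto simp: G_def E'_def)
  moreover have "{z\<in>unit_disc. cmod z \<in> G} \<in> sets borel"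
  proof -
    have [measurable]: "G \<in> sets borel" by fact
    show ?thesis by measurable
  qed
  ultimately have "{z\<in>unit_disc. cmod z \<in> G} \<in> null_sets lborel"
    by (simp add: negligible_iff_null_sets null_sets_completion_iff)
  then have "G \<in> null_sets lborel" using null_sets_radial_iff[OF G] by simp
  moreover have "E - K \<subseteq> G" using E K'(2) by (auto simp: G_def E'_def)
  ultimately have "E - K \<in> sets lebesgue" by (intro null_sets_completion) auto
  moreover have "K \<in> sets lebesgue" using K(1) by simp
  ultimately have "K \<union> (E - K) \<in> sets lebesgue" by (rule sets.Un[rotated])
  moreover have "K \<union> (E - K) = E" using K(2) by auto
  ultimately show ?thesis by simp
qed

lemma sets_area_measure: "sets area_measure = sets (lebesgue_on unit_disc)"
  by (simp add: area_measure_def)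

lemma space_area_measure: "space area_measure = unit_disc"
  by (simp add: area_measure_def)

lemma radial_weight_measurable:
  assumes "radial_weight v"
  shows "v \<in> borel_measurable (lebesgue_on unit_disc)"
proof -
  have "v \<in> borel_measurable area_measure"
    using assms by (auto simp: radial_weight_def dest: borel_measurable_integrable)
  then show ?thesis by (simp add: measurable_def sets_area_measure space_area_measure)
qed

text \<open>The weight is Lebesgue measurable on the disc, while \<open>weight_hat\<close>
  integrates it along a radius, which is a null set of the plane. Radiality carries measurability
  over to the radius. A single Borel profile then describes the weight almost everywhere on the
  interval and on the disc.\<close>

lemma radial_weight_borel:
  assumes v: "radial_weight v"
  obtains \<phi> :: "real \<Rightarrow> real" where "\<phi> \<in> borel_measurable borel" "\<And>s. \<phi> s > 0"
    "AE s in lborel. s \<in> {0<..<1} \<longrightarrow> v (of_real s) = \<phi> s"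
    "AE z in lborel. z \<in> unit_disc \<longrightarrow> v z = \<phi> (cmod z)"
proof -
  define g where "g s = (if s \<in> {0<..<1} then v (of_real s) else 0)" for s :: real
  have vr: "v z = v (of_real (cmod z))" "v z > 0" if "z \<in> unit_disc" for z
    using v that unfolding radial_weight_def by blast+
  have "g \<in> borel_measurable lebesgue"
    unfolding borel_measurable_iff_greater
  proof
    fix a
    define E where "E = {s\<in>{0<..<1}. a < v (of_real s)}"
    have "E \<in> sets lebesgue"
    proof (rule radial_sets_lebesgue)
      have "{z \<in> space (lebesgue_on unit_disc). a < v z} \<in> sets (lebesgue_on unit_disc)"
        using radial_weight_measurable[OF v] by (rule borel_measurable_less[OF borel_measurable_const])
      then have 1: "{z \<in> unit_disc. a < v z} \<in> sets lebesgue"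
        by (simp add: sets_restrict_space_iff)
      have "a < v (of_real (cmod z)) \<longleftrightarrow> a < v z" if "z \<in> unit_disc" for z
        using vr(1)[OF that] by simp
      then have "{z\<in>unit_disc. cmod z \<in> E} = {z \<in> unit_disc. a < v z} - {0}"
        unfolding E_def by auto
      then show "{z\<in>unit_disc. cmod z \<in> E} \<in> sets lebesgue" using 1 by (simp add: sets.Diff)
    qed (auto simp: E_def)
    moreover have "{s \<in> space lebesgue. a < g s} = E \<union> (if a < 0 then - {0<..<1} else {})"
      by (auto simp: g_def E_def)
    ultimately show "{s \<in> space lebesgue. a < g s} \<in> sets lebesgue" by auto
  qed
  from completion_ex_borel_measurable_real[OF this]
  obtain g' where g': "g' \<in> borel_measurable borel" "AE s in lborel. g s = g' s" by auto
  have [measurable]: "g' \<in> borel_measurable borel" by fact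
  \<comment> \<open>The default value 1 makes the profile positive everywhere; it differs from the
    weight only on the exceptional null set or outside the interval.\<close>
  define \<phi> where "\<phi> s = (if g' s > 0 then g' s else 1)" for s
  have 1: "\<phi> \<in> borel_measurable borel" unfolding \<phi>_def by measurable
  have 2: "\<phi> s > 0" for s by (simp add: \<phi>_def)
  have 3: "AE s in lborel. s \<in> {0<..<1} \<longrightarrow> v (of_real s) = \<phi> s"
    using g'(2)
  proof eventually_elim
    case (elim s)
    have "v (of_real s) > 0" if "s \<in> {0<..<1}" using that by (intro vr) auto
    then show ?case using elim by (auto simp: g_def \<phi>_def)
  qed
  \<comment> \<open>The exceptional radii sweep out a null set of circles, which transfers the
    identity from the interval to the disc.\<close>
  obtain N where N: "N \<in> null_sets lborel" "{s. \<not> (s \<in> {0<..<1} \<longrightarrow> v (of_real s) = \<phi> s)} \<subseteq> N"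
    using 3 by (auto elim: AE_E simp: null_sets_def)
  have N01: "N \<inter> {0<..<1} \<in> null_sets lborel" using N(1) by (intro null_set_Int2) auto
  then have "{z\<in>unit_disc. cmod z \<in> N \<inter> {0<..<1}} \<in> null_sets lborel"
    using null_sets_radial_iff[of "N \<inter> {0<..<1}"] by auto
  then have "AE z in lborel. z \<notin> {z\<in>unit_disc. cmod z \<in> N \<inter> {0<..<1}}"
    by (rule AE_not_in)
  moreover have "AE z in lborel. z \<noteq> (0::complex)" by (rule AE_lborel_singleton)
  ultimately have 4: "AE z in lborel. z \<in> unit_disc \<longrightarrow> v z = \<phi> (cmod z)"
  proof eventually_elim
    case (elim z)
    show ?case
    proof
      assume z: "z \<in> unit_disc"
      then have "cmod z \<in> {0<..<1}" "cmod z \<notin> N" using elim by auto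
      then have "v (of_real (cmod z)) = \<phi> (cmod z)" using N(2) by blast
      then show "v z = \<phi> (cmod z)" using vr(1)[OF z] by simp
    qed
  qed
  show ?thesis using that 1 2 3 4 by blast
qed

locale radial_density =
  fixes v :: "complex \<Rightarrow> real" and \<phi> :: "real \<Rightarrow> real"
  assumes v: "radial_weight v"
    and \<phi>_measurable [measurable]: "\<phi> \<in> borel_measurable borel" and \<phi>_pos: "\<And>s. \<phi> s > 0"
    and \<phi>_interval: "AE s in lborel. s \<in> {0<..<1} \<longrightarrow> v (of_real s) = \<phi> s"
    and \<phi>_disc: "AE z in lborel. z \<in> unit_disc \<longrightarrow> v z = \<phi> (cmod z)"
begin

lemma weight_hat_eq:
  assumes "r \<ge> 0"
  shows "weight_hat v r = (\<integral>\<^sup>+s. ennreal (\<phi> s) * indicator {r<..<1} s \<partial>lborel)"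
  unfolding weight_hat_def nn_integral_completion
  by (rule nn_integral_cong_AE) (use \<phi>_interval assms in \<open>auto simp: indicator_def\<close>)

text \<open>The measure v dA, carried to the Borel sets of the whole plane and concentrated on the
  disc.\<close>

definition \<mu> :: "complex measure" where
  "\<mu> = density lborel (\<lambda>z. ennreal (\<phi> (cmod z) / pi) * indicator unit_disc z)"

lemma sets_\<mu> [simp, measurable_cong]: "sets \<mu> = sets borel"
  by (simp add: \<mu>_def)

lemma space_\<mu> [simp]: "space \<mu> = UNIV"
  by (simp add: \<mu>_def)

lemma nn_integral_\<mu>:
  assumes [measurable]: "f \<in> borel_measurable borel"
  shows "(\<integral>\<^sup>+z. f z \<partial>\<mu>) = (\<integral>\<^sup>+z. ennreal (\<phi> (cmod z) / pi) * indicator unit_disc z * f z \<partial>lborel)"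
  unfolding \<mu>_def by (rule nn_integral_density) measurable

lemma nn_integral_area:
  assumes F: "\<And>z. F z \<ge> 0" "continuous_on unit_disc F"
  shows "(\<integral>\<^sup>+z. ennreal (F z * v z) \<partial>area_measure) = (\<integral>\<^sup>+z. ennreal (indicator unit_disc z * F z) \<partial>\<mu>)"
proof -
  have [measurable]: "(\<lambda>z. indicator unit_disc z * F z) \<in> borel_measurable borel"
    using borel_measurable_continuous_on_indicator[OF _ F(2)] by simp
  have "F \<in> borel_measurable (lebesgue_on unit_disc)"
    by (rule continuous_imp_measurable_on_sets_lebesgue[OF F(2)]) simp
  then have [measurable]: "(\<lambda>z. ennreal (F z * v z)) \<in> borel_measurable (lebesgue_on unit_disc)"
    using radial_weight_measurable[OF v] by measurable
  have "(\<integral>\<^sup>+z. ennreal (F z * v z) \<partial>area_measure) = (\<integral>\<^sup>+z. ennreal (1 / pi) * ennreal (F z * v z) \<partial>lebesgue_on unit_disc)"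
    unfolding area_measure_def by (rule nn_integral_density) measurable
  also have "\<dots> = (\<integral>\<^sup>+z. ennreal (1 / pi) * ennreal (F z * v z) * indicator unit_disc z \<partial>lborel)"
    by (subst nn_integral_restrict_space) (simp_all add: nn_integral_completion)
  also have "\<dots> = (\<integral>\<^sup>+z. ennreal (\<phi> (cmod z) / pi) * indicator unit_disc z * ennreal (indicator unit_disc z * F z) \<partial>lborel)"
    using \<phi>_disc
    by (intro nn_integral_cong_AE, eventually_elim)
      (auto simp: indicator_def ennreal_mult[symmetric] F(1) \<phi>_pos less_imp_le mult_ac)
  also have "\<dots> = (\<integral>\<^sup>+z. ennreal (indicator unit_disc z * F z) \<partial>\<mu>)"
    by (rule nn_integral_\<mu>[symmetric]) measurable
  finally show ?thesis .
qed

lemma finite_measure_\<mu>: "finite_measure \<mu>"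
proof
  have "emeasure \<mu> (space \<mu>) = (\<integral>\<^sup>+z. 1 \<partial>\<mu>)" by simp
  also have "\<dots> = (\<integral>\<^sup>+z. ennreal (indicator unit_disc z * 1) \<partial>\<mu>)"
    by (subst (1 2) nn_integral_\<mu>) (auto intro!: nn_integral_cong simp: indicator_def)
  also have "\<dots> = (\<integral>\<^sup>+z. ennreal (1 * v z) \<partial>area_measure)"
    by (rule nn_integral_area[symmetric]) auto
  also have "\<dots> \<le> (\<integral>\<^sup>+z. ennreal (norm (v z)) \<partial>area_measure)"
    by (intro nn_integral_mono) (auto intro: ennreal_leI)
  also have "\<dots> < \<infinity>"
    using v by (auto simp: radial_weight_def integrable_iff_bounded)
  finally show "emeasure \<mu> (space \<mu>) \<noteq> \<infinity>" by simp
qed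

lemma distr_\<mu>_rotation:
  assumes a: "cmod a = 1"
  shows "distr \<mu> borel (\<lambda>z. a * z) = \<mu>"
proof (rule measure_eqI)
  fix X assume "X \<in> sets (distr \<mu> borel (\<lambda>z. a * z))"
  then have [measurable]: "X \<in> sets borel" by simp
  define h where "h z = ennreal (\<phi> (cmod z) / pi) * indicator unit_disc z * indicator X z" for z
  have [measurable]: "h \<in> borel_measurable borel" unfolding h_def by measurable
  have X': "(\<lambda>z. a * z) -` X \<in> sets borel"
    using measurable_sets[of "\<lambda>z. a * z" borel borel X] by simp
  have "emeasure (distr \<mu> borel (\<lambda>z. a * z)) X = emeasure \<mu> ((\<lambda>z. a * z) -` X)"
    by (subst emeasure_distr) auto
  also have "\<dots> = (\<integral>\<^sup>+z. ennreal (\<phi> (cmod z) / pi) * indicator unit_disc z * indicator ((\<lambda>z. a * z) -` X) z \<partial>lborel)"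
    unfolding \<mu>_def using X' by (subst emeasure_density) auto
  also have "\<dots> = (\<integral>\<^sup>+z. h (a * z) \<partial>lborel)"
    by (intro nn_integral_cong) (simp add: h_def norm_mult a indicator_def)
  also have "\<dots> = (\<integral>\<^sup>+z. h z \<partial>distr lborel borel (\<lambda>z. a * z))"
    by (subst nn_integral_distr) auto
  also have "\<dots> = (\<integral>\<^sup>+z. h z \<partial>lborel)" by (simp add: lborel_distr_rotation a)
  also have "\<dots> = emeasure \<mu> X"
    unfolding \<mu>_def h_def by (subst emeasure_density) auto
  finally show "emeasure (distr \<mu> borel (\<lambda>z. a * z)) X = emeasure \<mu> X" .
qed simp

lemma nn_integral_\<mu>_radial:
  assumes [measurable]: "f \<in> borel_measurable borel"
  shows "(\<integral>\<^sup>+z. f (cmod z) \<partial>\<mu>) = (\<integral>\<^sup>+s. f s * ennreal (2 * s * \<phi> s) * indicator {0<..<1} s \<partial>lborel)"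
proof -
  have "(\<integral>\<^sup>+z. f (cmod z) \<partial>\<mu>) = (\<integral>\<^sup>+z. (ennreal (\<phi> (cmod z) / pi) * f (cmod z)) * indicator unit_disc z \<partial>lborel)"
    by (subst nn_integral_\<mu>) (auto simp: mult_ac)
  also have "\<dots> = (\<integral>\<^sup>+s. (ennreal (\<phi> s / pi) * f s) * ennreal (2 * pi * s) * indicator {0<..<1} s \<partial>lborel)"
    by (rule nn_integral_radial) measurable
  also have "\<dots> = (\<integral>\<^sup>+s. f s * ennreal (2 * s * \<phi> s) * indicator {0<..<1} s \<partial>lborel)"
  proof (intro nn_integral_cong)
    fix s
    show "(ennreal (\<phi> s / pi) * f s) * ennreal (2 * pi * s) * indicator {0<..<1} s = f s * ennreal (2 * s * \<phi> s) * indicator {0<..<1} s"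
    proof (cases "s \<in> {0<..<1}")
      case True
      have "ennreal (\<phi> s / pi) * ennreal (2 * pi * s) = ennreal (\<phi> s / pi * (2 * pi * s))"
        using True \<phi>_pos[of s] by (intro ennreal_mult[symmetric]) auto
      also have "\<phi> s / pi * (2 * pi * s) = 2 * s * \<phi> s" by simp
      finally show ?thesis using True by (simp add: mult_ac)
    qed simp
  qed
  finally show ?thesis .
qed

end

section \<open>Parseval's identity on circles and on the disc\<close>

lemma borel_measurable_cnj [measurable]: "cnj \<in> borel_measurable borel"
  by (intro borel_measurable_continuous_onI continuous_intros)

text \<open>An abstract finite measure is used because the identity serves twice: for exponentials
  on a circle and for monomials cut off to a smaller disc. The summable majorant justifies
  integration term by term. Expanding \<open>F\<close> against \<open>cnj (e m)\<close> gives the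
  coefficients, expanding it against \<open>cnj F\<close> gives the identity.\<close>

lemma parseval_general:
  fixes e :: "nat \<Rightarrow> 'a \<Rightarrow> complex" and c :: "nat \<Rightarrow> complex"
  assumes M: "finite_measure M" and e [measurable]: "\<And>n. e n \<in> borel_measurable M"
    and b: "\<And>n x. x \<in> space M \<Longrightarrow> cmod (e n x) \<le> b n" and s: "summable (\<lambda>n. cmod (c n) * b n)"
    and orth: "\<forall>m n. m \<noteq> n \<longrightarrow> (\<integral>x. e m x * cnj (e n x) \<partial>M) = 0"
    and F [measurable]: "F \<in> borel_measurable M" and Fe: "\<And>x. x \<in> space M \<Longrightarrow> (\<lambda>n. c n * e n x) sums F x"
  shows "integrable M (\<lambda>x. (cmod (F x))\<^sup>2)"
    and "(\<lambda>n. (cmod (c n))\<^sup>2 * (\<integral>x. (cmod (e n x))\<^sup>2 \<partial>M)) sums (\<integral>x. (cmod (F x))\<^sup>2 \<partial>M)"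
proof -
  interpret finite_measure M by fact
  define B where "B = (\<Sum>n. cmod (c n) * b n)"
  have nb: "cmod (c n * e n x) \<le> cmod (c n) * b n" if "x \<in> space M" for n x
    using b[OF that] by (simp add: norm_mult mult_left_mono)
  have sn: "summable (\<lambda>n. cmod (c n * e n x))" if "x \<in> space M" for x
    by (rule summable_comparison_test'[OF s, of 0]) (use nb[OF that] in simp)
  have FB: "cmod (F x) \<le> B" if x: "x \<in> space M" for x
  proof -
    have "cmod (F x) = cmod (\<Sum>n. c n * e n x)" using Fe[OF x] by (simp add: sums_iff)
    also have "\<dots> \<le> (\<Sum>n. cmod (c n * e n x))" by (rule summable_norm[OF sn[OF x]])
    also have "\<dots> \<le> B" unfolding B_def by (rule suminf_le[OF nb[OF x] sn[OF x] s])
    finally show ?thesis .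
  qed
  have ie: "integrable M (\<lambda>x. G x * H x)"
    if "G \<in> borel_measurable M" "H \<in> borel_measurable M" "\<And>x. x \<in> space M \<Longrightarrow> cmod (G x) \<le> C"
      "\<And>x. x \<in> space M \<Longrightarrow> cmod (H x) \<le> D" for G H :: "'a \<Rightarrow> complex" and C D
  proof (rule integrable_const_bound[of _ "\<bar>C\<bar> * \<bar>D\<bar>"])
    show "AE x in M. norm (G x * H x) \<le> \<bar>C\<bar> * \<bar>D\<bar>"
    proof (rule AE_I2)
      fix x assume x: "x \<in> space M"
      show "norm (G x * H x) \<le> \<bar>C\<bar> * \<bar>D\<bar>"
        unfolding norm_mult
        by (intro mult_mono order_trans[OF that(3)[OF x] abs_ge_self] order_trans[OF that(4)[OF x] abs_ge_self]) auto
    qed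
    show "(\<lambda>x. G x * H x) \<in> borel_measurable M" using that by measurable
  qed
  have expand: "(\<lambda>n. c n * (\<integral>x. G x * e n x \<partial>M)) sums (\<integral>x. G x * F x \<partial>M)"
    if G [measurable]: "G \<in> borel_measurable M" and GC: "\<And>x. x \<in> space M \<Longrightarrow> cmod (G x) \<le> C" and C: "C \<ge> 0" for G C
  proof -
    have Ge: "integrable M (\<lambda>x. G x * e n x)" for n
      by (rule ie[OF G e GC b])
    have "(\<lambda>n. \<integral>x. c n * (G x * e n x) \<partial>M) sums (\<integral>x. (\<Sum>n. c n * (G x * e n x)) \<partial>M)"
    proof (rule sums_integral)
      show "integrable M (\<lambda>x. c n * (G x * e n x))" for n using Ge by simp
      have bd: "norm (c n * (G x * e n x)) \<le> C * (cmod (c n) * b n)" if "x \<in> space M" for n x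
      proof -
        have "norm (c n * (G x * e n x)) = cmod (G x) * cmod (c n * e n x)" by (simp add: norm_mult)
        also have "\<dots> \<le> C * (cmod (c n) * b n)" using nb[OF that] GC[OF that] C by (intro mult_mono) auto
        finally show ?thesis .
      qed
      show "AE x in M. summable (\<lambda>n. norm (c n * (G x * e n x)))"
      proof (rule AE_I2)
        fix x assume "x \<in> space M"
        then show "summable (\<lambda>n. norm (c n * (G x * e n x)))"
          by (intro summable_comparison_test'[OF summable_mult[OF s, of C], of 0]) (use bd in simp)
      qed
      show "summable (\<lambda>n. \<integral>x. norm (c n * (G x * e n x)) \<partial>M)"
      proof (rule summable_comparison_test'[OF summable_mult[OF s, of "C * measure M (space M)"], of 0])
        fix n
        have "(\<integral>x. norm (c n * (G x * e n x)) \<partial>M) \<le> (\<integral>x. C * (cmod (c n) * b n) \<partial>M)"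
          using Ge bd by (intro integral_mono) auto
        also have "\<dots> = C * measure M (space M) * (cmod (c n) * b n)" by simp
        finally show "norm (\<integral>x. norm (c n * (G x * e n x)) \<partial>M) \<le> C * measure M (space M) * (cmod (c n) * b n)"
          by simp
      qed
    qed
    moreover have "(\<integral>x. (\<Sum>n. c n * (G x * e n x)) \<partial>M) = (\<integral>x. G x * F x \<partial>M)"
    proof (rule Bochner_Integration.integral_cong[OF refl])
      fix x assume "x \<in> space M"
      from sums_mult[OF Fe[OF this], of "G x"]
      show "(\<Sum>n. c n * (G x * e n x)) = G x * F x" by (simp add: sums_iff mult_ac)
    qed
    ultimately show ?thesis by simp
  qed
  have coeff: "(\<integral>x. cnj (e m x) * F x \<partial>M) = c m * (\<integral>x. (cmod (e m x))\<^sup>2 \<partial>M)" for m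
  proof -
    have "(\<lambda>n. c n * (\<integral>x. cnj (e m x) * e n x \<partial>M)) sums (\<integral>x. cnj (e m x) * F x \<partial>M)"
      by (rule expand[of _ "\<bar>b m\<bar>"], measurable) (auto intro: order_trans[OF b])
    moreover have "c n * (\<integral>x. cnj (e m x) * e n x \<partial>M) = 0" if "n \<noteq> m" for n
      using orth that by (simp add: mult.commute)
    then have "(\<lambda>n. c n * (\<integral>x. cnj (e m x) * e n x \<partial>M)) sums (c m * (\<integral>x. cnj (e m x) * e m x \<partial>M))"
      using sums_finite[of "{m}" "\<lambda>n. c n * (\<integral>x. cnj (e m x) * e n x \<partial>M)"] by simp
    moreover have "(\<integral>x. cnj (e m x) * e m x \<partial>M) = of_real (\<integral>x. (cmod (e m x))\<^sup>2 \<partial>M)"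
      unfolding integral_complex_of_real[symmetric]
      by (intro Bochner_Integration.integral_cong refl) (simp only: complex_norm_square mult.commute)
    ultimately show ?thesis using sums_unique2 by metis
  qed
  show "integrable M (\<lambda>x. (cmod (F x))\<^sup>2)"
    by (rule integrable_const_bound[of _ "B\<^sup>2"]) (auto intro!: AE_I2 power_mono FB)
  have "(\<lambda>n. c n * (\<integral>x. cnj (F x) * e n x \<partial>M)) sums (\<integral>x. cnj (F x) * F x \<partial>M)"
    by (rule expand[of _ "\<bar>B\<bar>"], measurable) (auto intro: order_trans[OF FB])
  moreover have "(\<integral>x. cnj (F x) * e n x \<partial>M) = cnj (c n) * of_real (\<integral>x. (cmod (e n x))\<^sup>2 \<partial>M)" for n
  proof -
    have "(\<integral>x. cnj (F x) * e n x \<partial>M) = (\<integral>x. cnj (cnj (e n x) * F x) \<partial>M)"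
      by (simp add: mult.commute)
    also have "\<dots> = cnj (\<integral>x. cnj (e n x) * F x \<partial>M)" by (rule Bochner_Integration.integral_cnj)
    finally show ?thesis by (simp add: coeff)
  qed
  moreover have "(\<integral>x. cnj (F x) * F x \<partial>M) = of_real (\<integral>x. (cmod (F x))\<^sup>2 \<partial>M)"
    unfolding integral_complex_of_real[symmetric]
    by (intro Bochner_Integration.integral_cong refl) (simp only: complex_norm_square mult.commute)
  moreover have "c n * (cnj (c n) * of_real r) = of_real ((cmod (c n))\<^sup>2 * r)" for n and r :: real
    unfolding of_real_mult complex_norm_square by (simp add: mult.assoc)
  ultimately have "(\<lambda>n. complex_of_real ((cmod (c n))\<^sup>2 * (\<integral>x. (cmod (e n x))\<^sup>2 \<partial>M))) sums of_real (\<integral>x. (cmod (F x))\<^sup>2 \<partial>M)"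
    by simp
  then show "(\<lambda>n. (cmod (c n))\<^sup>2 * (\<integral>x. (cmod (e n x))\<^sup>2 \<partial>M)) sums (\<integral>x. (cmod (F x))\<^sup>2 \<partial>M)"
    unfolding sums_of_real_iff .
qed

definition taylor_coeff :: "(complex \<Rightarrow> complex) \<Rightarrow> nat \<Rightarrow> complex" where
  "taylor_coeff f n = (deriv ^^ n) f 0 / fact n"

lemma taylor_coeff_sums:
  assumes "f holomorphic_on unit_disc" "z \<in> unit_disc"
  shows "(\<lambda>n. taylor_coeff f n * z ^ n) sums f z"
  using holomorphic_power_series[OF assms] by (simp add: taylor_coeff_def)

lemma taylor_coeff_deriv: "taylor_coeff (deriv f) n = of_nat (Suc n) * taylor_coeff f (Suc n)"
  by (simp add: taylor_coeff_def funpow_swap1 fact_Suc del: of_nat_Suc)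

lemma taylor_coeff_0: "taylor_coeff f 0 = f 0"
  by (simp add: taylor_coeff_def)

lemma taylor_coeff_summable:
  assumes "f holomorphic_on unit_disc" "0 \<le> r" "r < 1"
  shows "summable (\<lambda>n. cmod (taylor_coeff f n) * r ^ n)"
proof -
  define R where "R = (r + 1) / 2"
  have R: "r < R" "R < 1" "0 < R" using assms by (auto simp: R_def)
  have "summable (\<lambda>n. taylor_coeff f n * (of_real R :: complex) ^ n)"
    using taylor_coeff_sums[OF assms(1), of "of_real R"] R by (auto simp: sums_iff)
  then have "summable (\<lambda>n. norm (taylor_coeff f n * (of_real r :: complex) ^ n))"
    by (rule powser_insidea) (use R assms in auto)
  then show ?thesis using assms by (simp add: norm_mult norm_power)
qed

lemma integral_cis_nat:
  assumes "m \<noteq> n"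
  shows "(\<integral>\<theta>. cis (real m * \<theta>) * cnj (cis (real n * \<theta>)) \<partial>restrict_space lborel {-pi..pi}) = 0"
proof -
  define k where "k = real m - real n"
  have k: "k \<noteq> 0" using assms by (simp add: k_def)
  have "(\<integral>\<theta>. cis (real m * \<theta>) * cnj (cis (real n * \<theta>)) \<partial>restrict_space lborel {-pi..pi}) =
      (\<integral>\<theta>. indicator {-pi..pi} \<theta> *\<^sub>R cis (k * \<theta>) \<partial>lborel)"
    by (subst integral_restrict_space)
      (auto simp: k_def cis_cnj cis_mult algebra_simps intro!: Bochner_Integration.integral_cong)
  also have "\<dots> = cis (k * pi) / (\<i> * k) - cis (k * (- pi)) / (\<i> * k)"
  proof (rule integral_FTC_Icc)
    fix x :: real
    have "((\<lambda>z. exp (\<i> * of_real k * z) / (\<i> * of_real k)) has_field_derivative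
        exp (\<i> * of_real k * of_real x) * (\<i> * of_real k) / (\<i> * of_real k)) (at (of_real x))"
      by (intro DERIV_cdivide DERIV_fun_exp DERIV_cmult_Id)
    moreover have "exp (\<i> * of_real k * of_real x) * (\<i> * of_real k) / (\<i> * of_real k) = cis (k * x)" for x
      using k by (simp add: cis_conv_exp mult.assoc)
    ultimately have "((\<lambda>\<theta>. exp (\<i> * of_real k * of_real \<theta>) / (\<i> * of_real k)) has_vector_derivative cis (k * x)) (at x within {-pi..pi})"
      by (intro has_vector_derivative_real_field) simp
    moreover have "exp (\<i> * of_real k * of_real \<theta>) / (\<i> * of_real k) = cis (k * \<theta>) / (\<i> * k)" for \<theta>
      by (simp add: cis_conv_exp mult.assoc)
    ultimately show "((\<lambda>\<theta>. cis (k * \<theta>) / (\<i> * k)) has_vector_derivative cis (k * x)) (at x within {-pi..pi})"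
      by (simp only:)
  next
    show "continuous_on {-pi..pi} (\<lambda>\<theta>. cis (k * \<theta>))" by (intro continuous_intros)
  qed simp
  also have "\<dots> = (cis (k * pi) - cis (- (k * pi))) / (\<i> * k)" by (simp add: diff_divide_distrib)
  also have "cis (k * pi) - cis (- (k * pi)) = 2 * \<i> * of_real (sin (k * pi))"
    by (intro complex_eqI) auto
  also have "sin (k * pi) = 0"
  proof -
    have "sin (k * pi) = sin (real m * pi - real n * pi)" by (simp add: k_def left_diff_distrib)
    then show ?thesis by (simp add: sin_diff)
  qed
  finally show ?thesis by simp
qed

lemma integral_mean2_eq:
  assumes f: "f holomorphic_on unit_disc" and r: "0 < r" "r < 1"
  shows "summable (\<lambda>n. (cmod (taylor_coeff f n))\<^sup>2 * (r ^ n)\<^sup>2)"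
    and "integral_mean2 r f = sqrt (\<Sum>n. (cmod (taylor_coeff f n))\<^sup>2 * (r ^ n)\<^sup>2)"
proof -
  let ?M = "restrict_space lborel {-pi..pi}"
  define e where "e n \<theta> = of_real (r ^ n) * cis (real n * \<theta>)" for n \<theta>
  define F where "F \<theta> = f (of_real r * cis \<theta>)" for \<theta>
  have fin: "finite_measure ?M"
    by (rule finite_measureI) (simp add: emeasure_restrict_space)
  have sp: "measure ?M (space ?M) = 2 * pi"
    by (simp add: measure_restrict_space)
  have cF: "continuous_on UNIV F"
    unfolding F_def using r
    by (intro continuous_on_compose2[OF holomorphic_on_imp_continuous_on[OF f]] continuous_intros)
      (auto simp: norm_mult)
  have e: "e n \<in> borel_measurable ?M" for n
  proof -
    have "e n \<in> borel_measurable borel"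
      unfolding e_def by (intro borel_measurable_continuous_onI continuous_intros)
    then show ?thesis by (simp add: measurable_restrict_space1)
  qed
  have F: "F \<in> borel_measurable ?M"
    using borel_measurable_continuous_onI[OF cF] by (simp add: measurable_restrict_space1)
  have be: "cmod (e n x) \<le> r ^ n" for n x using r by (simp add: e_def norm_mult norm_power)
  have su: "summable (\<lambda>n. cmod (taylor_coeff f n) * r ^ n)" using taylor_coeff_summable[OF f] r by simp
  have orth: "\<forall>m n. m \<noteq> n \<longrightarrow> (\<integral>x. e m x * cnj (e n x) \<partial>?M) = 0"
  proof (intro allI impI)
    fix m n :: nat assume mn: "m \<noteq> n"
    have "(\<lambda>x. e m x * cnj (e n x)) = (\<lambda>x. of_real (r ^ m * r ^ n) * (cis (real m * x) * cnj (cis (real n * x))))"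
      by (simp add: e_def mult_ac fun_eq_iff)
    then show "(\<integral>x. e m x * cnj (e n x) \<partial>?M) = 0" using integral_cis_nat[OF mn] by simp
  qed
  have Fe: "(\<lambda>n. taylor_coeff f n * e n x) sums F x" for x
    using taylor_coeff_sums[OF f, of "of_real r * cis x"] r
    by (simp add: F_def e_def norm_mult power_mult_distrib Complex.DeMoivre)
  note par = parseval_general[OF fin e be su orth F Fe]
  have en: "(\<integral>\<theta>. (cmod (e n \<theta>))\<^sup>2 \<partial>?M) = 2 * pi * (r ^ n)\<^sup>2" for n
    using sp r by (simp add: e_def norm_mult norm_power)
  have "(\<integral>\<theta>. (cmod (F \<theta>))\<^sup>2 \<partial>?M) = (LINT \<theta>:{-pi..pi}|lborel. (cmod (f (of_real r * cis \<theta>)))\<^sup>2)"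
    unfolding set_lebesgue_integral_def F_def by (subst integral_restrict_space) auto
  then have "(\<lambda>n. 1 / (2 * pi) * ((cmod (taylor_coeff f n))\<^sup>2 * (2 * pi * (r ^ n)\<^sup>2))) sums
      (1 / (2 * pi) * (LINT \<theta>:{-pi..pi}|lborel. (cmod (f (of_real r * cis \<theta>)))\<^sup>2))"
    using par(2) unfolding en by (intro sums_mult) simp
  then have s: "(\<lambda>n. (cmod (taylor_coeff f n))\<^sup>2 * (r ^ n)\<^sup>2) sums
      (1 / (2 * pi) * (LINT \<theta>:{-pi..pi}|lborel. (cmod (f (of_real r * cis \<theta>)))\<^sup>2))"
    by (simp add: field_simps)
  then show "summable (\<lambda>n. (cmod (taylor_coeff f n))\<^sup>2 * (r ^ n)\<^sup>2)" by (rule sums_summable)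
  show "integral_mean2 r f = sqrt (\<Sum>n. (cmod (taylor_coeff f n))\<^sup>2 * (r ^ n)\<^sup>2)"
    unfolding integral_mean2_def sums_unique[OF s] ..
qed

lemma borel_measurable_complex_power [measurable]: "(\<lambda>z::complex. z ^ n) \<in> borel_measurable borel"
  by (intro borel_measurable_continuous_onI continuous_intros)

lemma sets_borel_ball [measurable]: "ball x r \<in> sets borel"
  by simp

context radial_density
begin

definition rad :: "nat \<Rightarrow> real" where
  "rad k = 1 - 1 / (real k + 2)"

lemma rad: "0 < rad k" "rad k < 1" "k \<le> l \<Longrightarrow> rad k \<le> rad l"
  by (auto simp: rad_def field_simps)

lemma nn_integral_exhaust_disc:
  assumes [measurable]: "(\<lambda>z. indicator unit_disc z * h z) \<in> borel_measurable borel"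
  shows "(\<lambda>k. \<integral>\<^sup>+z. indicator (ball 0 (rad k)) z * h z \<partial>\<mu>) \<longlonglongrightarrow> (\<integral>\<^sup>+z. indicator unit_disc z * h z \<partial>\<mu>)"
    (is "?f \<longlonglongrightarrow> _")
proof (rule nn_integral_LIMSEQ)
  have eq: "indicator (ball 0 (rad k)) z * h z = indicator (ball 0 (rad k)) z * (indicator unit_disc z * h z)" for k z
    using rad(2)[of k] by (auto simp: indicator_def)
  show "(\<lambda>z. indicator (ball 0 (rad k)) z * h z) \<in> borel_measurable \<mu>" for k
    unfolding eq by measurable
  show "incseq (\<lambda>k z. indicator (ball 0 (rad k)) z * h z)"
    using rad(3) by (auto simp: incseq_def le_fun_def indicator_def intro: less_le_trans)
  fix z
  show "(\<lambda>k. indicator (ball 0 (rad k)) z * h z) \<longlonglongrightarrow> indicator unit_disc z * h z"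
  proof (cases "z \<in> unit_disc")
    case True
    have "(\<lambda>k. 1 / (real k + 2)) \<longlonglongrightarrow> 0" 
      using LIMSEQ_ignore_initial_segment[OF lim_inverse_n', of 2] by (simp add: add.commute)
    then have "(\<lambda>k. rad k) \<longlonglongrightarrow> 1 - 0" unfolding rad_def by (intro tendsto_intros)
    moreover have "cmod z < 1 - 0" using True by simp
    ultimately have "\<forall>\<^sub>F k in sequentially. cmod z < rad k" by (rule order_tendstoD)
    then have "\<forall>\<^sub>F k in sequentially. indicator (ball 0 (rad k)) z * h z = indicator unit_disc z * h z"
      by eventually_elim (use True in auto)
    then show ?thesis by (rule tendsto_eventually)
  next
    case False
    then have "z \<notin> ball 0 (rad k)" for k using rad(2)[of k] by auto
    then show ?thesis using False by simp
  qed
qed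

text \<open>Rotation invariance suffices: \<open>a\<close> is chosen such that the rotation
  multiplies the integrand by \<open>cis pi = -1\<close>, so the integral equals its own
  negative.\<close>

lemma integral_monomials_orthogonal:
  assumes "m \<noteq> n"
  shows "(\<integral>z. (indicator (ball 0 R) z * z ^ m) * cnj (indicator (ball 0 R) z * z ^ n) \<partial>\<mu>) = 0"
proof -
  define a where "a = cis (pi / (real m - real n))"
  define G where "G z = (indicator (ball 0 R) z * z ^ m) * cnj (indicator (ball 0 R) z * z ^ n :: complex)" for z
  have [measurable]: "G \<in> borel_measurable borel" unfolding G_def by measurable
  have a: "cmod a = 1" by (simp add: a_def)
  have "a ^ m * cnj (a ^ n) = cis ((real m - real n) * (pi / (real m - real n)))"
  proof -
    let ?t = "pi / (real m - real n)"
    have "a ^ m * cnj (a ^ n) = cis (real m * ?t) * cnj (cis (real n * ?t))"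
      unfolding a_def Complex.DeMoivre ..
    also have "\<dots> = cis (real m * ?t - real n * ?t)" by (simp only: cis_cnj cis_mult diff_conv_add_uminus)
    finally show ?thesis by (simp only: left_diff_distrib)
  qed
  also have "\<dots> = -1" using assms by simp
  finally have am: "a ^ m * cnj (a ^ n) = -1" .
  have Ga: "G (a * z) = - G z" for z
  proof -
    have "G (a * z) = (a ^ m * cnj (a ^ n)) * G z"
      by (simp add: G_def norm_mult a power_mult_distrib mult_ac indicator_def)
    then show ?thesis unfolding am by simp
  qed
  have "(\<integral>z. G z \<partial>\<mu>) = (\<integral>z. G z \<partial>distr \<mu> borel (\<lambda>z. a * z))" by (simp add: distr_\<mu>_rotation a)
  also have "\<dots> = (\<integral>z. G (a * z) \<partial>\<mu>)" by (rule integral_distr) measurable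
  also have "\<dots> = - (\<integral>z. G z \<partial>\<mu>)" by (simp add: Ga)
  finally show ?thesis unfolding G_def by simp
qed

text \<open>On the discs of radius \<open>rad k\<close> the power series is dominated by a summable
  sequence and Parseval applies. Both sides increase with the radius, so monotone convergence gives
  an identity of extended values, without assuming that either side is finite.\<close>

lemma nn_integral_holomorphic:
  assumes f: "f holomorphic_on unit_disc"
  shows "(\<integral>\<^sup>+z. ennreal (indicator unit_disc z * (cmod (f z))\<^sup>2) \<partial>\<mu>) =
         (\<Sum>n. ennreal ((cmod (taylor_coeff f n))\<^sup>2) * (\<integral>\<^sup>+z. ennreal ((cmod z ^ n)\<^sup>2) \<partial>\<mu>))"
proof -
  interpret fm: finite_measure \<mu> by (rule finite_measure_\<mu>)
  have cf: "continuous_on unit_disc f" using f by (rule holomorphic_on_imp_continuous_on)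
  define h1 where "h1 z = ennreal ((cmod (f z))\<^sup>2)" for z
  define h2 where "h2 z = (\<Sum>n. ennreal ((cmod (taylor_coeff f n))\<^sup>2 * (cmod z ^ n)\<^sup>2))" for z
  have [measurable]: "h2 \<in> borel_measurable borel" unfolding h2_def by measurable
  have fm1: "(\<lambda>z. indicator D z * f z) \<in> borel_measurable borel" if "D \<subseteq> unit_disc" "D \<in> sets borel" for D
  proof -
    have "(\<lambda>z. indicator D z * f z) = (\<lambda>z. indicator D z *\<^sub>R f z)" by (auto simp: fun_eq_iff indicator_def)
    then show ?thesis using borel_measurable_continuous_on_indicator[OF that(2) continuous_on_subset[OF cf that(1)]]
      by simp
  qed
  have h1m: "(\<lambda>z. indicator unit_disc z * h1 z) \<in> borel_measurable borel"
  proof -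
    have [measurable]: "(\<lambda>z. indicator unit_disc z * f z) \<in> borel_measurable borel" by (rule fm1) auto
    have "(\<lambda>z. indicator unit_disc z * h1 z) = (\<lambda>z. ennreal ((cmod (indicator unit_disc z * f z))\<^sup>2))"
      by (auto simp: h1_def indicator_def fun_eq_iff)
    then show ?thesis by simp
  qed
  have k: "(\<integral>\<^sup>+z. indicator (ball 0 (rad k)) z * h1 z \<partial>\<mu>) = (\<integral>\<^sup>+z. indicator (ball 0 (rad k)) z * h2 z \<partial>\<mu>)" for k
  proof -
    let ?D = "ball (0::complex) (rad k)"
    define e where "e n z = indicator ?D z * z ^ n" for n and z :: complex
    define F where "F z = indicator ?D z * f z" for z
    have sub: "?D \<subseteq> unit_disc" using rad(2)[of k] by auto
    have e [measurable]: "e n \<in> borel_measurable borel" for n unfolding e_def by measurable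
    have F [measurable]: "F \<in> borel_measurable borel" unfolding F_def by (rule fm1[OF sub]) simp
    have be: "cmod (e n z) \<le> rad k ^ n" for n z
      using rad(1)[of k] by (auto simp: e_def norm_mult norm_power indicator_def intro: power_mono)
    have su: "summable (\<lambda>n. cmod (taylor_coeff f n) * rad k ^ n)" using taylor_coeff_summable[OF f] rad[of k] by simp
    have orth: "\<forall>m n. m \<noteq> n \<longrightarrow> (\<integral>x. e m x * cnj (e n x) \<partial>\<mu>) = 0"
      unfolding e_def using integral_monomials_orthogonal by blast
    have Fe: "(\<lambda>n. taylor_coeff f n * e n x) sums F x" for x
    proof (cases "x \<in> ?D")
      case True
      then have "x \<in> unit_disc" using sub by blast
      from taylor_coeff_sums[OF f this] show ?thesis using True by (simp add: F_def e_def)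
    next
      case False
      then show ?thesis by (simp add: F_def e_def)
    qed
    have e': "e n \<in> borel_measurable \<mu>" for n by measurable
    have F': "F \<in> borel_measurable \<mu>" by measurable
    note par = parseval_general[OF finite_measure_\<mu> e' be su orth F' Fe]
    have ie: "integrable \<mu> (\<lambda>z. (cmod (e n z))\<^sup>2)" for n
      by (rule fm.integrable_const_bound[of _ "(rad k ^ n)\<^sup>2"]) (auto intro!: AE_I2 power_mono be)
    have "(\<integral>\<^sup>+z. indicator ?D z * h1 z \<partial>\<mu>) = (\<integral>\<^sup>+z. ennreal ((cmod (F z))\<^sup>2) \<partial>\<mu>)"
      by (intro nn_integral_cong) (auto simp: h1_def F_def indicator_def)
    also have "\<dots> = ennreal (\<integral>z. (cmod (F z))\<^sup>2 \<partial>\<mu>)"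
      by (rule nn_integral_eq_integral[OF par(1)]) (intro AE_I2, simp)
    also have "\<dots> = (\<Sum>n. ennreal ((cmod (taylor_coeff f n))\<^sup>2 * (\<integral>z. (cmod (e n z))\<^sup>2 \<partial>\<mu>)))"
      unfolding sums_unique[OF par(2)]
      by (rule suminf_ennreal2[symmetric, OF _ sums_summable[OF par(2)]]) simp
    also have "\<dots> = (\<Sum>n. \<integral>\<^sup>+z. ennreal ((cmod (taylor_coeff f n))\<^sup>2 * (cmod (e n z))\<^sup>2) \<partial>\<mu>)"
    proof (intro suminf_cong)
      fix n
      have "(\<integral>\<^sup>+z. ennreal ((cmod (taylor_coeff f n))\<^sup>2 * (cmod (e n z))\<^sup>2) \<partial>\<mu>) = ennreal (\<integral>z. (cmod (taylor_coeff f n))\<^sup>2 * (cmod (e n z))\<^sup>2 \<partial>\<mu>)"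
        by (rule nn_integral_eq_integral[OF integrable_mult_right[OF ie]]) (intro AE_I2, simp)
      then show "ennreal ((cmod (taylor_coeff f n))\<^sup>2 * (\<integral>z. (cmod (e n z))\<^sup>2 \<partial>\<mu>)) = (\<integral>\<^sup>+z. ennreal ((cmod (taylor_coeff f n))\<^sup>2 * (cmod (e n z))\<^sup>2) \<partial>\<mu>)"
        by simp
    qed
    also have "\<dots> = (\<integral>\<^sup>+z. (\<Sum>n. ennreal ((cmod (taylor_coeff f n))\<^sup>2 * (cmod (e n z))\<^sup>2)) \<partial>\<mu>)"
      by (rule nn_integral_suminf[symmetric]) measurable
    also have "\<dots> = (\<integral>\<^sup>+z. indicator ?D z * h2 z \<partial>\<mu>)"
    proof (intro nn_integral_cong)
      fix z
      show "(\<Sum>n. ennreal ((cmod (taylor_coeff f n))\<^sup>2 * (cmod (e n z))\<^sup>2)) = indicator ?D z * h2 z"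
      proof (cases "z \<in> ?D")
        case True
        then have "cmod (e n z) = cmod z ^ n" for n by (simp add: e_def norm_power)
        then show ?thesis using True by (simp add: h2_def)
      next
        case False
        then have "cmod (e n z) = 0" for n by (simp add: e_def)
        then show ?thesis using False by simp
      qed
    qed
    finally show ?thesis .
  qed
  have "(\<integral>\<^sup>+z. indicator unit_disc z * h1 z \<partial>\<mu>) = (\<integral>\<^sup>+z. indicator unit_disc z * h2 z \<partial>\<mu>)"
  proof (rule LIMSEQ_unique)
    show "(\<lambda>k. \<integral>\<^sup>+z. indicator (ball 0 (rad k)) z * h2 z \<partial>\<mu>) \<longlonglongrightarrow> (\<integral>\<^sup>+z. indicator unit_disc z * h1 z \<partial>\<mu>)"
      using nn_integral_exhaust_disc[OF h1m] unfolding k .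
    show "(\<lambda>k. \<integral>\<^sup>+z. indicator (ball 0 (rad k)) z * h2 z \<partial>\<mu>) \<longlonglongrightarrow> (\<integral>\<^sup>+z. indicator unit_disc z * h2 z \<partial>\<mu>)"
      by (rule nn_integral_exhaust_disc) measurable
  qed
  moreover have "(\<integral>\<^sup>+z. indicator unit_disc z * h2 z \<partial>\<mu>) = (\<integral>\<^sup>+z. h2 z \<partial>\<mu>)"
  proof -
    have "(\<integral>\<^sup>+z. indicator unit_disc z * h2 z \<partial>\<mu>) = (\<integral>\<^sup>+z. ennreal (\<phi> (cmod z) / pi) * indicator unit_disc z * (indicator unit_disc z * h2 z) \<partial>lborel)"
      by (rule nn_integral_\<mu>) measurable
    also have "\<dots> = (\<integral>\<^sup>+z. ennreal (\<phi> (cmod z) / pi) * indicator unit_disc z * h2 z \<partial>lborel)"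
      by (intro nn_integral_cong) (simp add: indicator_def)
    also have "\<dots> = (\<integral>\<^sup>+z. h2 z \<partial>\<mu>)" by (rule nn_integral_\<mu>[symmetric]) measurable
    finally show ?thesis .
  qed
  moreover have "(\<integral>\<^sup>+z. h2 z \<partial>\<mu>) = (\<Sum>n. \<integral>\<^sup>+z. ennreal ((cmod (taylor_coeff f n))\<^sup>2 * (cmod z ^ n)\<^sup>2) \<partial>\<mu>)"
    unfolding h2_def by (rule nn_integral_suminf) measurable
  moreover have "(\<integral>\<^sup>+z. ennreal ((cmod (taylor_coeff f n))\<^sup>2 * (cmod z ^ n)\<^sup>2) \<partial>\<mu>) = ennreal ((cmod (taylor_coeff f n))\<^sup>2) * (\<integral>\<^sup>+z. ennreal ((cmod z ^ n)\<^sup>2) \<partial>\<mu>)" for n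
  proof -
    have "(\<integral>\<^sup>+z. ennreal ((cmod (taylor_coeff f n))\<^sup>2 * (cmod z ^ n)\<^sup>2) \<partial>\<mu>) = (\<integral>\<^sup>+z. ennreal ((cmod (taylor_coeff f n))\<^sup>2) * ennreal ((cmod z ^ n)\<^sup>2) \<partial>\<mu>)"
      by (intro nn_integral_cong ennreal_mult) auto
    also have "\<dots> = ennreal ((cmod (taylor_coeff f n))\<^sup>2) * (\<integral>\<^sup>+z. ennreal ((cmod z ^ n)\<^sup>2) \<partial>\<mu>)"
      by (rule nn_integral_cmult) measurable
    finally show ?thesis .
  qed
  moreover have "(\<integral>\<^sup>+z. ennreal (indicator unit_disc z * (cmod (f z))\<^sup>2) \<partial>\<mu>) = (\<integral>\<^sup>+z. indicator unit_disc z * h1 z \<partial>\<mu>)"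
    by (intro nn_integral_cong) (auto simp: h1_def indicator_def)
  ultimately show ?thesis by (simp only:)
qed

end

section \<open>Consequences of the integral conditions\<close>

text \<open>Every term dominates a fixed fraction of the tail sum starting at it, so the tail sums
  shrink by a fixed factor. The denominator \<open>L + 1\<close> instead of \<open>L\<close> keeps
  this factor positive.\<close>

lemma geometric_decay:
  fixes a :: "nat \<Rightarrow> real"
  assumes a: "\<And>k. a k > 0" and L: "L \<ge> 1" and sum: "\<And>j n. (\<Sum>k=j..n. a k) \<le> L * a j"
  shows "a (j + d) \<le> L * (1 - 1 / (L + 1)) ^ d * a j"
proof -
  define \<rho> where "\<rho> = 1 - 1 / (L + 1)"
  have \<rho>: "\<rho> > 0" using L by (simp add: \<rho>_def field_simps)
  define T where "T i = (\<Sum>k=i..j+d. a k)" for i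
  have step: "T (Suc i) \<le> \<rho> * T i" if "i \<le> j + d" for i
  proof -
    have Ti: "T i = a i + T (Suc i)" unfolding T_def using that by (rule sum.atLeast_Suc_atMost)
    have "T i \<le> L * a i" unfolding T_def by (rule sum)
    also have "\<dots> \<le> (L + 1) * a i" using a[of i] by simp
    finally have "T i / (L + 1) \<le> a i" using L by (simp add: divide_le_eq mult.commute)
    then show ?thesis using Ti by (simp add: \<rho>_def left_diff_distrib)
  qed
  have "T (j + i) \<le> \<rho> ^ i * T j" if "i \<le> d" for i
    using that
  proof (induction i)
    case (Suc i)
    have "T (j + Suc i) \<le> \<rho> * T (j + i)" using step[of "j + i"] Suc.prems by simp
    also have "\<dots> \<le> \<rho> * (\<rho> ^ i * T j)" using Suc \<rho> by (intro mult_left_mono) auto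
    finally show ?case by simp
  qed simp
  from this[of d] have "a (j + d) \<le> \<rho> ^ d * T j" by (simp add: T_def)
  also have "\<dots> \<le> \<rho> ^ d * (L * a j)" using \<rho> sum by (intro mult_left_mono) (auto simp: T_def)
  finally show ?thesis by (simp add: \<rho>_def mult_ac)
qed

text \<open>If one factor is infinite, finiteness of \<open>M\<close> forces the other one to be 0,
  and then the product is 0 by convention; otherwise the square roots can be squared.\<close>

lemma epowr_half_product:
  assumes "epowr X (1/2) * epowr Y (1/2) \<le> M" "M < \<infinity>"
  shows "X * Y \<le> M\<^sup>2"
proof -
  have z: "Z = 0" if "epowr Z (1/2) = 0" for Z
    using that by (cases Z) (auto simp: epowr_def split: if_splits)
  have fin: "epowr Z (1/2) * epowr Z (1/2) = Z" if "Z \<noteq> \<infinity>" for Z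
    using that by (cases Z) (auto simp: epowr_def ennreal_mult[symmetric] powr_add[symmetric] powr_one)
  consider "X = 0 \<or> Y = 0" | "X = \<infinity>" "Y \<noteq> 0" | "Y = \<infinity>" "X \<noteq> 0" | "X \<noteq> \<infinity>" "Y \<noteq> \<infinity>" by blast
  then show ?thesis
  proof cases
    case 2
    then have "epowr Y (1/2) \<noteq> 0" using z by blast
    then show ?thesis using assms 2 by (auto simp: epowr_def ennreal_top_mult)
  next
    case 3
    then have "epowr X (1/2) \<noteq> 0" using z by blast
    then show ?thesis using assms 3 by (auto simp: epowr_def ennreal_mult_top)
  next
    case 4
    have "X * Y = (epowr X (1/2) * epowr Y (1/2))\<^sup>2"
      using fin[OF 4(1)] fin[OF 4(2)] by (simp add: power2_eq_square mult_ac)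
    also have "\<dots> \<le> M\<^sup>2" by (intro power_mono assms) auto
    finally show ?thesis .
  qed auto
qed

lemma ennreal_divide_antimono:
  fixes x y c :: ennreal
  assumes "x \<le> y" shows "c / y \<le> c / x"
proof -
  have "inverse y \<le> inverse x"
    using assms
  proof (cases x; cases y)
    fix a b assume "x = ennreal a" "0 \<le> a" "y = ennreal b" "0 \<le> b"
    then show ?thesis using assms by (cases "a = 0") (auto simp: inverse_ennreal intro!: ennreal_leI le_imp_inverse_le)
  qed (auto simp: top_unique)
  then show ?thesis unfolding divide_ennreal_def by (rule mult_left_mono) simp
qed

text \<open>Starting at 1/2 instead of 0 keeps every point inside the open unit interval, over which
  the suprema in \<open>M1_const\<close> and \<open>M2_const\<close> range.\<close>

definition dyadic_pt :: "nat \<Rightarrow> real" where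
  "dyadic_pt j = 1 - 1 / 2 ^ Suc j"

lemma dyadic_pt_bounds: "0 < dyadic_pt j" "dyadic_pt j < 1" "1 / 2 \<le> dyadic_pt j"
proof -
  have "(2::real) \<le> 2 ^ Suc j" using power_increasing[of 1 "Suc j" "2::real"] by simp
  then have "1 / 2 ^ Suc j \<le> (1 / 2 :: real)" by (intro divide_left_mono) auto
  then show "1 / 2 \<le> dyadic_pt j" by (simp add: dyadic_pt_def)
  then show "0 < dyadic_pt j" by simp
  show "dyadic_pt j < 1" by (simp add: dyadic_pt_def)
qed

lemma dyadic_pt_Suc: "dyadic_pt (Suc j) - dyadic_pt j = 1 / 2 ^ (j + 2)"
  by (simp add: dyadic_pt_def field_simps)

lemma dyadic_pt_mono: "j \<le> k \<Longrightarrow> dyadic_pt j \<le> dyadic_pt k"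
  by (auto simp: dyadic_pt_def intro!: divide_left_mono power_increasing)

lemma one_minus_dyadic_pt: "1 - dyadic_pt j = 1 / 2 ^ Suc j"
  by (simp add: dyadic_pt_def)

text \<open>A lower sum over consecutive dyadic intervals; the \<open>k\<close>-th one has length
  \<open>1 / 2 ^ (k + 2)\<close>.\<close>

lemma nn_integral_step_lower:
  fixes f :: "real \<Rightarrow> ennreal" and b :: "nat \<Rightarrow> real"
  assumes b: "\<And>k. b k \<ge> 0" and f: "\<And>k s. k \<in> {j..n} \<Longrightarrow> s \<in> {dyadic_pt k<..<dyadic_pt (Suc k)} \<Longrightarrow> ennreal (b k) \<le> f s"
  shows "ennreal (\<Sum>k=j..n. b k / 2 ^ (k + 2)) \<le> (\<integral>\<^sup>+s\<in>{dyadic_pt j<..<1}. f s \<partial>lborel)"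
proof -
  have disj: "disjoint_family_on (\<lambda>k. {dyadic_pt k<..<dyadic_pt (Suc k)}) {j..n}"
    unfolding disjoint_family_on_def
  proof (intro ballI impI)
    fix k l :: nat assume "k \<noteq> l"
    then have "Suc k \<le> l \<or> Suc l \<le> k" by linarith
    then show "{dyadic_pt k<..<dyadic_pt (Suc k)} \<inter> {dyadic_pt l<..<dyadic_pt (Suc l)} = {}"
      using dyadic_pt_mono[of "Suc k" l] dyadic_pt_mono[of "Suc l" k] by auto
  qed
  have "ennreal (\<Sum>k=j..n. b k / 2 ^ (k + 2)) = (\<Sum>k=j..n. ennreal (b k) * emeasure lborel {dyadic_pt k<..<dyadic_pt (Suc k)})"
    using b dyadic_pt_mono by (subst sum_ennreal[symmetric])
      (auto simp: dyadic_pt_Suc ennreal_mult[symmetric] simp del: power_Suc intro!: sum.cong)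
  also have "\<dots> = (\<integral>\<^sup>+s. (\<Sum>k=j..n. ennreal (b k) * indicator {dyadic_pt k<..<dyadic_pt (Suc k)} s) \<partial>lborel)"
    by (subst nn_integral_sum) (auto simp: nn_integral_cmult_indicator)
  also have "\<dots> \<le> (\<integral>\<^sup>+s\<in>{dyadic_pt j<..<1}. f s \<partial>lborel)"
  proof (rule nn_integral_mono)
    fix s
    show "(\<Sum>k=j..n. ennreal (b k) * indicator {dyadic_pt k<..<dyadic_pt (Suc k)} s) \<le> f s * indicator {dyadic_pt j<..<1} s"
    proof (cases "\<exists>k\<in>{j..n}. s \<in> {dyadic_pt k<..<dyadic_pt (Suc k)}")
      case True
      then obtain k where k: "k \<in> {j..n}" "s \<in> {dyadic_pt k<..<dyadic_pt (Suc k)}" by blast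
      have "indicator {dyadic_pt l<..<dyadic_pt (Suc l)} s = (0::ennreal)" if "l \<in> {j..n}" "l \<noteq> k" for l
      proof -
        have "s \<notin> {dyadic_pt l<..<dyadic_pt (Suc l)}" using disj k that unfolding disjoint_family_on_def by blast
        then show ?thesis by (simp add: indicator_def)
      qed
      then have "(\<Sum>l=j..n. ennreal (b l) * indicator {dyadic_pt l<..<dyadic_pt (Suc l)} s) = (\<Sum>l\<in>{k}. ennreal (b l) * indicator {dyadic_pt l<..<dyadic_pt (Suc l)} s)"
        using k(1) by (intro sum.mono_neutral_right) auto
      also have "\<dots> = ennreal (b k)" using k by simp
      also have "\<dots> \<le> f s" using f k by blast
      also have "f s = f s * indicator {dyadic_pt j<..<1} s"
        using k dyadic_pt_mono[of j k] dyadic_pt_bounds(2)[of "Suc k"] by (auto simp: indicator_def)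
      finally show ?thesis .
    next
      case False
      then have "(\<Sum>k=j..n. ennreal (b k) * indicator {dyadic_pt k<..<dyadic_pt (Suc k)} s) = 0"
        by (intro sum.neutral) (auto simp: indicator_def)
      then show ?thesis by simp
    qed
  qed
  finally show ?thesis .
qed

context radial_density
begin

text \<open>The distribution of \<open>cmod z\<close> under \<open>\<mu>\<close>.\<close>

definition \<nu> :: "real measure" where
  "\<nu> = density lborel (\<lambda>s. ennreal (2 * s * \<phi> s) * indicator {0<..<1} s)"

lemma sets_\<nu> [simp, measurable_cong]: "sets \<nu> = sets borel"
  by (simp add: \<nu>_def)

lemma space_\<nu> [simp]: "space \<nu> = UNIV"
  by (simp add: \<nu>_def)

lemma nn_integral_\<mu>_\<nu>:
  assumes [measurable]: "f \<in> borel_measurable borel"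
  shows "(\<integral>\<^sup>+z. f (cmod z) \<partial>\<mu>) = (\<integral>\<^sup>+s. f s \<partial>\<nu>)"
  unfolding nn_integral_\<mu>_radial[OF assms] \<nu>_def
  by (subst nn_integral_density) (auto intro!: nn_integral_cong simp: mult_ac)

lemma emeasure_\<nu>_finite: "emeasure \<nu> UNIV < \<infinity>"
proof -
  have "emeasure \<nu> UNIV = emeasure \<mu> UNIV"
    using nn_integral_\<mu>_\<nu>[of "\<lambda>_. 1"] by simp
  then show ?thesis using finite_measure.emeasure_finite[OF finite_measure_\<mu>, of UNIV] by (simp add: less_top)
qed

lemma emeasure_\<nu>_tail:
  assumes "0 \<le> r"
  shows "emeasure \<nu> {r<..<1} \<le> 2 * weight_hat v r" "ennreal (2 * r) * weight_hat v r \<le> emeasure \<nu> {r<..<1}"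
proof -
  have e: "emeasure \<nu> {r<..<1} = (\<integral>\<^sup>+s. ennreal (2 * s * \<phi> s) * indicator {r<..<1} s \<partial>lborel)"
    unfolding \<nu>_def using assms
    by (subst emeasure_density) (auto intro!: nn_integral_cong simp: indicator_def)
  have le: "2 * s * \<phi> s \<le> 2 * \<phi> s" "2 * r * \<phi> s \<le> 2 * s * \<phi> s" if "r < s" "s < 1" for s
    using that \<phi>_pos[of s] assms by auto
  have "emeasure \<nu> {r<..<1} \<le> (\<integral>\<^sup>+s. 2 * (ennreal (\<phi> s) * indicator {r<..<1} s) \<partial>lborel)"
    unfolding e
  proof (rule nn_integral_mono)
    fix s
    have "2 * ennreal (\<phi> s) = ennreal (2 * \<phi> s)" using \<phi>_pos[of s] by (simp add: ennreal_mult less_imp_le)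
    then show "ennreal (2 * s * \<phi> s) * indicator {r<..<1} s \<le> 2 * (ennreal (\<phi> s) * indicator {r<..<1} s)"
      using le(1)[of s] by (auto simp: indicator_def intro: ennreal_leI)
  qed
  also have "\<dots> = 2 * weight_hat v r" unfolding weight_hat_eq[OF assms] by (rule nn_integral_cmult) measurable
  finally show "emeasure \<nu> {r<..<1} \<le> 2 * weight_hat v r" .
  have "ennreal (2 * r) * weight_hat v r = (\<integral>\<^sup>+s. ennreal (2 * r) * (ennreal (\<phi> s) * indicator {r<..<1} s) \<partial>lborel)"
    unfolding weight_hat_eq[OF assms] by (rule nn_integral_cmult[symmetric]) measurable
  also have "\<dots> \<le> emeasure \<nu> {r<..<1}"
    unfolding e using assms \<phi>_pos
    by (intro nn_integral_mono)
      (auto simp: indicator_def ennreal_mult[symmetric] less_imp_le intro!: ennreal_leI le(2))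
  finally show "ennreal (2 * r) * weight_hat v r \<le> emeasure \<nu> {r<..<1}" .
qed

lemma weight_hat_finite: "0 < r \<Longrightarrow> weight_hat v r < \<infinity>"
proof -
  assume r: "0 < r"
  have "ennreal (2 * r) * weight_hat v r \<le> emeasure \<nu> UNIV"
    using emeasure_\<nu>_tail(2)[of r] r emeasure_mono[of "{r<..<1}" UNIV \<nu>] by (simp add: order_trans)
  then have "ennreal (2 * r) * weight_hat v r < \<infinity>" using emeasure_\<nu>_finite by (rule le_less_trans)
  then show ?thesis using r by (auto simp: ennreal_mult_less_top less_top)
qed

lemma weight_hat_pos:
  assumes "0 \<le> r" "r < 1" shows "weight_hat v r > 0"
proof (rule ccontr)
  assume "\<not> weight_hat v r > 0"
  then have "(\<integral>\<^sup>+s. ennreal (\<phi> s) * indicator {r<..<1} s \<partial>lborel) = 0" using weight_hat_eq[OF assms(1)] by simp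
  then have "AE s in lborel. ennreal (\<phi> s) * indicator {r<..<1} s = 0"
    by (subst (asm) nn_integral_0_iff_AE) auto
  then have "AE s in lborel. s \<notin> {r<..<1}"
    by eventually_elim (use \<phi>_pos in \<open>auto simp: indicator_def not_le[symmetric] ennreal_eq_0_iff split: if_splits\<close>)
  then have "{r<..<1} \<in> null_sets lborel" by (subst AE_iff_null_sets) auto
  then have "emeasure lborel {r<..<1} = 0" by (rule null_setsD1)
  then show False using assms by simp
qed

lemma weight_hat_antimono: "r \<le> s \<Longrightarrow> weight_hat v s \<le> weight_hat v r"
  unfolding weight_hat_def by (intro nn_integral_mono) (auto simp: indicator_def)

definition V :: "nat \<Rightarrow> real" where
  "V j = enn2real (weight_hat v (dyadic_pt j))"

lemma V: "weight_hat v (dyadic_pt j) = ennreal (V j)" "V j > 0"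
proof -
  have "weight_hat v (dyadic_pt j) < \<infinity>" "weight_hat v (dyadic_pt j) > 0"
    using weight_hat_finite weight_hat_pos dyadic_pt_bounds[of j] by auto
  then show "weight_hat v (dyadic_pt j) = ennreal (V j)" "V j > 0"
    by (auto simp: V_def enn2real_positive_iff)
qed

lemma weight_hat_between:
  assumes "dyadic_pt k \<le> s" "s \<le> dyadic_pt l"
  shows "ennreal (V l) \<le> weight_hat v s" "weight_hat v s \<le> ennreal (V k)"
  using weight_hat_antimono[OF assms(1)] weight_hat_antimono[OF assms(2)] by (simp_all add: V)

lemma V_antimono: "j \<le> k \<Longrightarrow> V k \<le> V j"
  using weight_hat_antimono[OF dyadic_pt_mono[of j k]] V(2)[of j] by (simp add: V)

text \<open>The supremum is tested at \<open>r = dyadic_pt (Suc j)\<close>. The integral from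
  \<open>r\<close> to 1 dominates half of the partial sums of \<open>2 ^ k * V k\<close> over
  \<open>k \<ge> j + 2\<close>, and the dyadic interval just before \<open>r\<close> alone gives the
  other integral the lower bound \<open>1 / (2 ^ (j + 2) * V j)\<close>.\<close>

lemma sum_aV_le:
  assumes M: "M1_const v < \<infinity>"
  obtains L where "L \<ge> 1" "\<And>j n. (\<Sum>k=j..n. 2 ^ k * V k) \<le> L * (2 ^ j * V j)"
proof -
  define m where "m = enn2real (M1_const v)"
  have m: "M1_const v = ennreal m" "m \<ge> 0" using M by (auto simp: m_def)
  have main: "(\<Sum>k=j+2..n. 2 ^ k * V k) \<le> 8 * m\<^sup>2 * (2 ^ j * V j)" for j n
  proof -
    let ?r = "dyadic_pt (Suc j)"
    define X where "X = (\<integral>\<^sup>+s\<in>{?r<..<1}. weight_hat v s / ennreal ((1 - s)^2) \<partial>lborel)"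
    define Y where "Y = (\<integral>\<^sup>+s\<in>{0<..<?r}. 1 / weight_hat v s \<partial>lborel)"
    have "epowr X (1/2) * epowr Y (1/2) \<le> M1_const v"
      unfolding M1_const_def X_def Y_def
      by (rule SUP_upper[of ?r]) (use dyadic_pt_bounds[of "Suc j"] in auto)
    then have XY: "X * Y \<le> ennreal (m\<^sup>2)"
      using epowr_half_product M m by (metis ennreal_power)
    have X: "ennreal (\<Sum>k=Suc j..n. (V (Suc k) * 4 ^ Suc k) / 2 ^ (k + 2)) \<le> X"
      unfolding X_def
    proof (rule nn_integral_step_lower)
      fix k s assume s: "s \<in> {dyadic_pt k<..<dyadic_pt (Suc k)}"
      then have s1: "s < 1" using dyadic_pt_bounds(2)[of "Suc k"] by auto
      have "1 - s \<le> 1 / 2 ^ Suc k" using s one_minus_dyadic_pt[of k] by auto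
      then have "(1 - s)\<^sup>2 \<le> (1 / 2 ^ Suc k)\<^sup>2" using s1 by (intro power_mono) auto
      also have "\<dots> = 1 / 4 ^ Suc k" by (simp add: power_divide power2_eq_square power_mult_distrib[symmetric])
      finally have "4 ^ Suc k \<le> 1 / (1 - s)\<^sup>2" using s1 by (simp add: field_simps)
      then have "V (Suc k) * 4 ^ Suc k \<le> V (Suc k) * (1 / (1 - s)\<^sup>2)"
        using V(2)[of "Suc k"] by (intro mult_left_mono) auto
      then have "ennreal (V (Suc k) * 4 ^ Suc k) \<le> ennreal (V (Suc k)) / ennreal ((1 - s)\<^sup>2)"
        using s1 V(2)[of "Suc k"] by (simp add: divide_ennreal less_imp_le)
      also have "\<dots> \<le> weight_hat v s / ennreal ((1 - s)\<^sup>2)"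
        using s by (intro divide_right_mono_ennreal weight_hat_between[of k]) auto
      finally show "ennreal (V (Suc k) * 4 ^ Suc k) \<le> weight_hat v s / ennreal ((1 - s)\<^sup>2)" .
    qed (use V(2) in \<open>auto simp: less_imp_le\<close>)
    have Y: "ennreal (1 / V j / 2 ^ (j + 2)) \<le> Y"
    proof -
      have "ennreal (1 / V j / 2 ^ (j + 2)) = (\<integral>\<^sup>+s. ennreal (1 / V j) * indicator {dyadic_pt j<..<?r} s \<partial>lborel)"
        using V(2)[of j] dyadic_pt_mono[of j "Suc j"] dyadic_pt_Suc[of j]
        by (subst nn_integral_cmult_indicator) (auto simp: ennreal_mult[symmetric])
      also have "\<dots> \<le> Y" unfolding Y_def
      proof (rule nn_integral_mono)
        fix s
        have "ennreal (1 / V j) \<le> 1 / weight_hat v s" if "s \<in> {dyadic_pt j<..<?r}"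
        proof -
          have "ennreal (1 / V j) = 1 / ennreal (V j)" using V(2)[of j] by (simp add: divide_ennreal flip: ennreal_1)
          also have "\<dots> \<le> 1 / weight_hat v s"
            using that weight_hat_between(2)[of j s "Suc j"] by (intro ennreal_divide_antimono) auto
          finally show ?thesis .
        qed
        then show "ennreal (1 / V j) * indicator {dyadic_pt j<..<?r} s \<le> 1 / weight_hat v s * indicator {0<..<?r} s"
          using dyadic_pt_bounds(1)[of j] by (auto simp: indicator_def)
      qed
      finally show ?thesis .
    qed
    let ?S = "\<Sum>k=Suc j..n. (V (Suc k) * 4 ^ Suc k) / 2 ^ (k + 2)"
    have S0: "?S \<ge> 0" by (intro sum_nonneg) (use V(2) in \<open>auto simp: less_imp_le\<close>)
    have "ennreal (?S * (1 / V j / 2 ^ (j + 2))) = ennreal ?S * ennreal (1 / V j / 2 ^ (j + 2))"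
      using S0 V(2)[of j] by (intro ennreal_mult) auto
    also have "\<dots> \<le> X * Y" by (rule mult_mono[OF X Y]) auto
    also note XY
    finally have "?S * (1 / V j / 2 ^ (j + 2)) \<le> m\<^sup>2" by (simp only: ennreal_le_iff zero_le_power2)
    then have "?S \<le> m\<^sup>2 * (V j * 2 ^ (j + 2))" using V(2)[of j] by (simp add: field_simps)
    moreover have e1: "(V (Suc k) * 4 ^ Suc k) / 2 ^ (k + 2) = 2 ^ Suc k * V (Suc k) / 2" for k
      by (simp add: field_simps flip: power_mult_distrib)
    have "(\<Sum>k=Suc (Suc j)..Suc n. 2 ^ k * V k) / 2 = ?S"
      unfolding e1 sum_divide_distrib by (rule sum.shift_bounds_cl_Suc_ivl)
    ultimately have "(\<Sum>k=Suc (Suc j)..Suc n. 2 ^ k * V k) / 2 \<le> m\<^sup>2 * (V j * 2 ^ (j + 2))"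
      by (simp only:)
    moreover have "(\<Sum>k=j+2..n. 2 ^ k * V k) \<le> (\<Sum>k=Suc (Suc j)..Suc n. 2 ^ k * V k)"
      using V(2) by (intro sum_mono2) (auto simp: less_imp_le)
    moreover have "m\<^sup>2 * (V j * 2 ^ (j + 2)) = 4 * m\<^sup>2 * (2 ^ j * V j)" by (simp add: power_add)
    ultimately show ?thesis by linarith
  qed
  \<comment> \<open>The terms \<open>k = j\<close> and \<open>k = j + 1\<close> are not reached by
    the integral. As \<open>V\<close> decreases, they are at most 1 and 2 times
    \<open>2 ^ j * V j\<close>, whence the 3.\<close>
  have "(\<Sum>k=j..n. 2 ^ k * V k) \<le> (8 * m\<^sup>2 + 3) * (2 ^ j * V j)" for j n
  proof -
    have "(\<Sum>k=j..n. 2 ^ k * V k) \<le> (\<Sum>k\<in>{j, Suc j} \<union> {j+2..n}. 2 ^ k * V k)"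
      using V(2) by (intro sum_mono2) (auto simp: less_imp_le)
    also have "\<dots> = (2 ^ j * V j + 2 ^ Suc j * V (Suc j)) + (\<Sum>k=j+2..n. 2 ^ k * V k)"
      by (subst sum.union_disjoint) auto
    also have "2 ^ Suc j * V (Suc j) \<le> 2 * (2 ^ j * V j)" using V_antimono[of j "Suc j"] by simp
    finally show ?thesis using main[of j n] by (simp add: algebra_simps)
  qed
  then show ?thesis using that[of "8 * m\<^sup>2 + 3"] by auto
qed

text \<open>The supremum is tested at \<open>r = dyadic_pt j\<close>. The interval from
  \<open>1 - 1 / 2 ^ j\<close> to \<open>r\<close> alone gives the first integral at least
  \<open>8 ^ j * V j / 2\<close>, and the second one dominates the partial sums of
  \<open>1 / (8 ^ k * V k)\<close> divided by 64; hence 128. The summand 1 only secures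
  \<open>L \<ge> 1\<close>.\<close>

lemma sum_dV_le:
  assumes M: "M2_const v < \<infinity>"
  obtains L where "L \<ge> 1" "\<And>j n. (\<Sum>k=j..n. 1 / (8 ^ k * V k)) \<le> L * (1 / (8 ^ j * V j))"
proof -
  define m where "m = enn2real (M2_const v)"
  have m: "M2_const v = ennreal m" "m \<ge> 0" using M by (auto simp: m_def)
  have "(\<Sum>k=j..n. 1 / (8 ^ k * V k)) \<le> (128 * m\<^sup>2 + 1) * (1 / (8 ^ j * V j))" for j n
  proof -
    let ?r = "dyadic_pt j" and ?l = "1 - 1 / 2 ^ j :: real"
    define X where "X = (\<integral>\<^sup>+s\<in>{0<..<?r}. weight_hat v s / ennreal ((1 - s)^4) \<partial>lborel)"
    define Y where "Y = (\<integral>\<^sup>+s\<in>{?r<..<1}. ennreal ((1 - s)^2) / weight_hat v s \<partial>lborel)"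
    have "epowr X (1/2) * epowr Y (1/2) \<le> M2_const v"
      unfolding M2_const_def X_def Y_def
      by (rule SUP_upper[of ?r]) (use dyadic_pt_bounds[of j] in auto)
    then have XY: "X * Y \<le> ennreal (m\<^sup>2)"
      using epowr_half_product M m by (metis ennreal_power)
    have Y: "ennreal (\<Sum>k=j..n. (1 / 4 ^ (k + 2) / V k) / 2 ^ (k + 2)) \<le> Y"
      unfolding Y_def
    proof (rule nn_integral_step_lower)
      fix k s assume s: "s \<in> {dyadic_pt k<..<dyadic_pt (Suc k)}"
      then have s1: "s < 1" using dyadic_pt_bounds(2)[of "Suc k"] by auto
      have "1 / 2 ^ (k + 2) \<le> 1 - s" using s one_minus_dyadic_pt[of "Suc k"] by auto
      then have "(1 / 2 ^ (k + 2))\<^sup>2 \<le> (1 - s)\<^sup>2" by (intro power_mono) auto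
      moreover have "(1 / 2 ^ (k + 2) :: real)\<^sup>2 = 1 / 4 ^ (k + 2)"
        by (simp add: power_divide power2_eq_square power_mult_distrib[symmetric])
      ultimately have "1 / 4 ^ (k + 2) / V k \<le> (1 - s)\<^sup>2 / V k"
        using V(2)[of k] by (intro divide_right_mono) auto
      then have "ennreal (1 / 4 ^ (k + 2) / V k) \<le> ennreal ((1 - s)\<^sup>2) / ennreal (V k)"
        using V(2)[of k] by (simp add: divide_ennreal)
      also have "\<dots> \<le> ennreal ((1 - s)\<^sup>2) / weight_hat v s"
        using s by (intro ennreal_divide_antimono weight_hat_between[of _ _ "Suc k"]) auto
      finally show "ennreal (1 / 4 ^ (k + 2) / V k) \<le> ennreal ((1 - s)\<^sup>2) / weight_hat v s" .
    qed (use V(2) in \<open>auto simp: less_imp_le\<close>)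
    have X: "ennreal (V j * 16 ^ j / 2 ^ Suc j) \<le> X"
    proof -
      have r0: "0 \<le> ?l" "?r - ?l = 1 / 2 ^ Suc j" by (simp_all add: dyadic_pt_def field_simps)
      have "(0::real) < 1 / 2 ^ Suc j" by simp
      then have le: "?l \<le> ?r" using r0(2) by linarith
      have e: "emeasure lborel {?l<..<?r} = ennreal (1 / 2 ^ Suc j)"
        unfolding emeasure_lborel_Ioo[OF le] r0(2) ..
      have "ennreal (V j * 16 ^ j / 2 ^ Suc j) = ennreal (V j * 16 ^ j * (1 / 2 ^ Suc j))" by simp
      also have "\<dots> = ennreal (V j * 16 ^ j) * ennreal (1 / 2 ^ Suc j)"
        using V(2)[of j] by (intro ennreal_mult) auto
      also have "\<dots> = (\<integral>\<^sup>+s. ennreal (V j * 16 ^ j) * indicator {?l<..<?r} s \<partial>lborel)"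
        unfolding e[symmetric] by (rule nn_integral_cmult_indicator[symmetric]) simp
      also have "\<dots> \<le> X" unfolding X_def
      proof (rule nn_integral_mono)
        fix s
        have "ennreal (V j * 16 ^ j) \<le> weight_hat v s / ennreal ((1 - s)^4)" if s: "s \<in> {?l<..<?r}"
        proof -
          have s1: "s < 1" using s dyadic_pt_bounds(2)[of j] by auto
          have "1 - s \<le> 1 / 2 ^ j" using s by auto
          then have "(1 - s)^4 \<le> (1 / 2 ^ j)^4" using s1 by (intro power_mono) auto
          also have "\<dots> = 1 / 16 ^ j" by (simp add: power_divide power_mult[symmetric] mult.commute[of j] power_mult)
          finally have "16 ^ j \<le> 1 / (1 - s)^4" using s1 by (simp add: field_simps)
          then have "V j * 16 ^ j \<le> V j * (1 / (1 - s)^4)"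
            using V(2)[of j] by (intro mult_left_mono) auto
          then have "ennreal (V j * 16 ^ j) \<le> ennreal (V j) / ennreal ((1 - s)^4)"
            using s1 V(2)[of j] by (simp add: divide_ennreal less_imp_le)
          also have "\<dots> \<le> weight_hat v s / ennreal ((1 - s)^4)"
            using s weight_hat_antimono[of s "dyadic_pt j"] by (intro divide_right_mono_ennreal) (auto simp: V)
          finally show ?thesis .
        qed
        moreover have "0 < s" if "s \<in> {?l<..<?r}"
          using that r0(1) unfolding greaterThanLessThan_iff by linarith
        ultimately show "ennreal (V j * 16 ^ j) * indicator {?l<..<?r} s \<le> weight_hat v s / ennreal ((1 - s)^4) * indicator {0<..<?r} s"
          by (cases "s \<in> {?l<..<?r}") simp_all
      qed
      finally show ?thesis .
    qed
    let ?S = "\<Sum>k=j..n. (1 / 4 ^ (k + 2) / V k) / 2 ^ (k + 2)"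
    have S0: "?S \<ge> 0" by (intro sum_nonneg) (use V(2) in \<open>auto simp: less_imp_le\<close>)
    have "ennreal ((V j * 16 ^ j / 2 ^ Suc j) * ?S) = ennreal (V j * 16 ^ j / 2 ^ Suc j) * ennreal ?S"
      using S0 V(2)[of j] by (intro ennreal_mult) auto
    also have "\<dots> \<le> X * Y" by (rule mult_mono[OF X Y]) auto
    also note XY
    finally have "(V j * 16 ^ j / 2 ^ Suc j) * ?S \<le> m\<^sup>2" by (simp only: ennreal_le_iff zero_le_power2)
    moreover have "(V j * 16 ^ j / 2 ^ Suc j) = 8 ^ j * V j / 2"
      by (simp add: field_simps flip: power_mult_distrib)
    moreover have "?S = (\<Sum>k=j..n. 1 / (8 ^ k * V k)) / 64"
      unfolding sum_divide_distrib
      by (intro sum.cong refl) (simp add: power_add field_simps flip: power_mult_distrib)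
    ultimately have "8 ^ j * V j / 2 * ((\<Sum>k=j..n. 1 / (8 ^ k * V k)) / 64) \<le> m\<^sup>2" by (simp only:)
    then have "(\<Sum>k=j..n. 1 / (8 ^ k * V k)) \<le> 128 * m\<^sup>2 * (1 / (8 ^ j * V j))"
      using V(2)[of j] by (simp add: field_simps)
    also have "\<dots> \<le> (128 * m\<^sup>2 + 1) * (1 / (8 ^ j * V j))"
      using V(2)[of j] by (intro mult_right_mono) auto
    finally show ?thesis .
  qed
  then show ?thesis using that[of "128 * m\<^sup>2 + 1"] by auto
qed

end

section \<open>Moments of the weight and the norms of the monomials\<close>

text \<open>With \<open>y = 2 * n * (1 - s)\<close> the squared power is at most
  \<open>exp (- y)\<close>, and \<open>(1 + y / 4) ^ 4 \<le> exp y\<close>. The exponent 4 is large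
  enough to sum over dyadic shells when \<open>8 ^ k * V k\<close> is almost increasing.\<close>

lemma power4_times_power_le:
  fixes s N :: real
  assumes s: "0 \<le> s" "s \<le> 1" and N: "0 \<le> N" "N \<le> real n + 2"
  shows "N ^ 4 * (1 - s) ^ 4 * (s ^ n)\<^sup>2 \<le> 16"
proof -
  define y where "y = 2 * real n * (1 - s)"
  have y: "y \<ge> 0" using s by (simp add: y_def)
  have "s \<le> exp (- (1 - s))" using exp_ge_add_one_self[of "- (1 - s)"] by simp
  then have "s ^ (2 * n) \<le> exp (- (1 - s)) ^ (2 * n)" using s by (intro power_mono)
  also have "\<dots> = exp (- y)" by (simp add: y_def algebra_simps flip: exp_of_nat_mult)
  finally have 1: "(s ^ n)\<^sup>2 \<le> exp (- y)" by (simp add: power_mult mult.commute flip: power_mult)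
  have "(1 + y / 4) ^ 4 \<le> exp (y / 4) ^ 4"
    using y exp_ge_add_one_self[of "y / 4"] by (intro power_mono) auto
  also have "\<dots> = exp y" by (simp flip: exp_of_nat_mult)
  finally have 2: "(1 + y / 4) ^ 4 \<le> exp y" .
  have "(real n + 2) * (1 - s) = y / 2 + 2 * (1 - s)" by (simp add: y_def field_simps)
  then have "N * (1 - s) \<le> 2 * (1 + y / 4)"
    using mult_right_mono[OF N(2), of "1 - s"] s by simp
  then have "(N * (1 - s)) ^ 4 \<le> (2 * (1 + y / 4)) ^ 4" using N s by (intro power_mono) auto
  also have "\<dots> = 16 * (1 + y / 4) ^ 4" unfolding power_mult_distrib by simp
  also have "\<dots> \<le> 16 * exp y" using 2 by simp
  finally have "(N * (1 - s)) ^ 4 * (s ^ n)\<^sup>2 \<le> 16 * exp y * exp (- y)"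
    using 1 by (intro mult_mono) auto
  also have "\<dots> = 16" by (simp add: exp_minus)
  finally show ?thesis by (simp add: power_mult_distrib)
qed

text \<open>Bernoulli's inequality gives at least 1/2 for the exponent \<open>2 ^ j\<close>, and
  \<open>2 * n\<close> is at most four times this exponent.\<close>

lemma dyadic_pt_power_ge:
  assumes "n + 2 \<le> 2 ^ (j + 1)"
  shows "(dyadic_pt j ^ n)\<^sup>2 \<ge> 1 / 16"
proof -
  have "1 + real (2 ^ j) * (- 1 / 2 ^ Suc j) \<le> (1 + (- 1 / 2 ^ Suc j)) ^ (2 ^ j)"
  proof (rule Bernoulli_inequality)
    have "(1::real) \<le> 2 ^ Suc j" by (rule one_le_power) simp
    then show "-1 \<le> (- 1 / 2 ^ Suc j :: real)" by (simp only: divide_le_eq le_divide_eq) simp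
  qed
  then have h: "1 / 2 \<le> dyadic_pt j ^ (2 ^ j)" by (simp add: dyadic_pt_def)
  have "(1 / 2) ^ 4 \<le> (dyadic_pt j ^ (2 ^ j)) ^ 4" using h by (intro power_mono) auto
  also have "\<dots> = dyadic_pt j ^ (2 ^ j * 4)" by (simp only: power_mult)
  also have "\<dots> \<le> dyadic_pt j ^ (n * 2)"
    using assms dyadic_pt_bounds[of j] by (intro power_decreasing) auto
  finally show ?thesis by (simp add: power_mult power_divide)
qed

lemma dyadic_pt_shell_exists:
  assumes "1 / 2 < s" "s \<le> dyadic_pt j"
  shows "\<exists>k<j. dyadic_pt k < s \<and> s \<le> dyadic_pt (Suc k)"
  using assms
proof (induction j)
  case 0 then show ?case by (simp add: dyadic_pt_def)
next
  case (Suc j)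
  show ?case
  proof (cases "s \<le> dyadic_pt j")
    case True
    then show ?thesis using Suc by (metis less_SucI)
  next
    case False
    then show ?thesis using Suc.prems by (intro exI[of _ j]) auto
  qed
qed

context radial_density
begin

text \<open>The squared norm of the monomial z^n in the Bergman space of the weight.\<close>

definition mom :: "nat \<Rightarrow> real" where
  "mom n = enn2real (\<integral>\<^sup>+z. ennreal ((cmod z ^ n)\<^sup>2) \<partial>\<mu>)"

lemma nn_integral_\<nu>_mono:
  assumes [measurable]: "f \<in> borel_measurable borel" "g \<in> borel_measurable borel"
    and "\<And>s. s \<in> {0<..<1} \<Longrightarrow> f s \<le> g s"
  shows "(\<integral>\<^sup>+s. f s \<partial>\<nu>) \<le> (\<integral>\<^sup>+s. g s \<partial>\<nu>)"
proof -
  have e: "(\<integral>\<^sup>+s. h s \<partial>\<nu>) = (\<integral>\<^sup>+s. ennreal (2 * s * \<phi> s) * indicator {0<..<1} s * h s \<partial>lborel)"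
    if [measurable]: "h \<in> borel_measurable borel" for h
    unfolding \<nu>_def by (rule nn_integral_density) measurable
  show ?thesis unfolding e[OF assms(1)] e[OF assms(2)]
  proof (rule nn_integral_mono)
    fix s
    show "ennreal (2 * s * \<phi> s) * indicator {0<..<1} s * f s \<le> ennreal (2 * s * \<phi> s) * indicator {0<..<1} s * g s"
      using assms(3)[of s] by (cases "s \<in> {0<..<1}") (auto intro: mult_left_mono)
  qed
qed

lemma mom_\<nu>: "(\<integral>\<^sup>+z. ennreal ((cmod z ^ n)\<^sup>2) \<partial>\<mu>) = (\<integral>\<^sup>+s. ennreal ((s ^ n)\<^sup>2) \<partial>\<nu>)"
  by (rule nn_integral_\<mu>_\<nu>) measurable

lemma mom_eq: "(\<integral>\<^sup>+z. ennreal ((cmod z ^ n)\<^sup>2) \<partial>\<mu>) = ennreal (mom n)"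
proof -
  have "(\<integral>\<^sup>+s. ennreal ((s ^ n)\<^sup>2) \<partial>\<nu>) \<le> (\<integral>\<^sup>+s. 1 \<partial>\<nu>)"
  proof (rule nn_integral_\<nu>_mono)
    fix s :: real assume "s \<in> {0<..<1}"
    then have "(s ^ n)\<^sup>2 \<le> 1" by (intro power_le_one) auto
    then show "ennreal ((s ^ n)\<^sup>2) \<le> 1" using ennreal_leI by fastforce
  qed measurable
  also have "\<dots> < \<infinity>" using emeasure_\<nu>_finite by simp
  finally show ?thesis unfolding mom_def mom_\<nu> by simp
qed

text \<open>Only radii beyond \<open>dyadic_pt j\<close> are kept. There the squared power is at
  least 1/16, and the mass of \<open>\<nu>\<close> is at least \<open>V j\<close> because
  \<open>2 * dyadic_pt j \<ge> 1\<close>.\<close>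

lemma mom_lower:
  assumes "n + 2 \<le> 2 ^ (j + 1)"
  shows "V j / 16 \<le> mom n"
proof -
  have "ennreal (V j / 16) \<le> ennreal (1 / 16) * (ennreal (2 * dyadic_pt j) * weight_hat v (dyadic_pt j))"
  proof -
    have "ennreal (1 / 16) * (ennreal (2 * dyadic_pt j) * weight_hat v (dyadic_pt j)) = ennreal (1 / 16 * (2 * dyadic_pt j * V j))"
      using V[of j] dyadic_pt_bounds[of j] by (simp add: ennreal_mult[symmetric] less_imp_le)
    moreover have "V j / 16 \<le> 1 / 16 * (2 * dyadic_pt j * V j)" using V(2)[of j] dyadic_pt_bounds(3)[of j] by simp
    ultimately show ?thesis by (simp add: ennreal_leI)
  qed
  also have "\<dots> \<le> ennreal (1 / 16) * emeasure \<nu> {dyadic_pt j<..<1}"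
    using dyadic_pt_bounds[of j] by (intro mult_left_mono emeasure_\<nu>_tail) auto
  also have "\<dots> = (\<integral>\<^sup>+s. ennreal (1 / 16) * indicator {dyadic_pt j<..<1} s \<partial>\<nu>)"
    by (rule nn_integral_cmult_indicator[symmetric]) simp
  also have "\<dots> \<le> (\<integral>\<^sup>+s. ennreal ((s ^ n)\<^sup>2) \<partial>\<nu>)"
  proof (rule nn_integral_mono)
    fix s
    have "1 / 16 \<le> (s ^ n)\<^sup>2" if "s \<in> {dyadic_pt j<..<1}"
    proof -
      have "(dyadic_pt j ^ n)\<^sup>2 \<le> (s ^ n)\<^sup>2" using that dyadic_pt_bounds[of j] by (intro power_mono) auto
      then show ?thesis using dyadic_pt_power_ge[OF assms] by linarith
    qed
    then show "ennreal (1 / 16) * indicator {dyadic_pt j<..<1} s \<le> ennreal ((s ^ n)\<^sup>2)"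
      by (cases "s \<in> {dyadic_pt j<..<1}") (auto intro: ennreal_leI)
  qed
  also have "\<dots> = ennreal (mom n)" by (simp only: mom_eq mom_\<nu>[symmetric])
  finally show ?thesis by (simp add: mom_def)
qed

text \<open>The shell \<open>k\<close> contributes a multiple of \<open>16 ^ k * V k\<close>. Almost
  monotonicity of \<open>8 ^ k * V k\<close> replaces this by \<open>2 ^ k * 8 ^ j * V j\<close>,
  and the geometric sum over \<open>k < j\<close> is at most \<open>2 ^ j\<close>, so that the
  factor \<open>16 ^ j\<close> cancels.\<close>

lemma mom_upper:
  assumes L: "L \<ge> 1" "\<And>k j. k \<le> j \<Longrightarrow> 8 ^ k * V k \<le> L * (8 ^ j * V j)"
  obtains C where "C > 0" "\<And>j n. 2 ^ j \<le> n + 2 \<Longrightarrow> mom n \<le> C * V j"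
proof -
  define t where "t = enn2real (emeasure \<nu> UNIV)"
  have t: "emeasure \<nu> UNIV = ennreal t" "t \<ge> 0" using emeasure_\<nu>_finite by (auto simp: t_def)
  define C where "C = 16 * (16 * t * L / V 0 + 512 * L) + 2"
  have "mom n \<le> C * V j" if n: "2 ^ j \<le> n + 2" for j n
  proof -
    have N: "(2::real) ^ j \<le> real n + 2" using n by (metis of_nat_add of_nat_le_iff of_nat_numeral of_nat_power)
    let ?a = "16 / 16 ^ j :: real"
    \<comment> \<open>The bound \<open>16 / (16 ^ j * (1 - s) ^ 4)\<close> is replaced by indicators
      of tails: 16 covers \<open>s \<le> 1 / 2\<close>, \<open>16 ^ (k + 2)\<close> covers the shell
      from \<open>dyadic_pt k\<close> to \<open>dyadic_pt (Suc k)\<close>, and beyond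
      \<open>dyadic_pt j\<close> the trivial bound 1 is used. Each tail then integrates to at most
      \<open>2 * V k\<close>.\<close>
    have pt: "(s ^ n)\<^sup>2 \<le> ?a * (16 + (\<Sum>k<j. 16 ^ (k + 2) * indicator {dyadic_pt k<..<1} s)) + indicator {dyadic_pt j<..<1} s"
      (is "_ \<le> ?a * (16 + ?S) + _") if s: "s \<in> {0<..<1}" for s :: real
    proof -
      have S0: "?S \<ge> 0" by (intro sum_nonneg) auto
      have b: "(s ^ n)\<^sup>2 \<le> ?a * (1 / (1 - s) ^ 4)"
      proof -
        have "((2::real) ^ j) ^ 4 = 16 ^ j" by (simp add: power_mult[symmetric] mult.commute[of j]) (simp add: power_mult)
        then have "16 ^ j * (1 - s) ^ 4 * (s ^ n)\<^sup>2 \<le> 16"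
          using power4_times_power_le[of s "2 ^ j" n] s N by simp
        moreover have "16 ^ j * (1 - s) ^ 4 > 0" using s by simp
        ultimately show ?thesis by (simp add: field_simps)
      qed
      have inv: "1 / (1 - s) ^ 4 \<le> 16 ^ m" if "1 / 2 ^ m \<le> 1 - s" for m
      proof -
        have "(1 / 2 ^ m) ^ 4 \<le> (1 - s) ^ 4" using that by (intro power_mono) auto
        moreover have "(1 / 2 ^ m :: real) ^ 4 = 1 / 16 ^ m"
          by (simp add: power_divide power_mult[symmetric] mult.commute[of m]) (simp add: power_mult)
        ultimately show ?thesis using s by (simp add: field_simps)
      qed
      consider "s > dyadic_pt j" | "s \<le> 1 / 2" | "1 / 2 < s" "s \<le> dyadic_pt j" by linarith
      then show ?thesis
      proof cases
        case 1
        have "(s ^ n)\<^sup>2 \<le> 1" using s by (intro power_le_one) auto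
        moreover have "?a * (16 + ?S) \<ge> 0" using S0 by simp
        ultimately show ?thesis using 1 s by (simp add: indicator_def)
      next
        case 2
        then have "1 / (1 - s) ^ 4 \<le> 16 ^ 1" by (intro inv) simp
        then have "?a * (1 / (1 - s) ^ 4) \<le> ?a * (16 + ?S)" using S0 by (intro mult_left_mono) auto
        then show ?thesis using b by (auto simp: indicator_def)
      next
        case 3
        then obtain k where k: "k < j" "dyadic_pt k < s" "s \<le> dyadic_pt (Suc k)" using dyadic_pt_shell_exists by blast
        have "1 / 2 ^ (k + 2) \<le> 1 - s" using k(3) one_minus_dyadic_pt[of "Suc k"] by simp
        then have "1 / (1 - s) ^ 4 \<le> 16 ^ (k + 2)" by (rule inv)
        also have "\<dots> = 16 ^ (k + 2) * indicator {dyadic_pt k<..<1} s" using k s by (simp add: indicator_def)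
        also have "\<dots> \<le> ?S" using k(1) by (intro member_le_sum) auto
        finally have "?a * (1 / (1 - s) ^ 4) \<le> ?a * (16 + ?S)" by (intro mult_left_mono) auto
        then show ?thesis using b by (auto simp: indicator_def)
      qed
    qed
    have "ennreal (mom n) = (\<integral>\<^sup>+s. ennreal ((s ^ n)\<^sup>2) \<partial>\<nu>)" by (simp only: mom_eq[symmetric] mom_\<nu>)
    also have "\<dots> \<le> (\<integral>\<^sup>+s. ennreal ?a * (16 + (\<Sum>k<j. ennreal (16 ^ (k + 2)) * indicator {dyadic_pt k<..<1} s)) + indicator {dyadic_pt j<..<1} s \<partial>\<nu>)"
    proof (rule nn_integral_\<nu>_mono)
      fix s :: real assume s: "s \<in> {0<..<1}"
      have i: "ennreal (indicator D s) = indicator D s" for D by (simp add: indicator_def)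
      have "ennreal ((s ^ n)\<^sup>2) \<le> ennreal (?a * (16 + (\<Sum>k<j. 16 ^ (k + 2) * indicator {dyadic_pt k<..<1} s)) + indicator {dyadic_pt j<..<1} s)"
        by (rule ennreal_leI[OF pt[OF s]])
      also have "\<dots> = ennreal ?a * (ennreal 16 + (\<Sum>k<j. ennreal (16 ^ (k + 2) * indicator {dyadic_pt k<..<1} s))) + indicator {dyadic_pt j<..<1} s"
        by (subst ennreal_plus, simp add: sum_nonneg, simp, subst ennreal_mult, simp, simp add: sum_nonneg,
            subst ennreal_plus, simp, simp add: sum_nonneg, subst sum_ennreal, simp, simp add: i)
      also have "(\<Sum>k<j. ennreal (16 ^ (k + 2) * indicator {dyadic_pt k<..<1} s)) = (\<Sum>k<j. ennreal (16 ^ (k + 2)) * indicator {dyadic_pt k<..<1} s)"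
        by (intro sum.cong refl) (simp add: indicator_def)
      finally show "ennreal ((s ^ n)\<^sup>2) \<le> ennreal ?a * (16 + (\<Sum>k<j. ennreal (16 ^ (k + 2)) * indicator {dyadic_pt k<..<1} s)) + indicator {dyadic_pt j<..<1} s"
        by simp
    qed measurable
    also have "\<dots> = ennreal ?a * (16 * emeasure \<nu> UNIV + (\<Sum>k<j. ennreal (16 ^ (k + 2)) * emeasure \<nu> {dyadic_pt k<..<1})) + emeasure \<nu> {dyadic_pt j<..<1}"
    proof -
      let ?g = "\<lambda>k s. ennreal (16 ^ (k + 2)) * indicator {dyadic_pt k<..<1} s"
      have "(\<integral>\<^sup>+s. ennreal ?a * (16 + (\<Sum>k<j. ?g k s)) + indicator {dyadic_pt j<..<1} s \<partial>\<nu>) =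
          (\<integral>\<^sup>+s. ennreal ?a * (16 + (\<Sum>k<j. ?g k s)) \<partial>\<nu>) + (\<integral>\<^sup>+s. indicator {dyadic_pt j<..<1} s \<partial>\<nu>)"
        by (rule nn_integral_add) measurable
      also have "(\<integral>\<^sup>+s. ennreal ?a * (16 + (\<Sum>k<j. ?g k s)) \<partial>\<nu>) = ennreal ?a * (\<integral>\<^sup>+s. 16 + (\<Sum>k<j. ?g k s) \<partial>\<nu>)"
        by (rule nn_integral_cmult) measurable
      also have "(\<integral>\<^sup>+s. 16 + (\<Sum>k<j. ?g k s) \<partial>\<nu>) = (\<integral>\<^sup>+s. 16 \<partial>\<nu>) + (\<integral>\<^sup>+s. (\<Sum>k<j. ?g k s) \<partial>\<nu>)"
        by (rule nn_integral_add) measurable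
      also have "(\<integral>\<^sup>+s. (\<Sum>k<j. ?g k s) \<partial>\<nu>) = (\<Sum>k<j. \<integral>\<^sup>+s. ?g k s \<partial>\<nu>)"
        by (rule nn_integral_sum) measurable
      also have "\<dots> = (\<Sum>k<j. ennreal (16 ^ (k + 2)) * emeasure \<nu> {dyadic_pt k<..<1})"
        by (intro sum.cong refl nn_integral_cmult_indicator) simp
      finally show ?thesis by simp
    qed
    also have "\<dots> \<le> ennreal ?a * (ennreal (16 * t) + (\<Sum>k<j. ennreal (16 ^ (k + 2) * (2 * V k)))) + ennreal (2 * V j)"
    proof -
      have e: "emeasure \<nu> {dyadic_pt k<..<1} \<le> ennreal (2 * V k)" for k
        using emeasure_\<nu>_tail(1)[of "dyadic_pt k"] dyadic_pt_bounds[of k] V[of k] by (simp add: ennreal_mult less_imp_le)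
      have "ennreal (16 ^ (k + 2)) * emeasure \<nu> {dyadic_pt k<..<1} \<le> ennreal (16 ^ (k + 2) * (2 * V k))" for k
        using mult_left_mono[OF e[of k], of "ennreal (16 ^ (k + 2))"] V(2)[of k] by (subst ennreal_mult) (auto simp: less_imp_le)
      moreover have "16 * emeasure \<nu> UNIV = ennreal (16 * t)" using t by (simp add: ennreal_mult)
      ultimately show ?thesis by (intro add_mono mult_left_mono sum_mono e) auto
    qed
    also have "\<dots> = ennreal (?a * (16 * t + (\<Sum>k<j. 16 ^ (k + 2) * (2 * V k))) + 2 * V j)"
    proof -
      have nn: "16 ^ (k + 2) * (2 * V k) \<ge> 0" for k using V(2)[of k] by simp
      have s0: "(\<Sum>k<j. 16 ^ (k + 2) * (2 * V k)) \<ge> 0" by (intro sum_nonneg nn)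
      have "(\<Sum>k<j. ennreal (16 ^ (k + 2) * (2 * V k))) = ennreal (\<Sum>k<j. 16 ^ (k + 2) * (2 * V k))"
        by (rule sum_ennreal[OF nn])
      then have "ennreal (16 * t) + (\<Sum>k<j. ennreal (16 ^ (k + 2) * (2 * V k))) = ennreal (16 * t + (\<Sum>k<j. 16 ^ (k + 2) * (2 * V k)))"
        using t(2) s0 by (simp only: ennreal_plus)
      then show ?thesis using t(2) s0 V(2)[of j]
        by (simp only:) (subst ennreal_plus, simp, simp, subst ennreal_mult, simp_all)
    qed
    finally have "mom n \<le> ?a * (16 * t + (\<Sum>k<j. 16 ^ (k + 2) * (2 * V k))) + 2 * V j"
    proof (subst (asm) ennreal_le_iff)
      show "0 \<le> ?a * (16 * t + (\<Sum>k<j. 16 ^ (k + 2) * (2 * V k))) + 2 * V j"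
        using t(2) V(2) by (intro add_nonneg_nonneg mult_nonneg_nonneg sum_nonneg) (auto simp: less_imp_le)
    qed
    also have "\<dots> \<le> ?a * (16 * t * L / V 0 * (16 ^ j * V j) + 512 * L * (16 ^ j * V j)) + 2 * V j"
    proof (intro add_mono mult_left_mono order_refl)
      have p2: "(1::real) \<le> 2 ^ j" by simp
      have dj: "8 ^ j * V j \<le> 16 ^ j * V j" using V(2)[of j] by (intro mult_right_mono power_mono) auto
      have "V 0 \<le> L * (8 ^ j * V j)" using L(2)[of 0 j] by simp
      also have "\<dots> \<le> L * (16 ^ j * V j)" using L(1) dj by (intro mult_left_mono) auto
      finally have "16 * t * 1 \<le> 16 * t * (L * (16 ^ j * V j) / V 0)"
        using t(2) V(2)[of 0] by (intro mult_left_mono) auto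
      then show "16 * t \<le> 16 * t * L / V 0 * (16 ^ j * V j)" by simp
      have "(\<Sum>k<j. 16 ^ (k + 2) * (2 * V k)) = (\<Sum>k<j. 512 * (2 ^ k * (8 ^ k * V k)))"
        by (intro sum.cong refl) (simp add: power_add power_mult_distrib[symmetric] flip: mult.assoc)
      also have "\<dots> \<le> (\<Sum>k<j. 512 * (2 ^ k * (L * (8 ^ j * V j))))"
        by (intro sum_mono mult_left_mono L(2)) auto
      also have "\<dots> = 512 * (L * (8 ^ j * V j)) * (\<Sum>k<j. 2 ^ k)"
        unfolding sum_distrib_left by (intro sum.cong refl) (simp only: mult_ac)
      also have "\<dots> \<le> 512 * (L * (8 ^ j * V j)) * 2 ^ j"
      proof (rule mult_left_mono)
        have "(\<Sum>k<j. 2 ^ k :: real) = 2 ^ j - 1" using geometric_sum[of "2::real" j] by simp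
        then show "(\<Sum>k<j. 2 ^ k :: real) \<le> 2 ^ j" by simp
      qed (use L(1) V(2)[of j] in auto)
      also have "\<dots> = 512 * L * (16 ^ j * V j)"
      proof -
        have "(8::real) ^ j * 2 ^ j = 16 ^ j" by (simp add: power_mult_distrib[symmetric])
        then show ?thesis by (simp only: mult_ac flip: \<open>(8::real) ^ j * 2 ^ j = 16 ^ j\<close>)
      qed
      finally show "(\<Sum>k<j. 16 ^ (k + 2) * (2 * V k)) \<le> 512 * L * (16 ^ j * V j)" .
    qed auto
    also have "\<dots> = C * V j" by (simp add: C_def field_simps)
    finally show ?thesis .
  qed
  moreover have "C > 0" using t(2) L(1) V(2)[of 0] unfolding C_def by (intro add_nonneg_pos mult_nonneg_nonneg add_nonneg_nonneg) auto
  ultimately show ?thesis using that by blast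
qed

text \<open>The derivative of z^n is n z^(n-1), which shifts the moment by one; the constant
  function enters only through its value at 0.\<close>

definition w :: "nat \<Rightarrow> real" where
  "w n = (if n = 0 then 1 else (real n)\<^sup>2 * mom (n - 1))"

lemma dirichlet_norm_eq:
  assumes f: "f holomorphic_on unit_disc"
  shows "dirichlet_norm v f = epowr (\<Sum>n. ennreal ((cmod (taylor_coeff f n))\<^sup>2 * w n)) (1/2)"
proof -
  have df: "deriv f holomorphic_on unit_disc" using f by (intro holomorphic_deriv) auto
  have "(\<integral>\<^sup>+z. ennreal ((cmod (deriv f z))\<^sup>2 * v z) \<partial>area_measure) =
      (\<integral>\<^sup>+z. ennreal (indicator unit_disc z * (cmod (deriv f z))\<^sup>2) \<partial>\<mu>)"
    by (rule nn_integral_area) (auto intro!: continuous_intros holomorphic_on_imp_continuous_on df)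
  also have "\<dots> = (\<Sum>n. ennreal ((cmod (taylor_coeff (deriv f) n))\<^sup>2) * ennreal (mom n))"
    unfolding nn_integral_holomorphic[OF df] mom_eq ..
  also have "\<dots> = (\<Sum>n. ennreal ((cmod (taylor_coeff f (Suc n)))\<^sup>2 * w (Suc n)))"
    by (intro suminf_cong)
      (simp add: taylor_coeff_deriv w_def norm_mult power_mult_distrib mom_def ennreal_mult[symmetric] mult_ac del: of_nat_Suc)
  finally have e: "(\<integral>\<^sup>+z. ennreal ((cmod (deriv f z))\<^sup>2 * v z) \<partial>area_measure) =
      (\<Sum>n. ennreal ((cmod (taylor_coeff f (Suc n)))\<^sup>2 * w (Suc n)))" .
  have "(\<lambda>n. ennreal ((cmod (taylor_coeff f (Suc n)))\<^sup>2 * w (Suc n))) sums (\<Sum>n. ennreal ((cmod (taylor_coeff f (Suc n)))\<^sup>2 * w (Suc n)))"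
    by (rule summable_sums) simp
  from sums_unique[OF sums_Suc[where f = "\<lambda>n. ennreal ((cmod (taylor_coeff f n))\<^sup>2 * w n)", OF this]]
  show ?thesis unfolding dirichlet_norm_def e by (simp add: w_def taylor_coeff_0 add.commute)
qed

lemma hilbert_matrix_exists:
  assumes M1: "M1_const v < \<infinity>" and M2: "M2_const v < \<infinity>"
  obtains W c C q where "hilbert_matrix w W c C q"
proof -
  obtain L1 where L1: "L1 \<ge> 1" "\<And>j n. (\<Sum>k=j..n. 2 ^ k * V k) \<le> L1 * (2 ^ j * V j)"
    using sum_aV_le[OF M1] by blast
  obtain L2 where L2: "L2 \<ge> 1" "\<And>j n. (\<Sum>k=j..n. 1 / (8 ^ k * V k)) \<le> L2 * (1 / (8 ^ j * V j))"
    using sum_dV_le[OF M2] by blast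
  define L where "L = max L1 L2"
  define \<rho> where "\<rho> = 1 - 1 / (L + 1)"
  have L: "L \<ge> 1" using L1 by (simp add: L_def)
  have \<rho>: "0 < \<rho>" "\<rho> < 1" using L by (auto simp: \<rho>_def field_simps)
  have a: "(2 ^ (j + d) * V (j + d)) \<le> L * \<rho> ^ d * (2 ^ j * V j)" for j d
    unfolding \<rho>_def
  proof (rule geometric_decay[of "\<lambda>k. 2 ^ k * V k"])
    show "(\<Sum>k=j..n. 2 ^ k * V k) \<le> L * (2 ^ j * V j)" for j n
      using V(2)[of j] by (intro order_trans[OF L1(2)] mult_right_mono) (auto simp: L_def)
  qed (use V(2) L in auto)
  have d: "1 / (8 ^ (j + d) * V (j + d)) \<le> L * \<rho> ^ d * (1 / (8 ^ j * V j))" for j d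
    unfolding \<rho>_def
  proof (rule geometric_decay[of "\<lambda>k. 1 / (8 ^ k * V k)"])
    show "(\<Sum>k=j..n. 1 / (8 ^ k * V k)) \<le> L * (1 / (8 ^ j * V j))" for j n
      using V(2)[of j] by (intro order_trans[OF L2(2)] mult_right_mono) (auto simp: L_def)
  qed (use V(2) L in auto)
  \<comment> \<open>Forgetting the geometric factor leaves almost monotonicity of
    \<open>8 ^ k * V k\<close>, the form in which the moment bound takes it.\<close>
  have dd: "8 ^ k * V k \<le> L * (8 ^ j * V j)" if "k \<le> j" for k j
  proof -
    have "1 / (8 ^ j * V j) \<le> L * \<rho> ^ (j - k) * (1 / (8 ^ k * V k))" using d[of k "j - k"] that by simp
    also have "\<dots> \<le> L * 1 * (1 / (8 ^ k * V k))"
      using L \<rho> V(2)[of k] by (intro mult_right_mono mult_left_mono power_le_one) auto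
    finally show ?thesis using V(2)[of k] V(2)[of j] by (simp add: field_simps)
  qed
  obtain Cm where Cm: "Cm > 0" "\<And>j n. 2 ^ j \<le> n + 2 \<Longrightarrow> mom n \<le> Cm * V j"
    using mom_upper[OF L dd] by blast
  \<comment> \<open>On block \<open>j\<close> the factor \<open>n\<^sup>2\<close> in the norm is of
    order \<open>4 ^ j\<close> and the moment is of order \<open>V j\<close>.\<close>
  define W where "W j = 4 ^ j * V j" for j
  have Wp: "W j > 0" for j using V(2) by (simp add: W_def)
  \<comment> \<open>64 and \<open>4 * Cm\<close> are the comparison constants on the blocks
    \<open>j \<noteq> 0\<close>; \<open>V 0\<close> and its inverse are added for block 0, where
    \<open>w 0 = 1\<close> has to be compared with \<open>W 0 = V 0\<close>.\<close>
  define c where "c = 64 + 4 * Cm + V 0 + 1 / V 0"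
  have c: "c \<ge> 64" "c \<ge> 4 * Cm" "c \<ge> V 0" "c \<ge> 1 / V 0"
    using Cm(1) V(2)[of 0] by (auto simp: c_def)
  have wW: "W j \<le> 64 * w n \<and> w n \<le> 4 * Cm * W j" if n: "n \<in> blk j" and j: "j \<noteq> 0" for n j
  proof -
    have nj: "2 ^ j \<le> n + 1" "n + 1 < 2 ^ (j + 1)" using n by (auto simp: blk_iff)
    have "(2::nat) ^ 1 \<le> 2 ^ j" using j by (intro power_increasing) auto
    then have n0: "n \<noteq> 0" and n2: "2 ^ j \<le> 2 * n" using nj(1) by auto
    have r2: "(2::real) ^ j \<le> 2 * real n"
      using n2 by (metis of_nat_le_iff of_nat_mult of_nat_numeral of_nat_power)
    have r1: "real n \<le> 2 * 2 ^ j"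
    proof -
      have "n \<le> 2 * 2 ^ j" using nj(2) by simp
      then show ?thesis by (metis of_nat_le_iff of_nat_mult of_nat_numeral of_nat_power)
    qed
    have w: "w n = (real n)\<^sup>2 * mom (n - 1)" using n0 by (simp add: w_def)
    have four: "(2 ^ j)\<^sup>2 = (4::real) ^ j" by (simp add: power2_eq_square power_mult_distrib[symmetric])
    have "(2 ^ j)\<^sup>2 \<le> (2 * real n)\<^sup>2" using r2 by (intro power_mono) auto
    then have "4 ^ j / 4 \<le> (real n)\<^sup>2" unfolding four by (simp add: power_mult_distrib)
    moreover have "V j / 16 \<le> mom (n - 1)" using nj n0 by (intro mom_lower) auto
    ultimately have "4 ^ j / 4 * (V j / 16) \<le> w n" unfolding w using V(2)[of j] by (intro mult_mono) auto
    then have 1: "W j \<le> 64 * w n" by (simp add: W_def)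
    have "(real n)\<^sup>2 \<le> (2 * 2 ^ j)\<^sup>2" using r1 by (intro power_mono) auto
    then have "(real n)\<^sup>2 \<le> 4 * 4 ^ j" by (simp add: power_mult_distrib four)
    moreover have "mom (n - 1) \<le> Cm * V j" using nj n0 by (intro Cm(2)) auto
    ultimately have "w n \<le> 4 * 4 ^ j * (Cm * V j)" unfolding w by (intro mult_mono) (auto simp: mom_def)
    then show ?thesis using 1 by (simp add: W_def mult_ac)
  qed
  have wp: "w n > 0" for n
  proof -
    obtain j where j: "n \<in> blk j" using in_blk_exists by blast
    show ?thesis
    proof (cases "j = 0")
      case True
      then show ?thesis using j by (simp add: blk_0 w_def)
    next
      case False
      then show ?thesis using wW[OF j False] Wp[of j] by linarith
    qed
  qed
  have "hilbert_matrix w W c (sqrt L) (sqrt \<rho>)"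
  proof
    show "w n > 0" for n by (rule wp)
    show "W j > 0" for j by (rule Wp)
    show "c \<ge> 1" "sqrt L > 0" "0 < sqrt \<rho>" "sqrt \<rho> < 1" using c L \<rho> by auto
    fix n j assume n: "n \<in> blk j"
    show "W j \<le> c * w n"
    proof (cases "j = 0")
      case True
      then show ?thesis using n c by (simp add: blk_0 w_def W_def)
    next
      case False
      then have "W j \<le> 64 * w n" using wW n by blast
      also have "\<dots> \<le> c * w n" using c wp[of n] by (intro mult_right_mono) auto
      finally show ?thesis .
    qed
    show "w n \<le> c * W j"
    proof (cases "j = 0")
      case True
      have "1 = 1 / V 0 * V 0" using V(2)[of 0] by simp
      also have "\<dots> \<le> c * V 0" using c V(2)[of 0] by (intro mult_right_mono) auto
      finally show ?thesis using n True by (simp add: blk_0 w_def W_def)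
    next
      case False
      then have "w n \<le> 4 * Cm * W j" using wW n by blast
      also have "\<dots> \<le> c * W j" using c Wp[of j] by (intro mult_right_mono) auto
      finally show ?thesis .
    qed
  next
    fix j k
    have four: "(2 ^ i)\<^sup>2 = (4::real) ^ i" for i by (simp add: power2_eq_square power_mult_distrib[symmetric])
    have s4: "sqrt (4 ^ i) = 2 ^ i" for i unfolding four[symmetric] by simp
    have goal: "sqrt (W j * 2 ^ j * 2 ^ k / W k) / 2 ^ max j k = sqrt (W j * 2 ^ j * 2 ^ k / W k / 4 ^ max j k)"
      by (simp only: real_sqrt_divide s4)
    have rhs: "sqrt L * sqrt \<rho> ^ absdiff j k = sqrt (L * \<rho> ^ absdiff j k)"
      by (simp add: real_sqrt_mult real_sqrt_power)
    \<comment> \<open>The left side is the quotient of \<open>2 ^ j * V j\<close> by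
      \<open>2 ^ k * V k\<close> if \<open>k \<le> j\<close>, and that of \<open>8 ^ j * V j\<close>
      by \<open>8 ^ k * V k\<close> otherwise. The two geometric decays are stated for these
      quotients.\<close>
    have "W j * 2 ^ j * 2 ^ k / W k / 4 ^ max j k \<le> L * \<rho> ^ absdiff j k"
    proof (cases "k \<le> j")
      case True
      then have "absdiff j k = j - k" "max j k = j" by (auto simp: absdiff_def)
      moreover have "W j * 2 ^ j * 2 ^ k / W k / 4 ^ j = (2 ^ j * V j) / (2 ^ k * V k)"
        using V(2)[of k] by (simp add: W_def field_simps) (simp add: power_mult_distrib[symmetric] flip: mult.assoc)
      moreover have "2 ^ j * V j \<le> L * \<rho> ^ (j - k) * (2 ^ k * V k)" using a[of k "j - k"] True by simp
      ultimately show ?thesis using V(2)[of k] by (simp add: divide_le_eq)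
    next
      case False
      then have jk: "absdiff j k = k - j" "max j k = k" "j \<le> k" by (auto simp: absdiff_def)
      moreover have "W j * 2 ^ j * 2 ^ k / W k / 4 ^ k = (8 ^ j * V j) * (1 / (8 ^ k * V k))"
      proof -
        have "(4::real) ^ j * 2 ^ j = 8 ^ j" "(4::real) ^ k * 4 ^ k = 8 ^ k * 2 ^ k"
          by (simp_all add: power_mult_distrib[symmetric])
        then show ?thesis using V(2)[of k] unfolding W_def
          by (simp add: field_simps)
      qed
      moreover have "(8 ^ j * V j) * (1 / (8 ^ k * V k)) \<le> (8 ^ j * V j) * (L * \<rho> ^ (k - j) * (1 / (8 ^ j * V j)))"
        using d[of j "k - j"] jk(3) V(2)[of j] by (intro mult_left_mono) auto
      moreover have "(8 ^ j * V j) * (L * \<rho> ^ (k - j) * (1 / (8 ^ j * V j))) = L * \<rho> ^ (k - j)"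
        using V(2)[of j] by simp
      ultimately show ?thesis by simp
    qed
    then show "sqrt (W j * 2 ^ j * 2 ^ k / W k) / 2 ^ max j k \<le> sqrt L * sqrt \<rho> ^ absdiff j k"
      unfolding goal rhs by (rule real_sqrt_le_mono)
  qed
  then show ?thesis using that by blast
qed

end

section \<open>Dyadic description of the integral means\<close>

locale coeff_mean =
  fixes \<gamma> :: "nat \<Rightarrow> complex" and m :: "real \<Rightarrow> real"
  assumes summable_mean: "\<And>r. 0 < r \<Longrightarrow> r < 1 \<Longrightarrow> summable (\<lambda>n. (cmod (\<gamma> n))\<^sup>2 * (r ^ n)\<^sup>2)"
    and mean_eq: "\<And>r. 0 < r \<Longrightarrow> r < 1 \<Longrightarrow> m r = sqrt (\<Sum>n. (cmod (\<gamma> n))\<^sup>2 * (r ^ n)\<^sup>2)"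
begin

abbreviation A :: "nat \<Rightarrow> real" where
  "A \<equiv> dyadic_mean \<gamma>"

lemma mean_nonneg: "0 < r \<Longrightarrow> r < 1 \<Longrightarrow> m r \<ge> 0"
  by (simp add: mean_eq suminf_nonneg[OF summable_mean])

text \<open>Only block \<open>j\<close> of the series is kept; at radii beyond
  \<open>dyadic_pt j\<close> its squared powers are at least 1/16.\<close>

lemma mean_ge:
  assumes r: "dyadic_pt j \<le> r" "r < 1"
  shows "sqrt (2 ^ j) * A j / 4 \<le> m r"
proof -
  have r0: "0 < r" using r dyadic_pt_bounds(1)[of j] by linarith
  have "(sqrt (2 ^ j) * A j / 4)\<^sup>2 = (2 ^ j * (A j)\<^sup>2) * (1 / 16)"
    by (simp add: power_mult_distrib power_divide)
  also have "\<dots> = (\<Sum>n\<in>blk j. (cmod (\<gamma> n))\<^sup>2 * (1 / 16))"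
    unfolding dyadic_mean_sq sum_distrib_right ..
  also have "\<dots> \<le> (\<Sum>n\<in>blk j. (cmod (\<gamma> n))\<^sup>2 * (r ^ n)\<^sup>2)"
  proof (intro sum_mono mult_left_mono)
    fix n assume "n \<in> blk j"
    then have "n + 2 \<le> 2 ^ (j + 1)" by (auto simp: blk_iff)
    then have "1 / 16 \<le> (dyadic_pt j ^ n)\<^sup>2" by (rule dyadic_pt_power_ge)
    also have "\<dots> \<le> (r ^ n)\<^sup>2" using r dyadic_pt_bounds[of j] by (intro power_mono) auto
    finally show "1 / 16 \<le> (r ^ n)\<^sup>2" .
  qed auto
  also have "\<dots> \<le> (\<Sum>n. (cmod (\<gamma> n))\<^sup>2 * (r ^ n)\<^sup>2)"
    by (rule sum_le_suminf[OF summable_mean[OF r0 r(2)]]) auto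
  finally show ?thesis
    unfolding mean_eq[OF r0 r(2)] by (rule real_le_rsqrt)
qed

definition \<theta> :: real where "\<theta> = 1 / sqrt 2"

lemma \<theta>: "0 < \<theta>" "\<theta> < 1"
  by (auto simp: \<theta>_def)

text \<open>On the shell where \<open>1 - r\<close> is of order 2^-i, a block
  \<open>j \<le> i\<close> loses the square root of 2^(i-j) through the factor
  \<open>sqrt (1 - r)\<close> alone. For \<open>j > i\<close> the growth of
  \<open>sqrt (2 ^ j)\<close> is more than compensated by the smallness of the power of
  \<open>r\<close>.\<close>

lemma power_blk_le:
  assumes r: "0 < r" "r < 1" and i: "1 / 2 ^ Suc i \<le> 1 - r" "1 - r \<le> 1 / 2 ^ i"
  shows "sqrt (1 - r) * (sqrt (2 ^ j) * r ^ (2 ^ j - 1)) \<le> 16 * \<theta> ^ absdiff i j"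
proof -
  have th: "\<theta> ^ d = 1 / sqrt (2 ^ d)" for d by (simp add: \<theta>_def power_divide real_sqrt_power)
  have r1: "r ^ (2 ^ j - 1) \<le> 1" using r by (intro power_le_one) auto
  have s: "sqrt (1 - r) \<le> 1 / sqrt (2 ^ i)"
    using real_sqrt_le_mono[OF i(2)] by (simp add: real_sqrt_divide)
  show ?thesis
  proof (cases "j \<le> i")
    case True
    then have d: "absdiff i j = i - j" by (simp add: absdiff_def)
    have "sqrt (1 - r) * (sqrt (2 ^ j) * r ^ (2 ^ j - 1)) \<le> 1 / sqrt (2 ^ i) * (sqrt (2 ^ j) * 1)"
      using r r1 s by (intro mult_mono) auto
    also have "\<dots> = 1 / sqrt (2 ^ (i - j))"
    proof -
      have "(2::real) ^ i = 2 ^ (i - j) * 2 ^ j" using True by (simp flip: power_add)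
      then show ?thesis by (simp add: real_sqrt_mult)
    qed
    also have "\<dots> \<le> 16 * (1 / sqrt (2 ^ (i - j)))" by (simp add: divide_right_mono)
    finally show ?thesis unfolding d th .
  next
    case False
    define d where "d = j - i"
    have d: "absdiff i j = d" "j = i + d" using False by (auto simp: absdiff_def d_def)
    define x where "x = r ^ (2 ^ j - 1)"
    have x0: "x \<ge> 0" using r by (simp add: x_def)
    have sq: "sqrt (2 ^ d) \<le> (2::real) ^ d" by (rule real_le_lsqrt) (auto simp: power2_eq_square)
    have "(2::real) ^ j \<le> real (2 ^ j - 1) + 2" by (simp add: of_nat_diff)
    then have "(2 ^ j) ^ 4 * (1 - r) ^ 4 * x\<^sup>2 \<le> 16"
      unfolding x_def using r by (intro power4_times_power_le) auto
    then have le: "(2 ^ j * (1 - r)) ^ 4 * x\<^sup>2 \<le> 16" by (simp add: power_mult_distrib)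
    have "2 ^ d / 2 = 2 ^ j * (1 / 2 ^ Suc i :: real)" by (simp add: d(2) power_add)
    also have "\<dots> \<le> 2 ^ j * (1 - r)" by (intro mult_left_mono i) simp
    finally have "(2 ^ d / 2) ^ 4 \<le> (2 ^ j * (1 - r)) ^ 4" by (intro power_mono) auto
    then have "(2 ^ d / 2) ^ 4 * x\<^sup>2 \<le> (2 ^ j * (1 - r)) ^ 4 * x\<^sup>2" by (rule mult_right_mono) simp
    then have "(2 ^ d / 2) ^ 4 * x\<^sup>2 \<le> 16" using le by linarith
    moreover have "(D\<^sup>2 * x / 4)\<^sup>2 = (D / 2) ^ 4 * x\<^sup>2" for D :: real
      by (simp add: power2_eq_square power4_eq_xxxx)
    ultimately have "((2 ^ d)\<^sup>2 * x / 4)\<^sup>2 \<le> 4\<^sup>2" by simp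
    then have "(2 ^ d)\<^sup>2 * x / 4 \<le> 4" by (rule power2_le_imp_le) simp
    then have x: "2 ^ d * x \<le> 16 / 2 ^ d" by (simp add: field_simps power2_eq_square)
    have "sqrt (1 - r) * (sqrt (2 ^ j) * x) \<le> 1 / sqrt (2 ^ i) * (sqrt (2 ^ j) * x)"
      using x0 s by (intro mult_right_mono) auto
    also have "\<dots> = sqrt (2 ^ d) * x" by (simp add: d(2) power_add real_sqrt_mult)
    also have "\<dots> \<le> 2 ^ d * x" by (rule mult_right_mono[OF sq x0])
    also have "\<dots> \<le> 16 / 2 ^ d" by (rule x)
    also have "\<dots> \<le> 16 * (1 / sqrt (2 ^ d))"
    proof -
      from sq have "1 / 2 ^ d \<le> 1 / sqrt (2 ^ d)" by (intro divide_left_mono) auto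
      then show ?thesis by simp
    qed
    finally show ?thesis unfolding d(1) th x_def .
  qed
qed

text \<open>Over the blocks the l^2 norm is bounded by the l^1 norm, which makes the mean linear in
  \<open>A\<close>; a kernel with geometric off-diagonal decay is then applied to
  \<open>A\<close>.\<close>

lemma mean_le_sum:
  assumes r: "0 < r" "r < 1" and i: "1 / 2 ^ Suc i \<le> 1 - r" "1 - r \<le> 1 / 2 ^ i"
    and B: "\<And>N. (\<Sum>j<N. A j * (16 * \<theta> ^ absdiff i j)) \<le> B"
  shows "m r * sqrt (1 - r) \<le> B"
proof -
  have part: "sqrt (\<Sum>n<2 ^ N - 1. (cmod (\<gamma> n))\<^sup>2 * (r ^ n)\<^sup>2) * sqrt (1 - r) \<le> B" for N
  proof -
    have "(\<Sum>n\<in>blk j. (cmod (\<gamma> n))\<^sup>2 * (r ^ n)\<^sup>2) \<le> (sqrt (2 ^ j) * A j * r ^ (2 ^ j - 1))\<^sup>2" for j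
    proof -
      have "(\<Sum>n\<in>blk j. (cmod (\<gamma> n))\<^sup>2 * (r ^ n)\<^sup>2) \<le> (\<Sum>n\<in>blk j. (cmod (\<gamma> n))\<^sup>2 * (r ^ (2 ^ j - 1))\<^sup>2)"
        using r by (intro sum_mono mult_left_mono power_mono power_decreasing) (auto simp: blk_def)
      also have "\<dots> = (2 ^ j * (A j)\<^sup>2) * (r ^ (2 ^ j - 1))\<^sup>2"
        unfolding dyadic_mean_sq sum_distrib_right ..
      finally show ?thesis by (simp add: power_mult_distrib)
    qed
    then have "sqrt (\<Sum>n<2 ^ N - 1. (cmod (\<gamma> n))\<^sup>2 * (r ^ n)\<^sup>2) \<le> sqrt (\<Sum>j<N. (sqrt (2 ^ j) * A j * r ^ (2 ^ j - 1))\<^sup>2)"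
      unfolding sum_blk by (intro real_sqrt_le_mono sum_mono)
    also have "\<dots> = L2_set (\<lambda>j. sqrt (2 ^ j) * A j * r ^ (2 ^ j - 1)) {..<N}" by (simp add: L2_set_def)
    also have "\<dots> \<le> (\<Sum>j<N. sqrt (2 ^ j) * A j * r ^ (2 ^ j - 1))"
      using r by (intro L2_set_le_sum) auto
    finally have "sqrt (\<Sum>n<2 ^ N - 1. (cmod (\<gamma> n))\<^sup>2 * (r ^ n)\<^sup>2) * sqrt (1 - r) \<le>
        (\<Sum>j<N. sqrt (2 ^ j) * A j * r ^ (2 ^ j - 1)) * sqrt (1 - r)"
      using r by (intro mult_right_mono) auto
    also have "\<dots> = (\<Sum>j<N. A j * (sqrt (1 - r) * (sqrt (2 ^ j) * r ^ (2 ^ j - 1))))"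
      unfolding sum_distrib_right by (intro sum.cong refl) (simp only: mult_ac)
    also have "\<dots> \<le> (\<Sum>j<N. A j * (16 * \<theta> ^ absdiff i j))"
      by (intro sum_mono mult_left_mono power_blk_le r i dyadic_mean_nonneg)
    also have "\<dots> \<le> B" by (rule B)
    finally show ?thesis .
  qed
  have "(\<lambda>N. \<Sum>n<2 ^ N - 1. (cmod (\<gamma> n))\<^sup>2 * (r ^ n)\<^sup>2) \<longlonglongrightarrow> (\<Sum>n. (cmod (\<gamma> n))\<^sup>2 * (r ^ n)\<^sup>2)"
    by (rule filterlim_compose[OF summable_LIMSEQ[OF summable_mean[OF r]] filterlim_two_power_minus_1])
  then have "(\<lambda>N. sqrt (\<Sum>n<2 ^ N - 1. (cmod (\<gamma> n))\<^sup>2 * (r ^ n)\<^sup>2) * sqrt (1 - r)) \<longlonglongrightarrow> m r * sqrt (1 - r)"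
    unfolding mean_eq[OF r] by (intro tendsto_intros)
  then show ?thesis by (rule LIMSEQ_le_const2) (use part in blast)
qed

definition K\<theta> :: real where "K\<theta> = 16 * (2 / (1 - \<theta>))"

lemma K\<theta>_pos: "K\<theta> > 0"
  using \<theta> by (simp add: K\<theta>_def)

lemma sum_kernel_le: "(\<Sum>j<N. 16 * \<theta> ^ absdiff i j) \<le> K\<theta>"
  unfolding K\<theta>_def sum_distrib_left[symmetric]
  by (intro mult_left_mono sum_geometric_absdiff) (use \<theta> in auto)

lemma shell_exists:
  fixes r :: real
  assumes "0 < r" "r < 1"
  obtains i where "1 / 2 ^ Suc i \<le> 1 - r" "1 - r \<le> 1 / 2 ^ i"
proof -
  have ex: "\<exists>i. 1 / 2 ^ i \<le> 1 - r"
  proof -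
    obtain i where "(1 / 2) ^ i < 1 - r" using real_arch_pow_inv[of "1 - r" "1 / 2"] assms by auto
    then show ?thesis by (intro exI[of _ i]) (simp add: power_divide)
  qed
  define n where "n = (LEAST i. 1 / 2 ^ i \<le> 1 - r)"
  have n: "1 / 2 ^ n \<le> 1 - r" unfolding n_def by (rule LeastI_ex[OF ex])
  have "n \<noteq> 0" using n assms by (intro notI) simp
  then obtain i where i: "n = Suc i" using not0_implies_Suc by blast
  have "\<not> 1 / 2 ^ i \<le> 1 - r" using not_less_Least[of i "\<lambda>i. 1 / 2 ^ i \<le> 1 - r"] i unfolding n_def by simp
  then show ?thesis using that[of i] n i by simp
qed

lemma mean_le_sup:
  assumes r: "0 < r" "r < 1" and B: "\<And>j. A j \<le> B"
  shows "m r * (1 - r) powr (1/2) \<le> K\<theta> * B"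
proof -
  have B0: "B \<ge> 0" using B[of 0] dyadic_mean_nonneg[of \<gamma> 0] by linarith
  obtain i where i: "1 / 2 ^ Suc i \<le> 1 - r" "1 - r \<le> 1 / 2 ^ i" using shell_exists[OF r] .
  have "m r * sqrt (1 - r) \<le> K\<theta> * B"
  proof (rule mean_le_sum[OF r i])
    fix N
    have "(\<Sum>j<N. A j * (16 * \<theta> ^ absdiff i j)) \<le> (\<Sum>j<N. B * (16 * \<theta> ^ absdiff i j))"
      using \<theta> by (intro sum_mono mult_right_mono B) auto
    also have "\<dots> = B * (\<Sum>j<N. 16 * \<theta> ^ absdiff i j)" by (simp add: sum_distrib_left)
    also have "\<dots> \<le> B * K\<theta>" by (intro mult_left_mono sum_kernel_le B0)
    finally show "(\<Sum>j<N. A j * (16 * \<theta> ^ absdiff i j)) \<le> K\<theta> * B" by (simp add: mult.commute)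
  qed
  then show ?thesis using r by (simp add: powr_half_sqrt)
qed

lemma A_le_mean: "\<exists>r\<in>{0<..<1}. A j / 8 \<le> m r * (1 - r) powr (1/2)"
proof
  let ?r = "dyadic_pt j"
  have z: "sqrt (1 - dyadic_pt j) = 1 / (sqrt 2 * sqrt (2 ^ j))" by (simp add: one_minus_dyadic_pt real_sqrt_divide real_sqrt_mult)
  have "sqrt (2 ^ j) * A j / 4 \<le> m (dyadic_pt j)" by (rule mean_ge) (use dyadic_pt_bounds in auto)
  then have h1: "sqrt (2 ^ j) * A j / 4 * (1 / (sqrt 2 * sqrt (2 ^ j))) \<le> m (dyadic_pt j) * (1 / (sqrt 2 * sqrt (2 ^ j)))"
    by (intro mult_right_mono) auto
  have h2: "A j / 8 \<le> sqrt (2 ^ j) * A j / 4 * (1 / (sqrt 2 * sqrt (2 ^ j)))"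
  proof -
    have "sqrt 2 \<le> 2" by (rule real_le_lsqrt) auto
    then have "1 / 2 \<le> 1 / sqrt 2" by (intro divide_left_mono) auto
    then have "A j / 4 * (1 / 2) \<le> A j / 4 * (1 / sqrt 2)" by (intro mult_left_mono) auto
    then show ?thesis by simp
  qed
  have "A j / 8 \<le> m (dyadic_pt j) * sqrt (1 - dyadic_pt j)" unfolding z by (rule order_trans[OF h2 h1])
  then show "A j / 8 \<le> m ?r * (1 - ?r) powr (1/2)" using dyadic_pt_bounds(2)[of j] by (simp add: powr_half_sqrt)
qed (use dyadic_pt_bounds in auto)

text \<open>The weight is regrouped so that the remaining measure is dr / (1 - r). It gives all
  dyadic shells comparable mass, so the integral behaves like an l^p sum over shells.\<close>

lemma powr_split:
  assumes "0 < r" "r < 1"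
  shows "m r powr p * (1 - r) powr (p / 2 - 1) = (m r * sqrt (1 - r)) powr p / (1 - r)"
proof -
  have "(1 - r) powr (p / 2 - 1) = (1 - r) powr (p / 2) / (1 - r)"
    using assms by (simp add: powr_diff)
  moreover have "(m r * sqrt (1 - r)) powr p = m r powr p * (1 - r) powr (p / 2)"
    using assms mean_nonneg[OF assms]
    by (simp add: powr_mult powr_half_sqrt[symmetric] powr_powr)
  ultimately show ?thesis by simp
qed

text \<open>On the shell from \<open>dyadic_pt k\<close> to \<open>dyadic_pt (Suc k)\<close> the
  factor \<open>1 / (1 - r)\<close> is at least \<open>2 ^ (k + 1)\<close>, against the length
  \<open>1 / 2 ^ (k + 2)\<close>; this is the origin of the division by 2.\<close>

lemma sum_A_le_integral:
  assumes p: "p \<ge> 1"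
  shows "ennreal (\<Sum>j\<le>n. (A j / 8) powr p / 2) \<le>
    (\<integral>\<^sup>+r\<in>{0<..<1}. ennreal (m r powr p * (1 - r) powr (p / 2 - 1)) \<partial>lborel)"
proof -
  have "(A k / 8) powr p / 2 = (A k / 8) powr p * 2 ^ (k + 1) / 2 ^ (k + 2)" for k by simp
  then have "ennreal (\<Sum>j\<le>n. (A j / 8) powr p / 2) = ennreal (\<Sum>k=0..n. (A k / 8) powr p * 2 ^ (k + 1) / 2 ^ (k + 2))"
    by (simp only: atMost_atLeast0)
  also have "\<dots> \<le> (\<integral>\<^sup>+r\<in>{dyadic_pt 0<..<1}. ennreal (m r powr p * (1 - r) powr (p / 2 - 1)) \<partial>lborel)"
  proof (rule nn_integral_step_lower)
    fix k r assume r: "r \<in> {dyadic_pt k<..<dyadic_pt (Suc k)}"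
    then have r01: "0 < r" "r < 1" using dyadic_pt_bounds(1)[of k] dyadic_pt_bounds(2)[of "Suc k"] by auto
    have b: "1 / 2 ^ (k + 2) \<le> 1 - r" "1 - r \<le> 1 / 2 ^ (k + 1)"
      using r one_minus_dyadic_pt[of k] one_minus_dyadic_pt[of "Suc k"] by auto
    have "sqrt (1 / 2 ^ (k + 2)) \<le> sqrt (1 - r)" by (rule real_sqrt_le_mono[OF b(1)])
    then have s: "1 / (2 * sqrt (2 ^ k)) \<le> sqrt (1 - r)" by (simp add: real_sqrt_divide real_sqrt_mult)
    have "A k / 8 = sqrt (2 ^ k) * A k / 4 * (1 / (2 * sqrt (2 ^ k)))" by simp
    also have "\<dots> \<le> m r * sqrt (1 - r)"
      using r r01 by (intro mult_mono mean_ge s mean_nonneg) auto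
    finally have "(A k / 8) powr p \<le> (m r * sqrt (1 - r)) powr p"
      using p by (intro powr_mono2) auto
    moreover have "2 ^ (k + 1) \<le> 1 / (1 - r)" using b(2) r01 by (simp add: field_simps)
    ultimately have "(A k / 8) powr p * 2 ^ (k + 1) \<le> (m r * sqrt (1 - r)) powr p * (1 / (1 - r))"
      by (intro mult_mono) auto
    then show "ennreal ((A k / 8) powr p * 2 ^ (k + 1)) \<le> ennreal (m r powr p * (1 - r) powr (p / 2 - 1))"
      unfolding powr_split[OF r01] by (intro ennreal_leI) simp
  qed simp
  also have "\<dots> \<le> (\<integral>\<^sup>+r\<in>{0<..<1}. ennreal (m r powr p * (1 - r) powr (p / 2 - 1)) \<partial>lborel)"
    using dyadic_pt_bounds(1)[of 0] by (intro nn_integral_mono) (auto simp: indicator_def)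
  finally show ?thesis .
qed

text \<open>On the \<open>i\<close>-th shell the normalized mean is at most \<open>B i\<close>, the
  kernel \<open>16 * \<theta> ^ absdiff i j\<close> applied to \<open>A\<close>, and the shell has
  mass at most 1 for dr / (1 - r). Schur's test bounds the l^p norm of \<open>B\<close> by that of
  \<open>A\<close>.\<close>

lemma integral_le_sum_A:
  assumes p: "p \<ge> 1" and R: "\<And>N. (\<Sum>j<N. A j powr p) \<le> R"
  shows "(\<integral>\<^sup>+r\<in>{0<..<1}. ennreal (m r powr p * (1 - r) powr (p / 2 - 1)) \<partial>lborel) \<le> ennreal (K\<theta> powr p * R)"
proof -
  have R0: "R \<ge> 0" using R[of 0] by simp
  have A_le: "A j \<le> R powr (1 / p)" for j
  proof -
    have "A j powr p \<le> (\<Sum>j<Suc j. A j powr p)" by (rule member_le_sum) auto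
    also have "\<dots> \<le> R" by (rule R)
    finally have "(A j powr p) powr (1 / p) \<le> R powr (1 / p)" using p by (intro powr_mono2) auto
    then show ?thesis using p by (simp add: powr_powr)
  qed
  \<comment> \<open>The series converges because \<open>A\<close> is bounded, as each of its terms
    is at most \<open>R powr (1 / p)\<close>.\<close>
  define B where "B i = (\<Sum>j. A j * (16 * \<theta> ^ absdiff i j))" for i
  have part_le: "(\<Sum>j<N. A j * (16 * \<theta> ^ absdiff i j)) \<le> R powr (1 / p) * K\<theta>" for N i
  proof -
    have "(\<Sum>j<N. A j * (16 * \<theta> ^ absdiff i j)) \<le> (\<Sum>j<N. R powr (1 / p) * (16 * \<theta> ^ absdiff i j))"
      using \<theta> by (intro sum_mono mult_right_mono A_le) auto
    also have "\<dots> = R powr (1 / p) * (\<Sum>j<N. 16 * \<theta> ^ absdiff i j)" by (simp only: sum_distrib_left)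
    also have "\<dots> \<le> R powr (1 / p) * K\<theta>" by (intro mult_left_mono sum_kernel_le) auto
    finally show ?thesis .
  qed
  have sB: "summable (\<lambda>j. A j * (16 * \<theta> ^ absdiff i j))" for i
    by (rule summableI_nonneg_bounded[OF _ part_le]) (use \<theta> in simp)
  have partB: "(\<Sum>j<N. A j * (16 * \<theta> ^ absdiff i j)) \<le> B i" for N i
    unfolding B_def by (rule sum_le_suminf[OF sB]) (use \<theta> in auto)
  have B0: "B i \<ge> 0" for i using partB[of i 0] by simp
  have schur: "(\<Sum>i<I. B i powr p) \<le> K\<theta> powr p * R" for I
  proof (rule LIMSEQ_le_const2)
    show "(\<lambda>N. \<Sum>i<I. (\<Sum>j<N. A j * (16 * \<theta> ^ absdiff i j)) powr p) \<longlonglongrightarrow> (\<Sum>i<I. B i powr p)"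
    proof (intro tendsto_sum tendsto_powr' tendsto_const)
      fix i
      show "(\<lambda>N. \<Sum>j<N. A j * (16 * \<theta> ^ absdiff i j)) \<longlonglongrightarrow> B i"
        unfolding B_def by (rule summable_LIMSEQ[OF sB])
      show "B i \<noteq> 0 \<or> (0 < p \<and> (\<forall>\<^sub>F N in sequentially. 0 \<le> (\<Sum>j<N. A j * (16 * \<theta> ^ absdiff i j))))"
        using p \<theta> by (auto intro!: always_eventually sum_nonneg)
    qed
    have "(\<Sum>i<I. (\<Sum>j<N. A j * (16 * \<theta> ^ absdiff i j)) powr p) \<le> K\<theta> powr p * (\<Sum>j<N. A j powr p)" for N
    proof (rule schur_powr)
      show "(\<Sum>i<I. 16 * \<theta> ^ absdiff i j) \<le> K\<theta>" for j
        using sum_kernel_le[of j I] by (simp add: absdiff_commute)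
    qed (use p K\<theta>_pos \<theta> sum_kernel_le in auto)
    also have "K\<theta> powr p * (\<Sum>j<N. A j powr p) \<le> K\<theta> powr p * R" for N
      by (intro mult_left_mono R) auto
    finally show "\<exists>N. \<forall>n\<ge>N. (\<Sum>i<I. (\<Sum>j<n. A j * (16 * \<theta> ^ absdiff i j)) powr p) \<le> K\<theta> powr p * R" by blast
  qed
  \<comment> \<open>These shells start at 0, unlike those between the points
    \<open>dyadic_pt\<close>, and they are closed; hence every \<open>r\<close> in the open unit
    interval lies in at least one of them.\<close>
  define e :: "nat \<Rightarrow> real" where "e i = 1 - 1 / 2 ^ i" for i
  have len: "emeasure lborel {e i..e (Suc i)} = ennreal (1 / 2 ^ Suc i)" for i
    by (subst emeasure_lborel_Icc) (auto simp: e_def field_simps)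
  have "(\<integral>\<^sup>+r\<in>{0<..<1}. ennreal (m r powr p * (1 - r) powr (p / 2 - 1)) \<partial>lborel) \<le>
      (\<integral>\<^sup>+r. (\<Sum>i. ennreal (B i powr p * 2 ^ Suc i) * indicator {e i..e (Suc i)} r) \<partial>lborel)"
  proof (rule nn_integral_mono)
    fix r
    show "ennreal (m r powr p * (1 - r) powr (p / 2 - 1)) * indicator {0<..<1} r \<le>
        (\<Sum>i. ennreal (B i powr p * 2 ^ Suc i) * indicator {e i..e (Suc i)} r)"
    proof (cases "r \<in> {0<..<1}")
      case True
      then have r: "0 < r" "r < 1" by auto
      obtain i where i: "1 / 2 ^ Suc i \<le> 1 - r" "1 - r \<le> 1 / 2 ^ i" using shell_exists[OF r] .
      have "m r * sqrt (1 - r) \<le> B i" by (rule mean_le_sum[OF r i partB])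
      then have "(m r * sqrt (1 - r)) powr p \<le> B i powr p"
        using p r mean_nonneg[OF r] by (intro powr_mono2) auto
      moreover have "1 / (1 - r) \<le> 2 ^ Suc i" using i(1) r by (simp add: field_simps)
      ultimately have "(m r * sqrt (1 - r)) powr p * (1 / (1 - r)) \<le> B i powr p * 2 ^ Suc i"
        using r by (intro mult_mono) auto
      then have "ennreal (m r powr p * (1 - r) powr (p / 2 - 1)) \<le> ennreal (B i powr p * 2 ^ Suc i)"
        unfolding powr_split[OF r] by (intro ennreal_leI) simp
      also have "\<dots> = ennreal (B i powr p * 2 ^ Suc i) * indicator {e i..e (Suc i)} r"
      proof -
        have "r \<in> {e i..e (Suc i)}" using i unfolding e_def atLeastAtMost_iff by linarith
        then show ?thesis by simp
      qed
      also have "\<dots> \<le> (\<Sum>i. ennreal (B i powr p * 2 ^ Suc i) * indicator {e i..e (Suc i)} r)"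
      proof -
        define f where "f i = ennreal (B i powr p * 2 ^ Suc i) * indicator {e i..e (Suc i)} r" for i
        have "f i \<le> suminf f" using sum_le_suminf[of f "{i}"] by simp
        then show ?thesis unfolding f_def .
      qed
      finally show ?thesis using True by simp
    qed simp
  qed
  also have "\<dots> = (\<Sum>i. \<integral>\<^sup>+r. ennreal (B i powr p * 2 ^ Suc i) * indicator {e i..e (Suc i)} r \<partial>lborel)"
    by (rule nn_integral_suminf) measurable
  also have "\<dots> = (\<Sum>i. ennreal (B i powr p))"
  proof (rule suminf_cong)
    fix i
    have "(\<integral>\<^sup>+r. ennreal (B i powr p * 2 ^ Suc i) * indicator {e i..e (Suc i)} r \<partial>lborel) = ennreal (B i powr p * 2 ^ Suc i) * ennreal (1 / 2 ^ Suc i)"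
      unfolding len[symmetric] by (rule nn_integral_cmult_indicator) simp
    also have "\<dots> = ennreal (B i powr p * 2 ^ Suc i * (1 / 2 ^ Suc i))"
      by (rule ennreal_mult[symmetric]) auto
    finally show "(\<integral>\<^sup>+r. ennreal (B i powr p * 2 ^ Suc i) * indicator {e i..e (Suc i)} r \<partial>lborel) = ennreal (B i powr p)"
      by simp
  qed
  also have "\<dots> \<le> ennreal (K\<theta> powr p * R)"
  proof (rule suminf_le_const[OF summableI])
    fix I
    have "(\<Sum>i<I. ennreal (B i powr p)) = ennreal (\<Sum>i<I. B i powr p)" by (rule sum_ennreal) simp
    then show "(\<Sum>i<I. ennreal (B i powr p)) \<le> ennreal (K\<theta> powr p * R)"
      using schur[of I] by (simp add: ennreal_leI)
  qed
  finally show ?thesis .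
qed

end

section \<open>The generalized Hilbert operator as a matrix\<close>

lemma summable_linear_power:
  fixes r :: real
  assumes "0 \<le> r" "r < 1"
  shows "summable (\<lambda>n. real (Suc n) * r ^ n)"
  using geometric_deriv_sums[of r] assms by (auto simp: sums_iff)

lemma taylor_coeff_unique:
  assumes s: "\<And>z. z \<in> unit_disc \<Longrightarrow> (\<lambda>n. a n * z ^ n) sums f z"
  shows "f holomorphic_on unit_disc" and "taylor_coeff f n = a n"
proof -
  show "f holomorphic_on unit_disc"
    by (rule power_series_holomorphic[of 0 1 a]) (use s in auto)
  have "summable (\<lambda>n. a n * (1 / 2) ^ n)" using s[of "1 / 2"] by (simp add: sums_iff norm_divide)
  then have "norm (1 / 2 :: complex) \<le> conv_radius a" by (rule conv_radius_geI)
  then have cr: "fps_conv_radius (Abs_fps a) > 0"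
    unfolding fps_conv_radius_def by (auto intro: less_le_trans[rotated] simp: zero_less_divide_iff norm_divide)
  have "\<forall>\<^sub>F z in nhds 0. z \<in> unit_disc"
    by (rule eventually_nhds_in_open) auto
  then have "\<forall>\<^sub>F z in nhds 0. eval_fps (Abs_fps a) z = f z"
    by eventually_elim (use s in \<open>simp add: eval_fps_def sums_iff\<close>)
  with cr have "f has_fps_expansion Abs_fps a" by (simp add: has_fps_expansion_def)
  from fps_nth_fps_expansion[OF this, of n] show "taylor_coeff f n = a n" by (simp add: taylor_coeff_def)
qed

lemma taylor_coeff_cong:
  assumes "f holomorphic_on unit_disc" "\<And>z. z \<in> unit_disc \<Longrightarrow> h z = f z"
  shows "h holomorphic_on unit_disc" "taylor_coeff h n = taylor_coeff f n"
  using taylor_coeff_unique[of "taylor_coeff f" h] taylor_coeff_sums[OF assms(1)] assms(2) by auto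

lemma taylor_coeff_diff:
  assumes "f holomorphic_on unit_disc" "h holomorphic_on unit_disc"
  shows "taylor_coeff (\<lambda>z. f z - h z) n = taylor_coeff f n - taylor_coeff h n"
proof (rule taylor_coeff_unique(2))
  fix z :: complex assume "z \<in> unit_disc"
  from sums_diff[OF taylor_coeff_sums[OF assms(1) this] taylor_coeff_sums[OF assms(2) this]]
  show "(\<lambda>n. (taylor_coeff f n - taylor_coeff h n) * z ^ n) sums (f z - h z)" by (simp add: left_diff_distrib)
qed

lemma taylor_coeff_add:
  assumes "f holomorphic_on unit_disc" "h holomorphic_on unit_disc"
  shows "taylor_coeff (\<lambda>z. f z + h z) n = taylor_coeff f n + taylor_coeff h n"
proof (rule taylor_coeff_unique(2))
  fix z :: complex assume "z \<in> unit_disc"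
  from sums_add[OF taylor_coeff_sums[OF assms(1) this] taylor_coeff_sums[OF assms(2) this]]
  show "(\<lambda>n. (taylor_coeff f n + taylor_coeff h n) * z ^ n) sums (f z + h z)" by (simp add: distrib_right)
qed

lemma taylor_coeff_cmult:
  assumes "f holomorphic_on unit_disc"
  shows "taylor_coeff (\<lambda>z. c * f z) n = c * taylor_coeff f n"
proof (rule taylor_coeff_unique(2))
  fix z :: complex assume "z \<in> unit_disc"
  from sums_mult[OF taylor_coeff_sums[OF assms(1) this], of c]
  show "(\<lambda>n. c * taylor_coeff f n * z ^ n) sums (c * f z)" by (simp add: mult.assoc)
qed

lemma taylor_coeff_eq_imp_eq:
  assumes "f holomorphic_on unit_disc" "h holomorphic_on unit_disc" "\<And>n. taylor_coeff f n = taylor_coeff h n" "z \<in> unit_disc"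
  shows "f z = h z"
  using taylor_coeff_sums[OF assms(1,4)] taylor_coeff_sums[OF assms(2,4)] assms(3) sums_unique2 by auto

lemma has_bochner_integral_power_01:
  "has_bochner_integral lborel (\<lambda>t. indicator {0<..<1} t *\<^sub>R complex_of_real (t ^ n)) (of_real (1 / real (Suc n)))"
proof -
  have "has_bochner_integral lborel (\<lambda>t. t ^ n * indicator {0..1} t) (1 ^ Suc n / real (Suc n) - 0 ^ Suc n / real (Suc n))"
  proof (rule has_bochner_integral_FTC_Icc_real)
    fix x :: real
    show "((\<lambda>t. t ^ Suc n / real (Suc n)) has_real_derivative x ^ n) (at x)"
      by (rule derivative_eq_intros refl | simp)+
    show "isCont (\<lambda>t. t ^ n) x" by (intro continuous_intros)
  qed simp
  then have "has_bochner_integral lborel (\<lambda>t. complex_of_real (t ^ n * indicator {0..1} t)) (of_real (1 / real (Suc n)))"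
    by (intro has_bochner_integral_of_real) simp
  moreover have "AE t in lborel. complex_of_real (t ^ n * indicator {0..1} t) = indicator {0<..<1} t *\<^sub>R complex_of_real (t ^ n)"
    using AE_lborel_singleton[of 0] AE_lborel_singleton[of 1]
    by eventually_elim (auto simp: indicator_def)
  ultimately show ?thesis
    by (subst has_bochner_integral_cong_AE[symmetric]) auto
qed

text \<open>Term by term integration of the kernel, expanded in powers of \<open>t\<close>. Absolute
  summability at \<open>t = 1\<close> gives a majorant that only uses integrability of
  \<open>h\<close>.\<close>

lemma integral_against_power_series:
  fixes h :: "real \<Rightarrow> complex" and b :: "nat \<Rightarrow> complex"
  assumes h: "set_integrable lborel {0<..<1} h" and b: "summable (\<lambda>n. cmod (b n))"
    and G: "\<And>t. t \<in> {0<..<1} \<Longrightarrow> (\<lambda>n. b n * of_real (t ^ n)) sums G t"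
  shows "(\<lambda>n. b n * (LINT t:{0<..<1}|lborel. h t * of_real (t ^ n))) sums (LINT t:{0<..<1}|lborel. h t * G t)"
proof -
  define k where "k t = indicator {0<..<1} t *\<^sub>R h t" for t
  have k: "integrable lborel k" using h by (simp add: k_def[abs_def] set_integrable_def)
  have kn: "integrable lborel (\<lambda>t. k t * of_real (t ^ n))" for n
  proof (rule Bochner_Integration.integrable_bound[OF k])
    have "k \<in> borel_measurable lborel" using k by (rule borel_measurable_integrable)
    then show "(\<lambda>t. k t * of_real (t ^ n)) \<in> borel_measurable lborel" by measurable
    show "AE t in lborel. norm (k t * of_real (t ^ n)) \<le> norm (k t)"
    proof (rule AE_I2)
      fix t
      show "norm (k t * of_real (t ^ n)) \<le> norm (k t)"
        by (cases "t \<in> {0<..<1}") (auto simp: k_def norm_mult norm_power intro!: mult_right_le_one_le power_le_one)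
    qed
  qed
  have bnd: "norm (b n * (k t * of_real (t ^ n))) \<le> cmod (b n) * cmod (k t)" for n t
    by (cases "t \<in> {0<..<1}")
      (auto simp: k_def norm_mult norm_power intro!: mult_left_mono mult_right_le_one_le power_le_one)
  have "(\<lambda>n. \<integral>t. b n * (k t * of_real (t ^ n)) \<partial>lborel) sums (\<integral>t. (\<Sum>n. b n * (k t * of_real (t ^ n))) \<partial>lborel)"
  proof (rule sums_integral)
    show "integrable lborel (\<lambda>t. b n * (k t * of_real (t ^ n)))" for n using kn by simp
    show "AE t in lborel. summable (\<lambda>n. norm (b n * (k t * of_real (t ^ n))))"
    proof (rule AE_I2)
      fix t
      show "summable (\<lambda>n. norm (b n * (k t * of_real (t ^ n))))"
        by (rule summable_comparison_test'[OF summable_mult2[OF b, of "cmod (k t)"], of 0]) (use bnd in simp)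
    qed
    show "summable (\<lambda>n. \<integral>t. norm (b n * (k t * of_real (t ^ n))) \<partial>lborel)"
    proof (rule summable_comparison_test'[OF summable_mult2[OF b, of "\<integral>t. cmod (k t) \<partial>lborel"], of 0])
      fix n
      have "(\<integral>t. norm (b n * (k t * of_real (t ^ n))) \<partial>lborel) \<le> (\<integral>t. cmod (b n) * cmod (k t) \<partial>lborel)"
        using kn k by (intro integral_mono bnd integrable_norm integrable_mult_right) auto
      then show "norm (\<integral>t. norm (b n * (k t * of_real (t ^ n))) \<partial>lborel) \<le> cmod (b n) * (\<integral>t. cmod (k t) \<partial>lborel)"
        by simp
    qed
  qed
  moreover have "(\<Sum>n. b n * (k t * of_real (t ^ n))) = indicator {0<..<1} t *\<^sub>R (h t * G t)" for t
  proof (cases "t \<in> {0<..<1}")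
    case True
    from sums_mult[OF G[OF True], of "h t"] show ?thesis
      using True by (simp add: k_def sums_iff mult_ac)
  qed (simp add: k_def)
  moreover have "(\<integral>t. b n * (k t * of_real (t ^ n)) \<partial>lborel) = b n * (LINT t:{0<..<1}|lborel. h t * of_real (t ^ n))" for n
  proof -
    have "(\<integral>t. b n * (k t * of_real (t ^ n)) \<partial>lborel) = b n * (\<integral>t. k t * of_real (t ^ n) \<partial>lborel)"
      by (rule integral_mult_right_zero)
    then show ?thesis by (simp add: set_lebesgue_integral_def k_def)
  qed
  ultimately show ?thesis by (simp only: set_lebesgue_integral_def)
qed

text \<open>The series of f may diverge at the end point 1. The hypothesis says exactly that the
  integrals of the moduli of its terms over the radius are summable, which yields both integrability
  and integration term by term.\<close>

lemma power_series_integrable: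
  fixes a :: "nat \<Rightarrow> complex"
  assumes a: "summable (\<lambda>k. cmod (a k) / real (Suc k))"
    and f: "\<And>t. t \<in> {0<..<1} \<Longrightarrow> summable (\<lambda>k. cmod (a k) * t ^ k)" "\<And>t. t \<in> {0<..<1} \<Longrightarrow> (\<lambda>k. a k * of_real (t ^ k)) sums f t"
  shows "set_integrable lborel {0<..<1} f"
    and "(\<lambda>k. a k / of_nat (Suc (n + k))) sums (LINT t:{0<..<1}|lborel. f t * of_real (t ^ n))"
proof -
  have main: "integrable lborel (\<lambda>t. \<Sum>k. a k * (indicator {0<..<1} t *\<^sub>R of_real (t ^ (n + k)))) \<and>
    (\<lambda>k. a k / of_nat (Suc (n + k))) sums (\<integral>t. (\<Sum>k. a k * (indicator {0<..<1} t *\<^sub>R of_real (t ^ (n + k)))) \<partial>lborel)" for n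
  proof -
    let ?u = "\<lambda>k t. a k * (indicator {0<..<1} t *\<^sub>R of_real (t ^ (n + k)))"
    have u: "has_bochner_integral lborel (?u k) (a k * of_real (1 / real (Suc (n + k))))" for k
      by (rule has_bochner_integral_mult_right[OF has_bochner_integral_power_01])
    have nu: "(\<integral>t. norm (?u k t) \<partial>lborel) = cmod (a k) / real (Suc (n + k))" for k
    proof -
      have "norm (?u k t) = cmod (a k) * Re (indicator {0<..<1} t *\<^sub>R of_real (t ^ (n + k)))" for t
        by (cases "t \<in> {0<..<1}") (auto simp: norm_mult norm_power)
      then have "(\<lambda>t. norm (?u k t)) = (\<lambda>t. cmod (a k) * Re (indicator {0<..<1} t *\<^sub>R of_real (t ^ (n + k))))"
        by (rule ext)
      then have "(\<integral>t. norm (?u k t) \<partial>lborel) = (\<integral>t. cmod (a k) * Re (indicator {0<..<1} t *\<^sub>R of_real (t ^ (n + k))) \<partial>lborel)"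
        by (rule arg_cong)
      also have "\<dots> = cmod (a k) * (\<integral>t. Re (indicator {0<..<1} t *\<^sub>R of_real (t ^ (n + k))) \<partial>lborel)"
        by (rule integral_mult_right_zero)
      also have "(\<integral>t. Re (indicator {0<..<1} t *\<^sub>R of_real (t ^ (n + k))) \<partial>lborel) = Re (of_real (1 / real (Suc (n + k))))"
        using has_bochner_integral_power_01[of "n + k"]
        by (subst integral_Re) (simp_all add: has_bochner_integral_iff)
      finally show ?thesis by simp
    qed
    have i1: "integrable lborel (?u k)" for k using u[of k] unfolding has_bochner_integral_iff by blast
    have i2: "AE t in lborel. summable (\<lambda>k. norm (?u k t))"
    proof (rule AE_I2)
      fix t
      show "summable (\<lambda>k. norm (?u k t))"
      proof (cases "t \<in> {0<..<1}")
        case True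
        have "summable (\<lambda>k. t ^ n * (cmod (a k) * t ^ k))" by (rule summable_mult[OF f(1)[OF True]])
        then show ?thesis using True by (simp add: norm_mult norm_power power_add mult_ac)
      qed simp
    qed
    have i3: "summable (\<lambda>k. \<integral>t. norm (?u k t) \<partial>lborel)"
      unfolding nu
    proof (rule summable_comparison_test'[OF a, of 0])
      fix k
      show "norm (cmod (a k) / real (Suc (n + k))) \<le> cmod (a k) / real (Suc k)"
        by (simp add: divide_left_mono)
    qed
    have "(\<lambda>k. \<integral>t. ?u k t \<partial>lborel) sums (\<integral>t. (\<Sum>k. ?u k t) \<partial>lborel)"
      by (rule sums_integral[OF i1 i2 i3])
    moreover have "(\<integral>t. ?u k t \<partial>lborel) = a k / of_nat (Suc (n + k))" for k
      using has_bochner_integral_integral_eq[OF u[of k]] by (simp del: of_nat_Suc)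
    moreover have "integrable lborel (\<lambda>t. \<Sum>k. ?u k t)"
      by (rule integrable_suminf[OF i1 i2 i3])
    ultimately show ?thesis by (simp only:)
  qed
  have eq: "(\<Sum>k. a k * (indicator {0<..<1} t *\<^sub>R of_real (t ^ (n + k)))) = indicator {0<..<1} t *\<^sub>R (f t * of_real (t ^ n))" for n and t :: real
  proof (cases "t \<in> {0<..<1}")
    case True
    from sums_mult[OF f(2)[OF True], of "of_real (t ^ n)"] show ?thesis
      using True by (simp add: sums_iff power_add mult_ac)
  qed simp
  show "set_integrable lborel {0<..<1} f"
    using conjunct1[OF main[of 0]] unfolding eq set_integrable_def by simp
  show "(\<lambda>k. a k / of_nat (Suc (n + k))) sums (LINT t:{0<..<1}|lborel. f t * of_real (t ^ n))"
    using conjunct2[OF main[of n]] unfolding eq set_lebesgue_integral_def .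
qed

section \<open>The Dirichlet space in coordinates and the matrix of the operator\<close>

locale dirichlet_setting =
  radial_density v \<phi> + hilbert_matrix "radial_density.w \<phi>" W c C q "taylor_coeff (deriv g)"
  for v \<phi> W c C q and g :: "complex \<Rightarrow> complex" +
  assumes g: "g holomorphic_on unit_disc"
begin

text \<open>Coordinates with respect to the normalized monomials. \<open>Phi\<close> is an isometry
  and \<open>Psi\<close> a right inverse; values outside the disc are forgotten, so equal images
  mean equality on the disc only.\<close>

definition Phi :: "(complex \<Rightarrow> complex) \<Rightarrow> ell2" where
  "Phi f = Ell2 (\<lambda>n. of_real (sqrt (w n)) * taylor_coeff f n)"

definition Psi :: "ell2 \<Rightarrow> complex \<Rightarrow> complex" where
  "Psi u z = (\<Sum>n. cf u n / of_real (sqrt (w n)) * z ^ n)"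

abbreviation "\<D> \<equiv> dirichlet_space v"
abbreviation "T \<equiv> hilbert_op g"

lemma w_nonneg: "w n \<ge> 0"
  using w_pos[of n] by simp

lemma cmod_weighted: "(cmod (of_real (sqrt (w n)) * x))\<^sup>2 = (cmod x)\<^sup>2 * w n"
  using w_nonneg[of n] by (simp add: norm_mult power_mult_distrib)

lemma dirichlet_norm_summable:
  assumes "f holomorphic_on unit_disc" "summable (\<lambda>n. (cmod (taylor_coeff f n))\<^sup>2 * w n)"
  shows "dirichlet_norm v f = ennreal (sqrt (\<Sum>n. (cmod (taylor_coeff f n))\<^sup>2 * w n))"
proof -
  have nn: "(\<Sum>n. (cmod (taylor_coeff f n))\<^sup>2 * w n) \<ge> 0" by (rule suminf_nonneg[OF assms(2)]) (use w_nonneg in simp)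
  have "(\<Sum>n. ennreal ((cmod (taylor_coeff f n))\<^sup>2 * w n)) = ennreal (\<Sum>n. (cmod (taylor_coeff f n))\<^sup>2 * w n)"
    by (rule suminf_ennreal2[OF _ assms(2)]) (use w_nonneg in simp)
  then show ?thesis unfolding dirichlet_norm_eq[OF assms(1)] using nn
    by (simp add: epowr_def powr_half_sqrt)
qed

lemma in_D_iff: "f \<in> \<D> \<longleftrightarrow> f holomorphic_on unit_disc \<and> summable (\<lambda>n. (cmod (taylor_coeff f n))\<^sup>2 * w n)"
proof (cases "f holomorphic_on unit_disc")
  case True
  have "summable (\<lambda>n. (cmod (taylor_coeff f n))\<^sup>2 * w n)" if "dirichlet_norm v f < \<infinity>"
  proof (rule summable_suminf_not_top)
    show "(\<Sum>n. ennreal ((cmod (taylor_coeff f n))\<^sup>2 * w n)) \<noteq> top"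
      using that unfolding dirichlet_norm_eq[OF True] by (auto simp: epowr_def)
  qed (use w_nonneg in simp)
  then show ?thesis using True dirichlet_norm_summable[OF True] by (auto simp: dirichlet_space_def)
qed (simp add: dirichlet_space_def)

lemma D_holo: "f \<in> \<D> \<Longrightarrow> f holomorphic_on unit_disc"
  by (simp add: in_D_iff)

lemma cf_Phi: "f \<in> \<D> \<Longrightarrow> cf (Phi f) n = of_real (sqrt (w n)) * taylor_coeff f n"
  unfolding Phi_def by (subst cf_Ell2) (simp_all only: cmod_weighted in_D_iff)

lemma norm_Phi: "f \<in> \<D> \<Longrightarrow> dirichlet_norm v f = ennreal (norm (Phi f))"
proof -
  assume f: "f \<in> \<D>"
  have "(norm (Phi f))\<^sup>2 = (\<Sum>n. (cmod (taylor_coeff f n))\<^sup>2 * w n)"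
    using sums_norm_ell2[of "Phi f"] unfolding cf_Phi[OF f] cmod_weighted by (simp add: sums_iff)
  then have "norm (Phi f) = sqrt (\<Sum>n. (cmod (taylor_coeff f n))\<^sup>2 * w n)"
    by (metis norm_ge_zero real_sqrt_unique)
  then show ?thesis using f dirichlet_norm_summable by (simp add: in_D_iff)
qed

text \<open>The pairing of square-summable sequences with \<open>kernel 0\<close>. It yields
  convergence of the series \<open>Psi u\<close> in the disc as well as integrability of functions
  in the space along the radius.\<close>

lemma kernel_summable: "summable (\<lambda>n. cmod (cf u n / of_real (sqrt (w n))) / real (Suc n))"
proof -
  have "summable (\<lambda>n. cmod (cf u n) * cmod (cf (kernel 0) n))"
    by (rule sq_summable_prod[OF summable_cf summable_cf])
  then show ?thesis unfolding cf_kernel using w_nonneg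
    by (simp add: norm_divide norm_mult del: of_nat_Suc)
qed

text \<open>Summability of the coefficients divided by \<open>Suc n\<close> makes them grow at most
  linearly, which is enough inside the disc.\<close>

lemma Psi_sums:
  assumes z: "z \<in> unit_disc"
  shows "(\<lambda>n. cf u n / of_real (sqrt (w n)) * z ^ n) sums Psi u z"
proof -
  let ?a = "\<lambda>n. cf u n / of_real (sqrt (w n))"
  have r: "0 \<le> cmod z" "cmod z < 1" using z by auto
  define S where "S = (\<Sum>n. cmod (?a n) / real (Suc n))"
  have aS: "cmod (?a n) \<le> S * real (Suc n)" for n
  proof -
    have "cmod (?a n) / real (Suc n) \<le> S"
      using sum_le_suminf[OF kernel_summable, of "{n}" u] by (simp add: S_def)
    then show ?thesis by (simp add: divide_le_eq del: of_nat_Suc)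
  qed
  have "summable (\<lambda>n. ?a n * z ^ n)"
  proof (rule summable_comparison_test'[OF summable_mult[OF summable_linear_power[OF r], of S], of 0])
    fix n
    have "norm (?a n * z ^ n) = cmod (?a n) * cmod z ^ n" by (simp only: norm_mult norm_power)
    also have "\<dots> \<le> (S * real (Suc n)) * cmod z ^ n" by (intro mult_right_mono aS) simp
    finally show "norm (?a n * z ^ n) \<le> S * (real (Suc n) * cmod z ^ n)" by (simp only: mult.assoc)
  qed
  then show ?thesis unfolding Psi_def by (rule summable_sums)
qed

lemma Psi_holo: "Psi u holomorphic_on unit_disc"
  by (rule taylor_coeff_unique(1)[OF Psi_sums])

lemma taylor_coeff_Psi: "taylor_coeff (Psi u) n = cf u n / of_real (sqrt (w n))"
  by (rule taylor_coeff_unique(2)[OF Psi_sums])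

lemma Psi_in_D: "Psi u \<in> \<D>"
proof -
  have "(cmod (taylor_coeff (Psi u) n))\<^sup>2 * w n = (cmod (cf u n))\<^sup>2" for n
    using w_pos[of n] by (simp add: taylor_coeff_Psi norm_divide power_divide)
  then show ?thesis using summable_cf[of u] by (simp add: in_D_iff Psi_holo)
qed

lemma Phi_Psi: "Phi (Psi u) = u"
proof (rule ell2_eqI)
  show "cf (Phi (Psi u)) n = cf u n" for n
    using w_pos[of n] by (simp add: cf_Phi[OF Psi_in_D] taylor_coeff_Psi)
qed

lemma Phi_eq_imp_eq:
  assumes "f \<in> \<D>" "h \<in> \<D>" "Phi f = Phi h" "z \<in> unit_disc"
  shows "f z = h z"
proof (rule taylor_coeff_eq_imp_eq[OF D_holo[OF assms(1)] D_holo[OF assms(2)] _ assms(4)])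
  fix n
  have "of_real (sqrt (w n)) * taylor_coeff f n = of_real (sqrt (w n)) * taylor_coeff h n"
    using assms(3) by (simp flip: cf_Phi[OF assms(1)] cf_Phi[OF assms(2)])
  then show "taylor_coeff f n = taylor_coeff h n" using w_pos[of n] by simp
qed

lemma D_I:
  assumes "f holomorphic_on unit_disc" "\<And>n. of_real (sqrt (w n)) * taylor_coeff f n = cf u n"
  shows "f \<in> \<D>" "Phi f = u"
proof -
  have "(cmod (taylor_coeff f n))\<^sup>2 * w n = (cmod (cf u n))\<^sup>2" for n
    unfolding cmod_weighted[symmetric] assms(2) ..
  then show f: "f \<in> \<D>" using assms(1) summable_cf[of u] by (simp add: in_D_iff)
  show "Phi f = u" by (rule ell2_eqI) (simp add: cf_Phi[OF f] assms(2))
qed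

lemma D_add:
  assumes "f \<in> \<D>" "h \<in> \<D>"
  shows "(\<lambda>z. f z + h z) \<in> \<D>" "Phi (\<lambda>z. f z + h z) = Phi f + Phi h"
proof -
  have 1: "(\<lambda>z. f z + h z) holomorphic_on unit_disc" using assms by (intro holomorphic_intros D_holo)
  have 2: "of_real (sqrt (w n)) * taylor_coeff (\<lambda>z. f z + h z) n = cf (Phi f + Phi h) n" for n
    using assms by (simp add: taylor_coeff_add D_holo cf_Phi distrib_left)
  show "(\<lambda>z. f z + h z) \<in> \<D>" "Phi (\<lambda>z. f z + h z) = Phi f + Phi h" by (rule D_I[OF 1 2])+
qed

lemma D_diff:
  assumes "f \<in> \<D>" "h \<in> \<D>"
  shows "(\<lambda>z. f z - h z) \<in> \<D>" "Phi (\<lambda>z. f z - h z) = Phi f - Phi h"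
proof -
  have 1: "(\<lambda>z. f z - h z) holomorphic_on unit_disc" using assms by (intro holomorphic_intros D_holo)
  have 2: "of_real (sqrt (w n)) * taylor_coeff (\<lambda>z. f z - h z) n = cf (Phi f - Phi h) n" for n
    using assms by (simp add: taylor_coeff_diff D_holo cf_Phi right_diff_distrib)
  show "(\<lambda>z. f z - h z) \<in> \<D>" "Phi (\<lambda>z. f z - h z) = Phi f - Phi h" by (rule D_I[OF 1 2])+
qed

lemma D_cmult:
  assumes "f \<in> \<D>"
  shows "(\<lambda>z. a * f z) \<in> \<D>" "Phi (\<lambda>z. a * f z) = cscale a (Phi f)"
proof -
  have 1: "(\<lambda>z. a * f z) holomorphic_on unit_disc" using assms by (intro holomorphic_intros D_holo)
  have 2: "of_real (sqrt (w n)) * taylor_coeff (\<lambda>z. a * f z) n = cf (cscale a (Phi f)) n" for n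
    using assms by (simp add: taylor_coeff_cmult D_holo cf_Phi)
  show "(\<lambda>z. a * f z) \<in> \<D>" "Phi (\<lambda>z. a * f z) = cscale a (Phi f)" by (rule D_I[OF 1 2])+
qed

lemma deriv_continuous: "f holomorphic_on unit_disc \<Longrightarrow> continuous_on unit_disc (deriv f)"
  by (intro holomorphic_on_imp_continuous_on holomorphic_deriv) auto

definition energy :: "(complex \<Rightarrow> complex) \<Rightarrow> real" where
  "energy f = (\<integral>z. (cmod (deriv f z))\<^sup>2 * v z \<partial>area_measure)"

lemma measurable_area:
  fixes h :: "complex \<Rightarrow> 'a :: euclidean_space"
  assumes "continuous_on unit_disc h" shows "h \<in> borel_measurable area_measure"
proof -
  have "h \<in> borel_measurable (lebesgue_on unit_disc)"
    by (rule continuous_imp_measurable_on_sets_lebesgue[OF assms]) simp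
  then show ?thesis by (simp add: measurable_def sets_area_measure space_area_measure)
qed

lemma v_measurable_area: "v \<in> borel_measurable area_measure"
  using v by (auto simp: radial_weight_def dest: borel_measurable_integrable)

lemma energy_D:
  assumes f: "f \<in> \<D>"
  shows "integrable area_measure (\<lambda>z. (cmod (deriv f z))\<^sup>2 * v z)"
    and "(cmod (f 0))\<^sup>2 + energy f = (norm (Phi f))\<^sup>2"
proof -
  let ?I = "\<integral>\<^sup>+z. ennreal ((cmod (deriv f z))\<^sup>2 * v z) \<partial>area_measure"
  have c: "continuous_on unit_disc (\<lambda>z. (cmod (deriv f z))\<^sup>2)"
    using deriv_continuous[OF D_holo[OF f]] by (intro continuous_intros)
  have meas: "(\<lambda>z. (cmod (deriv f z))\<^sup>2 * v z) \<in> borel_measurable area_measure"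
    by (rule borel_measurable_times[OF measurable_area[OF c] v_measurable_area])
  have nn: "AE z in area_measure. 0 \<le> (cmod (deriv f z))\<^sup>2 * v z"
  proof (rule AE_I2)
    fix z assume "z \<in> space area_measure"
    then have "v z > 0" using v unfolding radial_weight_def space_area_measure by blast
    then show "0 \<le> (cmod (deriv f z))\<^sup>2 * v z" by simp
  qed
  have N: "dirichlet_norm v f = ennreal (norm (Phi f))" by (rule norm_Phi[OF f])
  have "ennreal ((cmod (f 0))\<^sup>2) + ?I \<noteq> \<infinity>"
    using N unfolding dirichlet_norm_def by (auto simp: epowr_def)
  then have fin: "?I < \<infinity>" by (auto simp: less_top)
  show int: "integrable area_measure (\<lambda>z. (cmod (deriv f z))\<^sup>2 * v z)"
    by (rule integrableI_nonneg[OF meas nn fin])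
  have I: "?I = ennreal (energy f)" unfolding energy_def by (rule nn_integral_eq_integral[OF int nn])
  have E0: "energy f \<ge> 0" unfolding energy_def by (rule integral_nonneg_AE[OF nn])
  have "epowr (ennreal ((cmod (f 0))\<^sup>2 + energy f)) (1/2) = ennreal (norm (Phi f))"
    using N unfolding dirichlet_norm_def I ennreal_plus[OF zero_le_power2 E0, symmetric] .
  then have "sqrt ((cmod (f 0))\<^sup>2 + energy f) = norm (Phi f)"
    using add_nonneg_nonneg[OF zero_le_power2 E0] by (simp add: epowr_def powr_half_sqrt del: ennreal_plus)
  then show "(cmod (f 0))\<^sup>2 + energy f = (norm (Phi f))\<^sup>2"
    using E0 by (metis add_nonneg_nonneg real_sqrt_pow2 zero_le_power2)
qed

lemma polarization_complex:
  fixes a b :: complex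
  shows "4 * (a * cnj b) = of_real ((cmod (a + b))\<^sup>2) - of_real ((cmod (a - b))\<^sup>2)
    + \<i> * of_real ((cmod (a + \<i> * b))\<^sup>2) - \<i> * of_real ((cmod (a - \<i> * b))\<^sup>2)"
  unfolding complex_norm_square by (simp add: algebra_simps)

lemma polarization_cinner:
  "4 * cinner a b = of_real ((norm (a + b))\<^sup>2) - of_real ((norm (a - b))\<^sup>2)
    + \<i> * of_real ((norm (a + cscale \<i> b))\<^sup>2) - \<i> * of_real ((norm (a - cscale \<i> b))\<^sup>2)"
  unfolding cinner_self[symmetric] cinner_add_left cinner_add_right cinner_diff_left cinner_diff_right
    cinner_cscale_left cinner_cscale_right
  by (simp add: algebra_simps)

lemma deriv_lin:
  assumes "f \<in> \<D>" "h \<in> \<D>" "z \<in> unit_disc"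
  shows "deriv (\<lambda>z. f z + h z) z = deriv f z + deriv h z" "deriv (\<lambda>z. f z - h z) z = deriv f z - deriv h z"
    "deriv (\<lambda>z. a * h z) z = a * deriv h z"
  using D_holo[OF assms(1)] D_holo[OF assms(2)] assms(3)
  by (auto simp: holomorphic_on_imp_differentiable_at[of _ unit_disc])

text \<open>The norms agree on both sides, and polarization carries this over to inner products. The
  mixed integrand is a combination of four energy densities that are already known to be
  integrable.\<close>

lemma dirichlet_inner_Phi:
  assumes f: "f \<in> \<D>" and h: "h \<in> \<D>"
  shows "dirichlet_inner v f h = cinner (Phi f) (Phi h)"
proof -
  note ih = D_cmult(1)[OF h, of \<i>]
  let ?p = "\<lambda>z. f z + h z" and ?m = "\<lambda>z. f z - h z" and ?q = "\<lambda>z. f z + \<i> * h z" and ?r = "\<lambda>z. f z - \<i> * h z"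
  note D4 = D_add(1)[OF f h] D_diff(1)[OF f h] D_add(1)[OF f ih] D_diff(1)[OF f ih]
  let ?e = "\<lambda>f z. complex_of_real ((cmod (deriv f z))\<^sup>2 * v z)"
  have int: "integrable area_measure (?e k)" "(\<integral>z. ?e k z \<partial>area_measure) = of_real (energy k)" if "k \<in> \<D>" for k
    using energy_D(1)[OF that] unfolding energy_def integral_complex_of_real by (auto simp del: of_real_mult of_real_power)
  have pt: "deriv f z * cnj (deriv h z) * of_real (v z) = (?e ?p z - ?e ?m z + \<i> * ?e ?q z - \<i> * ?e ?r z) / 4"
    if z: "z \<in> unit_disc" for z
  proof -
    have d: "deriv ?p z = deriv f z + deriv h z" "deriv ?m z = deriv f z - deriv h z"
      "deriv ?q z = deriv f z + \<i> * deriv h z" "deriv ?r z = deriv f z - \<i> * deriv h z"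
      using deriv_lin(1,2)[OF f h z] deriv_lin(1,2)[OF f ih z] deriv_lin(3)[OF f h z, of \<i>] by auto
    have "4 * (deriv f z * cnj (deriv h z) * of_real (v z)) = (4 * (deriv f z * cnj (deriv h z))) * of_real (v z)"
      by (simp only: mult.assoc)
    also have "\<dots> = ?e ?p z - ?e ?m z + \<i> * ?e ?q z - \<i> * ?e ?r z"
      unfolding polarization_complex d of_real_mult
      by (simp only: left_diff_distrib distrib_right mult.assoc)
    finally have "4 * (deriv f z * cnj (deriv h z) * of_real (v z)) = ?e ?p z - ?e ?m z + \<i> * ?e ?q z - \<i> * ?e ?r z" .
    moreover have "x = y / 4" if "4 * x = y" for x y :: complex using that by (simp add: mult.commute eq_divide_eq)
    ultimately show ?thesis by blast
  qed
  have "(\<integral>z. deriv f z * cnj (deriv h z) * of_real (v z) \<partial>area_measure) =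
      (\<integral>z. (?e ?p z - ?e ?m z + \<i> * ?e ?q z - \<i> * ?e ?r z) / 4 \<partial>area_measure)"
    by (rule Bochner_Integration.integral_cong[OF refl]) (use pt in \<open>simp only: space_area_measure\<close>)
  also have "\<dots> = (of_real (energy ?p) - of_real (energy ?m) + \<i> * of_real (energy ?q) - \<i> * of_real (energy ?r)) / 4"
    using int[OF D4(1)] int[OF D4(2)] int[OF D4(3)] int[OF D4(4)]
    by (simp only: integral_divide_zero Bochner_Integration.integral_diff Bochner_Integration.integral_add
        Bochner_Integration.integrable_diff Bochner_Integration.integrable_add integrable_mult_right integral_mult_right_zero)
  finally have I0: "(\<integral>z. deriv f z * cnj (deriv h z) * of_real (v z) \<partial>area_measure) =
      (of_real (energy ?p) - of_real (energy ?m) + \<i> * of_real (energy ?q) - \<i> * of_real (energy ?r)) / 4" .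
  have times4: "4 * x = y" if "x = y / 4" for x y :: complex using that by (simp add: mult.commute)
  have I: "4 * (\<integral>z. deriv f z * cnj (deriv h z) * of_real (v z) \<partial>area_measure) =
      of_real (energy ?p) - of_real (energy ?m) + \<i> * of_real (energy ?q) - \<i> * of_real (energy ?r)"
    by (rule times4[OF I0])
  have e: "complex_of_real ((norm (Phi k))\<^sup>2) = of_real ((cmod (k 0))\<^sup>2) + of_real (energy k)" if "k \<in> \<D>" for k
    unfolding energy_D(2)[OF that, symmetric] by (rule of_real_add)
  have P: "Phi ?p = Phi f + Phi h" "Phi ?m = Phi f - Phi h" "Phi ?q = Phi f + cscale \<i> (Phi h)" "Phi ?r = Phi f - cscale \<i> (Phi h)"
    using D_add(2)[OF f h] D_diff(2)[OF f h] D_add(2)[OF f ih] D_diff(2)[OF f ih] D_cmult(2)[OF h, of \<i>] by simp_all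
  have fin: "4 * cinner (Phi f) (Phi h) = 4 * (f 0 * cnj (h 0)) + 4 * (\<integral>z. deriv f z * cnj (deriv h z) * of_real (v z) \<partial>area_measure)"
    unfolding polarization_cinner P[symmetric] e[OF D4(1)] e[OF D4(2)] e[OF D4(3)] e[OF D4(4)] I polarization_complex
    by (simp add: algebra_simps)
  have cancel: "x + y = z" if "4 * z = 4 * x + 4 * y" for x y z :: complex
  proof -
    have "4 * z = 4 * (x + y)" unfolding that by (rule distrib_left[symmetric])
    then show ?thesis by (simp only: mult_cancel_left) simp
  qed
  show ?thesis unfolding dirichlet_inner_def by (rule cancel[OF fin])
qed

text \<open>Expanding g'(tz) inside the integral, the \<open>n\<close>-th coefficient of the image
  is that of g' times the integral of f(t) t^n, and this integral is the pairing of
  \<open>Phi f\<close> with \<open>kernel n\<close>.\<close>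

lemma hilbert_op_sums:
  assumes f: "f \<in> \<D>" and z: "z \<in> unit_disc"
  shows "(\<lambda>n. taylor_coeff (deriv g) n * cinner (Phi f) (kernel n) * z ^ n) sums T f z"
proof -
  have fh: "f holomorphic_on unit_disc" by (rule D_holo[OF f])
  have a: "summable (\<lambda>k. cmod (taylor_coeff f k) / real (Suc k))"
  proof -
    have "cf (Phi f) k / of_real (sqrt (w k)) = taylor_coeff f k" for k using w_pos[of k] by (simp add: cf_Phi[OF f])
    then show ?thesis using kernel_summable[of "Phi f"] by simp
  qed
  have s1: "summable (\<lambda>k. cmod (taylor_coeff f k) * t ^ k)" if "t \<in> {0<..<1}" for t
    using taylor_coeff_summable[OF fh] that by auto
  have s2: "(\<lambda>k. taylor_coeff f k * of_real (t ^ k)) sums f (of_real t)" if "t \<in> {0<..<1}" for t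
    using taylor_coeff_sums[OF fh, of "of_real t"] that by simp
  note I = power_series_integrable[OF a s1 s2]
  have L: "(LINT t:{0<..<1}|lborel. f (of_real t) * of_real (t ^ n)) = cinner (Phi f) (kernel n)" for n
  proof -
    have "cf (Phi f) k * cnj (cf (kernel n) k) = taylor_coeff f k / of_nat (Suc (n + k))" for k
      using w_pos[of k] by (simp add: cf_Phi[OF f] cf_kernel del: of_nat_Suc)
    then show ?thesis using sums_unique[OF I(2)[of n]] by (simp add: cinner_def)
  qed
  have dg: "deriv g holomorphic_on unit_disc" using g by (intro holomorphic_deriv) auto
  have "(\<lambda>n. (taylor_coeff (deriv g) n * z ^ n) * (LINT t:{0<..<1}|lborel. f (of_real t) * of_real (t ^ n))) sums
      (LINT t:{0<..<1}|lborel. f (of_real t) * deriv g (of_real t * z))"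
  proof (rule integral_against_power_series[OF I(1)])
    show "summable (\<lambda>n. cmod (taylor_coeff (deriv g) n * z ^ n))"
      using taylor_coeff_summable[OF dg, of "cmod z"] z by (simp add: norm_mult norm_power)
    fix t :: real assume t: "t \<in> {0<..<1}"
    have "cmod (of_real t * z) < 1"
      using t z mult_left_le_one_le[of "cmod z" t] by (auto simp: norm_mult)
    then have "of_real t * z \<in> unit_disc" by simp
    from taylor_coeff_sums[OF dg this]
    show "(\<lambda>n. taylor_coeff (deriv g) n * z ^ n * of_real (t ^ n)) sums deriv g (of_real t * z)"
      by (simp add: power_mult_distrib mult_ac)
  qed
  then show ?thesis unfolding L hilbert_op_def by (simp add: mult_ac)
qed

lemma T_holo: "f \<in> \<D> \<Longrightarrow> T f holomorphic_on unit_disc"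
  by (rule taylor_coeff_unique(1)[OF hilbert_op_sums])

lemma taylor_coeff_T: "f \<in> \<D> \<Longrightarrow> of_real (sqrt (w n)) * taylor_coeff (T f) n = M (Phi f) n"
  using taylor_coeff_unique(2)[OF hilbert_op_sums, of f n] by (simp add: M_def mult_ac)

lemma T_in_D_iff: "f \<in> \<D> \<Longrightarrow> T f \<in> \<D> \<longleftrightarrow> summable (\<lambda>n. (cmod (M (Phi f) n))\<^sup>2)"
  by (simp add: in_D_iff T_holo flip: cmod_weighted taylor_coeff_T)

lemma Phi_T: "f \<in> \<D> \<Longrightarrow> T f \<in> \<D> \<Longrightarrow> Phi (T f) = S (Phi f)"
  by (simp add: Phi_def[of "T f"] S_def taylor_coeff_T)

lemma total_iff: "total \<longleftrightarrow> (\<forall>f\<in>\<D>. T f \<in> \<D>)"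
proof
  assume "\<forall>f\<in>\<D>. T f \<in> \<D>"
  then show total unfolding total_def using T_in_D_iff[OF Psi_in_D] Psi_in_D by (simp add: Phi_Psi)
qed (simp add: T_in_D_iff total_def)

lemma linear_T:
  assumes total
  shows "linear_operator v T"
  unfolding linear_operator_def
proof (intro conjI ballI allI)
  have TD: "T f \<in> \<D>" if "f \<in> \<D>" for f using assms that by (simp add: total_iff)
  show "T f \<in> \<D>" if "f \<in> \<D>" for f by (rule TD[OF that])
  show "T (\<lambda>w. f w + h w) z = T f z + T h z" if f: "f \<in> \<D>" and h: "h \<in> \<D>" and z: "z \<in> unit_disc" for f h z
    using hilbert_op_sums[OF D_add(1)[OF f h] z] sums_add[OF hilbert_op_sums[OF f z] hilbert_op_sums[OF h z]]
    by (simp add: D_add(2)[OF f h] cinner_add_left algebra_simps sums_iff)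
  show "T (\<lambda>w. a * f w) z = a * T f z" if f: "f \<in> \<D>" and z: "z \<in> unit_disc" for a f z
    using hilbert_op_sums[OF D_cmult(1)[OF f, of a] z] sums_mult[OF hilbert_op_sums[OF f z], of a]
    by (simp add: D_cmult(2)[OF f] cinner_cscale_left mult_ac sums_iff)
qed

end

section \<open>Transfer of the Schatten norms\<close>

text \<open>The index set may be uncountable. The bound on finite sums makes each level set
  \<open>f s > 1 / (n + 1)\<close> finite, and the integral is the increasing limit of the sums over
  these sets.\<close>

lemma nn_integral_count_space_le:
  fixes f :: "'a \<Rightarrow> ennreal"
  assumes B: "\<And>F. finite F \<Longrightarrow> F \<subseteq> X \<Longrightarrow> sum f F \<le> ennreal b"
  shows "(\<integral>\<^sup>+s. f s \<partial>count_space X) \<le> ennreal b"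
proof -
  define Y where "Y n = {s \<in> X. f s > ennreal (1 / real (Suc n))}" for n
  have fin: "finite (Y n)" for n
  proof (rule ccontr)
    assume inf: "infinite (Y n)"
    define N where "N = nat \<lceil>b * real (Suc n)\<rceil> + 1"
    obtain F where F: "F \<subseteq> Y n" "finite F" "card F = N" using infinite_arbitrarily_large[OF inf] by blast
    have "ennreal (real N / real (Suc n)) = (\<Sum>s\<in>F. ennreal (1 / real (Suc n)))"
      by (simp add: F(3) flip: ennreal_of_nat_eq_real_of_nat ennreal_mult' del: of_nat_Suc)
        (simp add: ennreal_of_nat_eq_real_of_nat flip: ennreal_mult' del: of_nat_Suc)
    also have "\<dots> \<le> sum f F" by (rule sum_mono) (use F(1) in \<open>auto simp: Y_def intro: less_imp_le\<close>)
    also have "\<dots> \<le> ennreal b" by (rule B) (use F in \<open>auto simp: Y_def\<close>)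
    finally have "real N / real (Suc n) \<le> b"
      by (subst (asm) ennreal_le_iff2) (auto simp: N_def divide_le_0_iff)
    moreover have "b * real (Suc n) < real N" unfolding N_def by linarith
    ultimately show False by (simp add: field_simps)
  qed
  have Ymono: "Y m \<subseteq> Y n" if "m \<le> n" for m n
  proof -
    have "ennreal (1 / real (Suc n)) \<le> ennreal (1 / real (Suc m))"
      using that by (intro ennreal_leI divide_left_mono) auto
    from le_less_trans[OF this] show ?thesis unfolding Y_def by blast
  qed
  have sup: "(SUP n. f s * indicator (Y n) s) = f s" if s: "s \<in> X" for s
  proof (rule antisym)
    show "(SUP n. f s * indicator (Y n) s) \<le> f s" by (rule SUP_least) (simp add: indicator_def)
    show "f s \<le> (SUP n. f s * indicator (Y n) s)"
    proof (cases "f s = 0")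
      case False
      then have "\<exists>n. ennreal (1 / real (Suc n)) < f s"
      proof (cases "f s")
        case (real r)
        with False obtain n where "inverse (real (Suc n)) < r" using reals_Archimedean[of r] by auto
        then have "ennreal (1 / real (Suc n)) < f s" using real by (simp add: ennreal_less_iff inverse_eq_divide)
        then show ?thesis ..
      qed simp
      then obtain n where "s \<in> Y n" using s by (auto simp: Y_def)
      then show ?thesis by (intro SUP_upper2[of n]) simp_all
    qed simp
  qed
  have "(\<integral>\<^sup>+s. f s \<partial>count_space X) = (\<integral>\<^sup>+s. (SUP n. f s * indicator (Y n) s) \<partial>count_space X)"
    by (rule nn_integral_cong) (simp add: sup)
  also have "\<dots> = (SUP n. \<integral>\<^sup>+s. f s * indicator (Y n) s \<partial>count_space X)"
  proof (rule nn_integral_monotone_convergence_SUP)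
    show "incseq (\<lambda>n s. f s * indicator (Y n) s)"
      unfolding incseq_def le_fun_def
    proof (intro allI impI mult_left_mono)
      fix m n s assume "m \<le> (n :: nat)"
      from Ymono[OF this] show "indicator (Y m) s \<le> (indicator (Y n) s :: ennreal)" by (auto simp: indicator_def)
    qed simp
  qed simp
  also have "\<dots> \<le> ennreal b"
  proof (rule SUP_least)
    fix n
    have "(\<integral>\<^sup>+s. f s * indicator (Y n) s \<partial>count_space X) = (\<Sum>s\<in>Y n. f s * indicator (Y n) s)"
      by (rule nn_integral_count_space'[OF fin]) (auto simp: Y_def)
    also have "\<dots> = sum f (Y n)" by (rule sum.cong) auto
    also have "\<dots> \<le> ennreal b" by (rule B[OF fin]) (auto simp: Y_def)
    finally show "(\<integral>\<^sup>+s. f s * indicator (Y n) s \<partial>count_space X) \<le> ennreal b" .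
  qed
  finally show ?thesis .
qed

lemma sum_le_nn_integral_count_space:
  assumes F: "finite F" "F \<subseteq> X"
  shows "sum f F \<le> (\<integral>\<^sup>+s. f s \<partial>count_space X)"
proof -
  have "sum f F = (\<Sum>s\<in>F. f s * indicator F s)" by (rule sum.cong) auto
  also have "\<dots> = (\<integral>\<^sup>+s. f s * indicator F s \<partial>count_space X)"
    by (rule nn_integral_count_space'[symmetric]) (use F in auto)
  also have "\<dots> \<le> (\<integral>\<^sup>+s. f s \<partial>count_space X)"
    by (rule nn_integral_mono) (simp add: indicator_def)
  finally show ?thesis .
qed

lemma epowr_mono: "a \<ge> 0 \<Longrightarrow> x \<le> y \<Longrightarrow> epowr x a \<le> epowr y a"
  by (cases x; cases y) (auto simp: epowr_def top_unique intro!: ennreal_leI powr_mono2)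

lemma epowr_scale:
  assumes "D \<ge> 0" "y \<ge> 0" "P > 0"
  shows "epowr (ennreal (D powr P * y)) (1 / P) = ennreal D * epowr (ennreal y) (1 / P)"
  using assms by (simp add: epowr_def powr_mult powr_powr flip: ennreal_mult)

lemma singular_vectors_orthogonal:
  assumes "x \<in> singular_vectors S s" "y \<in> singular_vectors S t" "s > 0" "t > 0" "s \<noteq> t"
  shows "cinner x y = 0"
proof -
  have "of_real (s\<^sup>2) * cinner x y = cinner (S x) (S y)"
    using assms(1) by (simp add: singular_vectors_def)
  also have "\<dots> = cnj (cinner (S y) (S x))" by (rule cinner_commute)
  also have "\<dots> = cnj (of_real (t\<^sup>2) * cinner y x)" using assms(2) by (simp add: singular_vectors_def)
  also have "\<dots> = of_real (t\<^sup>2) * cinner x y" by (simp flip: cinner_commute[of x y])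
  finally have "cinner x y = 0 \<or> of_real (s\<^sup>2) = (of_real (t\<^sup>2) :: complex)"
    unfolding mult_cancel_right .
  moreover have "s\<^sup>2 \<noteq> t\<^sup>2" using assms(3-5) by (simp add: power2_eq_iff)
  ultimately show ?thesis by (simp only: of_real_eq_iff) blast
qed

context dirichlet_setting
begin

lemma singular_space_iff:
  assumes total and f: "f \<in> \<D>"
  shows "f \<in> singular_space v T s \<longleftrightarrow> Phi f \<in> singular_vectors S s"
proof -
  have TD: "T h \<in> \<D>" if "h \<in> \<D>" for h using assms(1) that by (simp add: total_iff)
  have eq: "dirichlet_inner v (T f) (T h) = of_real (s\<^sup>2) * dirichlet_inner v f h \<longleftrightarrow>
      cinner (S (Phi f)) (S (Phi h)) = of_real (s\<^sup>2) * cinner (Phi f) (Phi h)" if h: "h \<in> \<D>" for h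
    using f h TD by (simp add: dirichlet_inner_Phi Phi_T)
  show ?thesis
  proof
    assume a: "f \<in> singular_space v T s"
    show "Phi f \<in> singular_vectors S s"
      unfolding singular_vectors_def
    proof (intro CollectI allI)
      fix h
      have "dirichlet_inner v (T f) (T (Psi h)) = of_real (s\<^sup>2) * dirichlet_inner v f (Psi h)"
        using a Psi_in_D by (simp add: singular_space_def)
      then show "cinner (S (Phi f)) (S h) = of_real (s\<^sup>2) * cinner (Phi f) h"
        unfolding eq[OF Psi_in_D] Phi_Psi .
    qed
  next
    assume a: "Phi f \<in> singular_vectors S s"
    show "f \<in> singular_space v T s"
      unfolding singular_space_def using f a eq by (simp add: singular_vectors_def)
  qed
qed

lemma D_zero: "(\<lambda>z. 0) \<in> \<D>" "Phi (\<lambda>z. 0) = 0"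
proof -
  have "taylor_coeff (\<lambda>z. 0) n = 0" for n by (rule taylor_coeff_unique(2)) simp
  then have tc0: "of_real (sqrt (w n)) * taylor_coeff (\<lambda>z. 0) n = cf 0 n" for n by (simp only: cf_zero mult_zero_right)
  show "(\<lambda>z. 0) \<in> \<D>" "Phi (\<lambda>z. 0) = 0" by (rule D_I[OF holomorphic_on_const tc0])+
qed

lemma D_sum:
  fixes n :: nat
  assumes "\<And>i. i < n \<Longrightarrow> e i \<in> \<D>"
  shows "(\<lambda>z. \<Sum>i<n. a i * e i z) \<in> \<D> \<and> Phi (\<lambda>z. \<Sum>i<n. a i * e i z) = (\<Sum>i<n. cscale (a i) (Phi (e i)))"
  using assms
proof (induction n)
  case 0
  show ?case unfolding lessThan_0 sum.empty using D_zero by (rule conjI)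
next
  case (Suc n)
  have e: "e n \<in> \<D>" by (rule Suc.prems) simp
  have "(\<lambda>z. \<Sum>i<n. a i * e i z) \<in> \<D> \<and> Phi (\<lambda>z. \<Sum>i<n. a i * e i z) = (\<Sum>i<n. cscale (a i) (Phi (e i)))"
    by (rule Suc.IH) (rule Suc.prems, simp)
  note IH = conjunct1[OF this] conjunct2[OF this]
  note D_add[OF IH(1) D_cmult(1)[OF e, of "a n"]]
  then show ?case unfolding sum.lessThan_Suc IH(2) D_cmult(2)[OF e] by (rule conjI)
qed

lemma disc_independent_iff:
  fixes n :: nat
  assumes e: "\<And>i. i < n \<Longrightarrow> e i \<in> \<D>"
  shows "disc_independent n e \<longleftrightarrow> (\<forall>a. (\<Sum>i<n. cscale (a i) (Phi (e i))) = 0 \<longrightarrow> (\<forall>i<n. a i = 0))"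
proof -
  have "(\<forall>z\<in>unit_disc. (\<Sum>i<n. a i * e i z) = 0) \<longleftrightarrow> (\<Sum>i<n. cscale (a i) (Phi (e i))) = 0" for a
  proof -
    have D: "(\<lambda>z. \<Sum>i<n. a i * e i z) \<in> \<D> \<and> Phi (\<lambda>z. \<Sum>i<n. a i * e i z) = (\<Sum>i<n. cscale (a i) (Phi (e i)))"
      by (rule D_sum) (rule e)
    show ?thesis
    proof
      assume z: "\<forall>z\<in>unit_disc. (\<Sum>i<n. a i * e i z) = 0"
      have "taylor_coeff (\<lambda>z. \<Sum>i<n. a i * e i z) k = taylor_coeff (\<lambda>z. 0) k" for k
        by (rule taylor_coeff_cong(2)[OF holomorphic_on_const]) (use z in blast)
      then have "Phi (\<lambda>z. \<Sum>i<n. a i * e i z) = Phi (\<lambda>z. 0)" by (simp only: Phi_def)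
      then show "(\<Sum>i<n. cscale (a i) (Phi (e i))) = 0" unfolding conjunct2[OF D] D_zero .
    next
      assume "(\<Sum>i<n. cscale (a i) (Phi (e i))) = 0"
      then have eq: "Phi (\<lambda>z. \<Sum>i<n. a i * e i z) = Phi (\<lambda>z. 0)" unfolding conjunct2[OF D] D_zero .
      show "\<forall>z\<in>unit_disc. (\<Sum>i<n. a i * e i z) = 0"
        using Phi_eq_imp_eq[OF conjunct1[OF D] D_zero(1) eq] by blast
    qed
  qed
  then show ?thesis unfolding disc_independent_def by simp
qed

lemma orthonormal_card_le_mult:
  assumes total and U: "finite U" "orthonormal_on U (\<lambda>u. u)" "U \<subseteq> singular_vectors S s"
  shows "of_nat (card U) \<le> singular_mult v T s"
proof -
  obtain b where b: "bij_betw b {..<card U} U" using ex_bij_betw_nat_finite[OF U(1)] by (auto simp: atLeast0LessThan)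
  have bU: "b i \<in> U" if "i < card U" for i using b that by (auto simp: bij_betw_def)
  have on: "orthonormal_on {..<card U} b"
    unfolding orthonormal_on_def
  proof (intro ballI)
    fix i j assume ij: "i \<in> {..<card U}" "j \<in> {..<card U}"
    have "b i = b j \<longleftrightarrow> i = j" using b ij by (auto simp: bij_betw_def inj_on_def)
    then show "cinner (b i) (b j) = (if i = j then 1 else 0)"
      using U(2) bU ij by (simp add: orthonormal_on_def)
  qed
  have ind: "disc_independent (card U) (\<lambda>i. Psi (b i))"
    unfolding disc_independent_iff[of "card U" "\<lambda>i. Psi (b i)", OF Psi_in_D] Phi_Psi
  proof (intro allI impI)
    fix a i assume sum: "(\<Sum>i<card U. cscale (a i) (b i)) = 0" and i: "i < card U"
    show "a i = 0" using cinner_projection[OF _ on, of i a] i sum by simp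
  qed
  have "Psi (b i) \<in> singular_space v T s" if "i < card U" for i
    using singular_space_iff[OF assms(1) Psi_in_D] bU[OF that] U(3) by (auto simp: Phi_Psi)
  then show ?thesis unfolding singular_mult_def
    by (intro SUP_upper CollectI exI[of _ "\<lambda>i. Psi (b i)"]) (use ind in simp)
qed

lemma orthonormal_of_independent:
  assumes total and e: "\<And>i. i < n \<Longrightarrow> e i \<in> singular_space v T s" "disc_independent n e"
  shows "\<exists>u. orthonormal_on {..<n} u \<and> (\<forall>i<n. u i \<in> singular_vectors S s)"
proof -
  have eD: "e i \<in> \<D>" if "i < n" for i using e(1)[OF that] by (simp add: singular_space_def)
  have S: "S (cscale a x) = cscale a (S x)" "S (x + y) = S x + S y" for a x y
    using assms(1) by (simp_all add: S_cscale S_add)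
  have S0: "S 0 = 0" using S(2)[of 0 0] by simp
  show ?thesis
  proof (rule gram_schmidt[where n = n and e = "\<lambda>i. Phi (e i)" and X = "singular_vectors S s"])
    show "\<forall>i<n. a i = 0" if "(\<Sum>i<n. cscale (a i) (Phi (e i))) = 0" for a
      using e(2) that disc_independent_iff[of n e] eD by blast
    show "0 \<in> singular_vectors S s" by (simp add: singular_vectors_def S0)
    show "x + y \<in> singular_vectors S s" if "x \<in> singular_vectors S s" "y \<in> singular_vectors S s" for x y
      using that by (simp add: singular_vectors_def S cinner_add_left distrib_left)
    show "cscale a x \<in> singular_vectors S s" if "x \<in> singular_vectors S s" for a x
      using that by (simp add: singular_vectors_def S cinner_cscale_left mult.left_commute)
    show "Phi (e i) \<in> singular_vectors S s" if "i < n" for i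
      using singular_space_iff[OF assms(1) eD[OF that]] e(1)[OF that] by simp
  next
    fix f assume "orthonormal_on {..<n} f" "\<And>i. i < n \<Longrightarrow> f i \<in> singular_vectors S s"
    then show ?thesis by blast
  qed
qed

text \<open>A bound on the sizes of independent families turns the supremum into a maximum, so that
  a family realizing the multiplicity can be chosen.\<close>

lemma singular_mult_attained:
  assumes bd: "\<And>n e. (\<forall>i<n. e i \<in> singular_space v T s) \<Longrightarrow> disc_independent n e \<Longrightarrow> real n \<le> b"
  shows "\<exists>n e. singular_mult v T s = of_nat n \<and> (\<forall>i<n. e i \<in> singular_space v T s) \<and> disc_independent n e"
proof -
  define N where "N = {n. \<exists>e. (\<forall>i<n. e i \<in> singular_space v T s) \<and> disc_independent n e}"
  have "N \<subseteq> {..nat \<lceil>b\<rceil>}"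
  proof
    fix n assume "n \<in> N"
    then have "real n \<le> b" using bd unfolding N_def by blast
    then show "n \<in> {..nat \<lceil>b\<rceil>}" by simp linarith
  qed
  then have fin: "finite N" by (rule finite_subset) simp
  have "0 \<in> N" by (simp add: N_def disc_independent_def)
  then have ne: "N \<noteq> {}" by blast
  have "singular_mult v T s = of_nat (Max N)"
    unfolding singular_mult_def N_def[symmetric]
  proof (rule antisym)
    show "(SUP n\<in>N. of_nat n) \<le> (of_nat (Max N) :: ennreal)"
      by (rule SUP_least) (use Max_ge[OF fin] in simp)
    show "(of_nat (Max N) :: ennreal) \<le> (SUP n\<in>N. of_nat n)"
      by (rule SUP_upper[OF Max_in[OF fin ne]])
  qed
  moreover have "Max N \<in> {n. \<exists>e. (\<forall>i<n. e i \<in> singular_space v T s) \<and> disc_independent n e}"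
    using Max_in[OF fin ne] unfolding N_def[symmetric] .
  ultimately show ?thesis by blast
qed

text \<open>The index \<open>(s, i)\<close> consists of a singular value and a position inside its
  eigenspace. Eigenspaces for different values are orthogonal, so their orthonormal bases combine to
  a single orthonormal family indexed by pairs.\<close>

lemma singular_sum_le:
  assumes total and P: "P \<ge> 1"
    and R: "\<And>(I :: (real \<times> nat) set) u. finite I \<Longrightarrow> orthonormal_on I u \<Longrightarrow> (\<forall>i\<in>I. fst i > 0 \<and> u i \<in> singular_vectors S (fst i)) \<Longrightarrow>
              (\<Sum>i\<in>I. fst i powr P) \<le> R"
  shows "(\<integral>\<^sup>+s. singular_mult v T s * ennreal (s powr P) \<partial>count_space {0<..}) \<le> ennreal R"
proof (rule nn_integral_count_space_le)
  fix F :: "real set" assume F: "finite F" "F \<subseteq> {0<..}"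
  have on: "\<exists>u. orthonormal_on {..<n} u \<and> (\<forall>i<n. u i \<in> singular_vectors S s)"
    if "\<forall>i<n. e i \<in> singular_space v T s" "disc_independent n e" for n e s
    using orthonormal_of_independent[OF assms(1) _ that(2)] that(1) by blast
  \<comment> \<open>The multiplicity of a single value is finite: \<open>n\<close> orthonormal
    vectors at level \<open>s\<close> already contribute \<open>n * s powr P\<close>, which is at
    most \<open>R\<close>.\<close>
  have "\<exists>n e. singular_mult v T s = of_nat n \<and> (\<forall>i<n. e i \<in> singular_space v T s) \<and> disc_independent n e"
    if s: "s > 0" for s
  proof (rule singular_mult_attained)
    fix n e assume e: "\<forall>i<n. e i \<in> singular_space v T s" "disc_independent n e"
    obtain u where u: "orthonormal_on {..<n} u" "\<forall>i<n. u i \<in> singular_vectors S s" using on[OF e] by blast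
    have "(\<Sum>i\<in>{s} \<times> {..<n}. fst i powr P) \<le> R"
    proof (rule R)
      show "orthonormal_on ({s} \<times> {..<n}) (\<lambda>i. u (snd i))" using u(1) by (auto simp: orthonormal_on_def)
    qed (use s u(2) in auto)
    moreover have "(\<Sum>i\<in>{s} \<times> {..<n}. fst i powr P) = (\<Sum>i\<in>{s} \<times> {..<n}. s powr P)" by (rule sum.cong) auto
    ultimately have "real n * s powr P \<le> R" by (simp add: card_cartesian_product)
    then show "real n \<le> R / s powr P" using s by (simp add: field_simps)
  qed
  then have "\<exists>n u. singular_mult v T s = of_nat n \<and> orthonormal_on {..<n} u \<and> (\<forall>i<n. u i \<in> singular_vectors S s)"
    if "s > 0" for s using that on by meson
  then have "\<forall>s\<in>F. \<exists>n u. singular_mult v T s = of_nat n \<and> orthonormal_on {..<n} u \<and> (\<forall>i<n. u i \<in> singular_vectors S s)"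
    using F(2) by blast
  from bchoice[OF this] obtain n where "\<forall>s\<in>F. \<exists>u. singular_mult v T s = of_nat (n s) \<and> orthonormal_on {..<n s} u \<and> (\<forall>i<n s. u i \<in> singular_vectors S s)"
    by blast
  from bchoice[OF this] obtain u where u: "\<And>s. s \<in> F \<Longrightarrow> singular_mult v T s = of_nat (n s)"
    "\<And>s. s \<in> F \<Longrightarrow> orthonormal_on {..<n s} (u s)" "\<And>s i. s \<in> F \<Longrightarrow> i < n s \<Longrightarrow> u s i \<in> singular_vectors S s"
    by blast
  have "(\<Sum>s\<in>F. singular_mult v T s * ennreal (s powr P)) = (\<Sum>s\<in>F. ennreal (real (n s) * s powr P))"
    by (rule sum.cong) (simp_all add: u(1) ennreal_mult' ennreal_of_nat_eq_real_of_nat)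
  also have "\<dots> = ennreal (\<Sum>s\<in>F. real (n s) * s powr P)" by (rule sum_ennreal) simp
  also have "(\<Sum>s\<in>F. real (n s) * s powr P) = (\<Sum>s\<in>F. \<Sum>i<n s. s powr P)" by simp
  also have "\<dots> = (\<Sum>i\<in>(SIGMA s:F. {..<n s}). fst i powr P)"
    using F(1) by (subst sum.Sigma) (auto intro!: sum.cong)
  also have "ennreal \<dots> \<le> ennreal R"
  proof (rule ennreal_leI, rule R)
    show "finite (SIGMA s:F. {..<n s})" using F(1) by simp
    show "orthonormal_on (SIGMA s:F. {..<n s}) (\<lambda>i. u (fst i) (snd i))"
      unfolding orthonormal_on_def
    proof (intro ballI)
      fix i j assume i: "i \<in> (SIGMA s:F. {..<n s})" and j: "j \<in> (SIGMA s:F. {..<n s})"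
      show "cinner (u (fst i) (snd i)) (u (fst j) (snd j)) = (if i = j then 1 else 0)"
      proof (cases "fst i = fst j")
        case True
        then show ?thesis using i j u(2)[of "fst i"] by (auto simp: orthonormal_on_def prod_eq_iff)
      next
        case False
        have "cinner (u (fst i) (snd i)) (u (fst j) (snd j)) = 0"
          by (rule singular_vectors_orthogonal[OF u(3) u(3) _ _ False]) (use i j F(2) in auto)
        with False show ?thesis by auto
      qed
    qed
    show "\<forall>i\<in>(SIGMA s:F. {..<n s}). fst i > 0 \<and> u (fst i) (snd i) \<in> singular_vectors S (fst i)"
      using F(2) u(3) by auto
  qed
  finally show "(\<Sum>s\<in>F. singular_mult v T s * ennreal (s powr P)) \<le> ennreal R" .
qed

text \<open>The vectors are grouped by their singular value; each group is orthonormal in one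
  eigenspace, hence not larger than the multiplicity.\<close>

lemma le_singular_sum:
  assumes total and U: "finite U" "orthonormal_on U (\<lambda>u. u)" "\<And>u. u \<in> U \<Longrightarrow> s u > 0 \<and> u \<in> singular_vectors S (s u)"
  shows "ennreal (\<Sum>u\<in>U. s u powr P) \<le> (\<integral>\<^sup>+s. singular_mult v T s * ennreal (s powr P) \<partial>count_space {0<..})"
proof -
  have "ennreal (\<Sum>u\<in>U. s u powr P) = (\<Sum>u\<in>U. ennreal (s u powr P))" by (rule sum_ennreal[symmetric]) simp
  also have "\<dots> = (\<Sum>t\<in>s ` U. \<Sum>u | u \<in> U \<and> s u = t. ennreal (s u powr P))"
    by (rule sum.image_gen[OF U(1)])
  also have "\<dots> = (\<Sum>t\<in>s ` U. of_nat (card {u \<in> U. s u = t}) * ennreal (t powr P))"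
    by (intro sum.cong refl) simp
  also have "\<dots> \<le> (\<Sum>t\<in>s ` U. singular_mult v T t * ennreal (t powr P))"
  proof (intro sum_mono mult_right_mono)
    fix t
    show "of_nat (card {u \<in> U. s u = t}) \<le> singular_mult v T t"
      by (rule orthonormal_card_le_mult[OF assms(1)]) (use U in \<open>auto simp: orthonormal_on_def\<close>)
  qed simp
  also have "\<dots> \<le> (\<integral>\<^sup>+s. singular_mult v T s * ennreal (s powr P) \<partial>count_space {0<..})"
    by (rule sum_le_nn_integral_count_space) (use U in auto)
  finally show ?thesis .
qed

section \<open>Boundedness and compactness in both descriptions of the operator\<close>

lemma operator_norm_le:
  assumes total and b: "\<And>u. norm (S u) \<le> b * norm u" "b \<ge> 0"
  shows "operator_norm v T \<le> ennreal b"
  unfolding operator_norm_def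
proof (rule SUP_least)
  fix f assume "f \<in> {f \<in> \<D>. dirichlet_norm v f \<le> 1}"
  then have f: "f \<in> \<D>" and n: "norm (Phi f) \<le> 1" using norm_Phi[of f] by auto
  have Tf: "T f \<in> \<D>" using assms(1) f by (simp add: total_iff)
  have "norm (S (Phi f)) \<le> b * 1" by (rule order_trans[OF b(1) mult_left_mono[OF n b(2)]])
  then show "dirichlet_norm v (T f) \<le> ennreal b" unfolding norm_Phi[OF Tf] Phi_T[OF f Tf] by (simp add: ennreal_leI)
qed

lemma unit_ball_operator_norm:
  assumes "norm u \<le> 1"
  shows "dirichlet_norm v (T (Psi u)) \<le> operator_norm v T"
  unfolding operator_norm_def
  by (rule SUP_upper) (use assms norm_Phi[OF Psi_in_D, of u] Psi_in_D in \<open>simp add: Phi_Psi\<close>)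

lemma bounded_operator_S:
  assumes "bounded_operator v T"
  shows total and "bounded_linear S"
proof -
  show t: total using assms by (simp add: bounded_operator_def linear_operator_def total_iff)
  define b where "b = enn2real (operator_norm v T)"
  have le1: "norm (S u) \<le> b" if u: "norm u \<le> 1" for u
  proof -
    have Tf: "T (Psi u) \<in> \<D>" using t Psi_in_D by (simp add: total_iff)
    have "ennreal (norm (S u)) \<le> operator_norm v T"
      using unit_ball_operator_norm[OF u] by (simp add: norm_Phi[OF Tf] Phi_T[OF Psi_in_D Tf] Phi_Psi)
    also have "\<dots> = ennreal b" using assms by (simp add: b_def bounded_operator_def)
    finally show ?thesis by (simp add: b_def)
  qed
  show "bounded_linear S"
  proof (rule bounded_linear_intro)
    show "S (x + y) = S x + S y" for x y using t by (rule S_add)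
    show sc: "S (r *\<^sub>R x) = r *\<^sub>R S x" for r x using t by (rule S_scaleR)
    fix u
    show "norm (S u) \<le> norm u * b"
    proof (cases "u = 0")
      case True
      then show ?thesis using sc[of 0 0] by simp
    next
      case False
      have "norm (S ((1 / norm u) *\<^sub>R u)) \<le> b" by (rule le1) (use False in simp)
      then have "norm (S u) / norm u \<le> b" unfolding sc by simp
      then show ?thesis using False by (simp add: field_simps)
    qed
  qed
qed

lemma compact_operator_S:
  fixes x :: "nat \<Rightarrow> ell2"
  assumes T: "compact_operator v T" and x: "\<And>n. norm (x n) \<le> 1"
  shows "\<exists>k h. strict_mono (k :: nat \<Rightarrow> nat) \<and> (\<lambda>n. S (x (k n))) \<longlonglongrightarrow> h"
proof -
  have t: total using T bounded_operator_S(1) by (simp add: compact_operator_def)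
  have F: "Psi (x n) \<in> \<D> \<and> dirichlet_norm v (Psi (x n)) \<le> 1" for n
    using Psi_in_D x[of n] by (simp add: norm_Phi Phi_Psi)
  then obtain k h where k: "strict_mono (k :: nat \<Rightarrow> nat)" and h: "h \<in> \<D>"
    and lim: "(\<lambda>n. dirichlet_norm v (\<lambda>z. T (Psi (x (k n))) z - h z)) \<longlonglongrightarrow> 0"
    using conjunct2[OF T[unfolded compact_operator_def], rule_format, of "\<lambda>n. Psi (x n)"] by blast
  have TD: "T (Psi u) \<in> \<D>" for u using t Psi_in_D by (simp add: total_iff)
  have "dirichlet_norm v (\<lambda>z. T (Psi u) z - h z) = ennreal (norm (S u - Phi h))" for u
    unfolding norm_Phi[OF D_diff(1)[OF TD h]] D_diff(2)[OF TD h] Phi_T[OF Psi_in_D TD] Phi_Psi ..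
  with lim have "(\<lambda>n. ennreal (norm (S (x (k n)) - Phi h))) \<longlonglongrightarrow> 0" by simp
  then have "(\<lambda>n. norm (S (x (k n)) - Phi h)) \<longlonglongrightarrow> 0" by (subst (asm) ennreal_tendsto_0_iff) auto
  then have "(\<lambda>n. S (x (k n))) \<longlonglongrightarrow> Phi h" by (rule LIM_zero_cancel[OF tendsto_norm_zero_cancel])
  with k show ?thesis by blast
qed

lemma bounded_operator_T:
  assumes B: "\<And>j. A j \<le> B"
  shows "operator_norm v T \<le> ennreal (K * B)" and "bounded_operator v T"
proof -
  have B0: "B \<ge> 0" using B[of 0] A_nonneg[of 0] by linarith
  show le: "operator_norm v T \<le> ennreal (K * B)"
    by (rule operator_norm_le[OF bounded_imp_total(1)[OF B] bounded_imp_total(2)[OF B]]) (use K_pos B0 in simp)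
  show "bounded_operator v T"
    unfolding bounded_operator_def
    using linear_T[OF bounded_imp_total(1)[OF B]] le_less_trans[OF le] by simp
qed

lemma compact_operator_T:
  assumes A: "A \<longlonglongrightarrow> 0"
  shows "compact_operator v T"
proof -
  have "Bseq A" using A by (intro convergent_imp_Bseq) (auto simp: convergent_def)
  then obtain B where "\<forall>j. norm (A j) \<le> B" by (auto simp: Bseq_def)
  then have B: "\<And>j. A j \<le> B" by simp
  have t: total by (rule bounded_imp_total(1)[OF B])
  then have TD: "T f \<in> \<D>" if "f \<in> \<D>" for f using that by (simp add: total_iff)
  show ?thesis
    unfolding compact_operator_def
  proof (intro conjI allI impI)
    show "bounded_operator v T" by (rule bounded_operator_T(2)[OF B])
    fix F :: "nat \<Rightarrow> complex \<Rightarrow> complex"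
    assume F: "\<forall>n. F n \<in> \<D> \<and> dirichlet_norm v (F n) \<le> 1"
    have FD: "F n \<in> \<D>" for n using F by blast
    have F1: "norm (Phi (F n)) \<le> 1" for n
      using F[rule_format, of n] norm_Phi[OF FD, of n] by simp
    obtain k h where k: "strict_mono (k :: nat \<Rightarrow> nat)" and h: "(\<lambda>n. S (Phi (F (k n)))) \<longlonglongrightarrow> h"
      using compact_S[OF A, of "\<lambda>n. Phi (F n)", OF F1] by blast
    have "dirichlet_norm v (\<lambda>z. T (F n) z - Psi h z) = ennreal (norm (S (Phi (F n)) - h))" for n
      unfolding norm_Phi[OF D_diff(1)[OF TD[OF FD] Psi_in_D]] D_diff(2)[OF TD[OF FD] Psi_in_D] Phi_T[OF FD TD[OF FD]] Phi_Psi ..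
    moreover have "(\<lambda>n. ennreal (norm (S (Phi (F (k n))) - h))) \<longlonglongrightarrow> 0"
      using tendsto_norm_zero[OF LIM_zero[OF h]] by (subst ennreal_tendsto_0_iff) auto
    ultimately show "\<exists>k h. strict_mono k \<and> h \<in> \<D> \<and> (\<lambda>n. dirichlet_norm v (\<lambda>z. T (F (k n)) z - h z)) \<longlonglongrightarrow> 0"
      using k Psi_in_D by (intro exI[of _ k] exI[of _ "Psi h"]) simp
  qed
qed

text \<open>No boundedness is assumed. If the image of a test function leaves the space, it is still
  holomorphic, so its norm and hence the operator norm are infinite; otherwise its coordinates are
  bounded below on the block.\<close>

lemma A_le_operator_norm: "ennreal (A j) \<le> ennreal (4 * c) * operator_norm v T"
proof -
  have c0: "c > 0" using c_ge by simp
  let ?u = "testvec j"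
  let ?f = "Psi ?u"
  have "ennreal (A j / (4 * c)) \<le> dirichlet_norm v (T ?f)"
  proof (cases "T ?f \<in> \<D>")
    case False
    then show ?thesis using T_holo[OF Psi_in_D, of ?u] by (simp add: dirichlet_space_def not_less top_unique)
  next
    case True
    have "cf (S ?u) n = M ?u n" for n
      using cf_Phi[OF True, of n] taylor_coeff_T[OF Psi_in_D, of n ?u] by (simp add: Phi_T[OF Psi_in_D True] Phi_Psi)
    then have "(\<Sum>n\<in>blk j. (cmod (M ?u n))\<^sup>2) \<le> (norm (S ?u))\<^sup>2"
      using sum_cf_le_norm[OF finite_blk, of "S ?u" j] by simp
    then have "(A j / (4 * c))\<^sup>2 \<le> (norm (S ?u))\<^sup>2"
      using sum_M_testvec_ge[of j] by linarith
    then have "A j / (4 * c) \<le> norm (S ?u)" by (rule power2_le_imp_le) simp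
    then show ?thesis unfolding norm_Phi[OF True] Phi_T[OF Psi_in_D True] Phi_Psi by (rule ennreal_leI)
  qed
  also have "\<dots> \<le> operator_norm v T" by (rule unit_ball_operator_norm) (simp add: norm_testvec)
  finally have "ennreal (4 * c) * ennreal (A j / (4 * c)) \<le> ennreal (4 * c) * operator_norm v T"
    by (rule mult_left_mono) simp
  then show ?thesis using c0 A_nonneg[of j] by (simp flip: ennreal_mult)
qed



section \<open>Comparison of the Schatten norm with the norm of B(2,p)\<close>

abbreviation mean :: "real \<Rightarrow> real" where
  "mean r \<equiv> integral_mean2 r (deriv g)"

sublocale mean: coeff_mean "taylor_coeff (deriv g)" mean
proof
  have "deriv g holomorphic_on unit_disc" using g by (intro holomorphic_deriv) auto
  note eq = integral_mean2_eq[OF this]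
  fix r :: real assume "0 < r" "r < 1"
  then show "summable (\<lambda>n. (cmod (taylor_coeff (deriv g) n))\<^sup>2 * (r ^ n)\<^sup>2)"
    and "mean r = sqrt (\<Sum>n. (cmod (taylor_coeff (deriv g) n))\<^sup>2 * (r ^ n)\<^sup>2)" using eq by blast+
qed

abbreviation mean_sup :: ennreal where
  "mean_sup \<equiv> (SUP r\<in>{0<..<1}. ennreal (mean r * (1 - r) powr (1/2)))"

abbreviation mean_int :: "real \<Rightarrow> ennreal" where
  "mean_int P \<equiv> (\<integral>\<^sup>+ r\<in>{0<..<1}. ennreal (mean r powr P * (1 - r) powr (P / 2 - 1)) \<partial>lborel)"

abbreviation singular_sum :: "real \<Rightarrow> ennreal" where
  "singular_sum P \<equiv> (\<integral>\<^sup>+s. singular_mult v T s * ennreal (s powr P) \<partial>count_space {0<..})"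

lemma operator_norm_le_mean_sup:
  assumes "mean_sup < \<infinity>"
  shows "operator_norm v T \<le> ennreal (8 * K) * mean_sup" and "bounded_operator v T"
proof -
  define y where "y = enn2real mean_sup"
  have y: "mean_sup = ennreal y" "y \<ge> 0" using assms by (simp_all add: y_def)
  have A: "A j \<le> 8 * y" for j
  proof -
    obtain r where r: "r \<in> {0<..<1}" "A j / 8 \<le> mean r * (1 - r) powr (1/2)"
      using mean.A_le_mean[of j] by blast
    have "ennreal (A j / 8) \<le> ennreal (mean r * (1 - r) powr (1/2))" by (rule ennreal_leI[OF r(2)])
    also have "\<dots> \<le> mean_sup" by (rule SUP_upper[OF r(1)])
    finally show ?thesis using y by simp
  qed
  show "bounded_operator v T" by (rule bounded_operator_T(2)[OF A])
  have "operator_norm v T \<le> ennreal (K * (8 * y))" by (rule bounded_operator_T(1)[OF A])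
  also have "K * (8 * y) = 8 * K * y" by simp
  also have "ennreal (8 * K * y) = ennreal (8 * K) * mean_sup" unfolding y(1) using K_pos y(2) by (simp add: ennreal_mult)
  finally show "operator_norm v T \<le> ennreal (8 * K) * mean_sup" .
qed

lemma mean_sup_le_operator_norm: "mean_sup \<le> ennreal (mean.K\<theta> * (4 * c)) * operator_norm v T"
proof (cases "operator_norm v T = \<infinity>")
  case True
  then show ?thesis using mean.K\<theta>_pos c_ge by (simp add: ennreal_mult_top)
next
  case False
  define y where "y = enn2real (operator_norm v T)"
  have y: "operator_norm v T = ennreal y" "y \<ge> 0" using False by (simp_all add: y_def less_top)
  have A: "A j \<le> 4 * c * y" for j
  proof -
    have "ennreal (A j) \<le> ennreal (4 * c * y)"
      using A_le_operator_norm[of j] y c_ge by (simp add: ennreal_mult)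
    then show ?thesis using y(2) c_ge by simp
  qed
  show ?thesis
  proof (rule SUP_least)
    fix r :: real assume "r \<in> {0<..<1}"
    then have "mean r * (1 - r) powr (1/2) \<le> mean.K\<theta> * (4 * c * y)"
      by (intro mean.mean_le_sup[OF _ _ A]) auto
    then have "ennreal (mean r * (1 - r) powr (1/2)) \<le> ennreal (mean.K\<theta> * (4 * c * y))" by (rule ennreal_leI)
    also have "mean.K\<theta> * (4 * c * y) = mean.K\<theta> * (4 * c) * y" by simp
    also have "ennreal (mean.K\<theta> * (4 * c) * y) = ennreal (mean.K\<theta> * (4 * c)) * operator_norm v T"
      unfolding y(1) using mean.K\<theta>_pos c_ge y(2) by (intro ennreal_mult) auto
    finally show "ennreal (mean r * (1 - r) powr (1/2)) \<le> ennreal (mean.K\<theta> * (4 * c)) * operator_norm v T" .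
  qed
qed

text \<open>A finite integral makes \<open>A\<close> p-summable, hence a null sequence; this gives
  compactness, which \<open>schatten_norm\<close> demands before it counts singular values.\<close>

lemma singular_sum_le_mean_int:
  assumes P: "P \<ge> 1" and fin: "mean_int P < \<infinity>"
  shows "compact_operator v T"
    and "epowr (singular_sum P) (1 / P) \<le> ennreal (16 * K) * epowr (mean_int P) (1 / P)"
proof -
  define y where "y = enn2real (mean_int P)"
  have y: "mean_int P = ennreal y" "y \<ge> 0" using fin by (simp_all add: y_def)
  define R where "R = 2 * 8 powr P * y"
  have sumA: "(\<Sum>j<N. A j powr P) \<le> R" for N
  proof -
    have "ennreal (\<Sum>j\<le>N. (A j / 8) powr P / 2) \<le> ennreal y"
      using mean.sum_A_le_integral[OF P, of N] unfolding y(1) .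
    then have "(\<Sum>j\<le>N. (A j / 8) powr P / 2) \<le> y" using y(2) by simp
    moreover have "(\<Sum>j\<le>N. (A j / 8) powr P / 2) = (\<Sum>j\<le>N. A j powr P) / (2 * 8 powr P)"
      using A_nonneg by (simp add: powr_divide sum_divide_distrib mult.commute)
    moreover have "(\<Sum>j<N. A j powr P) \<le> (\<Sum>j\<le>N. A j powr P)" by (rule sum_mono2) auto
    ultimately show ?thesis by (simp add: R_def field_simps)
  qed
  have R0: "R \<ge> 0" using sumA[of 0] by simp
  have "summable (\<lambda>j. A j powr P)"
    by (rule summableI_nonneg_bounded[where x = R]) (use sumA in auto)
  then have "(\<lambda>j. (A j powr P) powr (1 / P)) \<longlonglongrightarrow> 0 powr (1 / P)"
    using P by (intro tendsto_powr' summable_LIMSEQ_zero tendsto_const) auto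
  then have lim: "A \<longlonglongrightarrow> 0" using P A_nonneg by (simp add: powr_powr)
  show "compact_operator v T" by (rule compact_operator_T[OF lim])
  obtain B where "\<forall>j. norm (A j) \<le> B"
    using convergent_imp_Bseq[OF convergentI[OF lim]] by (auto simp: Bseq_def)
  then have B: "\<And>j. A j \<le> B" by simp
  have "singular_sum P \<le> ennreal (K powr P * R)"
  proof (rule singular_sum_le[OF bounded_imp_total(1)[OF B] P])
    fix I :: "(real \<times> nat) set" and u
    assume "finite I" "orthonormal_on I u" and s: "\<forall>i\<in>I. fst i > 0 \<and> u i \<in> singular_vectors S (fst i)"
    then show "(\<Sum>i\<in>I. fst i powr P) \<le> K powr P * R"
      by (intro sum_singular_powr_le[OF B P sumA]) auto
  qed
  \<comment> \<open>The factor \<open>2 * 8 powr P\<close> from the comparison of \<open>A\<close>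
    with the integral is enlarged to \<open>16 powr P\<close>, so that the constant
    \<open>16 * K\<close> after taking the root does not depend on \<open>P\<close>.\<close>
  also have "K powr P * R \<le> (16 * K) powr P * y"
  proof -
    have "2 * 8 powr P \<le> (2 * 8) powr P"
      unfolding powr_mult using powr_mono[of 1 P 2] P by (intro mult_right_mono) auto
    then have "K powr P * (2 * 8 powr P * y) \<le> K powr P * (16 powr P * y)"
      using y(2) by (intro mult_left_mono mult_right_mono) auto
    then show ?thesis using K_pos by (simp add: R_def powr_mult mult_ac)
  qed
  finally have "singular_sum P \<le> ennreal ((16 * K) powr P * y)" by (simp add: ennreal_leI)
  then have "epowr (singular_sum P) (1 / P) \<le> epowr (ennreal ((16 * K) powr P * y)) (1 / P)"
    using P by (intro epowr_mono) auto
  also have "\<dots> = ennreal (16 * K) * epowr (ennreal y) (1 / P)"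
    by (rule epowr_scale) (use K_pos y P in auto)
  finally show "epowr (singular_sum P) (1 / P) \<le> ennreal (16 * K) * epowr (mean_int P) (1 / P)"
    unfolding y(1) .
qed

lemma mean_int_le_singular_sum:
  assumes P: "P \<ge> 1" and T: "compact_operator v T" and fin: "singular_sum P < \<infinity>"
  shows "epowr (mean_int P) (1 / P) \<le> ennreal (mean.K\<theta> * (4 * c)) * epowr (singular_sum P) (1 / P)"
proof -
  define y where "y = enn2real (singular_sum P)"
  have y: "singular_sum P = ennreal y" "y \<ge> 0" using fin by (simp_all add: y_def)
  have bT: "bounded_operator v T" using T by (simp add: compact_operator_def)
  note t = bounded_operator_S[OF bT]
  have A: "(\<Sum>j<N. A j powr P) \<le> (4 * c) powr P * y" for N
  proof (rule sum_A_powr_le[OF t P])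
    show "\<exists>k h. strict_mono (k :: nat \<Rightarrow> nat) \<and> (\<lambda>n. S (x (k n))) \<longlonglongrightarrow> h"
      if "\<And>n. norm (x n) \<le> 1" for x :: "nat \<Rightarrow> ell2" by (rule compact_operator_S[OF T that])
    fix U s assume "finite U" "orthonormal_on U (\<lambda>u. u)" "\<And>u. u \<in> U \<Longrightarrow> s u > 0 \<and> u \<in> singular_vectors S (s u)"
    from le_singular_sum[OF t(1) this, of P] show "(\<Sum>u\<in>U. s u powr P) \<le> y"
      unfolding y(1) using y(2) by simp
  qed
  have "mean_int P \<le> ennreal (mean.K\<theta> powr P * ((4 * c) powr P * y))"
    by (rule mean.integral_le_sum_A[OF P A])
  also have "mean.K\<theta> powr P * ((4 * c) powr P * y) = (mean.K\<theta> * (4 * c)) powr P * y"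
    using mean.K\<theta>_pos c_ge by (subst powr_mult) auto
  finally have "epowr (mean_int P) (1 / P) \<le> epowr (ennreal ((mean.K\<theta> * (4 * c)) powr P * y)) (1 / P)"
    using P by (intro epowr_mono) auto
  also have "\<dots> = ennreal (mean.K\<theta> * (4 * c)) * epowr (ennreal y) (1 / P)"
    by (rule epowr_scale) (use mean.K\<theta>_pos c_ge y P in auto)
  finally show ?thesis unfolding y(1) .
qed

lemma deriv_minus_const: "z \<in> unit_disc \<Longrightarrow> deriv (\<lambda>z. g z - a) z = deriv g z"
  using g by (auto simp: holomorphic_on_imp_differentiable_at[of _ unit_disc])

lemma mean_minus_const:
  assumes "r \<in> {0<..<1}"
  shows "integral_mean2 r (deriv (\<lambda>z. g z - a)) = mean r"
proof -
  have "deriv (\<lambda>z. g z - a) (of_real r * cis \<theta>) = deriv g (of_real r * cis \<theta>)" for \<theta>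
    by (rule deriv_minus_const) (use assms in \<open>simp add: norm_mult\<close>)
  then show ?thesis by (simp add: integral_mean2_def)
qed

lemma B2_norm_infinity:
  "B2_norm \<infinity> g = ennreal (cmod (g 0)) + mean_sup" "B2_norm \<infinity> (\<lambda>z. g z - g 0) = mean_sup"
proof -
  show "B2_norm \<infinity> g = ennreal (cmod (g 0)) + mean_sup" by (simp add: B2_norm_def)
  have "(SUP r\<in>{0<..<1}. ennreal (integral_mean2 r (deriv (\<lambda>z. g z - g 0)) * (1 - r) powr (1/2))) = mean_sup"
    by (rule SUP_cong[OF refl]) (simp only: mean_minus_const)
  then show "B2_norm \<infinity> (\<lambda>z. g z - g 0) = mean_sup" by (simp add: B2_norm_def)
qed

lemma B2_norm_finite:
  assumes P: "P \<ge> 1"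
  shows "B2_norm (ennreal P) g = epowr (ennreal (cmod (g 0) powr P) + mean_int P) (1 / P)"
    and "B2_norm (ennreal P) (\<lambda>z. g z - g 0) = epowr (mean_int P) (1 / P)"
proof -
  have P': "enn2real (ennreal P) = P" using P by simp
  show "B2_norm (ennreal P) g = epowr (ennreal (cmod (g 0) powr P) + mean_int P) (1 / P)"
    unfolding B2_norm_def P' by simp
  have "(\<integral>\<^sup>+ r\<in>{0<..<1}. ennreal (integral_mean2 r (deriv (\<lambda>z. g z - g 0)) powr P * (1 - r) powr (P / 2 - 1)) \<partial>lborel) = mean_int P"
  proof (rule nn_integral_cong)
    fix r :: real
    show "ennreal (integral_mean2 r (deriv (\<lambda>z. g z - g 0)) powr P * (1 - r) powr (P / 2 - 1)) * indicator {0<..<1} r =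
      ennreal (mean r powr P * (1 - r) powr (P / 2 - 1)) * indicator {0<..<1} r"
      by (cases "r \<in> {0<..<1}") (simp_all only: mean_minus_const indicator_simps mult_zero_right not_False_eq_True)
  qed
  then show "B2_norm (ennreal P) (\<lambda>z. g z - g 0) = epowr (mean_int P) (1 / P)"
    unfolding B2_norm_def P' using P by simp
qed

lemma epowr_less_top: "epowr x a < \<infinity> \<longleftrightarrow> x < \<infinity>"
  by (simp add: epowr_def less_top)

text \<open>The inequalities are between extended values, so membership follows by comparing
  finiteness; since the constants are positive, an infinite right side makes them trivial.
  Boundedness is carried along because \<open>schatten_class\<close> asks for it separately.\<close>

lemma hilbert_op_schatten:
  assumes p: "1 \<le> p"
  shows "T \<in> schatten_class v p \<longleftrightarrow> g \<in> B2_space p"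
    and "schatten_norm v p T \<le> ennreal (16 * K) * B2_norm p (\<lambda>z. g z - g 0)"
    and "B2_norm p (\<lambda>z. g z - g 0) \<le> ennreal (mean.K\<theta> * (4 * c)) * schatten_norm v p T"
proof -
  let ?g = "\<lambda>z. g z - g 0"
  have "(B2_norm p g < \<infinity> \<longleftrightarrow> B2_norm p ?g < \<infinity>) \<and> (B2_norm p ?g < \<infinity> \<longrightarrow> bounded_operator v T) \<and>
    schatten_norm v p T \<le> ennreal (16 * K) * B2_norm p ?g \<and>
    B2_norm p ?g \<le> ennreal (mean.K\<theta> * (4 * c)) * schatten_norm v p T"
  proof (cases p rule: ennreal_cases)
    case top
    then have p: "p = \<infinity>" by simp
    have "operator_norm v T \<le> ennreal (16 * K) * mean_sup"
    proof (cases "mean_sup = \<infinity>")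
      case True
      have "ennreal (16 * K) * mean_sup = \<infinity>" unfolding True using K_pos by (simp add: ennreal_mult_top)
      then show ?thesis by (simp only: infinity_ennreal_def top_greatest)
    next
      case False
      then have "mean_sup < \<infinity>" by (simp only: infinity_ennreal_def less_top[symmetric] not_False_eq_True)
      then have "operator_norm v T \<le> ennreal (8 * K) * mean_sup"
        by (rule operator_norm_le_mean_sup(1))
      also have "\<dots> \<le> ennreal (16 * K) * mean_sup"
        by (intro mult_right_mono ennreal_leI) (use K_pos in auto)
      finally show ?thesis .
    qed
    moreover have "ennreal (cmod (g 0)) + mean_sup < \<infinity> \<longleftrightarrow> mean_sup < \<infinity>" by (simp add: less_top)
    ultimately show ?thesis
      unfolding p B2_norm_infinity schatten_norm_def if_P[OF refl]
      using mean_sup_le_operator_norm operator_norm_le_mean_sup(2) by blast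
  next
    case (real P)
    have P: "P \<ge> 1" using p real by simp
    have sch: "schatten_norm v p T = (if compact_operator v T then epowr (singular_sum P) (1 / P) else \<infinity>)"
      unfolding schatten_norm_def using real by simp
    have lower: "epowr (mean_int P) (1 / P) \<le> ennreal (mean.K\<theta> * (4 * c)) * schatten_norm v p T"
    proof (cases "compact_operator v T \<and> singular_sum P < \<infinity>")
      case True
      then show ?thesis unfolding sch using mean_int_le_singular_sum[OF P] by simp
    next
      case False
      then have "schatten_norm v p T = \<infinity>" unfolding sch by (auto simp: epowr_def less_top)
      then show ?thesis using mean.K\<theta>_pos c_ge by (simp add: ennreal_mult_top)
    qed
    have upper: "schatten_norm v p T \<le> ennreal (16 * K) * epowr (mean_int P) (1 / P)"
    proof (cases "mean_int P < \<infinity>")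
      case True
      from singular_sum_le_mean_int[OF P this] show ?thesis unfolding sch by simp
    next
      case False
      then have "epowr (mean_int P) (1 / P) = \<infinity>" by (simp add: epowr_def less_top)
      then show ?thesis using K_pos by (simp add: ennreal_mult_top)
    qed
    have fin: "epowr (ennreal (cmod (g 0) powr P) + mean_int P) (1 / P) < \<infinity> \<longleftrightarrow> epowr (mean_int P) (1 / P) < \<infinity>"
      unfolding epowr_less_top by (simp add: less_top)
    have bdd: "epowr (mean_int P) (1 / P) < \<infinity> \<longrightarrow> bounded_operator v T"
      unfolding epowr_less_top using singular_sum_le_mean_int(1)[OF P] by (simp add: compact_operator_def)
    show ?thesis using fin bdd upper lower unfolding real(2) B2_norm_finite[OF P] by blast
  qed
  note * = this
  show up: "schatten_norm v p T \<le> ennreal (16 * K) * B2_norm p ?g"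
    and low: "B2_norm p ?g \<le> ennreal (mean.K\<theta> * (4 * c)) * schatten_norm v p T" using * by blast+
  have "schatten_norm v p T < \<infinity>" if "B2_norm p ?g < \<infinity>"
    by (rule le_less_trans[OF up]) (use that in \<open>simp add: ennreal_mult_less_top\<close>)
  moreover have "B2_norm p ?g < \<infinity>" if "schatten_norm v p T < \<infinity>"
    by (rule le_less_trans[OF low]) (use that in \<open>simp add: ennreal_mult_less_top\<close>)
  ultimately show "T \<in> schatten_class v p \<longleftrightarrow> g \<in> B2_space p"
    using * g unfolding schatten_class_def B2_space_def by blast
qed

end

theorem theorem1:
  fixes v :: "complex \<Rightarrow> real" and p :: ennreal
  assumes "1 \<le> p"
    and "v \<in> D_hat"
    and "M1_const v < \<infinity>"
    and "M2_const v < \<infinity>"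
  shows "(\<forall>g. g holomorphic_on unit_disc \<longrightarrow>
            (hilbert_op g \<in> schatten_class v p \<longleftrightarrow> g \<in> B2_space p)) \<and>
         (\<exists>C::real. C > 0 \<and> (\<forall>g. g holomorphic_on unit_disc \<longrightarrow>
            schatten_norm v p (hilbert_op g) \<le> ennreal C * B2_norm p (\<lambda>z. g z - g 0) \<and>
            B2_norm p (\<lambda>z. g z - g 0) \<le> ennreal C * schatten_norm v p (hilbert_op g)))"
proof -
  have v: "radial_weight v" using assms(2) by (simp add: D_hat_def)
  obtain \<phi> :: "real \<Rightarrow> real" where \<phi>: "\<phi> \<in> borel_measurable borel" "\<And>s. \<phi> s > 0"
    "AE s in lborel. s \<in> {0<..<1} \<longrightarrow> v (of_real s) = \<phi> s"
    "AE z in lborel. z \<in> unit_disc \<longrightarrow> v z = \<phi> (cmod z)"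
    using radial_weight_borel[OF v] by blast
  have rd: "radial_density v \<phi>" by (rule radial_density.intro) (fact v \<phi>)+
  obtain W c C q where hm: "hilbert_matrix (radial_density.w \<phi>) W c C q"
    using radial_density.hilbert_matrix_exists[OF rd assms(3,4)] by blast
  have set: "dirichlet_setting v \<phi> W c C q g" if "g holomorphic_on unit_disc" for g
    by (intro dirichlet_setting.intro dirichlet_setting_axioms.intro rd hm that)
  \<comment> \<open>The parameters of the matrix are obtained from the weight before any
    \<open>g\<close> is fixed and \<open>K\<theta>\<close> is an absolute constant, so one maximum
    serves both inequalities for every \<open>g\<close>.\<close>
  define D where "D = max (16 * hilbert_matrix.K c C q) (coeff_mean.K\<theta> * (4 * c))"
  have est: "schatten_norm v p (hilbert_op g) \<le> ennreal D * B2_norm p (\<lambda>z. g z - g 0) \<and>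
      B2_norm p (\<lambda>z. g z - g 0) \<le> ennreal D * schatten_norm v p (hilbert_op g)"
    if g: "g holomorphic_on unit_disc" for g
  proof
    note h = dirichlet_setting.hilbert_op_schatten(2,3)[OF set[OF g] assms(1)]
    show "schatten_norm v p (hilbert_op g) \<le> ennreal D * B2_norm p (\<lambda>z. g z - g 0)"
      by (rule order_trans[OF h(1)]) (intro mult_right_mono ennreal_leI, auto simp: D_def)
    show "B2_norm p (\<lambda>z. g z - g 0) \<le> ennreal D * schatten_norm v p (hilbert_op g)"
      by (rule order_trans[OF h(2)]) (intro mult_right_mono ennreal_leI, auto simp: D_def)
  qed
  have "D > 0" unfolding D_def using hilbert_matrix.K_pos[OF hm] by simp
  then show ?thesis
    using dirichlet_setting.hilbert_op_schatten(1)[OF set assms(1)] est by blast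
qed

end
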